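(* Let $d=2$ and let $(u_\ell)_{\ell\in\mathbb{N}_0}$ be the sequence of Galerkin solutions generated by the adaptive algorithm described in the context, run with either marking criterion A or marking criterion B (described in the context) with arbitrary parameters $0<\theta_{\mathbb{X}},\theta_{\mathbb{P}}\le1$ and $\vartheta>0$. Let $(\widehat u_\ell)_{\ell\in\mathbb{N}_0}$ be the associated sequence of enriched Galerkin solutions, i.e., $\widehat u_\ell\in\widehat{\mathbb{V}}_\ell$ with $B(\widehat u_\ell,\widehat v)=F(\widehat v)$ for all $\widehat v\in\widehat{\mathbb{V}}_\ell$. Suppose that the saturation assumption holds for each pair $u_\ell,\widehat u_\ell$, i.e., there is a constant $0<q_{\mathrm{sat}}<1$ such that $\|u-\widehat u_\ell\|_B\le q_{\mathrm{sat}}\,\|u-u_\ell\|_B$ for all $\ell\in\mathbb{N}_0$. Then there exists a constant $0<q_{\mathrm{lin}}<1$ such that $$\|u-u_{\ell+1}\|_B\le q_{\mathrm{lin}}\,\|u-u_\ell\|_B\quad\text{for all }\ell\in\mathbb{N}_0.$$ The constant $q_{\mathrm{lin}}$ depends only on the mean field $a_0$, the constant $\tau$, the saturation constant $q_{\mathrm{sat}}$, the coarse mesh $\mathcal{T}_0$, and the marking parameters $\theta_{\mathbb{X}},\theta_{\mathbb{P}},\vartheta$.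
   Context: **Problem.** Let $D\subset\mathbb{R}^2$ be a bounded Lipschitz domain with polygonal boundary and $\Gamma:=\prod_{m=1}^\infty[-1,1]$. Let $\pi=\prod_{m=1}^\infty\pi_m$ be a product probability measure on $(\Gamma,\mathcal{B}(\Gamma))$, each $\pi_m$ being a symmetric Borel probability measure on $[-1,1]$ (with infinite support, so that orthogonal polynomials of every degree exist). Let $a(x,\mathbf{y})=a_0(x)+\sum_{m=1}^\infty y_m a_m(x)$ with $a_m\in W^{1,\infty}(D)$ for $m\in\mathbb{N}_0$, $0<a_0^{\min}\le a_0(x)\le a_0^{\max}<\infty$ for a.e. $x\in D$, and $\tau:=\frac{1}{a_0^{\min}}\sum_{m=1}^\infty\|a_m\|_{L^\infty(D)}<1$. Let $\mathbb{X}:=H^1_0(D)$, $\mathbb{P}:=L^2_\pi(\Gamma)$, $\mathbb{V}:=L^2_\pi(\Gamma;\mathbb{X})\cong\mathbb{X}\otimes\mathbb{P}$, $f\in L^2_\pi(\Gamma;H^{-1}(D))$, $F(v):=\int_\Gamma\int_D f v\,dx\,d\pi(\mathbf{y})$ (duality pairing in $x$), $B_0(u,v):=\int_\Gamma\int_D a_0\nabla u\cdot\nabla v\,dx\,d\pi(\mathbf{y})$, and $B(u,v):=B_0(u,v)+\sum_{m=1}^\infty\int_\Gamma\int_D y_m a_m\nabla u\cdot\nabla v\,dx\,d\pi(\mathbf{y})$, where gradients are with respect to $x$. Both $B_0$ and $B$ are symmetric, continuous, elliptic bilinear forms on $\mathbb{V}$; $\|v\|_B:=B(v,v)^{1/2}$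 is the energy norm. The exact solution $u\in\mathbb{V}$ satisfies $B(u,v)=F(v)$ for all $v\in\mathbb{V}$. **Meshes.** All meshes are conforming triangulations of $D$ obtained by newest vertex bisection (NVB) from a fixed initial conforming mesh $\mathcal{T}_0$ (each triangle having a reference edge; a triangle is bisected by halving its reference edge, and the reference edges of the sons are opposite to the new vertex). For a mesh $\mathcal{T}_\bullet$, $\mathcal{N}_\bullet$ is its set of vertices and $\mathbb{X}_\bullet:=\mathcal{S}^1_0(\mathcal{T}_\bullet):=\{v\in H^1_0(D): v|_T\text{ affine for all }T\in\mathcal{T}_\bullet\}$. $\widehat{\mathcal{T}}_\bullet$ denotes the coarsest NVB refinement of $\mathcal{T}_\bullet$ such that all edges of $\mathcal{T}_\bullet$ have been bisected once (each triangle is bisected three times). $\widehat{\mathcal{N}}_\bullet$ is its vertex set, $\widehat\varphi_{\bullet,z}$ ($z\in\widehat{\mathcal{N}}_\bullet$) its hat functions, $\widehat{\mathbb{X}}_\bullet:=\mathcal{S}^1_0(\widehat{\mathcal{T}}_\bullet)$, and $\mathcal{N}_\bullet^+:=(\widehat{\mathcal{N}}_\bullet\setminus\mathcal{N}_\bullet)\setminus\partial D$. For $\mathcal{M}_\bullet\subseteq\mathcal{N}_\bullet^+$, $\mathrm{refine}(\mathcal{T}_\bullet,\mathcal{M}_\bullet)$ is the coarsest conforming NVB refinement of $\mathcal{T}_\bullet$ whose vertex set contains $\mathcal{M}_\bullet$. **Polynomial spaces.** For each $m\in\mathbb{N}$, $(P^m_n)_{n\in\mathbb{N}_0}$ are the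 polynomials with $\deg P^m_n=n$, orthonormal in $L^2_{\pi_m}(-1,1)$, $P^m_0\equiv1$. Let $\mathfrak{I}$ be the set of finitely supported $\nu\in\mathbb{N}_0^{\mathbb{N}}$, $\mathrm{supp}(\nu):=\{m:\nu_m\ne0\}$, and $P_\nu(\mathbf{y}):=\prod_{m\in\mathbb{N}}P^m_{\nu_m}(y_m)$; $\{P_\nu\}_{\nu\in\mathfrak{I}}$ is an orthonormal basis of $\mathbb{P}$. For a finite $\mathfrak{P}_\bullet\subset\mathfrak{I}$ with $\mathbf{0}\in\mathfrak{P}_\bullet$, put $\mathbb{P}_\bullet:=\mathrm{span}\{P_\nu:\nu\in\mathfrak{P}_\bullet\}$ and define the detail index set $\mathfrak{Q}_\bullet:=\{\mu\in\mathfrak{I}\setminus\mathfrak{P}_\bullet:\mu=\nu\pm\varepsilon_m\text{ for some }\nu\in\mathfrak{P}_\bullet\text{ and some }m\in\{1,\dots,M_{\mathfrak{P}_\bullet}+1\}\}$, where $\varepsilon_m$ is the $m$-th unit sequence, $M_{\{\mathbf{0}\}}:=0$ and otherwise $M_{\mathfrak{P}_\bullet}:=\max\{\max\mathrm{supp}(\nu):\nu\in\mathfrak{P}_\bullet\setminus\{\mathbf{0}\}\}$. Put $\widehat{\mathbb{P}}_\bullet:=\mathrm{span}\{P_\nu:\nu\in\mathfrak{P}_\bullet\cup\mathfrak{Q}_\bullet\}$. **Galerkin solutions and error estimates.** $\mathbb{V}_\bullet:=\mathbb{X}_\bullet\otimes\mathbb{P}_\bullet$, and $u_\bullet\in\mathbb{V}_\bullet$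 is the unique solution of $B(u_\bullet,v)=F(v)$ for all $v\in\mathbb{V}_\bullet$. The enriched space is $\widehat{\mathbb{V}}_\bullet:=(\widehat{\mathbb{X}}_\bullet\otimes\mathbb{P}_\bullet)+(\mathbb{X}_\bullet\otimes\widehat{\mathbb{P}}_\bullet)$. For $z\in\mathcal{N}_\bullet^+$, $\eta_\bullet(z)\ge 0$ is defined by $$\eta_\bullet(z)^2:=\sum_{\nu\in\mathfrak{P}_\bullet}\frac{|F(\widehat\varphi_{\bullet,z}P_\nu)-B(u_\bullet,\widehat\varphi_{\bullet,z}P_\nu)|^2}{\|a_0^{1/2}\nabla\widehat\varphi_{\bullet,z}\|_{L^2(D)}^2}.$$ For $\nu\in\mathfrak{Q}_\bullet$, $e_\bullet^\nu\in\mathbb{X}_\bullet$ solves $B_0(e_\bullet^\nu P_\nu,vP_\nu)=F(vP_\nu)-B(u_\bullet,vP_\nu)$ for all $v\in\mathbb{X}_\bullet$, and $\eta_\bullet(\nu):=\|a_0^{1/2}\nabla e_\bullet^\nu\|_{L^2(D)}$. For $\mathcal{M}\subseteq\mathcal{N}_\bullet^+$ and $\mathfrak{M}\subseteq\mathfrak{Q}_\bullet$: $\eta_\bullet(\mathcal{M})^2:=\sum_{z\in\mathcal{M}}\eta_\bullet(z)^2$, $\eta_\bullet(\mathfrak{M})^2:=\sum_{\nu\in\mathfrak{M}}\eta_\bullet(\nu)^2$. **Adaptive algorithm.** Start with $\mathcal{T}_0$ and $\mathfrak{P}_0=\{\mathbf{0}\}$. For $\ell=0,1,2,\dots$: (i)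 compute $u_\ell\in\mathbb{V}_\ell$; (ii) compute $\eta_\ell(z)$ for all $z\in\mathcal{N}_\ell^+$ and $\eta_\ell(\nu)$ for all $\nu\in\mathfrak{Q}_\ell$; (iii) use the marking criterion to obtain $\mathcal{M}_\ell\subseteq\mathcal{N}_\ell^+$ and $\mathfrak{M}_\ell\subseteq\mathfrak{Q}_\ell$; (iv) set $\mathfrak{P}_{\ell+1}=\mathfrak{P}_\ell\cup\mathfrak{M}_\ell$ and $\mathcal{T}_{\ell+1}=\mathrm{refine}(\mathcal{T}_\ell,\mathcal{M}_\ell)$. **Marking criteria.** *Criterion A.* Case (a), $\vartheta\,\eta_\ell(\mathfrak{Q}_\ell)\le\eta_\ell(\mathcal{N}_\ell^+)$: set $\mathfrak{M}_\ell=\emptyset$ and choose $\mathcal{M}_\ell\subseteq\mathcal{N}_\ell^+$ of minimal cardinality with $\theta_{\mathbb{X}}\,\eta_\ell(\mathcal{N}_\ell^+)\le\eta_\ell(\mathcal{M}_\ell)$. Case (b), otherwise: set $\mathcal{M}_\ell=\emptyset$ and choose $\mathfrak{M}_\ell\subseteq\mathfrak{Q}_\ell$ of minimal cardinality with $\theta_{\mathbb{P}}\,\eta_\ell(\mathfrak{Q}_\ell)\le\eta_\ell(\mathfrak{M}_\ell)$. *Criterion B.* Choose $\widetilde{\mathfrak{M}}_\ell\subseteq\mathfrak{Q}_\ell$ of minimal cardinality with $\theta_{\mathbb{P}}\,\eta_\ell(\mathfrak{Q}_\ell)\le\eta_\ell(\widetilde{\mathfrak{M}}_\ell)$ and $\widetilde{\mathcal{M}}_\ell\subseteq\mathcal{N}_\ell^+$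 of minimal cardinality with $\theta_{\mathbb{X}}\,\eta_\ell(\mathcal{N}_\ell^+)\le\eta_\ell(\widetilde{\mathcal{M}}_\ell)$. Let $\widetilde{\mathcal{R}}_\ell:=\mathcal{N}_\ell^+\cap\widetilde{\mathcal{N}}_\ell$, where $\widetilde{\mathcal{N}}_\ell$ is the vertex set of $\mathrm{refine}(\mathcal{T}_\ell,\widetilde{\mathcal{M}}_\ell)$. Case (a), $\vartheta\,\eta_\ell(\widetilde{\mathfrak{M}}_\ell)\le\eta_\ell(\widetilde{\mathcal{R}}_\ell)$: set $\mathfrak{M}_\ell=\emptyset$, $\mathcal{M}_\ell=\widetilde{\mathcal{M}}_\ell$. Case (b), otherwise: set $\mathfrak{M}_\ell=\widetilde{\mathfrak{M}}_\ell$, $\mathcal{M}_\ell=\emptyset$. *)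

theory Defs
  imports "HOL-Probability.Probability" "HOL-Computational_Algebra.Polynomial"
begin

text \<open>
  Elements of Lebesgue, Sobolev and Bochner spaces are represented by functions, i.e. by
  representatives of the usual equivalence classes. All norms, functionals and bilinear
  forms below depend on the classes only.
\<close>

type_synonym point = "real ^ 2"

section \<open>Sobolev spaces on planar domains\<close>

text \<open>A bounded Lipschitz domain is locally the strict epigraph of a Lipschitz function
  in some orthonormal coordinate system.\<close>

definition lipschitz_domain :: "point set \<Rightarrow> bool" where
  "lipschitz_domain D \<longleftrightarrow> D \<noteq> {} \<and> open D \<and> connected D \<and> bounded D \<and>
     (\<forall>x\<in>frontier D. \<exists>r>0. \<exists>e1 e2 \<gamma> L. norm e1 = 1 \<and> norm e2 = 1 \<and> e1 \<bullet> e2 = 0 \<and>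
        L-lipschitz_on UNIV (\<gamma> :: real \<Rightarrow> real) \<and>
        D \<inter> ball x r = {z \<in> ball x r. \<gamma> (z \<bullet> e1) < z \<bullet> e2})"

definition polygonal_boundary :: "point set \<Rightarrow> bool" where
  "polygonal_boundary D \<longleftrightarrow>
     (\<exists>S. finite S \<and> frontier D = (\<Union>(p, q)\<in>S. closed_segment p q))"

definition partial :: "2 \<Rightarrow> (point \<Rightarrow> real) \<Rightarrow> point \<Rightarrow> real" where
  "partial i \<phi> = (\<lambda>x. frechet_derivative \<phi> (at x) (axis i 1))"

definition smooth :: "(point \<Rightarrow> real) \<Rightarrow> bool" where
  "smooth \<phi> \<longleftrightarrow> (\<forall>is x. foldr partial is \<phi> differentiable (at x))"

text \<open>Test functions on \<open>D\<close>, extended by zero to the whole plane.\<close>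

definition test_fun :: "point set \<Rightarrow> (point \<Rightarrow> real) set" where
  "test_fun D = {\<phi>. smooth \<phi> \<and> (\<exists>K. compact K \<and> K \<subseteq> D \<and> (\<forall>x. x \<notin> K \<longrightarrow> \<phi> x = 0))}"

definition L2 :: "point set \<Rightarrow> (point \<Rightarrow> 'b::euclidean_space) set" where
  "L2 D = {v \<in> borel_measurable (lebesgue_on D).
             integrable (lebesgue_on D) (\<lambda>x. (norm (v x))\<^sup>2)}"

definition L2_norm_on :: "point set \<Rightarrow> (point \<Rightarrow> 'b::euclidean_space) \<Rightarrow> real" where
  "L2_norm_on D v = sqrt (LINT x|lebesgue_on D. (norm (v x))\<^sup>2)"

definition Linf :: "point set \<Rightarrow> (point \<Rightarrow> 'b::euclidean_space) set" where
  "Linf D = {v \<in> borel_measurable (lebesgue_on D).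
               esssup (lebesgue_on D) (\<lambda>x. ereal (norm (v x))) < \<infinity>}"

definition Linf_norm :: "point set \<Rightarrow> (point \<Rightarrow> 'b::euclidean_space) \<Rightarrow> real" where
  "Linf_norm D v = real_of_ereal (esssup (lebesgue_on D) (\<lambda>x. ereal (norm (v x))))"

definition weak_gradient :: "point set \<Rightarrow> (point \<Rightarrow> real) \<Rightarrow> (point \<Rightarrow> point) \<Rightarrow> bool" where
  "weak_gradient D v g \<longleftrightarrow>
     (\<forall>\<phi>\<in>test_fun D. \<forall>i. (LINT x|lebesgue_on D. v x * partial i \<phi> x)
                         = - (LINT x|lebesgue_on D. g x $ i * \<phi> x))"

definition W1inf :: "point set \<Rightarrow> (point \<Rightarrow> real) set" where
  "W1inf D = {v \<in> Linf D. \<exists>g\<in>Linf D. weak_gradient D v g}"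

definition H1 :: "point set \<Rightarrow> (point \<Rightarrow> real) set" where
  "H1 D = {v \<in> L2 D. \<exists>g\<in>L2 D. weak_gradient D v g}"

text \<open>The weak gradient is unique almost everywhere in \<open>D\<close>; an arbitrary
  representative is chosen.\<close>

definition grad :: "point set \<Rightarrow> (point \<Rightarrow> real) \<Rightarrow> point \<Rightarrow> point" where
  "grad D v = (SOME g. g \<in> L2 D \<and> weak_gradient D v g)"

definition H1_norm :: "point set \<Rightarrow> (point \<Rightarrow> real) \<Rightarrow> real" where
  "H1_norm D v = sqrt ((L2_norm_on D v)\<^sup>2 + (L2_norm_on D (grad D v))\<^sup>2)"

definition H10 :: "point set \<Rightarrow> (point \<Rightarrow> real) set" where
  "H10 D = {v \<in> H1 D. \<exists>\<phi>. (\<forall>n. \<phi> n \<in> test_fun D) \<and>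
                          (\<lambda>n. H1_norm D (\<lambda>x. v x - \<phi> n x)) \<longlonglongrightarrow> 0}"

text \<open>Bounded linear functionals on \<open>H10 D\<close>; their values outside \<open>H10 D\<close> are irrelevant.\<close>

definition Hm1 :: "point set \<Rightarrow> ((point \<Rightarrow> real) \<Rightarrow> real) set" where
  "Hm1 D = {l. (\<forall>v\<in>H10 D. \<forall>w\<in>H10 D. l (\<lambda>x. v x + w x) = l v + l w) \<and>
               (\<forall>c. \<forall>v\<in>H10 D. l (\<lambda>x. c * v x) = c * l v) \<and>
               (\<exists>C. \<forall>v\<in>H10 D. \<bar>l v\<bar> \<le> C * H1_norm D v)}"

definition Hm1_norm :: "point set \<Rightarrow> ((point \<Rightarrow> real) \<Rightarrow> real) \<Rightarrow> real" where
  "Hm1_norm D l = (SUP v \<in> {v \<in> H10 D. H1_norm D v \<le> 1}. \<bar>l v\<bar>)"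


section \<open>Parameter space and Bochner spaces\<close>

text \<open>All sequences over \<open>{1, 2, \<dots>}\<close> are indexed from \<open>0\<close>: \<open>y m\<close>, \<open>a m\<close>, \<open>\<pi> m\<close>, \<open>P m\<close> and
  \<open>\<nu> m\<close> stand for the (m+1)-st parameter, coefficient, measure, family of polynomials
  and entry of a multi-index. The mean field \<open>a0\<close> is kept separate.\<close>

definition measure_support :: "real measure \<Rightarrow> real set" where
  "measure_support M = {x \<in> space M. \<forall>U. open U \<longrightarrow> x \<in> U \<longrightarrow> 0 < emeasure M (U \<inter> space M)}"

definition parameter_measure :: "real measure \<Rightarrow> bool" where
  "parameter_measure M \<longleftrightarrow>
     prob_space M \<and> sets M = sets (restrict_space borel {-1..1}) \<and>
     distr M M uminus = M \<and> infinite (measure_support M)"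

abbreviation prod_measure :: "(nat \<Rightarrow> real measure) \<Rightarrow> (nat \<Rightarrow> real) measure" where
  "prod_measure \<pi> \<equiv> Pi\<^sub>M UNIV \<pi>"

text \<open>Square integrable, strongly measurable functions with values in the space \<open>X\<close> of
  functions, seminormed by \<open>nrm\<close>. Strong measurability is approximability by simple functions
  at every point (every class has such a representative).\<close>

definition bochner_L2 ::
  "'s measure \<Rightarrow> ('b \<Rightarrow> real) set \<Rightarrow> (('b \<Rightarrow> real) \<Rightarrow> real) \<Rightarrow> ('s \<Rightarrow> 'b \<Rightarrow> real) set" where
  "bochner_L2 M X nrm = {v.
     (\<forall>y\<in>space M. v y \<in> X) \<and>
     (\<exists>s. (\<forall>n. simple_function M (s n) \<and> (\<forall>y\<in>space M. s n y \<in> X)) \<and>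
          (\<forall>y\<in>space M. (\<lambda>n::nat. nrm (\<lambda>x. s n y x - v y x)) \<longlonglongrightarrow> 0)) \<and>
     (\<integral>\<^sup>+y. ennreal ((nrm (v y))\<^sup>2) \<partial>M) < \<infinity>}"

type_synonym rfield = "(nat \<Rightarrow> real) \<Rightarrow> point \<Rightarrow> real"

definition V_space :: "point set \<Rightarrow> (nat \<Rightarrow> real measure) \<Rightarrow> rfield set" where
  "V_space D \<pi> = bochner_L2 (prod_measure \<pi>) (H10 D) (H1_norm D)"

definition rhs_space ::
  "point set \<Rightarrow> (nat \<Rightarrow> real measure) \<Rightarrow> ((nat \<Rightarrow> real) \<Rightarrow> (point \<Rightarrow> real) \<Rightarrow> real) set" where
  "rhs_space D \<pi> = bochner_L2 (prod_measure \<pi>) (Hm1 D) (Hm1_norm D)"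

definition F ::
  "(nat \<Rightarrow> real measure) \<Rightarrow> ((nat \<Rightarrow> real) \<Rightarrow> (point \<Rightarrow> real) \<Rightarrow> real) \<Rightarrow> rfield \<Rightarrow> real" where
  "F \<pi> f v = (LINT y|prod_measure \<pi>. f y (v y))"

definition B0 ::
  "point set \<Rightarrow> (point \<Rightarrow> real) \<Rightarrow> (nat \<Rightarrow> real measure) \<Rightarrow> rfield \<Rightarrow> rfield \<Rightarrow> real" where
  "B0 D a0 \<pi> u v =
     (LINT y|prod_measure \<pi>. LINT x|lebesgue_on D. a0 x * (grad D (u y) x \<bullet> grad D (v y) x))"

definition B ::
  "point set \<Rightarrow> (point \<Rightarrow> real) \<Rightarrow> (nat \<Rightarrow> real measure) \<Rightarrow> (nat \<Rightarrow> point \<Rightarrow> real) \<Rightarrow>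
   rfield \<Rightarrow> rfield \<Rightarrow> real" where
  "B D a0 \<pi> a u v = B0 D a0 \<pi> u v +
     (\<Sum>m. LINT y|prod_measure \<pi>. LINT x|lebesgue_on D.
              y m * a m x * (grad D (u y) x \<bullet> grad D (v y) x))"

definition energy_norm ::
  "point set \<Rightarrow> (point \<Rightarrow> real) \<Rightarrow> (nat \<Rightarrow> real measure) \<Rightarrow> (nat \<Rightarrow> point \<Rightarrow> real) \<Rightarrow>
   rfield \<Rightarrow> real" where
  "energy_norm D a0 \<pi> a v = sqrt (B D a0 \<pi> a v v)"

definition galerkin ::
  "point set \<Rightarrow> (point \<Rightarrow> real) \<Rightarrow> (nat \<Rightarrow> real measure) \<Rightarrow> (nat \<Rightarrow> point \<Rightarrow> real) \<Rightarrow>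
   ((nat \<Rightarrow> real) \<Rightarrow> (point \<Rightarrow> real) \<Rightarrow> real) \<Rightarrow> rfield set \<Rightarrow> rfield \<Rightarrow> bool" where
  "galerkin D a0 \<pi> a f W u \<longleftrightarrow> u \<in> W \<and> (\<forall>v\<in>W. B D a0 \<pi> a u v = F \<pi> f v)"


section \<open>Newest vertex bisection\<close>

text \<open>The triple \<open>(p, q, r)\<close> encodes the triangle with vertices \<open>p, q, r\<close> and
  reference edge \<open>pq\<close>.\<close>

type_synonym triangle = "point \<times> point \<times> point"

fun verts :: "triangle \<Rightarrow> point set" where
  "verts (p, q, r) = {p, q, r}"

definition tri :: "triangle \<Rightarrow> point set" where
  "tri t = convex hull (verts t)"

definition vertices :: "triangle set \<Rightarrow> point set" where
  "vertices T = (\<Union>t\<in>T. verts t)"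

definition conforming_triangulation :: "point set \<Rightarrow> triangle set \<Rightarrow> bool" where
  "conforming_triangulation D T \<longleftrightarrow>
     finite T \<and> inj_on verts T \<and>
     (\<forall>t\<in>T. case t of (p, q, r) \<Rightarrow> \<not> collinear {p, q, r}) \<and>
     (\<Union>t\<in>T. tri t) = closure D \<and>
     (\<forall>t\<in>T. \<forall>t'\<in>T. tri t \<inter> tri t' = convex hull (verts t \<inter> verts t'))"

fun bisect :: "triangle \<Rightarrow> triangle set" where
  "bisect (p, q, r) = {(r, p, midpoint p q), (q, r, midpoint p q)}"

text \<open>All (not necessarily conforming) meshes obtained by finitely many bisections.\<close>

inductive nvb_refinement :: "triangle set \<Rightarrow> triangle set \<Rightarrow> bool" for T where
  refl: "nvb_refinement T T"
| step: "nvb_refinement T S \<Longrightarrow> t \<in> S \<Longrightarrow> nvb_refinement T ((S - {t}) \<union> bisect t)"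

text \<open>\<open>T'\<close> is the coarsest conforming refinement of \<open>T\<close> whose vertices include \<open>M\<close>, i.e. the
  least one with respect to \<^const>\<open>nvb_refinement\<close>.\<close>

definition is_refine :: "point set \<Rightarrow> triangle set \<Rightarrow> point set \<Rightarrow> triangle set \<Rightarrow> bool" where
  "is_refine D T M T' \<longleftrightarrow>
     (nvb_refinement T T' \<and> conforming_triangulation D T' \<and> M \<subseteq> vertices T') \<and>
     (\<forall>T''. nvb_refinement T T'' \<and> conforming_triangulation D T'' \<and> M \<subseteq> vertices T''
            \<longrightarrow> nvb_refinement T' T'')"

text \<open>Each triangle is bisected three times: the reference edges of its two sons are
  its two remaining edges, so that each edge of the mesh is halved exactly once.\<close>

definition uniform_refinement :: "triangle set \<Rightarrow> triangle set" where
  "uniform_refinement T = (\<Union>t\<in>T. \<Union>s\<in>bisect t. bisect s)"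

definition new_vertices :: "point set \<Rightarrow> triangle set \<Rightarrow> point set" where
  "new_vertices D T = (vertices (uniform_refinement T) - vertices T) - frontier D"

definition affine_fun_on :: "point set \<Rightarrow> (point \<Rightarrow> real) \<Rightarrow> bool" where
  "affine_fun_on S v \<longleftrightarrow> (\<exists>g c. \<forall>x\<in>S. v x = g \<bullet> x + c)"

definition S10 :: "point set \<Rightarrow> triangle set \<Rightarrow> (point \<Rightarrow> real) set" where
  "S10 D T = {v \<in> H10 D. \<forall>t\<in>T. affine_fun_on (tri t) v}"

definition hat_fun :: "triangle set \<Rightarrow> point \<Rightarrow> point \<Rightarrow> real" where
  "hat_fun T z = (THE v. (\<forall>t\<in>T. affine_fun_on (tri t) v) \<and>
                         (\<forall>z'\<in>vertices T. v z' = (if z' = z then 1 else 0)) \<and>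
                         (\<forall>x. x \<notin> (\<Union>t\<in>T. tri t) \<longrightarrow> v x = 0))"


section \<open>Polynomial spaces\<close>

type_synonym multi_index = "nat \<Rightarrow> nat"

definition supp :: "multi_index \<Rightarrow> nat set" where
  "supp \<nu> = {m. \<nu> m \<noteq> 0}"

definition multi_indices :: "multi_index set" where
  "multi_indices = {\<nu>. finite (supp \<nu>)}"

definition orthonormal_polys :: "(nat \<Rightarrow> real measure) \<Rightarrow> (nat \<Rightarrow> nat \<Rightarrow> real poly) \<Rightarrow> bool" where
  "orthonormal_polys \<pi> P \<longleftrightarrow>
     (\<forall>m. P m 0 = 1 \<and> (\<forall>n. degree (P m n) = n) \<and>
          (\<forall>j k. (LINT t|\<pi> m. poly (P m j) t * poly (P m k) t) = (if j = k then 1 else 0)))"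

text \<open>The product over all \<open>m\<close> reduces to the support of \<open>\<nu>\<close>, since \<open>P m 0 = 1\<close>.\<close>

definition tensor_poly ::
  "(nat \<Rightarrow> nat \<Rightarrow> real poly) \<Rightarrow> multi_index \<Rightarrow> (nat \<Rightarrow> real) \<Rightarrow> real" where
  "tensor_poly P \<nu> y = (\<Prod>m\<in>supp \<nu>. poly (P m (\<nu> m)) (y m))"

text \<open>The linear span of \<open>tensor_poly P \<nu>\<close> for \<open>\<nu>\<close> in the finite set \<open>\<PP>\<close>.\<close>

definition poly_space ::
  "(nat \<Rightarrow> nat \<Rightarrow> real poly) \<Rightarrow> multi_index set \<Rightarrow> ((nat \<Rightarrow> real) \<Rightarrow> real) set" where
  "poly_space P \<PP> = {p. \<exists>c. p = (\<lambda>y. \<Sum>\<nu>\<in>\<PP>. c \<nu> * tensor_poly P \<nu> y)}"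

text \<open>Number of active parameters; \<open>Suc\<close> accounts for the indexing of parameters from \<open>0\<close>.\<close>

definition active_dim :: "multi_index set \<Rightarrow> nat" where
  "active_dim \<PP> = (if \<PP> = {\<lambda>_. 0} then 0 else Max (\<Union>\<nu>\<in>\<PP>. Suc ` supp \<nu>))"

text \<open>The indices \<open>1, \<dots>, active_dim \<PP> + 1\<close> of the parameters become
  \<open>0, \<dots>, active_dim \<PP>\<close>. The second alternative is \<open>\<mu> = \<nu> - \<epsilon>\<^sub>m\<close>, stated without truncated
  subtraction.\<close>

definition detail_indices :: "multi_index set \<Rightarrow> multi_index set" where
  "detail_indices \<PP> = {\<mu> \<in> multi_indices - \<PP>. \<exists>\<nu>\<in>\<PP>. \<exists>m \<le> active_dim \<PP>.
     \<mu> = \<nu>(m := \<nu> m + 1) \<or> \<nu> = \<mu>(m := \<mu> m + 1)}"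


section \<open>Discrete spaces and error estimates\<close>

definition tensor_space ::
  "(point \<Rightarrow> real) set \<Rightarrow> ((nat \<Rightarrow> real) \<Rightarrow> real) set \<Rightarrow> rfield set" where
  "tensor_space X Q = {w. \<exists>n v p. (\<forall>i<n. v i \<in> X \<and> p i \<in> Q) \<and>
                           w = (\<lambda>y x. \<Sum>i<(n::nat). v i x * p i y)}"

definition V_disc ::
  "point set \<Rightarrow> (nat \<Rightarrow> nat \<Rightarrow> real poly) \<Rightarrow> triangle set \<Rightarrow> multi_index set \<Rightarrow> rfield set" where
  "V_disc D P T \<PP> = tensor_space (S10 D T) (poly_space P \<PP>)"

definition V_enriched ::
  "point set \<Rightarrow> (nat \<Rightarrow> nat \<Rightarrow> real poly) \<Rightarrow> triangle set \<Rightarrow> multi_index set \<Rightarrow> rfield set" where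
  "V_enriched D P T \<PP> =
     {w. \<exists>v1 \<in> tensor_space (S10 D (uniform_refinement T)) (poly_space P \<PP>).
         \<exists>v2 \<in> tensor_space (S10 D T) (poly_space P (\<PP> \<union> detail_indices \<PP>)).
           w = (\<lambda>y x. v1 y x + v2 y x)}"

definition energy_seminorm0 :: "point set \<Rightarrow> (point \<Rightarrow> real) \<Rightarrow> (point \<Rightarrow> real) \<Rightarrow> real" where
  "energy_seminorm0 D a0 v = L2_norm_on D (\<lambda>x. sqrt (a0 x) *\<^sub>R grad D v x)"

definition residual ::
  "point set \<Rightarrow> (point \<Rightarrow> real) \<Rightarrow> (nat \<Rightarrow> real measure) \<Rightarrow> (nat \<Rightarrow> point \<Rightarrow> real) \<Rightarrow>
   ((nat \<Rightarrow> real) \<Rightarrow> (point \<Rightarrow> real) \<Rightarrow> real) \<Rightarrow> rfield \<Rightarrow> rfield \<Rightarrow> real" where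
  "residual D a0 \<pi> a f u v = F \<pi> f v - B D a0 \<pi> a u v"

definition eta_vertex ::
  "point set \<Rightarrow> (point \<Rightarrow> real) \<Rightarrow> (nat \<Rightarrow> real measure) \<Rightarrow> (nat \<Rightarrow> point \<Rightarrow> real) \<Rightarrow>
   (nat \<Rightarrow> nat \<Rightarrow> real poly) \<Rightarrow> ((nat \<Rightarrow> real) \<Rightarrow> (point \<Rightarrow> real) \<Rightarrow> real) \<Rightarrow>
   triangle set \<Rightarrow> multi_index set \<Rightarrow> rfield \<Rightarrow> point \<Rightarrow> real" where
  "eta_vertex D a0 \<pi> a P f T \<PP> u z =
     (let \<phi> = hat_fun (uniform_refinement T) z in
      sqrt (\<Sum>\<nu>\<in>\<PP>. \<bar>residual D a0 \<pi> a f u (\<lambda>y x. \<phi> x * tensor_poly P \<nu> y)\<bar>\<^sup>2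
                    / (energy_seminorm0 D a0 \<phi>)\<^sup>2))"

text \<open>The function below is unique up to its values outside the closure of \<open>D\<close>.\<close>

definition e_index ::
  "point set \<Rightarrow> (point \<Rightarrow> real) \<Rightarrow> (nat \<Rightarrow> real measure) \<Rightarrow> (nat \<Rightarrow> point \<Rightarrow> real) \<Rightarrow>
   (nat \<Rightarrow> nat \<Rightarrow> real poly) \<Rightarrow> ((nat \<Rightarrow> real) \<Rightarrow> (point \<Rightarrow> real) \<Rightarrow> real) \<Rightarrow>
   triangle set \<Rightarrow> rfield \<Rightarrow> multi_index \<Rightarrow> point \<Rightarrow> real" where
  "e_index D a0 \<pi> a P f T u \<nu> =
     (SOME e. e \<in> S10 D T \<and>
        (\<forall>v\<in>S10 D T. B0 D a0 \<pi> (\<lambda>y x. e x * tensor_poly P \<nu> y) (\<lambda>y x. v x * tensor_poly P \<nu> y)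
                      = residual D a0 \<pi> a f u (\<lambda>y x. v x * tensor_poly P \<nu> y)))"

definition eta_index ::
  "point set \<Rightarrow> (point \<Rightarrow> real) \<Rightarrow> (nat \<Rightarrow> real measure) \<Rightarrow> (nat \<Rightarrow> point \<Rightarrow> real) \<Rightarrow>
   (nat \<Rightarrow> nat \<Rightarrow> real poly) \<Rightarrow> ((nat \<Rightarrow> real) \<Rightarrow> (point \<Rightarrow> real) \<Rightarrow> real) \<Rightarrow>
   triangle set \<Rightarrow> rfield \<Rightarrow> multi_index \<Rightarrow> real" where
  "eta_index D a0 \<pi> a P f T u \<nu> = energy_seminorm0 D a0 (e_index D a0 \<pi> a P f T u \<nu>)"

definition eta_set :: "('z \<Rightarrow> real) \<Rightarrow> 'z set \<Rightarrow> real" where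
  "eta_set \<eta> M = sqrt (\<Sum>z\<in>M. (\<eta> z)\<^sup>2)"


section \<open>Marking and adaptive algorithm\<close>

definition minimal_marking :: "('z \<Rightarrow> real) \<Rightarrow> real \<Rightarrow> 'z set \<Rightarrow> 'z set \<Rightarrow> bool" where
  "minimal_marking \<eta> \<theta> N M \<longleftrightarrow> M \<subseteq> N \<and> \<theta> * eta_set \<eta> N \<le> eta_set \<eta> M \<and>
     (\<forall>M'. M' \<subseteq> N \<and> \<theta> * eta_set \<eta> N \<le> eta_set \<eta> M' \<longrightarrow> card M \<le> card M')"

definition marking_A ::
  "point set \<Rightarrow> real \<Rightarrow> real \<Rightarrow> real \<Rightarrow> (point \<Rightarrow> real) \<Rightarrow> (multi_index \<Rightarrow> real) \<Rightarrow>
   triangle set \<Rightarrow> multi_index set \<Rightarrow> point set \<Rightarrow> multi_index set \<Rightarrow> bool" where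
  "marking_A D \<theta>X \<theta>P \<Theta> \<eta>X \<eta>P T \<PP> M \<MM> \<longleftrightarrow>
     (if \<Theta> * eta_set \<eta>P (detail_indices \<PP>) \<le> eta_set \<eta>X (new_vertices D T)
      then \<MM> = {} \<and> minimal_marking \<eta>X \<theta>X (new_vertices D T) M
      else M = {} \<and> minimal_marking \<eta>P \<theta>P (detail_indices \<PP>) \<MM>)"

definition marking_B ::
  "point set \<Rightarrow> real \<Rightarrow> real \<Rightarrow> real \<Rightarrow> (point \<Rightarrow> real) \<Rightarrow> (multi_index \<Rightarrow> real) \<Rightarrow>
   triangle set \<Rightarrow> multi_index set \<Rightarrow> point set \<Rightarrow> multi_index set \<Rightarrow> bool" where
  "marking_B D \<theta>X \<theta>P \<Theta> \<eta>X \<eta>P T \<PP> M \<MM> \<longleftrightarrow>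
     (\<exists>\<MM>' M' T' R'.
        minimal_marking \<eta>P \<theta>P (detail_indices \<PP>) \<MM>' \<and>
        minimal_marking \<eta>X \<theta>X (new_vertices D T) M' \<and>
        is_refine D T M' T' \<and> R' = new_vertices D T \<inter> vertices T' \<and>
        (if \<Theta> * eta_set \<eta>P \<MM>' \<le> eta_set \<eta>X R'
         then \<MM> = {} \<and> M = M'
         else \<MM> = \<MM>' \<and> M = {}))"

text \<open>One run of the adaptive algorithm with the marking criterion \<open>marking\<close>, which is
  passed the error estimates, the mesh and the index set and relates them to the
  marked vertices and marked indices.\<close>

definition adaptive_run ::
  "point set \<Rightarrow> (point \<Rightarrow> real) \<Rightarrow> (nat \<Rightarrow> real measure) \<Rightarrow> (nat \<Rightarrow> point \<Rightarrow> real) \<Rightarrow>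
   (nat \<Rightarrow> nat \<Rightarrow> real poly) \<Rightarrow> ((nat \<Rightarrow> real) \<Rightarrow> (point \<Rightarrow> real) \<Rightarrow> real) \<Rightarrow>
   ((point \<Rightarrow> real) \<Rightarrow> (multi_index \<Rightarrow> real) \<Rightarrow> triangle set \<Rightarrow> multi_index set \<Rightarrow>
      point set \<Rightarrow> multi_index set \<Rightarrow> bool) \<Rightarrow>
   triangle set \<Rightarrow> (nat \<Rightarrow> triangle set) \<Rightarrow> (nat \<Rightarrow> multi_index set) \<Rightarrow> (nat \<Rightarrow> rfield) \<Rightarrow> bool" where
  "adaptive_run D a0 \<pi> a P f marking T0 T \<PP> u \<longleftrightarrow>
     T 0 = T0 \<and> \<PP> 0 = {\<lambda>_. 0} \<and>
     (\<forall>l. galerkin D a0 \<pi> a f (V_disc D P (T l) (\<PP> l)) (u l) \<and>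
          (\<exists>M \<MM>. marking (eta_vertex D a0 \<pi> a P f (T l) (\<PP> l) (u l))
                           (eta_index D a0 \<pi> a P f (T l) (u l)) (T l) (\<PP> l) M \<MM> \<and>
                  \<PP> (Suc l) = \<PP> l \<union> \<MM> \<and> is_refine D (T l) M (T (Suc l))))"

end

theory Submission
  imports Defs "HOL-Library.Function_Algebras"
begin

text \<open>
  Throughout, the error is measured in the energy norm. Since \<open>u_l\<close> is the \<open>B\<close>-orthogonal projection
  of \<open>u\<close> onto a discrete space contained in that of the next level and in the enriched space, Pythagoras gives
  \<open>|u - u_(l+1)|^2 = |u - u_l|^2 - |u_(l+1) - u_l|^2\<close> and, by saturation,
  \<open>|u^_l - u_l|^2 \<ge> (1 - q_sat^2) |u - u_l|^2\<close>. The theorem therefore reduces to the bound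
  \<open>|u^_l - u_l|^2 \<le> C |u_(l+1) - u_l|^2\<close> between two computable discrete increments, and the error
  estimates are the intermediate quantity: the full estimate bounds the enriched increment
  (\<open>reliability\<close>), the part of it that belongs to new mesh vertices or new indices is bounded by the actual
  increment (\<open>vertex_efficiency\<close>, \<open>index_efficiency\<close>), and either marking criterion guarantees that this part
  dominates the full estimate (\<open>marking_bound\<close>). Both estimator bounds use only residuals tested
  with discrete functions, so the right-hand side \<open>f\<close> never enters except through \<open>B (u - u_l)\<close>.

  Two facts about the refined finite element space carry the estimator bounds. First, a function on the
  uniformly refined mesh splits into its interpolant on the coarse mesh, which the residual does
  not see, and a combination of hat functions at the new vertices, whose energies are bounded by the
  energy of the function (\<open>interpolation_split\<close>). Second, at most three hat functions overlap at
  almost every point (\<open>hat_overlap\<close>). The constant of the splitting depends only on the shape of the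
  triangles, and bisection leaves the ratio of \<open>shape\<close> and area unchanged (\<open>bisect_shape\<close>), so the coarsest
  mesh controls all levels. The ellipticity bounds \<open>(1 - \<tau>) B0 \<le> B \<le> (1 + \<tau>) B0\<close> and the orthonormality
  of the polynomials reduce every estimate to single spatial functions.

  The finite element part has to be connected with weak gradients and with the closure of test functions in
  \<open>H1\<close>. That hat functions belong to \<open>H10\<close> is shown by truncation and mollification
  (\<open>H10_of_locally_affine\<close>). Conversely, discrete functions vanish on the boundary
  (\<open>H10_boundary_value\<close>), because they would otherwise have an unbounded gradient across a Lipschitz boundary;
  this is what makes boundary midpoints invisible in the splitting.
\<close>

section \<open>Functions as vectors, and semi-inner products\<close>

instantiation "fun" :: (type, real_vector) real_vector
begin

definition scaleR_fun :: "real \<Rightarrow> ('a \<Rightarrow> 'b) \<Rightarrow> 'a \<Rightarrow> 'b" where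
  "scaleR_fun c f = (\<lambda>x. c *\<^sub>R f x)"

instance
  by standard (auto simp: scaleR_fun_def algebra_simps fun_eq_iff)

end

lemma scaleR_fun_apply [simp]: "(c *\<^sub>R f) x = c *\<^sub>R f x"
  by (simp add: scaleR_fun_def)

lemma sum_fun_apply: "(\<Sum>i\<in>I. f i) x = (\<Sum>i\<in>I. f i x)"
  by (induction I rule: infinite_finite_induct) auto

text \<open>Only a semi-inner product on a subspace is assumed, because spaces of representatives contain
  nonzero functions of norm zero.\<close>

locale semi_inner =
  fixes X :: "'v::real_vector set" and b :: "'v \<Rightarrow> 'v \<Rightarrow> real"
  assumes sub: "subspace X"
    and sym: "v \<in> X \<Longrightarrow> w \<in> X \<Longrightarrow> b v w = b w v"
    and add: "u \<in> X \<Longrightarrow> v \<in> X \<Longrightarrow> w \<in> X \<Longrightarrow> b (u + v) w = b u w + b v w"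
    and scale: "v \<in> X \<Longrightarrow> w \<in> X \<Longrightarrow> b (c *\<^sub>R v) w = c * b v w"
    and nonneg: "v \<in> X \<Longrightarrow> 0 \<le> b v v"
begin

lemmas closed = subspace_add[OF sub] subspace_scale[OF sub] subspace_diff[OF sub]
  subspace_0[OF sub] subspace_neg[OF sub]

lemma add_right: "u \<in> X \<Longrightarrow> v \<in> X \<Longrightarrow> w \<in> X \<Longrightarrow> b w (u + v) = b w u + b w v"
  using add[of u v w] sym[of w "u + v"] sym[of w u] sym[of w v] by (simp add: closed)

lemma scale_right: "v \<in> X \<Longrightarrow> w \<in> X \<Longrightarrow> b w (c *\<^sub>R v) = c * b w v"
  using scale[of v w c] sym[of w "c *\<^sub>R v"] sym[of w v] by (simp add: closed)

lemma zero_left: "w \<in> X \<Longrightarrow> b 0 w = 0"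
  using scale[of w w 0] by simp

lemma diff_left: "u \<in> X \<Longrightarrow> v \<in> X \<Longrightarrow> w \<in> X \<Longrightarrow> b (u - v) w = b u w - b v w"
  using add[of u "(- 1) *\<^sub>R v" w] scale[of v w "- 1"] by (simp add: closed)

lemma sum_left:
  assumes "\<And>i. i \<in> I \<Longrightarrow> f i \<in> X" "w \<in> X"
  shows "b (\<Sum>i\<in>I. f i) w = (\<Sum>i\<in>I. b (f i) w)"
  using assms(1)
proof (induction I rule: infinite_finite_induct)
  case (insert i I)
  then show ?case by (simp add: add subspace_sum[OF sub] assms(2))
qed (simp_all add: zero_left assms)

lemma sum_right:
  assumes "\<And>i. i \<in> I \<Longrightarrow> f i \<in> X" "w \<in> X"
  shows "b w (\<Sum>i\<in>I. f i) = (\<Sum>i\<in>I. b w (f i))"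
proof -
  have "b w (\<Sum>i\<in>I. f i) = b (\<Sum>i\<in>I. f i) w"
    by (intro sym assms subspace_sum[OF sub])
  also have "\<dots> = (\<Sum>i\<in>I. b w (f i))"
    using sum_left[of I f w] assms by (simp add: sym[OF _ assms(2)])
  finally show ?thesis .
qed

lemma quadratic:
  assumes "v \<in> X" "w \<in> X"
  shows "b (v + c *\<^sub>R w) (v + c *\<^sub>R w) = b v v + 2 * c * b v w + c\<^sup>2 * b w w"
  using assms sym[of w v]
  by (simp add: add add_right scale scale_right closed power2_eq_square algebra_simps)

lemma Cauchy_Schwarz_square:
  assumes v: "v \<in> X" and w: "w \<in> X"
  shows "(b v w)\<^sup>2 \<le> b v v * b w w"
proof (cases "b w w = 0")
  case True
  have "b v w = 0"
  proof (rule ccontr)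
    assume "b v w \<noteq> 0"
    then have "b v v + 2 * (- (b v v + 1) / (2 * b v w)) * b v w = - 1"
      by (simp add: field_simps)
    then show False
      using nonneg[of "v + (- (b v v + 1) / (2 * b v w)) *\<^sub>R w"] v w True
      unfolding quadratic[OF v w] by (simp add: closed)
  qed
  then show ?thesis using True by simp
next
  case False
  then have pos: "b w w > 0" using nonneg[OF w] by simp
  have "0 \<le> b v v + 2 * (- b v w / b w w) * b v w + (- b v w / b w w)\<^sup>2 * b w w"
    using nonneg[of "v + (- b v w / b w w) *\<^sub>R w"] v w
    unfolding quadratic[OF v w] by (simp add: closed)
  also have "\<dots> = b v v - (b v w)\<^sup>2 / b w w"
    using False by (simp add: power2_eq_square field_simps)
  finally show ?thesis using pos by (simp add: field_simps)
qed

lemma Cauchy_Schwarz: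
  assumes "v \<in> X" "w \<in> X"
  shows "\<bar>b v w\<bar> \<le> sqrt (b v v) * sqrt (b w w)"
  using Cauchy_Schwarz_square[OF assms]
  by (metis real_sqrt_abs real_sqrt_le_iff real_sqrt_mult)

lemma triangle:
  assumes "v \<in> X" "w \<in> X"
  shows "sqrt (b (v + w) (v + w)) \<le> sqrt (b v v) + sqrt (b w w)"
proof (rule real_le_lsqrt)
  have "b (v + w) (v + w) = b v v + 2 * b v w + b w w"
    using quadratic[OF assms, of 1] by simp
  also have "\<dots> \<le> (sqrt (b v v) + sqrt (b w w))\<^sup>2"
    using Cauchy_Schwarz[OF assms] nonneg assms by (simp add: power2_sum)
  finally show "b (v + w) (v + w) \<le> (sqrt (b v v) + sqrt (b w w))\<^sup>2" .
qed (use assms nonneg in auto)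

lemma scale_sqrt: "v \<in> X \<Longrightarrow> sqrt (b (c *\<^sub>R v) (c *\<^sub>R v)) = \<bar>c\<bar> * sqrt (b v v)"
  by (simp add: scale scale_right closed real_sqrt_mult flip: mult.assoc)

text \<open>Gram--Schmidt for a degenerate form: induction over the spanning set, splitting off the
  \<open>b\<close>-orthogonal part \<open>w'\<close> of each new vector. The last assumption makes \<open>l\<close> vanish where \<open>w'\<close> has norm
  zero, so that the coefficient of \<open>w'\<close> can be set to zero there.\<close>

lemma finite_dim_riesz:
  assumes "finite Z" "Z \<subseteq> X"
    and "\<And>v w. v \<in> X \<Longrightarrow> w \<in> X \<Longrightarrow> l (v + w) = l v + l w"
    and "\<And>c v. v \<in> X \<Longrightarrow> l (c *\<^sub>R v) = c * l v"
    and "\<And>v. v \<in> X \<Longrightarrow> b v v = 0 \<Longrightarrow> l v = 0"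
  shows "\<exists>e\<in>span Z. \<forall>v\<in>span Z. b e v = l v"
  using assms
proof (induction Z arbitrary: l rule: finite_induct)
  case empty
  have "l 0 = 0" using empty(3)[of 0 0] closed by simp
  then show ?case by (simp add: zero_left closed)
next
  case (insert w Z)
  have wX: "w \<in> X" and ZX: "Z \<subseteq> X" using insert.prems(1) by auto
  have spX: "span Z \<subseteq> X" by (intro span_minimal ZX sub)
  obtain e0 where e0: "e0 \<in> span Z" "\<forall>v\<in>span Z. b e0 v = l v"
    using insert.IH[OF ZX insert.prems(2-4)] by blast
  obtain pw where pw: "pw \<in> span Z" "\<forall>v\<in>span Z. b pw v = b w v"
  proof -
    have "\<exists>e\<in>span Z. \<forall>v\<in>span Z. b e v = b w v"
    proof (rule insert.IH[OF ZX])
      fix v assume "v \<in> X" "b v v = 0"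
      then show "b w v = 0" using Cauchy_Schwarz_square[OF wX, of v] by simp
    qed (auto intro: add_right scale_right wX)
    then show ?thesis using that by blast
  qed
  define w' where "w' = w - pw"
  have w'X: "w' \<in> X" using wX pw spX by (auto simp: w'_def closed)
  have orth: "b w' v = 0" if "v \<in> span Z" for v
    using that pw wX spX unfolding w'_def by (subst diff_left) auto
  define c where "c = (if b w' w' = 0 then 0 else l w' / b w' w')"
  have c: "c * b w' w' = l w'" using insert.prems(4)[OF w'X] by (auto simp: c_def)
  define e where "e = e0 + c *\<^sub>R w'"
  have e0X: "e0 \<in> X" using e0 spX by auto
  have "pw \<in> span (insert w Z)" "e0 \<in> span (insert w Z)"
    using pw e0 span_mono[of Z "insert w Z"] by auto
  then have "e \<in> span (insert w Z)"
    unfolding e_def w'_def by (simp add: span_add span_scale span_diff span_base)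
  moreover have "b e v = l v" if v: "v \<in> span (insert w Z)" for v
  proof -
    obtain k where k: "v - k *\<^sub>R w \<in> span Z" using v by (auto simp: span_insert)
    define v1 where "v1 = (v - k *\<^sub>R w) + k *\<^sub>R pw"
    have v1: "v1 \<in> span Z" unfolding v1_def using k pw by (intro span_add span_scale) auto
    then have v1X: "v1 \<in> X" using spX by auto
    have veq: "v = v1 + k *\<^sub>R w'" by (simp add: v1_def w'_def algebra_simps)
    have "b e0 w' = 0" using orth[OF e0(1)] sym[OF e0X w'X] by simp
    then have "b e v = b e0 v1 + k * (c * b w' w')"
      unfolding veq e_def using v1X w'X e0X orth[OF v1]
      by (simp add: add add_right scale scale_right closed algebra_simps)
    also have "\<dots> = l v1 + k * l w'" using e0 v1 c by simp
    also have "\<dots> = l v" unfolding veq using v1X w'X insert.prems by (simp add: closed)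
    finally show ?thesis .
  qed
  ultimately show ?case by blast
qed

end

section \<open>Differentiation under the integral sign\<close>

lemma lborel_integral_translation:
  fixes f :: "'a::euclidean_space \<Rightarrow> real"
  assumes "f \<in> borel_measurable borel"
  shows "(\<integral>x. f (x + c) \<partial>lborel) = (\<integral>x. f x \<partial>lborel)"
proof -
  have "(\<integral>x. f x \<partial>lborel) = (\<integral>x. f x \<partial>distr lborel borel ((+) c))"
    by (simp add: lborel_distr_plus)
  also have "\<dots> = (\<integral>x. f (c + x) \<partial>lborel)"
    using assms by (intro integral_distr) auto
  finally show ?thesis by (simp add: add.commute)
qed

lemma integrable_continuous_bounded_support:
  fixes f :: "'a::euclidean_space \<Rightarrow> real"
  assumes "continuous_on UNIV f" "bounded S" "\<And>x. x \<notin> S \<Longrightarrow> f x = 0"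
  shows "integrable lborel f"
proof -
  obtain a b where ab: "S \<subseteq> cbox a b" using bounded_subset_cbox_symmetric[OF assms(2)] by blast
  have "integrable lborel (\<lambda>x. indicator (cbox a b) x *\<^sub>R f x)"
    by (intro borel_integrable_compact) (auto intro: continuous_on_subset[OF assms(1)])
  moreover have "(\<lambda>x. indicator (cbox a b) x *\<^sub>R f x) = f"
    using ab assms(3) by (auto simp: fun_eq_iff indicator_def)
  ultimately show ?thesis by simp
qed

lemma has_derivative_along_line:
  fixes f :: "'a::real_normed_vector \<Rightarrow> real"
  assumes der: "(f has_derivative f') (at x)"
  shows "((\<lambda>t. f (x + t *\<^sub>R h)) has_real_derivative f' h) (at 0)"
proof -
  interpret f': bounded_linear f' by (rule has_derivative_bounded_linear[OF der])
  have "((\<lambda>t. f (x + t *\<^sub>R h)) has_derivative (\<lambda>t. f' (t *\<^sub>R h))) (at 0)"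
  proof (rule has_derivative_compose[where g = f and g' = f' and f = "\<lambda>t. x + t *\<^sub>R h"])
    show "((\<lambda>t. x + t *\<^sub>R h) has_derivative (\<lambda>t. t *\<^sub>R h)) (at 0)"
      by (auto intro!: derivative_eq_intros)
    show "(f has_derivative f') (at (x + 0 *\<^sub>R h))" using der by simp
  qed
  then show ?thesis
    unfolding has_field_derivative_def
    by (rule has_derivative_eq_rhs) (simp add: f'.scaleR mult.commute fun_eq_iff)
qed

lemma has_derivative_le_lipschitz:
  fixes f :: "'a::real_normed_vector \<Rightarrow> real"
  assumes der: "(f has_derivative f') (at x)"
    and lip: "\<And>z. norm (z - x) < 1 \<Longrightarrow> \<bar>f z - f x\<bar> \<le> K * norm (z - x)"
  shows "\<bar>f' h\<bar> \<le> K * norm h"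
proof (cases "h = 0")
  case True
  then show ?thesis using linear_0[OF bounded_linear.linear[OF has_derivative_bounded_linear[OF der]]] by simp
next
  case False
  have "((\<lambda>t. (f (x + t *\<^sub>R h) - f x) / t) \<longlongrightarrow> f' h) (at 0)"
    using has_derivative_along_line[OF der, of h] by (simp add: DERIV_def)
  then have lim: "((\<lambda>t. \<bar>(f (x + t *\<^sub>R h) - f x) / t\<bar>) \<longlongrightarrow> \<bar>f' h\<bar>) (at 0)"
    by (rule tendsto_rabs)
  have "\<bar>(f (x + t *\<^sub>R h) - f x) / t\<bar> \<le> K * norm h" if t: "t \<noteq> 0" "\<bar>t\<bar> < 1 / norm h" for t :: real
  proof -
    have "\<bar>t\<bar> * norm h < 1" using t False by (simp add: pos_less_divide_eq)
    then have "\<bar>f (x + t *\<^sub>R h) - f x\<bar> \<le> K * (\<bar>t\<bar> * norm h)" using lip[of "x + t *\<^sub>R h"] by simp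
    then have "\<bar>f (x + t *\<^sub>R h) - f x\<bar> \<le> K * norm h * \<bar>t\<bar>" by (simp only: mult_ac)
    then show ?thesis using t by (simp add: abs_divide pos_divide_le_eq)
  qed
  then have "\<forall>\<^sub>F t in at (0::real). \<bar>(f (x + t *\<^sub>R h) - f x) / t\<bar> \<le> K * norm h"
    unfolding eventually_at using False by (intro exI[of _ "1 / norm h"]) (simp add: dist_real_def)
  then show ?thesis by (rule tendsto_upperbound[OF lim]) simp
qed

text \<open>Dominated convergence for difference quotients; the derivative need only exist almost everywhere,
  as it does for Lipschitz integrands that are piecewise affine.\<close>

lemma has_derivative_integral_param:
  fixes f :: "'a::real_normed_vector \<Rightarrow> 'b \<Rightarrow> real"
  assumes int: "\<And>x. integrable M (f x)"
    and der: "AE y in M. ((\<lambda>x. f x y) has_derivative f' y) (at x0)"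
    and meas: "\<And>h. (\<lambda>y. f' y h) \<in> borel_measurable M"
    and lip: "\<And>x y. norm (x - x0) < 1 \<Longrightarrow> \<bar>f x y - f x0 y\<bar> \<le> K y * norm (x - x0)"
    and K: "integrable M K"
  shows "((\<lambda>x. \<integral>y. f x y \<partial>M) has_derivative (\<lambda>h. \<integral>y. f' y h \<partial>M)) (at x0)"
    and "integrable M (\<lambda>y. f' y h)"
proof -
  have bnd: "AE y in M. \<forall>h. \<bar>f' y h\<bar> \<le> K y * norm h"
    using der
  proof eventually_elim
    case (elim y)
    show ?case using has_derivative_le_lipschitz[OF elim lip] by blast
  qed
  have lin: "AE y in M. linear (f' y)"
    using der by eventually_elim (auto dest: has_derivative_bounded_linear bounded_linear.linear)
  show int': "integrable M (\<lambda>y. f' y h)" for h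
  proof (rule Bochner_Integration.integrable_bound[of M "\<lambda>y. K y * norm h"])
    show "AE y in M. norm (f' y h) \<le> norm (K y * norm h)"
      using bnd by eventually_elim (metis abs_ge_self order_trans real_norm_def)
  qed (use K meas in auto)
  show "((\<lambda>x. \<integral>y. f x y \<partial>M) has_derivative (\<lambda>h. \<integral>y. f' y h \<partial>M)) (at x0)"
    unfolding has_derivative_at_within
  proof (intro conjI)
    show "bounded_linear (\<lambda>h. \<integral>y. f' y h \<partial>M)"
    proof (rule bounded_linear_intro[where K = "\<integral>y. K y \<partial>M"])
      fix h k
      have "(\<integral>y. f' y (h + k) \<partial>M) = (\<integral>y. f' y h + f' y k \<partial>M)"
        by (rule integral_cong_AE) (use meas lin in \<open>auto intro!: borel_measurable_add elim!: eventually_mono simp: linear_add\<close>)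
      then show "(\<integral>y. f' y (h + k) \<partial>M) = (\<integral>y. f' y h \<partial>M) + (\<integral>y. f' y k \<partial>M)"
        using int' by simp
    next
      fix r h
      have "(\<integral>y. f' y (r *\<^sub>R h) \<partial>M) = (\<integral>y. r * f' y h \<partial>M)"
        by (rule integral_cong_AE) (use meas lin in \<open>auto elim!: eventually_mono simp: linear_scale\<close>)
      then show "(\<integral>y. f' y (r *\<^sub>R h) \<partial>M) = r *\<^sub>R (\<integral>y. f' y h \<partial>M)" by simp
    next
      fix h
      have "(\<integral>y. norm (f' y h) \<partial>M) \<le> (\<integral>y. K y * norm h \<partial>M)"
        by (rule integral_mono_AE)
           (use bnd int' K in \<open>auto intro!: integrable_norm elim!: eventually_mono simp del: integral_mult_left_zero\<close>)
      then have "norm (\<integral>y. f' y h \<partial>M) \<le> (\<integral>y. K y * norm h \<partial>M)"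
        by (rule order_trans[OF integral_norm_bound])
      then show "norm (\<integral>y. f' y h \<partial>M) \<le> norm h * (\<integral>y. K y \<partial>M)"
        by (simp add: mult.commute)
    qed
    show "((\<lambda>x. ((\<integral>y. f x y \<partial>M) - (\<integral>y. f x0 y \<partial>M) - (\<integral>y. f' y (x - x0) \<partial>M)) /\<^sub>R norm (x - x0)) \<longlongrightarrow> 0) (at x0)"
      unfolding tendsto_at_iff_sequentially
    proof (intro allI impI)
      fix X assume X: "\<forall>i. X i \<in> UNIV - {x0}" "X \<longlonglongrightarrow> x0"
      obtain N where N: "\<And>n. n \<ge> N \<Longrightarrow> norm (X n - x0) < 1"
        using X(2)[unfolded LIMSEQ_iff, rule_format, of 1] by auto
      define q where "q n y = (f (X (n + N)) y - f x0 y - f' y (X (n + N) - x0)) / norm (X (n + N) - x0)" for n y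
      have "(\<lambda>n. \<integral>y. q n y \<partial>M) \<longlonglongrightarrow> (\<integral>y. 0 \<partial>M)"
      proof (rule integral_dominated_convergence[where w = "\<lambda>y. 2 * K y"])
        show "AE y in M. (\<lambda>n. q n y) \<longlonglongrightarrow> 0"
          using der
        proof eventually_elim
          case (elim y)
          then have "((\<lambda>x. (f x y - f x0 y - f' y (x - x0)) /\<^sub>R norm (x - x0)) \<longlongrightarrow> 0) (at x0)"
            by (simp add: has_derivative_at_within)
          then have "(\<lambda>n. (f (X n) y - f x0 y - f' y (X n - x0)) /\<^sub>R norm (X n - x0)) \<longlonglongrightarrow> 0"
            using X unfolding tendsto_at_iff_sequentially comp_def by blast
          then show ?case unfolding q_def
            using LIMSEQ_ignore_initial_segment[of _ 0 N] by (fastforce simp: divide_inverse mult.commute)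
        qed
        show "AE y in M. norm (q n y) \<le> 2 * K y" for n
          using bnd
        proof eventually_elim
          case (elim y)
          let ?z = "X (n + N)"
          have nz: "norm (?z - x0) > 0" using X by auto
          have "\<bar>f ?z y - f x0 y - f' y (?z - x0)\<bar> \<le> K y * norm (?z - x0) + K y * norm (?z - x0)"
            using lip[OF N[of "n + N"], of y] elim[rule_format, of "?z - x0"] by simp
          then show ?case unfolding q_def using nz by (simp add: abs_divide field_simps)
        qed
        show "(\<lambda>y. q n y) \<in> borel_measurable M" for n
          unfolding q_def using meas borel_measurable_integrable[OF int] by measurable
      qed (use K in auto)
      moreover have "(\<integral>y. q n y \<partial>M) = ((\<integral>y. f (X (n + N)) y \<partial>M) - (\<integral>y. f x0 y \<partial>M) - (\<integral>y. f' y (X (n + N) - x0) \<partial>M)) /\<^sub>R norm (X (n + N) - x0)" for n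
        unfolding q_def using int int' by (simp add: divide_inverse mult.commute)
      ultimately have "(\<lambda>n. ((\<integral>y. f (X (n + N)) y \<partial>M) - (\<integral>y. f x0 y \<partial>M) - (\<integral>y. f' y (X (n + N) - x0) \<partial>M)) /\<^sub>R norm (X (n + N) - x0)) \<longlonglongrightarrow> 0"
        by simp
      then show "((\<lambda>x. ((\<integral>y. f x y \<partial>M) - (\<integral>y. f x0 y \<partial>M) - (\<integral>y. f' y (x - x0) \<partial>M)) /\<^sub>R norm (x - x0)) \<circ> X) \<longlonglongrightarrow> 0"
        unfolding comp_def by (rule LIMSEQ_offset)
    qed
  qed
qed

text \<open>The integral of \<open>w (x + t e)\<close> does not depend on \<open>t\<close>; differentiating it at \<open>t = 0\<close> gives the claim.
  Applied to a product with a test function, this is integration by parts without any boundary term.\<close>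

lemma integral_directional_derivative_zero:
  fixes w :: "'a::euclidean_space \<Rightarrow> real"
  assumes lip: "L-lipschitz_on UNIV w" and S: "bounded S" "\<And>x. x \<notin> S \<Longrightarrow> w x = 0"
    and der: "AE x in lborel. ((\<lambda>t. w (x + t *\<^sub>R e)) has_real_derivative d x) (at 0)"
    and meas: "d \<in> borel_measurable borel"
  shows "integrable lborel d" "(\<integral>x. d x \<partial>lborel) = 0"
proof -
  have cont: "continuous_on UNIV w" using lipschitz_on_continuous_on[OF lip] .
  have bm: "w \<in> borel_measurable borel" using cont by (rule borel_measurable_continuous_onI)
  obtain R where R: "S \<subseteq> cball 0 R" "R \<ge> 0"
    using bounded_subset_ballD[OF S(1), of 0] ball_subset_cball by (meson less_imp_le order_trans)
  define K where "K x = indicator (cball 0 (R + norm e)) x * (L * norm e)" for x :: 'a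
  have L: "L \<ge> 0" using lip by (rule lipschitz_on_nonneg)
  have K: "integrable lborel K" unfolding K_def
    using emeasure_bounded_finite[of "cball (0::'a) (R + norm e)"]
    by (intro integrable_mult_left) (simp add: integrable_indicator_iff)
  have *: "((\<lambda>t. \<integral>x. w (x + t *\<^sub>R e) \<partial>lborel) has_derivative (\<lambda>h. \<integral>x. h * d x \<partial>lborel)) (at 0)"
       "\<And>h. integrable lborel (\<lambda>x. h * d x)"
  proof -
    have 1: "integrable lborel (\<lambda>x. w (x + t *\<^sub>R e))" for t
    proof (rule integrable_continuous_bounded_support[where S = "cball 0 (R + norm (t *\<^sub>R e))"])
      show "continuous_on UNIV (\<lambda>x. w (x + t *\<^sub>R e))"
        by (rule continuous_on_compose2[OF cont]) (auto intro!: continuous_intros)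
      fix x :: 'a assume "x \<notin> cball 0 (R + norm (t *\<^sub>R e))"
      then have "norm (x + t *\<^sub>R e) > R" using norm_triangle_ineq2[of x "- (t *\<^sub>R e)"] by auto
      then show "w (x + t *\<^sub>R e) = 0" using R by (intro S(2)) auto
    qed simp
    have 2: "AE x in lborel. ((\<lambda>t. w (x + t *\<^sub>R e)) has_derivative (\<lambda>h. h * d x)) (at 0)"
      using der unfolding has_field_derivative_def
      by eventually_elim (erule has_derivative_eq_rhs, simp add: fun_eq_iff mult.commute)
    have 3: "\<bar>w (x + t *\<^sub>R e) - w (x + 0 *\<^sub>R e)\<bar> \<le> K x * norm (t - 0)" if t: "norm (t - 0) < 1" for t x
    proof (cases "x \<in> cball 0 (R + norm e)")
      case True
      then have eq: "K x * norm (t - 0) = L * norm (t *\<^sub>R e)" by (simp add: K_def)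
      have "dist (w (x + t *\<^sub>R e)) (w x) \<le> L * dist (x + t *\<^sub>R e) x"
        by (rule lipschitz_onD[OF lip]) auto
      then show ?thesis unfolding eq by (simp add: dist_norm)
    next
      case False
      have "norm (t *\<^sub>R e) \<le> norm e" using t by (simp add: mult_left_le_one_le)
      moreover have "norm x > R + norm e" using False by simp
      moreover have "norm x - norm (t *\<^sub>R e) \<le> norm (x + t *\<^sub>R e)"
        using norm_triangle_ineq2[of x "- (t *\<^sub>R e)"] by simp
      ultimately have "norm (x + t *\<^sub>R e) > R" "norm x > R"
        using norm_ge_zero[of e] by linarith+
      then have "x + t *\<^sub>R e \<notin> S" "x \<notin> S" using R(1) by auto
      then have "w (x + t *\<^sub>R e) = 0" "w x = 0" by (simp_all add: S(2))
      then show ?thesis using L by (simp add: K_def)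
    qed
    have 4: "(\<lambda>x. h * d x) \<in> borel_measurable lborel" for h using meas by simp
    show "((\<lambda>t. \<integral>x. w (x + t *\<^sub>R e) \<partial>lborel) has_derivative (\<lambda>h. \<integral>x. h * d x \<partial>lborel)) (at 0)"
      by (rule has_derivative_integral_param(1)[where M = lborel and f = "\<lambda>t x. w (x + t *\<^sub>R e)" and f' = "\<lambda>x h. h * d x" and ?x0.0 = 0 and K = K])
         (fact 1 2 3 4 K)+
    show "\<And>h. integrable lborel (\<lambda>x. h * d x)"
      by (rule has_derivative_integral_param(2)[where M = lborel and f = "\<lambda>t x. w (x + t *\<^sub>R e)" and f' = "\<lambda>x h. h * d x" and ?x0.0 = 0 and K = K])
         (fact 1 2 3 4 K)+
  qed
  show "integrable lborel d" using *(2)[of 1] by simp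
  have shift: "(\<lambda>t. \<integral>x. w (x + t *\<^sub>R e) \<partial>lborel) = (\<lambda>t. \<integral>x. w x \<partial>lborel)"
    by (rule ext) (rule lborel_integral_translation[OF bm])
  have "((\<lambda>t::real. \<integral>x. w x \<partial>lborel) has_derivative (\<lambda>h. \<integral>x. h * d x \<partial>lborel)) (at 0)"
    by (rule subst[OF shift, where P = "\<lambda>I. (I has_derivative _) (at 0)"]) (rule *(1))
  then have "(\<lambda>h. \<integral>x. h * d x \<partial>lborel) = (\<lambda>h. 0)"
    by (rule has_derivative_unique) (rule has_derivative_const)
  from fun_cong[OF this, of 1] show "(\<integral>x. d x \<partial>lborel) = 0" by simp
qed

section \<open>Smooth functions and bump functions\<close>

text \<open>Smoothness quantifies over all iterated partial derivatives, so it follows for every member of a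
  set of differentiable functions that is closed under partial derivatives.\<close>

lemma smoothI_closed:
  assumes "f \<in> S" "\<And>g x. g \<in> S \<Longrightarrow> g differentiable (at x)" "\<And>g i. g \<in> S \<Longrightarrow> partial i g \<in> S"
  shows "smooth f"
proof -
  have "foldr partial is f \<in> S" for "is"
    by (induction "is") (auto intro: assms)
  then show ?thesis using assms(2) by (simp add: smooth_def)
qed

lemma smooth_partial: "smooth f \<Longrightarrow> smooth (partial i f)"
  unfolding smooth_def
proof (intro allI)
  fix "is" x assume "\<forall>is x. foldr partial is f differentiable (at x)"
  then have "foldr partial (is @ [i]) f differentiable (at x)" by blast
  then show "foldr partial is (partial i f) differentiable (at x)" by simp
qed

lemma smooth_differentiable: "smooth f \<Longrightarrow> f differentiable (at x)"
  unfolding smooth_def by (metis foldr.simps(1) id_apply)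

lemma smooth_continuous_on: "smooth f \<Longrightarrow> continuous_on S f"
  by (meson smooth_differentiable continuous_at_imp_continuous_on differentiable_imp_continuous_within)

lemma partial_eqI: "(f has_derivative f') (at x) \<Longrightarrow> partial i f x = f' (axis i 1)"
  unfolding partial_def using frechet_derivative_at by metis

text \<open>The classical gradient, as opposed to the weak gradient \<open>grad\<close>.\<close>

definition cgrad :: "(point \<Rightarrow> real) \<Rightarrow> point \<Rightarrow> point" where
  "cgrad f x = (\<chi> i. partial i f x)"

lemma has_derivative_gradientI:
  assumes "(f has_derivative f') (at (x::point))"
  shows "(f has_derivative (\<lambda>h. cgrad f x \<bullet> h)) (at x)"
proof -
  interpret f': bounded_linear f' by (rule has_derivative_bounded_linear[OF assms])
  have "f' h = cgrad f x \<bullet> h" for h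
  proof -
    have "f' h = f' (\<Sum>i\<in>UNIV. h $ i *\<^sub>R axis i 1)"
      using basis_expansion[of h] by (simp add: scalar_mult_eq_scaleR)
    also have "\<dots> = (\<Sum>i\<in>UNIV. h $ i * f' (axis i 1))" by (simp add: f'.sum f'.scaleR)
    also have "\<dots> = cgrad f x \<bullet> h"
      by (simp add: cgrad_def inner_vec_def partial_eqI[OF assms] mult.commute)
    finally show ?thesis .
  qed
  then have "f' = (\<lambda>h. cgrad f x \<bullet> h)" by auto
  then show ?thesis using assms by simp
qed

lemma smooth_has_derivative:
  "smooth f \<Longrightarrow> (f has_derivative (\<lambda>h. cgrad f x \<bullet> h)) (at x)"
  using smooth_differentiable[of f x] has_derivative_gradientI by (auto simp: differentiable_def)

lemma smooth_lincomb:
  assumes "smooth f" "smooth g"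
  shows "smooth (\<lambda>x. c * f x + d * g x)"
proof (rule smoothI_closed)
  let ?S = "{\<lambda>x. c * f x + d * g x | f g. smooth f \<and> smooth g}"
  show "(\<lambda>x. c * f x + d * g x) \<in> ?S" using assms by blast
  have der: "((\<lambda>x. c * f x + d * g x) has_derivative (\<lambda>h. c * (cgrad f x \<bullet> h) + d * (cgrad g x \<bullet> h))) (at x)"
    if "smooth f" "smooth g" for f g x
    by (intro derivative_intros smooth_has_derivative that)
  show "h differentiable (at x)" if "h \<in> ?S" for h x
    using that der by (auto simp: differentiable_def)
  show "partial i h \<in> ?S" if hS: "h \<in> ?S" for i h
  proof -
    obtain f g where h: "h = (\<lambda>x. c * f x + d * g x)" "smooth f" "smooth g" using hS by blast
    have "partial i h = (\<lambda>x. c * partial i f x + d * partial i g x)"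
      unfolding h(1) using partial_eqI[OF der[OF h(2,3)], of i] by (auto simp: cgrad_def inner_axis)
    then show ?thesis using h smooth_partial by blast
  qed
qed

text \<open>By the product rule, the algebra generated by a set of functions is closed under partial derivatives as soon as the
  partial derivatives of the generators lie in it.\<close>

inductive_set fun_algebra :: "(point \<Rightarrow> real) set \<Rightarrow> (point \<Rightarrow> real) set" for W where
  base: "w \<in> W \<Longrightarrow> w \<in> fun_algebra W"
| const: "(\<lambda>x. c) \<in> fun_algebra W"
| plus: "f \<in> fun_algebra W \<Longrightarrow> g \<in> fun_algebra W \<Longrightarrow> (\<lambda>x. f x + g x) \<in> fun_algebra W"
| times: "f \<in> fun_algebra W \<Longrightarrow> g \<in> fun_algebra W \<Longrightarrow> (\<lambda>x. f x * g x) \<in> fun_algebra W"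

lemma smooth_fun_algebra:
  assumes diff: "\<And>w x. w \<in> W \<Longrightarrow> w differentiable (at x)"
    and part: "\<And>w i. w \<in> W \<Longrightarrow> partial i w \<in> fun_algebra W"
    and f: "f \<in> fun_algebra W"
  shows "smooth f"
proof (rule smoothI_closed[OF f])
  show d: "g differentiable (at x)" if "g \<in> fun_algebra W" for g x
    using that by induction (auto intro: diff derivative_intros)
  have hd: "(g has_derivative (\<lambda>h. cgrad g x \<bullet> h)) (at x)" if "g \<in> fun_algebra W" for g x
    using d[OF that, of x] has_derivative_gradientI by (auto simp: differentiable_def)
  show "partial i g \<in> fun_algebra W" if "g \<in> fun_algebra W" for i g
    using that
  proof induction
    case (const c)
    have "partial i (\<lambda>x. c) = (\<lambda>x. 0)"
      by (rule ext) (use partial_eqI[OF has_derivative_const] in auto)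
    then show ?case by (simp add: fun_algebra.const)
  next
    case (plus f g)
    have "partial i (\<lambda>x. f x + g x) = (\<lambda>x. partial i f x + partial i g x)"
      by (rule ext, rule partial_eqI[OF has_derivative_add[OF hd[OF plus.hyps(1)] hd[OF plus.hyps(2)]], THEN trans])
         (simp add: cgrad_def inner_axis)
    then show ?case using plus by (simp add: fun_algebra.plus)
  next
    case (times f g)
    have "partial i (\<lambda>x. f x * g x) = (\<lambda>x. f x * partial i g x + partial i f x * g x)"
      by (rule ext, rule partial_eqI[OF has_derivative_mult[OF hd[OF times.hyps(1)] hd[OF times.hyps(2)]], THEN trans])
         (simp add: cgrad_def inner_axis)
    then show ?case using times by (simp add: fun_algebra.plus fun_algebra.times)
  qed (use part in auto)
qed

fun flat_poly :: "nat \<Rightarrow> real poly" where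
  "flat_poly 0 = 1"
| "flat_poly (Suc n) = [:0, 0, 1:] * (flat_poly n - pderiv (flat_poly n))"

text \<open>The \<open>n\<close>-th derivative of the function that is \<open>exp (- 1 / t)\<close> for \<open>t > 0\<close> and zero otherwise;
  the polynomials \<open>flat_poly n\<close> are its factors in \<open>1 / t\<close>.\<close>

definition flat_exp :: "nat \<Rightarrow> real \<Rightarrow> real" where
  "flat_exp n t = (if t \<le> 0 then 0 else poly (flat_poly n) (1 / t) * exp (- (1 / t)))"

lemma poly_exp_decay: "((\<lambda>s. s ^ k * poly p s * exp (- s)) \<longlongrightarrow> (0::real)) at_top"
proof (induction p arbitrary: k)
  case (pCons a p)
  have "((\<lambda>s. a * (s ^ k / exp s) + s ^ Suc k * poly p s * exp (- s)) \<longlongrightarrow> a * 0 + 0) at_top"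
    by (intro tendsto_intros tendsto_power_div_exp_0 pCons)
  then show ?case by (simp add: algebra_simps exp_minus divide_inverse)
qed simp

text \<open>At \<open>t = 0\<close> the substitution \<open>s = 1 / t\<close> reduces the difference quotient to the decay of a polynomial times
  \<open>exp (- s)\<close>.\<close>

lemma flat_exp_DERIV: "(flat_exp n has_real_derivative flat_exp (Suc n) t) (at t)"
proof -
  consider "t < 0" | "t > 0" | "t = 0" by linarith
  then show ?thesis
  proof cases
    case 1
    have "((\<lambda>_. 0) has_real_derivative 0) (at t)" by simp
    then have "(flat_exp n has_real_derivative 0) (at t)"
      by (rule has_field_derivative_transform_within_open[where S = "{..<0}"]) (use 1 in \<open>auto simp: flat_exp_def\<close>)
    then show ?thesis using 1 by (simp add: flat_exp_def)
  next
    case 2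
    have inv: "((\<lambda>t. 1 / t) has_real_derivative (- (1 / t\<^sup>2))) (at t)"
      using 2 by (auto intro!: derivative_eq_intros simp: power2_eq_square)
    have "((\<lambda>t. poly (flat_poly n) (1 / t) * exp (- (1 / t))) has_real_derivative flat_exp (Suc n) t) (at t)"
      by (rule DERIV_cong[OF DERIV_mult[OF DERIV_chain2[OF poly_DERIV inv] DERIV_chain2[OF DERIV_exp DERIV_minus[OF inv]]]])
         (use 2 in \<open>simp add: flat_exp_def algebra_simps power2_eq_square\<close>)
    then show ?thesis
      by (rule has_field_derivative_transform_within_open[where S = "{0<..}"]) (use 2 in \<open>auto simp: flat_exp_def\<close>)
  next
    case 3
    have "((\<lambda>h. inverse h ^ 1 * poly (flat_poly n) (inverse h) * exp (- inverse h)) \<longlongrightarrow> 0) (at_right (0::real))"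
      by (rule filterlim_compose[OF poly_exp_decay filterlim_inverse_at_top_right])
    then have "((\<lambda>h. flat_exp n h / h) \<longlongrightarrow> 0) (at_right 0)"
      by (rule Lim_transform_eventually)
         (auto simp: eventually_at_filter flat_exp_def divide_inverse mult_ac intro!: always_eventually)
    moreover have "((\<lambda>h. flat_exp n h / h) \<longlongrightarrow> 0) (at_left 0)"
      by (rule Lim_transform_eventually[OF tendsto_const])
         (auto simp: eventually_at_filter flat_exp_def intro!: always_eventually)
    ultimately have "((\<lambda>h. flat_exp n h / h) \<longlongrightarrow> 0) (at 0)" by (simp add: filterlim_at_split)
    then show ?thesis unfolding 3 by (simp add: DERIV_def flat_exp_def)
  qed
qed

lemma flat_exp_0: "flat_exp 0 t = (if t \<le> 0 then 0 else exp (- (1 / t)))"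
  by (simp add: flat_exp_def)

lemma flat_exp_0_bounds: "0 \<le> flat_exp 0 t" "flat_exp 0 t \<le> 1"
  by (auto simp: flat_exp_0)

lemma flat_exp_0_pos: "0 < flat_exp 0 t \<longleftrightarrow> 0 < t"
  by (auto simp: flat_exp_0)

lemma flat_exp_0_limit: "(\<lambda>n. flat_exp 0 (real (Suc n) * t)) \<longlonglongrightarrow> (if t > 0 then 1 else 0)"
proof (cases "t > 0")
  case True
  have "(\<lambda>n. exp (- (1 / t) * inverse (real (Suc n)))) \<longlonglongrightarrow> exp (- (1 / t) * 0)"
    by (intro tendsto_intros LIMSEQ_inverse_real_of_nat)
  moreover have "exp (- (1 / t) * inverse (real (Suc n))) = flat_exp 0 (real (Suc n) * t)" for n
    using True by (simp add: flat_exp_0 mult_le_0_iff not_le field_simps del: of_nat_Suc)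
  ultimately show ?thesis using True by simp
next
  case False
  then have "real (Suc n) * t \<le> 0" for n by (simp add: mult_le_0_iff)
  then show ?thesis using False by (simp add: flat_exp_0 del: of_nat_Suc)
qed

text \<open>A product of four one-sided bumps. As \<open>n\<close> grows, the functions approach the indicator of the open
  box with corners \<open>a\<close> and \<open>b\<close>, while their support stays the same.\<close>

definition box_bump :: "nat \<Rightarrow> point \<Rightarrow> point \<Rightarrow> point \<Rightarrow> real" where
  "box_bump n a b x =
     flat_exp 0 (real (Suc n) * (x $ 1 - a $ 1)) * flat_exp 0 (real (Suc n) * (b $ 1 - x $ 1)) *
     (flat_exp 0 (real (Suc n) * (x $ 2 - a $ 2)) * flat_exp 0 (real (Suc n) * (b $ 2 - x $ 2)))"

lemma box_bump_bounds: "0 \<le> box_bump n a b x" "box_bump n a b x \<le> 1"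
  unfolding box_bump_def by (auto intro!: mult_nonneg_nonneg mult_le_one flat_exp_0_bounds)

lemma mem_box_2: "x \<in> box a b \<longleftrightarrow> a $ 1 < x $ 1 \<and> x $ 1 < b $ 1 \<and> a $ 2 < x $ 2 \<and> x $ 2 < b $ 2" for x :: point
  by (auto simp: mem_box_cart forall_2)

lemma box_bump_pos: "x \<in> box a b \<Longrightarrow> 0 < box_bump n a b x"
  unfolding box_bump_def mem_box_2 by (auto intro!: mult_pos_pos simp: flat_exp_0_pos simp del: of_nat_Suc)

lemma box_bump_zero: "x \<notin> box a b \<Longrightarrow> box_bump n a b x = 0"
  unfolding box_bump_def mem_box_2 by (auto simp: flat_exp_0 mult_le_0_iff not_less)

lemma box_bump_limit: "(\<lambda>n. box_bump n a b x) \<longlonglongrightarrow> indicator (box a b) x"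
proof -
  have "(\<lambda>n. box_bump n a b x) \<longlonglongrightarrow>
      (if x $ 1 - a $ 1 > 0 then 1 else 0) * (if b $ 1 - x $ 1 > 0 then 1 else 0) *
      ((if x $ 2 - a $ 2 > 0 then 1 else 0) * (if b $ 2 - x $ 2 > 0 then 1 else 0))"
    unfolding box_bump_def by (intro tendsto_mult flat_exp_0_limit)
  then show ?thesis by (auto simp: mem_box_2 indicator_def split: if_splits)
qed

lemma smooth_box_bump: "smooth (box_bump n a b)"
proof (rule smooth_fun_algebra)
  let ?W = "{\<lambda>x::point. flat_exp k (c * x $ i + d) | k c i d. True}"
  have der: "((\<lambda>x::point. flat_exp k (c * x $ i + d)) has_derivative
      (\<lambda>h. flat_exp (Suc k) (c * x $ i + d) * (c * h $ i))) (at x)" for k c i d x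
  proof -
    have "((\<lambda>x::point. c * x $ i + d) has_derivative (\<lambda>h. c * h $ i)) (at x)"
      by (auto intro!: derivative_eq_intros bounded_linear.has_derivative[OF bounded_linear_vec_nth])
    then show ?thesis
      by (rule has_derivative_compose) (use flat_exp_DERIV in \<open>simp add: has_field_derivative_def\<close>)
  qed
  show "w differentiable (at x)" if "w \<in> ?W" for w x
    using that der unfolding differentiable_def by blast
  show "partial j w \<in> fun_algebra ?W" if w0: "w \<in> ?W" for w j
  proof -
    obtain k c i d where w: "w = (\<lambda>x. flat_exp k (c * x $ i + d))" using w0 by blast
    have "partial j w = (\<lambda>x. flat_exp (Suc k) (c * x $ i + d) * (c * (if i = j then 1 else 0)))"
      unfolding w by (rule ext, rule partial_eqI[OF der, THEN trans]) (simp add: axis_def)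
    moreover have "(\<lambda>x. flat_exp (Suc k) (c * x $ i + d)) \<in> fun_algebra ?W"
      by (intro fun_algebra.base) blast
    ultimately show ?thesis by (simp add: fun_algebra.times fun_algebra.const)
  qed
  have *: "(\<lambda>x. flat_exp 0 (real (Suc n) * (x $ i - r))) \<in> fun_algebra ?W"
          "(\<lambda>x. flat_exp 0 (real (Suc n) * (r - x $ i))) \<in> fun_algebra ?W" for i r
  proof -
    have "(\<lambda>x::point. flat_exp 0 (real (Suc n) * x $ i + - (real (Suc n) * r))) \<in> fun_algebra ?W"
         "(\<lambda>x::point. flat_exp 0 (- real (Suc n) * x $ i + real (Suc n) * r)) \<in> fun_algebra ?W"
      by (intro fun_algebra.base; blast)+
    then show "(\<lambda>x. flat_exp 0 (real (Suc n) * (x $ i - r))) \<in> fun_algebra ?W"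
          "(\<lambda>x. flat_exp 0 (real (Suc n) * (r - x $ i))) \<in> fun_algebra ?W"
      by (simp_all add: algebra_simps)
  qed
  show "box_bump n a b \<in> fun_algebra ?W"
    unfolding box_bump_def[abs_def] by (intro fun_algebra.times *)
qed

lemma test_funI:
  "smooth \<phi> \<Longrightarrow> compact K \<Longrightarrow> K \<subseteq> D \<Longrightarrow> (\<And>x. x \<notin> K \<Longrightarrow> \<phi> x = 0) \<Longrightarrow> \<phi> \<in> test_fun D"
  unfolding test_fun_def by blast

lemma box_bump_test_fun: "cbox a b \<subseteq> D \<Longrightarrow> box_bump n a b \<in> test_fun D"
  by (rule test_funI[OF smooth_box_bump compact_cbox])
     (auto intro!: box_bump_zero dest: subsetD[OF box_subset_cbox[of a b]])

lemma test_funE: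
  assumes "\<phi> \<in> test_fun D"
  obtains K where "smooth \<phi>" "compact K" "K \<subseteq> D" "\<And>x. x \<notin> K \<Longrightarrow> \<phi> x = 0"
  using assms by (auto simp: test_fun_def)

lemma test_fun_mono: "U \<subseteq> D \<Longrightarrow> test_fun U \<subseteq> test_fun D"
  by (auto simp: test_fun_def)

lemma cgrad_zero_open:
  assumes "open S" "x \<in> S" "\<And>y. y \<in> S \<Longrightarrow> \<phi> y = 0"
  shows "cgrad \<phi> x = 0"
proof -
  have "((\<lambda>_. 0) has_derivative (\<lambda>_. 0)) (at x)" by simp
  then have "(\<phi> has_derivative (\<lambda>_. 0)) (at x)"
    by (rule has_derivative_transform_within_open[OF _ assms(1,2)]) (simp add: assms)
  then show ?thesis by (simp add: cgrad_def vec_eq_iff partial_eqI)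
qed

lemma partial_eq_cgrad: "partial i \<phi> x = cgrad \<phi> x $ i"
  by (simp add: cgrad_def)

lemma test_fun_partial: 
  assumes "\<phi> \<in> test_fun D" shows "partial i \<phi> \<in> test_fun D"
proof -
  obtain K where K: "smooth \<phi>" "compact K" "K \<subseteq> D" "\<And>x. x \<notin> K \<Longrightarrow> \<phi> x = 0"
    using test_funE[OF assms] by blast
  have "partial i \<phi> x = 0" if "x \<notin> K" for x
  proof -
    have "cgrad \<phi> x = 0"
      by (rule cgrad_zero_open[of "- K"]) (use K that compact_imp_closed[OF K(2)] in auto)
    then show ?thesis by (simp add: cgrad_def vec_eq_iff)
  qed
  then show ?thesis using K smooth_partial by (auto simp: test_fun_def)
qed

lemma test_fun_lincomb:
  assumes "\<phi> \<in> test_fun D" "\<psi> \<in> test_fun D"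
  shows "(\<lambda>x. c * \<phi> x + d * \<psi> x) \<in> test_fun D"
proof -
  obtain K K' where K: "smooth \<phi>" "compact K" "K \<subseteq> D" "\<And>x. x \<notin> K \<Longrightarrow> \<phi> x = 0"
    and K': "smooth \<psi>" "compact K'" "K' \<subseteq> D" "\<And>x. x \<notin> K' \<Longrightarrow> \<psi> x = 0"
    using test_funE assms by metis
  then have "\<forall>x. x \<notin> K \<union> K' \<longrightarrow> c * \<phi> x + d * \<psi> x = 0" "compact (K \<union> K')" "K \<union> K' \<subseteq> D" by auto
  then show ?thesis unfolding test_fun_def using smooth_lincomb[OF K(1) K'(1)] by blast
qed

lemma test_fun_continuous: "\<phi> \<in> test_fun D \<Longrightarrow> continuous_on S \<phi>"
  by (auto simp: test_fun_def intro: smooth_continuous_on)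

lemma test_fun_measurable: "\<phi> \<in> test_fun D \<Longrightarrow> \<phi> \<in> borel_measurable borel"
  by (intro borel_measurable_continuous_onI test_fun_continuous)

lemma test_fun_bounded:
  assumes "\<phi> \<in> test_fun D" obtains C where "C \<ge> 0" "\<And>x. \<bar>\<phi> x\<bar> \<le> C"
proof -
  obtain K where K: "smooth \<phi>" "compact K" "K \<subseteq> D" "\<And>x. x \<notin> K \<Longrightarrow> \<phi> x = 0"
    using test_funE[OF assms] by blast
  have "bounded (\<phi> ` K)"
    by (intro compact_imp_bounded compact_continuous_image smooth_continuous_on K)
  then obtain C where "\<forall>x\<in>K. \<bar>\<phi> x\<bar> \<le> C" by (auto simp: bounded_iff)
  then have "\<bar>\<phi> x\<bar> \<le> max C 0" for x using K(4)[of x] by (cases "x \<in> K") auto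
  then show ?thesis using that[of "max C 0"] by auto
qed

lemma test_fun_has_derivative: "\<phi> \<in> test_fun D \<Longrightarrow> (\<phi> has_derivative (\<lambda>h. cgrad \<phi> x \<bullet> h)) (at x)"
  by (auto simp: test_fun_def intro: smooth_has_derivative)

lemma cgrad_measurable: "\<phi> \<in> test_fun D \<Longrightarrow> cgrad \<phi> \<in> borel_measurable borel"
  unfolding cgrad_def[abs_def]
  by (intro borel_measurable_continuous_onI continuous_on_vec_lambda test_fun_continuous test_fun_partial)

lemma test_fun_cgrad_bounded:
  assumes "\<phi> \<in> test_fun D" obtains C where "C \<ge> 0" "\<And>x. norm (cgrad \<phi> x) \<le> C"
proof -
  obtain C1 where C1: "C1 \<ge> 0" "\<And>x. \<bar>partial 1 \<phi> x\<bar> \<le> C1" using test_fun_bounded[OF test_fun_partial[OF assms]] by blast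
  obtain C2 where C2: "C2 \<ge> 0" "\<And>x. \<bar>partial 2 \<phi> x\<bar> \<le> C2" using test_fun_bounded[OF test_fun_partial[OF assms]] by blast
  have "norm (cgrad \<phi> x) \<le> C1 + C2" for x
    using norm_le_l1_cart[of "cgrad \<phi> x"] C1(2)[of x] C2(2)[of x] by (simp add: sum_2 cgrad_def)
  then show ?thesis using that C1 C2 by (meson add_nonneg_nonneg)
qed

lemma test_fun_lipschitz:
  assumes "\<phi> \<in> test_fun D" obtains L where "L-lipschitz_on UNIV \<phi>"
proof -
  obtain C where C: "C \<ge> 0" "\<And>x. norm (cgrad \<phi> x) \<le> C" using test_fun_cgrad_bounded[OF assms] by blast
  have "norm (\<phi> x - \<phi> y) \<le> C * norm (x - y)" for x y
  proof (rule differentiable_bound[of UNIV])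
    show "onorm (\<lambda>h. cgrad \<phi> z \<bullet> h) \<le> C" for z
      by (rule onorm_le) (metis C(2) Cauchy_Schwarz_ineq2 mult_right_mono norm_ge_zero order_trans real_norm_def)
  qed (use test_fun_has_derivative[OF assms] in auto)
  then show ?thesis using C that by (intro that[of C] lipschitz_onI) (auto simp: dist_norm)
qed

text \<open>A Lipschitz function may be unbounded on the plane, but on the support of the test function it is
  bounded; hence the product rule estimate survives.\<close>

lemma lipschitz_times_test_fun:
  assumes v: "L-lipschitz_on UNIV v" and \<phi>: "\<phi> \<in> test_fun D"
  obtains L' where "L'-lipschitz_on UNIV (\<lambda>x. v x * \<phi> x)"
proof -
  obtain K where K: "compact K" "\<And>x. x \<notin> K \<Longrightarrow> \<phi> x = 0"
    using test_funE[OF \<phi>] by metis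
  obtain C where C: "C \<ge> 0" "\<And>x. \<bar>\<phi> x\<bar> \<le> C" using test_fun_bounded[OF \<phi>] by blast
  obtain M where M: "M-lipschitz_on UNIV \<phi>" using test_fun_lipschitz[OF \<phi>] by blast
  have "bounded (v ` K)"
    by (intro compact_imp_bounded compact_continuous_image K continuous_on_subset[OF lipschitz_on_continuous_on[OF v]]) auto
  then obtain V0 where V0: "\<forall>x\<in>K. \<bar>v x\<bar> \<le> V0" by (auto simp: bounded_iff)
  define V where "V = max V0 0"
  have V: "V \<ge> 0" "\<And>x. x \<in> K \<Longrightarrow> \<bar>v x\<bar> \<le> V" using V0 by (auto simp: V_def)
  have L: "L \<ge> 0" and M0: "M \<ge> 0" using v M lipschitz_on_nonneg by blast+
  have *: "\<bar>v x * \<phi> x - v y * \<phi> y\<bar> \<le> (V * M + C * L) * dist x y" if "x \<in> K" for x y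
  proof -
    have "v x * \<phi> x - v y * \<phi> y = v x * (\<phi> x - \<phi> y) + \<phi> y * (v x - v y)" by (simp add: algebra_simps)
    then have "\<bar>v x * \<phi> x - v y * \<phi> y\<bar> \<le> \<bar>v x\<bar> * \<bar>\<phi> x - \<phi> y\<bar> + \<bar>\<phi> y\<bar> * \<bar>v x - v y\<bar>"
      by (metis abs_mult abs_triangle_ineq)
    also have "\<dots> \<le> V * (M * dist x y) + C * (L * dist x y)"
      using V that C L M0 lipschitz_onD[OF v, of x y] lipschitz_onD[OF M, of x y]
      by (intro add_mono mult_mono) (auto simp: dist_real_def)
    finally show ?thesis by (simp add: algebra_simps)
  qed
  have "dist (v x * \<phi> x) (v y * \<phi> y) \<le> (V * M + C * L) * dist x y" for x y
  proof -
    consider "x \<in> K" | "y \<in> K" | "x \<notin> K" "y \<notin> K" by blast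
    then show ?thesis
    proof cases
      case 2
      then show ?thesis using *[of y x] by (simp add: dist_commute dist_real_def abs_minus_commute)
    next
      case 1
      then show ?thesis using *[of x y] by (simp add: dist_real_def)
    next
      case 3
      then show ?thesis using V(1) C(1) L M0 by (simp add: K(2))
    qed
  qed
  then show ?thesis using V C L M0 by (intro that[of "V * M + C * L"] lipschitz_onI) auto
qed

lemma borel_imp_lebesgue_measurable:
  "f \<in> borel_measurable borel \<Longrightarrow> f \<in> borel_measurable lebesgue"
  by (simp add: measurable_completion)

lemma borel_imp_lebesgue_on_measurable:
  "f \<in> borel_measurable borel \<Longrightarrow> f \<in> borel_measurable (lebesgue_on D)"
  by (intro measurable_restrict_space1 borel_imp_lebesgue_measurable)

lemma vec_nth_measurable [measurable]:
  fixes f :: "'a \<Rightarrow> real ^ 'n"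
  shows "f \<in> borel_measurable M \<Longrightarrow> (\<lambda>x. f x $ i) \<in> borel_measurable M"
  by (simp add: cart_eq_inner_axis borel_measurable_inner)

lemma smooth_const: "smooth (\<lambda>_. c)"
  by (rule smooth_fun_algebra[of "{}", OF _ _ fun_algebra.const]) auto

lemma box_Int_box_2: 
  fixes a b c d :: point
  shows "box a b \<inter> box c d = box (\<chi> i. max (a $ i) (c $ i)) (\<chi> i. min (b $ i) (d $ i))"
  by (auto simp: mem_box_cart)

section \<open>Weak gradients and first order Sobolev spaces\<close>

text \<open>Test functions approximate indicators of boxes boundedly and pointwise.\<close>

lemma integral_box_zero:
  fixes G :: "point \<Rightarrow> real"
  assumes G: "integrable lebesgue G"
    and orth: "\<And>\<phi>. \<phi> \<in> test_fun U \<Longrightarrow> (\<integral>x. G x * \<phi> x \<partial>lebesgue) = 0"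
    and sub: "cbox a b \<subseteq> U"
  shows "(\<integral>x. G x * indicator (box a b) x \<partial>lebesgue) = 0"
proof -
  have bm: "box_bump n a b \<in> borel_measurable lebesgue" for n
    by (intro borel_imp_lebesgue_measurable test_fun_measurable[OF box_bump_test_fun[OF sub]])
  have "(\<lambda>n. \<integral>x. G x * box_bump n a b x \<partial>lebesgue) \<longlonglongrightarrow> (\<integral>x. G x * indicator (box a b) x \<partial>lebesgue)"
  proof (rule integral_dominated_convergence[where w = "\<lambda>x. \<bar>G x\<bar>"])
    show "AE x in lebesgue. (\<lambda>n. G x * box_bump n a b x) \<longlonglongrightarrow> G x * indicator (box a b) x"
      by (intro always_eventually allI tendsto_intros box_bump_limit)
    show "AE x in lebesgue. norm (G x * box_bump n a b x) \<le> \<bar>G x\<bar>" for n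
      using box_bump_bounds by (intro always_eventually) (auto simp: abs_mult mult_left_le)
    show "(\<lambda>x. G x * indicator (box a b) x) \<in> borel_measurable lebesgue"
      using borel_measurable_integrable[OF integrable_real_mult_indicator[OF _ G, of "box a b"]] by simp
    show "(\<lambda>x. G x * box_bump n a b x) \<in> borel_measurable lebesgue" for n
      using bm[of n] borel_measurable_integrable[OF G] by (rule borel_measurable_times[rotated])
    show "integrable lebesgue (\<lambda>x. \<bar>G x\<bar>)" using G by (rule integrable_abs)
  qed
  moreover have "(\<integral>x. G x * box_bump n a b x \<partial>lebesgue) = 0" for n
    by (rule orth[OF box_bump_test_fun[OF sub]])
  ultimately show ?thesis by (simp add: LIMSEQ_const_iff)
qed

text \<open>The fundamental lemma of the calculus of variations on a box: boxes form an intersection-stable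
  generator of the Borel sets, so the integral of \<open>G\<close> vanishes over every measurable subset.\<close>

lemma AE_zero_of_orthogonal_on_box:
  fixes G :: "point \<Rightarrow> real"
  assumes G: "integrable lebesgue G"
    and orth: "\<And>\<phi>. \<phi> \<in> test_fun U \<Longrightarrow> (\<integral>x. G x * \<phi> x \<partial>lebesgue) = 0"
    and cd: "cbox c d \<subseteq> U"
  shows "AE x in lebesgue. x \<in> cbox c d \<longrightarrow> G x = 0"
proof -
  define H where "H x = G x * indicator (box c d) x" for x
  have H: "integrable lebesgue H" unfolding H_def by (rule integrable_real_mult_indicator[OF _ G]) simp
  have HA: "integrable lebesgue (\<lambda>x. H x * indicator A x)" if "A \<in> sets lebesgue" for A
    by (rule integrable_real_mult_indicator[OF that H])
  have borel0: "A \<in> sets lebesgue \<and> (\<integral>x. H x * indicator A x \<partial>lebesgue) = 0" if "A \<in> sets borel" for A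
  proof -
    let ?G = "range (\<lambda>(a, b). box a b :: point set)"
    have "Int_stable ?G"
      unfolding Int_stable_def using box_Int_box_2 by fastforce
    moreover have "?G \<subseteq> Pow UNIV" by simp
    moreover have "A \<in> sigma_sets UNIV ?G" using that unfolding borel_eq_box by simp
    ultimately show ?thesis
    proof (induction rule: sigma_sets_induct_disjoint)
      case (basic A)
      then obtain a b where A: "A = box a b" by auto
      define a' b' :: point where "a' = (\<chi> i. max (a $ i) (c $ i))" and "b' = (\<chi> i. min (b $ i) (d $ i))"
      have eq: "box a' b' = box a b \<inter> box c d" using box_Int_box_2 by (simp add: a'_def b'_def)
      have "cbox a' b' \<subseteq> cbox c d" by (auto simp: mem_box_cart a'_def b'_def)
      then have "(\<integral>x. G x * indicator (box a' b') x \<partial>lebesgue) = 0"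
        using cd by (intro integral_box_zero[OF G orth, where U = U]) auto
      then show ?case unfolding A eq by (auto simp: H_def indicator_inter_arith mult_ac)
    next
      case (compl A)
      have "(\<integral>x. H x * indicator (UNIV - A) x \<partial>lebesgue) = (\<integral>x. H x - H x * indicator A x \<partial>lebesgue)"
        by (intro Bochner_Integration.integral_cong) (auto simp: indicator_def)
      also have "\<dots> = (\<integral>x. H x \<partial>lebesgue) - 0" using compl H HA by simp
      also have "(\<integral>x. H x \<partial>lebesgue) = 0"
        unfolding H_def by (rule integral_box_zero[OF G orth cd])
      finally show ?case using compl by auto
    next
      case (union A)
      have A: "A i \<in> sets lebesgue" for i using union by blast
      have disj: "A i \<inter> A j = {}" if "i \<noteq> j" for i j
        using union(1) that by (auto simp: disjoint_family_on_def)
      have sums: "(\<lambda>i. indicator (A i) x :: real) sums indicator (\<Union>i. A i) x" for x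
        by (rule indicator_sums) (rule disj)
      have le: "0 \<le> (\<Sum>i<n. indicator (A i) x :: real)" "(\<Sum>i<n. indicator (A i) x :: real) \<le> 1" for n x
      proof -
        have "(\<Sum>i<n. indicator (A i) x :: real) \<le> (\<Sum>i. indicator (A i) x)"
          by (rule sum_le_suminf[OF sums_summable[OF sums]]) auto
        also have "\<dots> \<le> 1" unfolding sums_unique[OF sums, symmetric] by (simp add: indicator_def)
        finally show "(\<Sum>i<n. indicator (A i) x :: real) \<le> 1" .
      qed (auto intro: sum_nonneg)
      have U: "(\<Union>i. A i) \<in> sets lebesgue" using A by auto
      have "(\<lambda>n. \<integral>x. (\<Sum>i<n. H x * indicator (A i) x) \<partial>lebesgue) \<longlonglongrightarrow> (\<integral>x. H x * indicator (\<Union>i. A i) x \<partial>lebesgue)"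
      proof (rule integral_dominated_convergence[where w = "\<lambda>x. \<bar>H x\<bar>"])
        show "AE x in lebesgue. (\<lambda>n. \<Sum>i<n. H x * indicator (A i) x) \<longlonglongrightarrow> H x * indicator (\<Union>i. A i) x"
          using sums unfolding sums_def sum_distrib_left[symmetric]
          by (intro always_eventually allI tendsto_mult tendsto_const) auto
        show "AE x in lebesgue. norm (\<Sum>i<n. H x * indicator (A i) x) \<le> \<bar>H x\<bar>" for n
          unfolding sum_distrib_left[symmetric] using le
          by (intro always_eventually allI) (simp add: abs_mult mult_left_le)
        show "(\<lambda>x. H x * indicator (\<Union>i. A i) x) \<in> borel_measurable lebesgue"
          by (rule borel_measurable_integrable[OF HA[OF U]])
        show "(\<lambda>x. \<Sum>i<n. H x * indicator (A i) x) \<in> borel_measurable lebesgue" for n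
          by (intro borel_measurable_sum borel_measurable_integrable[OF HA[OF A]])
        show "integrable lebesgue (\<lambda>x. \<bar>H x\<bar>)" using H by (rule integrable_abs)
      qed
      moreover have "(\<integral>x. (\<Sum>i<n. H x * indicator (A i) x) \<partial>lebesgue) = 0" for n
        using union(3) HA[OF A] by (subst Bochner_Integration.integral_sum) auto
      ultimately have "(\<integral>x. H x * indicator (\<Union>i. A i) x \<partial>lebesgue) = 0" by (simp add: LIMSEQ_const_iff)
      then show ?case using U by blast
    qed auto
  qed
  have leb0: "(\<integral>x. H x * indicator A x \<partial>lebesgue) = 0" if A: "A \<in> sets lebesgue" for A
  proof -
    obtain S N N' where S: "A = S \<union> N" "N \<subseteq> N'" "N' \<in> null_sets lborel" "S \<in> sets lborel"
      using sets_completionE[OF A] by metis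
    have "AE x in lebesgue. x \<notin> N'" using S(3) by (intro AE_not_in null_sets_completionI)
    then have "AE x in lebesgue. H x * indicator A x = H x * indicator S x"
      by eventually_elim (use S in \<open>auto simp: indicator_def\<close>)
    then have "(\<integral>x. H x * indicator A x \<partial>lebesgue) = (\<integral>x. H x * indicator S x \<partial>lebesgue)"
      using borel_measurable_integrable[OF HA] A borel0[of S] S(4) by (intro integral_cong_AE) auto
    also have "\<dots> = 0" using borel0[of S] S(4) by simp
    finally show ?thesis .
  qed
  interpret fm: finite_measure "lebesgue_on (box c d)"
    by (intro finite_measure_lebesgue_on lmeasurable_open) auto
  have "AE x in lebesgue_on (box c d). G x = 0"
  proof (rule fm.density_zero)
    have "integrable lebesgue (\<lambda>x. indicator (box c d) x *\<^sub>R G x)"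
      using H by (simp add: H_def[abs_def] mult.commute)
    then show "integrable (lebesgue_on (box c d)) G" by (simp add: integrable_restrict_space)
    fix A assume "A \<in> sets (lebesgue_on (box c d))"
    then have A: "A \<in> sets lebesgue" by (auto simp: sets_restrict_space)
    have "set_lebesgue_integral (lebesgue_on (box c d)) A G = (\<integral>x. H x * indicator A x \<partial>lebesgue)"
      unfolding set_lebesgue_integral_def
      by (subst integral_restrict_space) (auto simp: H_def mult_ac)
    then show "set_lebesgue_integral (lebesgue_on (box c d)) A G = 0" using leb0[OF A] by simp
  qed
  then have "AE x in lebesgue. x \<in> box c d \<longrightarrow> G x = 0" by (simp add: AE_restrict_space_iff)
  moreover have "AE x in lebesgue. x \<notin> cbox c d - box c d"
    using negligible_frontier_interval[of c d] by (intro AE_not_in) (simp add: negligible_iff_null_sets)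
  ultimately show ?thesis by eventually_elim auto
qed

lemma AE_zero_of_orthogonal_test_fun:
  fixes G :: "point \<Rightarrow> real"
  assumes "open U" and G: "integrable lebesgue G"
    and orth: "\<And>\<phi>. \<phi> \<in> test_fun U \<Longrightarrow> (\<integral>x. G x * \<phi> x \<partial>lebesgue) = 0"
  shows "AE x in lebesgue. x \<in> U \<longrightarrow> G x = 0"
proof -
  obtain \<D> where \<D>: "countable \<D>" "\<D> \<subseteq> Pow U" "\<And>X. X \<in> \<D> \<Longrightarrow> \<exists>a b. X = cbox a b" "\<Union>\<D> = U"
    using open_countable_Union_open_cbox[OF \<open>open U\<close>] by metis
  have "AE x in lebesgue. x \<in> X \<longrightarrow> G x = 0" if X: "X \<in> \<D>" for X
  proof -
    obtain a b where "X = cbox a b" using \<D>(3)[OF X] by blast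
    then show ?thesis using AE_zero_of_orthogonal_on_box[OF G orth, of U a b] X \<D>(2) by auto
  qed
  then have "AE x in lebesgue. \<forall>X\<in>\<D>. x \<in> X \<longrightarrow> G x = 0"
    by (rule AE_ball_countable'[OF _ \<D>(1)])
  then show ?thesis by eventually_elim (use \<D>(4) in auto)
qed

locale planar_domain =
  fixes D :: "point set"
  assumes open_D: "open D" and bounded_D: "bounded D" and nonempty_D: "D \<noteq> {}"
begin

lemma D_lmeasurable: "D \<in> lmeasurable"
  by (intro lmeasurable_open open_D bounded_D)

lemma D_sets [simp]: "D \<in> sets lebesgue" "D \<inter> space lebesgue \<in> sets lebesgue"
  using D_lmeasurable by auto

sublocale finD: finite_measure "lebesgue_on D"
  by (rule finite_measure_lebesgue_on[OF D_lmeasurable])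

lemma integral_on_D:
  fixes f :: "point \<Rightarrow> real"
  assumes "f \<in> borel_measurable borel" "\<And>x. x \<notin> D \<Longrightarrow> f x = 0"
  shows "(\<integral>x. f x \<partial>lebesgue_on D) = (\<integral>x. f x \<partial>lborel)"
proof -
  have "(\<lambda>x. indicator D x *\<^sub>R f x) = f" using assms(2) by (auto simp: fun_eq_iff indicator_def)
  then have "(\<integral>x. f x \<partial>lebesgue_on D) = (\<integral>x. f x \<partial>lebesgue)" by (simp add: integral_restrict_space)
  also have "\<dots> = (\<integral>x. f x \<partial>lborel)" using assms(1) by (intro integral_completion) simp
  finally show ?thesis .
qed

lemma AE_D: "(AE x in lebesgue_on D. P x) \<longleftrightarrow> (AE x in lebesgue. x \<in> D \<longrightarrow> P x)"
  by (rule AE_restrict_space_iff) simp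

lemma AE_D_I: "(AE x in lborel. x \<in> D \<longrightarrow> P x) \<Longrightarrow> (AE x in lebesgue_on D. P x)"
  unfolding AE_D by (rule AE_completion)

lemma L2_product_integrable:
  fixes v w :: "point \<Rightarrow> 'b::euclidean_space"
  assumes "v \<in> L2 D" "w \<in> L2 D"
  shows "integrable (lebesgue_on D) (\<lambda>x. v x \<bullet> w x)"
proof (rule Bochner_Integration.integrable_bound[where f = "\<lambda>x. (norm (v x))\<^sup>2 + (norm (w x))\<^sup>2"])
  show "(\<lambda>x. v x \<bullet> w x) \<in> borel_measurable (lebesgue_on D)"
    using assms by (auto simp: L2_def intro: borel_measurable_inner)
  have "\<bar>v x \<bullet> w x\<bar> \<le> (norm (v x))\<^sup>2 + (norm (w x))\<^sup>2" for x
  proof -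
    have "\<bar>v x \<bullet> w x\<bar> \<le> norm (v x) * norm (w x)" by (rule Cauchy_Schwarz_ineq2)
    also have "\<dots> \<le> (norm (v x))\<^sup>2 + (norm (w x))\<^sup>2"
      using sum_squares_bound[of "norm (v x)" "norm (w x)"] mult_nonneg_nonneg[OF norm_ge_zero norm_ge_zero, of "v x" "w x"]
      unfolding mult.assoc by linarith
    finally show ?thesis .
  qed
  then show "AE x in lebesgue_on D. norm (v x \<bullet> w x) \<le> norm ((norm (v x))\<^sup>2 + (norm (w x))\<^sup>2)"
    by auto
qed (use assms in \<open>auto simp: L2_def\<close>)

lemma bounded_in_L2:
  fixes v :: "point \<Rightarrow> 'b::euclidean_space"
  assumes "v \<in> borel_measurable (lebesgue_on D)" "AE x in lebesgue_on D. norm (v x) \<le> C"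
  shows "v \<in> L2 D"
proof -
  have "integrable (lebesgue_on D) (\<lambda>x. (norm (v x))\<^sup>2)"
  proof (rule finD.integrable_const_bound)
    show "AE x in lebesgue_on D. norm ((norm (v x))\<^sup>2) \<le> C\<^sup>2"
      using assms(2) by eventually_elim (auto intro: power_mono)
  qed (use assms(1) in measurable)
  then show ?thesis using assms by (simp add: L2_def)
qed

lemma L2_integrable:
  fixes v :: "point \<Rightarrow> real"
  assumes "v \<in> L2 D" shows "integrable (lebesgue_on D) v"
  using L2_product_integrable[OF assms bounded_in_L2[of "\<lambda>x. 1" 1]] by simp

lemma L2_nth: "g \<in> L2 D \<Longrightarrow> (\<lambda>x. (g x :: point) $ i) \<in> L2 D"
proof -
  assume g: "g \<in> L2 D"
  have "integrable (lebesgue_on D) (\<lambda>x. (norm (g x $ i))\<^sup>2)"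
  proof (rule Bochner_Integration.integrable_bound[where f = "\<lambda>x. (norm (g x))\<^sup>2"])
    show "AE x in lebesgue_on D. norm ((norm (g x $ i))\<^sup>2) \<le> norm ((norm (g x))\<^sup>2)"
      by (intro always_eventually allI) (simp add: component_le_norm_cart power_mono abs_le_square_iff[symmetric])
    show "(\<lambda>x. (norm (g x $ i))\<^sup>2) \<in> borel_measurable (lebesgue_on D)"
      using vec_nth_measurable[of g "lebesgue_on D" i] g by (auto simp: L2_def)
  qed (use g in \<open>simp add: L2_def\<close>)
  then show ?thesis using vec_nth_measurable[of g "lebesgue_on D" i] g by (auto simp: L2_def)
qed

lemma subspace_L2: "subspace (L2 D :: (point \<Rightarrow> 'b::euclidean_space) set)"
  unfolding subspace_def
proof (intro conjI ballI allI)
  show "(0 :: point \<Rightarrow> 'b) \<in> L2 D" by (simp add: L2_def zero_fun_def)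
next
  fix v w :: "point \<Rightarrow> 'b" assume vw: "v \<in> L2 D" "w \<in> L2 D"
  have "integrable (lebesgue_on D) (\<lambda>x. (norm (v x))\<^sup>2 + 2 * (v x \<bullet> w x) + (norm (w x))\<^sup>2)"
    using vw L2_product_integrable[OF vw] by (simp add: L2_def)
  moreover have "(norm (v x))\<^sup>2 + 2 * (v x \<bullet> w x) + (norm (w x))\<^sup>2 = (norm (v x + w x))\<^sup>2" for x
    by (simp add: power2_norm_eq_inner inner_add inner_commute)
  ultimately show "v + w \<in> L2 D" using vw by (auto simp: L2_def plus_fun_def)
next
  fix c and v :: "point \<Rightarrow> 'b" assume v: "v \<in> L2 D"
  then show "c *\<^sub>R v \<in> L2 D" by (auto simp: L2_def scaleR_fun_def power_mult_distrib)
qed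

lemma test_fun_L2: "\<phi> \<in> test_fun E \<Longrightarrow> \<phi> \<in> L2 D"
proof -
  assume \<phi>: "\<phi> \<in> test_fun E"
  obtain C where "\<And>x. \<bar>\<phi> x\<bar> \<le> C" using test_fun_bounded[OF \<phi>] by metis
  then show ?thesis
    by (intro bounded_in_L2[where C = C] borel_imp_lebesgue_on_measurable test_fun_measurable[OF \<phi>]) auto
qed

lemma cgrad_L2: "\<phi> \<in> test_fun E \<Longrightarrow> cgrad \<phi> \<in> L2 D"
proof -
  assume \<phi>: "\<phi> \<in> test_fun E"
  obtain C where "\<And>x. norm (cgrad \<phi> x) \<le> C" using test_fun_cgrad_bounded[OF \<phi>] by metis
  then show ?thesis
    by (intro bounded_in_L2[where C = C] borel_imp_lebesgue_on_measurable cgrad_measurable[OF \<phi>]) auto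
qed

lemma L2_times_integrable:
  fixes v w :: "point \<Rightarrow> real"
  shows "v \<in> L2 D \<Longrightarrow> w \<in> L2 D \<Longrightarrow> integrable (lebesgue_on D) (\<lambda>x. v x * w x)"
  using L2_product_integrable[of v w] by simp

text \<open>The local form, with test functions supported in a subset \<open>U\<close> only, makes it possible to compute
  weak gradients of piecewise affine functions triangle by triangle.\<close>

lemma weak_gradient_unique_on:
  fixes g h :: "point \<Rightarrow> point"
  assumes U: "open U" "U \<subseteq> D" and g: "g \<in> L2 D" and h: "h \<in> L2 D"
    and eq: "\<And>\<phi> i. \<phi> \<in> test_fun U \<Longrightarrow>
      (\<integral>x. g x $ i * \<phi> x \<partial>lebesgue_on D) = (\<integral>x. h x $ i * \<phi> x \<partial>lebesgue_on D)"
  shows "AE x in lebesgue_on D. x \<in> U \<longrightarrow> g x = h x"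
proof -
  have "AE x in lebesgue. x \<in> U \<longrightarrow> indicator D x * (g x $ i - h x $ i) = 0" for i
  proof (rule AE_zero_of_orthogonal_test_fun[OF U(1)])
    have int: "integrable (lebesgue_on D) (\<lambda>x. g x $ i - h x $ i)"
      by (intro Bochner_Integration.integrable_diff L2_integrable L2_nth[OF g] L2_nth[OF h])
    then show "integrable lebesgue (\<lambda>x. indicator D x * (g x $ i - h x $ i))"
      by (simp add: integrable_restrict_space)
    fix \<phi> assume \<phi>: "\<phi> \<in> test_fun U"
    have "(\<integral>x. indicator D x * (g x $ i - h x $ i) * \<phi> x \<partial>lebesgue) = (\<integral>x. (g x $ i - h x $ i) * \<phi> x \<partial>lebesgue_on D)"
      by (simp add: integral_restrict_space mult.assoc)
    also have "\<dots> = (\<integral>x. g x $ i * \<phi> x \<partial>lebesgue_on D) - (\<integral>x. h x $ i * \<phi> x \<partial>lebesgue_on D)"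
      using L2_times_integrable[OF L2_nth[OF g, of i] test_fun_L2[OF \<phi>]] L2_times_integrable[OF L2_nth[OF h, of i] test_fun_L2[OF \<phi>]]
      by (simp add: left_diff_distrib)
    also have "\<dots> = 0" using eq[OF \<phi>] by simp
    finally show "(\<integral>x. indicator D x * (g x $ i - h x $ i) * \<phi> x \<partial>lebesgue) = 0" .
  qed
  then have "AE x in lebesgue. \<forall>i\<in>UNIV. x \<in> U \<longrightarrow> indicator D x * (g x $ i - h x $ i) = 0"
    by (subst AE_finite_all) auto
  then show ?thesis unfolding AE_D by eventually_elim (auto simp: vec_eq_iff)
qed

text \<open>Almost everywhere differentiability is a hypothesis here, which avoids Rademacher's theorem: it is
  obvious for the piecewise affine functions of interest.\<close>

lemma weak_gradient_lipschitz_on: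
  assumes v: "L-lipschitz_on UNIV v" and U: "open U" "U \<subseteq> D"
    and der: "AE x in lborel. x \<in> U \<longrightarrow> (v has_derivative (\<lambda>h. g x \<bullet> h)) (at x)"
    and g: "g \<in> borel_measurable borel" and \<phi>: "\<phi> \<in> test_fun U"
  shows "(\<integral>x. v x * partial i \<phi> x \<partial>lebesgue_on D) = - (\<integral>x. g x $ i * \<phi> x \<partial>lebesgue_on D)"
proof -
  obtain K where K: "compact K" "K \<subseteq> U" "\<And>x. x \<notin> K \<Longrightarrow> \<phi> x = 0"
    using test_funE[OF \<phi>] by metis
  have pK: "partial i \<phi> x = 0" if "x \<notin> K" for x
  proof -
    have "cgrad \<phi> x = 0"
      by (rule cgrad_zero_open[of "- K"]) (use K that compact_imp_closed[OF K(1)] in auto)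
    then show ?thesis by (simp add: partial_eq_cgrad)
  qed
  obtain L' where w: "L'-lipschitz_on UNIV (\<lambda>x. v x * \<phi> x)" using lipschitz_times_test_fun[OF v \<phi>] by metis
  define d where "d x = g x $ i * \<phi> x + v x * partial i \<phi> x" for x
  have vc: "continuous_on UNIV v" using v by (rule lipschitz_on_continuous_on)
  have vp: "continuous_on UNIV (\<lambda>x. v x * partial i \<phi> x)"
    by (intro continuous_intros vc test_fun_continuous[OF test_fun_partial[OF \<phi>]])
  have vpm: "(\<lambda>x. v x * partial i \<phi> x) \<in> borel_measurable borel" by (rule borel_measurable_continuous_onI[OF vp])
  have gpm: "(\<lambda>x. g x $ i * \<phi> x) \<in> borel_measurable borel"
    by (intro borel_measurable_times vec_nth_measurable g test_fun_measurable[OF \<phi>])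
  have dm: "d \<in> borel_measurable borel" unfolding d_def[abs_def] using vpm gpm by measurable
  have "AE x in lborel. ((\<lambda>t. v (x + t *\<^sub>R axis i 1) * \<phi> (x + t *\<^sub>R axis i 1)) has_real_derivative d x) (at 0)"
    using der
  proof eventually_elim
    case (elim x)
    show ?case
    proof (cases "x \<in> U")
      case True
      then have "((\<lambda>x. v x * \<phi> x) has_derivative (\<lambda>h. v x * (cgrad \<phi> x \<bullet> h) + (g x \<bullet> h) * \<phi> x)) (at x)"
        using elim by (intro has_derivative_mult test_fun_has_derivative[OF \<phi>]) simp
      from has_derivative_along_line[OF this, of "axis i 1"] show ?thesis
        by (simp add: d_def inner_axis partial_eq_cgrad add.commute)
    next
      case False
      then have x: "x \<in> - K" using K by auto
      have "((\<lambda>_. 0::real) has_derivative (\<lambda>_. 0)) (at x)" by simp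
      then have "((\<lambda>x. v x * \<phi> x) has_derivative (\<lambda>_. 0)) (at x)"
        by (rule has_derivative_transform_within_open[OF _ _ x]) (use K compact_imp_closed[OF K(1)] in auto)
      from has_derivative_along_line[OF this, of "axis i 1"] show ?thesis
        using x K(3) pK by (simp add: d_def)
    qed
  qed
  from integral_directional_derivative_zero[OF w compact_imp_bounded[OF K(1)] _ this dm]
  have d: "integrable lborel d" "(\<integral>x. d x \<partial>lborel) = 0" using K(3) by auto
  have ivp: "integrable lborel (\<lambda>x. v x * partial i \<phi> x)"
    by (rule integrable_continuous_bounded_support[OF vp compact_imp_bounded[OF K(1)]]) (simp add: pK)
  have "(\<lambda>x. g x $ i * \<phi> x) = (\<lambda>x. d x - v x * partial i \<phi> x)" by (simp add: d_def)
  then have igp: "integrable lborel (\<lambda>x. g x $ i * \<phi> x)" using Bochner_Integration.integrable_diff[OF d(1) ivp] by simp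
  have "(\<integral>x. g x $ i * \<phi> x \<partial>lborel) + (\<integral>x. v x * partial i \<phi> x \<partial>lborel) = 0"
    using d(2) igp ivp by (simp add: d_def)
  moreover have "(\<integral>x. v x * partial i \<phi> x \<partial>lebesgue_on D) = (\<integral>x. v x * partial i \<phi> x \<partial>lborel)"
    by (rule integral_on_D[OF vpm]) (use pK K U in auto)
  moreover have "(\<integral>x. g x $ i * \<phi> x \<partial>lebesgue_on D) = (\<integral>x. g x $ i * \<phi> x \<partial>lborel)"
    by (rule integral_on_D[OF gpm]) (use K U in auto)
  ultimately show ?thesis by simp
qed

lemma H1_grad: "v \<in> H1 D \<Longrightarrow> grad D v \<in> L2 D \<and> weak_gradient D v (grad D v)"
  unfolding grad_def by (rule someI_ex[of "\<lambda>g. g \<in> L2 D \<and> weak_gradient D v g"]) (auto simp: H1_def)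

lemma H1_L2: "v \<in> H1 D \<Longrightarrow> v \<in> L2 D"
  by (simp add: H1_def)

lemma grad_unique:
  assumes "v \<in> L2 D" "g \<in> L2 D" "weak_gradient D v g"
  shows "v \<in> H1 D" "AE x in lebesgue_on D. grad D v x = g x"
proof -
  show H: "v \<in> H1 D" using assms by (auto simp: H1_def)
  have "AE x in lebesgue_on D. x \<in> D \<longrightarrow> grad D v x = g x"
    using H1_grad[OF H] assms by (intro weak_gradient_unique_on open_D) (auto simp: weak_gradient_def)
  then show "AE x in lebesgue_on D. grad D v x = g x"
    by (simp add: AE_D)
qed

lemma grad_lipschitz:
  assumes v: "L-lipschitz_on UNIV v" 
    and der: "AE x in lborel. x \<in> D \<longrightarrow> (v has_derivative (\<lambda>h. g x \<bullet> h)) (at x)"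
    and g: "g \<in> borel_measurable borel" "g \<in> L2 D"
  shows "v \<in> H1 D" "AE x in lebesgue_on D. grad D v x = g x"
proof -
  have vc: "continuous_on UNIV v" using v by (rule lipschitz_on_continuous_on)
  have "bounded (v ` closure D)"
    by (intro compact_imp_bounded compact_continuous_image continuous_on_subset[OF vc]) (use bounded_D in auto)
  then obtain C where C: "\<forall>x\<in>closure D. \<bar>v x\<bar> \<le> C" by (auto simp: bounded_iff)
  have "v \<in> L2 D"
  proof (rule bounded_in_L2)
    show "v \<in> borel_measurable (lebesgue_on D)"
      by (intro borel_imp_lebesgue_on_measurable borel_measurable_continuous_onI vc)
    show "AE x in lebesgue_on D. norm (v x) \<le> C" unfolding AE_D using C closure_subset by auto
  qed
  moreover have "weak_gradient D v g"
    unfolding weak_gradient_def using weak_gradient_lipschitz_on[OF v open_D _ der g(1)] by auto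
  ultimately show "v \<in> H1 D" "AE x in lebesgue_on D. grad D v x = g x" using grad_unique g(2) by blast+
qed

lemma test_fun_H1:
  assumes "\<phi> \<in> test_fun E"
  shows "\<phi> \<in> H1 D" "AE x in lebesgue_on D. grad D \<phi> x = cgrad \<phi> x"
proof -
  obtain L where L: "L-lipschitz_on UNIV \<phi>" using test_fun_lipschitz[OF assms] by metis
  show "\<phi> \<in> H1 D" "AE x in lebesgue_on D. grad D \<phi> x = cgrad \<phi> x"
    using grad_lipschitz[OF L _ cgrad_measurable[OF assms] cgrad_L2[OF assms]] test_fun_has_derivative[OF assms] by auto
qed

lemma H1_lincomb:
  assumes v: "v \<in> H1 D" and w: "w \<in> H1 D"
  shows "(\<lambda>x. c * v x + d * w x) \<in> H1 D"
    "AE x in lebesgue_on D. grad D (\<lambda>x. c * v x + d * w x) x = c *\<^sub>R grad D v x + d *\<^sub>R grad D w x"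
proof -
  have 1: "(\<lambda>x. c * v x + d * w x) \<in> L2 D"
    using subspace_add[OF subspace_L2 subspace_scale[OF subspace_L2 H1_L2[OF v]] subspace_scale[OF subspace_L2 H1_L2[OF w]], of c d]
    by (simp add: plus_fun_def scaleR_fun_def)
  have 2: "(\<lambda>x. c *\<^sub>R grad D v x + d *\<^sub>R grad D w x) \<in> L2 D"
    using subspace_add[OF subspace_L2 subspace_scale[OF subspace_L2, of "grad D v" c] subspace_scale[OF subspace_L2, of "grad D w" d]] H1_grad v w
    by (simp add: plus_fun_def scaleR_fun_def)
  have 3: "weak_gradient D (\<lambda>x. c * v x + d * w x) (\<lambda>x. c *\<^sub>R grad D v x + d *\<^sub>R grad D w x)"
    unfolding weak_gradient_def
  proof (intro ballI allI)
    fix \<phi> and i :: 2 assume \<phi>: "\<phi> \<in> test_fun D"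
    have p: "partial i \<phi> \<in> L2 D" by (rule test_fun_L2[OF test_fun_partial[OF \<phi>]])
    note int = L2_times_integrable[OF H1_L2[OF v] p] L2_times_integrable[OF H1_L2[OF w] p]
      L2_times_integrable[OF L2_nth[OF conjunct1[OF H1_grad[OF v]]] test_fun_L2[OF \<phi>]]
      L2_times_integrable[OF L2_nth[OF conjunct1[OF H1_grad[OF w]]] test_fun_L2[OF \<phi>]]
    have "(\<integral>x. (c * v x + d * w x) * partial i \<phi> x \<partial>lebesgue_on D) =
        c * (\<integral>x. v x * partial i \<phi> x \<partial>lebesgue_on D) + d * (\<integral>x. w x * partial i \<phi> x \<partial>lebesgue_on D)"
      using int by (simp add: distrib_right mult.assoc)
    also have "\<dots> = - (c * (\<integral>x. grad D v x $ i * \<phi> x \<partial>lebesgue_on D) + d * (\<integral>x. grad D w x $ i * \<phi> x \<partial>lebesgue_on D))"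
      using H1_grad[OF v] H1_grad[OF w] \<phi> by (simp add: weak_gradient_def)
    also have "\<dots> = - (\<integral>x. (c *\<^sub>R grad D v x + d *\<^sub>R grad D w x) $ i * \<phi> x \<partial>lebesgue_on D)"
      using int by (simp add: distrib_right mult.assoc)
    finally show "(\<integral>x. (c * v x + d * w x) * partial i \<phi> x \<partial>lebesgue_on D) =
      - (\<integral>x. (c *\<^sub>R grad D v x + d *\<^sub>R grad D w x) $ i * \<phi> x \<partial>lebesgue_on D)" .
  qed
  show "(\<lambda>x. c * v x + d * w x) \<in> H1 D"
    "AE x in lebesgue_on D. grad D (\<lambda>x. c * v x + d * w x) x = c *\<^sub>R grad D v x + d *\<^sub>R grad D w x"
    using grad_unique[OF 1 2 3] by auto
qed

lemma grad_add: "v \<in> H1 D \<Longrightarrow> w \<in> H1 D \<Longrightarrow> AE x in lebesgue_on D. grad D (v + w) x = grad D v x + grad D w x"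
  using H1_lincomb(2)[of v w 1 1] by (simp add: plus_fun_def)

lemma grad_scale: "v \<in> H1 D \<Longrightarrow> AE x in lebesgue_on D. grad D (c *\<^sub>R v) x = c *\<^sub>R grad D v x"
  using H1_lincomb(2)[of v v c 0] by (simp add: scaleR_fun_def)

lemma subspace_H1: "subspace (H1 D)"
  unfolding subspace_def
proof (intro conjI ballI allI)
  show "0 \<in> H1 D"
    using grad_lipschitz(1)[of 0 "\<lambda>_. 0" "\<lambda>_. 0"] bounded_in_L2[of "\<lambda>_. 0 :: point" 0]
    by (simp add: zero_fun_def lipschitz_on_def)
  show "v + w \<in> H1 D" if "v \<in> H1 D" "w \<in> H1 D" for v w
    using H1_lincomb(1)[OF that, of 1 1] by (simp add: plus_fun_def)
  show "c *\<^sub>R v \<in> H1 D" if "v \<in> H1 D" for c v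
    using H1_lincomb(1)[OF that that, of c 0] by (simp add: scaleR_fun_def)
qed

lemma grad_measurable [measurable]: "v \<in> H1 D \<Longrightarrow> grad D v \<in> borel_measurable (lebesgue_on D)"
  using H1_grad by (auto simp: L2_def)

lemma grad_affine_on:
  assumes v: "v \<in> H1 D" and U: "open U" "U \<subseteq> D" and aff: "\<And>x. x \<in> U \<Longrightarrow> v x = g \<bullet> x + c"
  shows "AE x in lebesgue_on D. x \<in> U \<longrightarrow> grad D v x = g"
proof (rule weak_gradient_unique_on[OF U])
  show "grad D v \<in> L2 D" using H1_grad[OF v] by simp
  show "(\<lambda>_. g) \<in> L2 D" by (rule bounded_in_L2[where C = "norm g"]) auto
  fix \<phi> and i :: 2 assume \<phi>: "\<phi> \<in> test_fun U"
  obtain K where K: "compact K" "K \<subseteq> U" "\<And>x. x \<notin> K \<Longrightarrow> \<phi> x = 0" using test_funE[OF \<phi>] by metis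
  have p0: "partial i \<phi> x = 0" if "x \<notin> U" for x
  proof -
    have "cgrad \<phi> x = 0"
      by (rule cgrad_zero_open[of "- K"]) (use K that compact_imp_closed[OF K(1)] in auto)
    then show ?thesis by (simp add: partial_eq_cgrad)
  qed
  have lip: "(norm g)-lipschitz_on UNIV (\<lambda>x. g \<bullet> x + c)"
    by (rule lipschitz_onI) (auto simp: dist_norm inner_diff_right[symmetric] intro: Cauchy_Schwarz_ineq2[of g, simplified])
  have "(\<integral>x. v x * partial i \<phi> x \<partial>lebesgue_on D) = (\<integral>x. (g \<bullet> x + c) * partial i \<phi> x \<partial>lebesgue_on D)"
    by (rule Bochner_Integration.integral_cong) (use aff p0 in auto)
  also have "\<dots> = - (\<integral>x. g $ i * \<phi> x \<partial>lebesgue_on D)"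
    by (rule weak_gradient_lipschitz_on[OF lip U _ _ \<phi>]) (auto intro!: derivative_eq_intros)
  finally show "(\<integral>x. grad D v x $ i * \<phi> x \<partial>lebesgue_on D) = (\<integral>x. g $ i * \<phi> x \<partial>lebesgue_on D)"
    using H1_grad[OF v] subsetD[OF test_fun_mono[OF U(2)] \<phi>] by (simp add: weak_gradient_def)
qed

text \<open>The square of \<open>H1_norm\<close> as a quadratic form, so that the triangle inequality comes from the Cauchy--Schwarz
  inequality.\<close>

definition h1_form :: "(point \<Rightarrow> real) \<Rightarrow> (point \<Rightarrow> real) \<Rightarrow> real" where
  "h1_form v w = (\<integral>x. v x * w x \<partial>lebesgue_on D) + (\<integral>x. grad D v x \<bullet> grad D w x \<partial>lebesgue_on D)"

text \<open>The Dirichlet form with weight \<open>a\<close>; all energies below are instances of it.\<close>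

definition dform :: "(point \<Rightarrow> real) \<Rightarrow> (point \<Rightarrow> real) \<Rightarrow> (point \<Rightarrow> real) \<Rightarrow> real" where
  "dform a v w = (\<integral>x. a x * (grad D v x \<bullet> grad D w x) \<partial>lebesgue_on D)"

lemma Linf_bound:
  assumes "a \<in> Linf D"
  shows "0 \<le> Linf_norm D a" "AE x in lebesgue_on D. norm (a x) \<le> Linf_norm D a"
proof -
  let ?e = "esssup (lebesgue_on D) (\<lambda>x. ereal (norm (a x)))"
  have ae: "AE x in lebesgue_on D. ereal (norm (a x)) \<le> ?e" by (rule esssup_AE)
  have "\<not> (AE x in lebesgue_on D. False)"
  proof
    assume "AE x in lebesgue_on D. False"
    then have "AE x in lebesgue. x \<notin> D" by (simp add: AE_D)
    then have "negligible D" by (simp add: AE_iff_null negligible_iff_null_sets)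
    then show False using open_D nonempty_D open_not_negligible by blast
  qed
  then have "0 \<le> ?e"
    using ae by (metis (no_types, lifting) AE_mp AE_I2 ereal_less_eq(5) norm_ge_zero order_trans)
  moreover have "?e < \<infinity>" using assms by (simp add: Linf_def)
  ultimately have e: "?e = ereal (Linf_norm D a)" "0 \<le> Linf_norm D a"
    unfolding Linf_norm_def by (cases ?e; auto)+
  show "0 \<le> Linf_norm D a" by (rule e(2))
  show "AE x in lebesgue_on D. norm (a x) \<le> Linf_norm D a" using ae unfolding e(1) by simp
qed

lemma weighted_integrable:
  fixes a :: "point \<Rightarrow> real"
  assumes a: "a \<in> Linf D" and f: "integrable (lebesgue_on D) f"
  shows "integrable (lebesgue_on D) (\<lambda>x. a x * f x)"
proof (rule Bochner_Integration.integrable_bound[where f = "\<lambda>x. Linf_norm D a * f x"])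
  show "(\<lambda>x. a x * f x) \<in> borel_measurable (lebesgue_on D)"
    using a borel_measurable_integrable[OF f] by (auto simp: Linf_def)
  show "AE x in lebesgue_on D. norm (a x * f x) \<le> norm (Linf_norm D a * f x)"
    using Linf_bound(2)[OF a] by eventually_elim (auto simp: abs_mult mult_right_mono)
qed (use f in auto)

lemma dform_integrable:
  assumes "a \<in> Linf D" "v \<in> H1 D" "w \<in> H1 D"
  shows "integrable (lebesgue_on D) (\<lambda>x. a x * (grad D v x \<bullet> grad D w x))"
  using assms H1_grad by (intro weighted_integrable L2_product_integrable) auto

lemma dform_sym: "dform a v w = dform a w v"
  by (simp add: dform_def inner_commute)

lemma dform_add:
  assumes a: "a \<in> Linf D" and v: "u \<in> H1 D" "v \<in> H1 D" "w \<in> H1 D"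
  shows "dform a (u + v) w = dform a u w + dform a v w"
proof -
  note int = dform_integrable[OF a v(1,3)] dform_integrable[OF a v(2,3)]
  have uv: "u + v \<in> H1 D" by (rule subspace_add[OF subspace_H1 v(1,2)])
  have "dform a (u + v) w = (\<integral>x. a x * (grad D u x \<bullet> grad D w x) + a x * (grad D v x \<bullet> grad D w x) \<partial>lebesgue_on D)"
    unfolding dform_def
  proof (rule integral_cong_AE)
    show "AE x in lebesgue_on D. a x * (grad D (u + v) x \<bullet> grad D w x) =
        a x * (grad D u x \<bullet> grad D w x) + a x * (grad D v x \<bullet> grad D w x)"
      using grad_add[OF v(1,2)] by eventually_elim (simp add: inner_add_left algebra_simps)
  qed (use borel_measurable_integrable[OF dform_integrable[OF a uv v(3)]] borel_measurable_integrable[OF int(1)] borel_measurable_integrable[OF int(2)] in \<open>auto intro!: borel_measurable_add\<close>)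
  then show ?thesis using int by (simp add: dform_def)
qed

lemma dform_scale:
  assumes a: "a \<in> Linf D" and v: "v \<in> H1 D" "w \<in> H1 D"
  shows "dform a (c *\<^sub>R v) w = c * dform a v w"
proof -
  have cv: "c *\<^sub>R v \<in> H1 D" by (rule subspace_scale[OF subspace_H1 v(1)])
  have "dform a (c *\<^sub>R v) w = (\<integral>x. c * (a x * (grad D v x \<bullet> grad D w x)) \<partial>lebesgue_on D)"
    unfolding dform_def
  proof (rule integral_cong_AE)
    show "AE x in lebesgue_on D. a x * (grad D (c *\<^sub>R v) x \<bullet> grad D w x) = c * (a x * (grad D v x \<bullet> grad D w x))"
      using grad_scale[OF v(1), of c] by eventually_elim simp
  qed (use borel_measurable_integrable[OF dform_integrable[OF a cv v(2)]] borel_measurable_integrable[OF dform_integrable[OF a v]] in auto)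
  then show ?thesis by (simp add: dform_def)
qed

lemma const_Linf: "(\<lambda>_. c :: real) \<in> Linf D"
proof -
  have "esssup (lebesgue_on D) (\<lambda>x. ereal (norm c)) \<le> ereal (norm c)"
    by (rule esssup_I) auto
  then show ?thesis by (auto simp: Linf_def less_eq_ereal_def)
qed

lemma dform_semi_inner:
  assumes a: "a \<in> Linf D" and pos: "AE x in lebesgue_on D. 0 \<le> a x"
  shows "semi_inner (H1 D) (dform a)"
proof
  show "0 \<le> dform a v v" for v
    unfolding dform_def by (rule integral_nonneg_AE) (use pos in \<open>auto elim!: eventually_mono\<close>)
qed (use subspace_H1 dform_sym dform_add[OF a] dform_scale[OF a] in auto)

lemma dform_mono:
  assumes a: "a \<in> Linf D" and b: "b \<in> Linf D" and v: "v \<in> H1 D"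
    and le: "AE x in lebesgue_on D. a x \<le> b x"
  shows "dform a v v \<le> dform b v v"
  unfolding dform_def
  by (rule integral_mono_AE) (use le dform_integrable[OF a v v] dform_integrable[OF b v v] in
    \<open>auto elim!: eventually_mono intro: mult_right_mono\<close>)

lemma dform_const: "dform (\<lambda>_. c) v w = c * dform (\<lambda>_. 1) v w"
  by (simp add: dform_def)

sublocale D1: semi_inner "H1 D" "dform (\<lambda>_. 1)"
  by (rule dform_semi_inner[OF const_Linf]) simp

lemma h1_form_alt: "h1_form v w = (\<integral>x. v x * w x \<partial>lebesgue_on D) + dform (\<lambda>_. 1) v w"
  by (simp add: h1_form_def dform_def)

sublocale H: semi_inner "H1 D" h1_form
proof
  show "subspace (H1 D)" by (rule subspace_H1)
  show "h1_form v w = h1_form w v" if "v \<in> H1 D" "w \<in> H1 D" for v w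
    using D1.sym that by (simp add: h1_form_alt mult.commute)
  show "h1_form (u + v) w = h1_form u w + h1_form v w" if "u \<in> H1 D" "v \<in> H1 D" "w \<in> H1 D" for u v w
    using D1.add[OF that] L2_times_integrable[OF H1_L2 H1_L2, of u w] L2_times_integrable[OF H1_L2 H1_L2, of v w] that
    by (simp add: h1_form_alt distrib_right)
  show "h1_form (c *\<^sub>R v) w = c * h1_form v w" if "v \<in> H1 D" "w \<in> H1 D" for c v w
    using D1.scale[OF that] by (simp add: h1_form_alt mult.assoc distrib_left)
  show "0 \<le> h1_form v v" if "v \<in> H1 D" for v
    using D1.nonneg[OF that] by (simp add: h1_form_alt)
qed

lemma H1_norm_eq: "H1_norm D v = sqrt (h1_form v v)"
  by (simp add: H1_norm_def L2_norm_on_def h1_form_def power2_norm_eq_inner flip: power2_eq_square)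

lemma H1_norm_triangle: "v \<in> H1 D \<Longrightarrow> w \<in> H1 D \<Longrightarrow> H1_norm D (v + w) \<le> H1_norm D v + H1_norm D w"
  unfolding H1_norm_eq by (rule H.triangle)

lemma H1_norm_scale: "v \<in> H1 D \<Longrightarrow> H1_norm D (c *\<^sub>R v) = \<bar>c\<bar> * H1_norm D v"
  unfolding H1_norm_eq by (rule H.scale_sqrt)

lemma H1_norm_nonneg: "v \<in> H1 D \<Longrightarrow> 0 \<le> H1_norm D v"
  unfolding H1_norm_eq using H.nonneg by simp

lemma D1_le_H1_norm: "v \<in> H1 D \<Longrightarrow> sqrt (dform (\<lambda>_. 1) v v) \<le> H1_norm D v"
  unfolding H1_norm_eq h1_form_alt by (auto intro: integral_nonneg_AE)

lemma H10_H1: "v \<in> H10 D \<Longrightarrow> v \<in> H1 D"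
  by (simp add: H10_def)

lemma H10I:
  "v \<in> H1 D \<Longrightarrow> (\<And>n. \<phi> n \<in> test_fun D) \<Longrightarrow> (\<lambda>n. H1_norm D (\<lambda>x. v x - \<phi> n x)) \<longlonglongrightarrow> 0 \<Longrightarrow> v \<in> H10 D"
  by (auto simp: H10_def)

text \<open>Sums and multiples of approximating sequences of test functions approximate the sums and multiples.\<close>

lemma subspace_H10: "subspace (H10 D)"
  unfolding subspace_def
proof (intro conjI ballI allI)
  have "(\<lambda>_. 0) \<in> test_fun D"
    by (rule test_funI[of _ "{}"]) (auto simp: smooth_const)
  moreover have "H1_norm D 0 = 0" using H1_norm_scale[of 0 0] subspace_0[OF subspace_H1] by simp
  ultimately show "0 \<in> H10 D" using subspace_0[OF subspace_H1]
    by (auto simp: H10_def zero_fun_def intro!: exI[of _ "\<lambda>_ _. 0"])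
next
  fix v w assume "v \<in> H10 D" "w \<in> H10 D"
  then obtain \<phi> \<psi> where v: "v \<in> H1 D" "\<And>n. \<phi> n \<in> test_fun D" "(\<lambda>n. H1_norm D (\<lambda>x. v x - \<phi> n x)) \<longlonglongrightarrow> 0"
    and w: "w \<in> H1 D" "\<And>n. \<psi> n \<in> test_fun D" "(\<lambda>n. H1_norm D (\<lambda>x. w x - \<psi> n x)) \<longlonglongrightarrow> 0"
    by (auto simp: H10_def)
  have d: "v - \<phi> n \<in> H1 D" "w - \<psi> n \<in> H1 D" for n
    using v w test_fun_H1(1) subspace_diff[OF subspace_H1] by blast+
  have "(\<lambda>n. H1_norm D (\<lambda>x. (v + w) x - (\<phi> n x + \<psi> n x))) \<longlonglongrightarrow> 0"
  proof (rule tendsto_sandwich[OF _ _ tendsto_const])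
    show "(\<lambda>n. H1_norm D (\<lambda>x. v x - \<phi> n x) + H1_norm D (\<lambda>x. w x - \<psi> n x)) \<longlonglongrightarrow> 0"
      using tendsto_add[OF v(3) w(3)] by simp
    have eq: "(\<lambda>x. (v + w) x - (\<phi> n x + \<psi> n x)) = (v - \<phi> n) + (w - \<psi> n)" for n by (auto simp: fun_eq_iff)
    show "\<forall>\<^sub>F n in sequentially. H1_norm D (\<lambda>x. (v + w) x - (\<phi> n x + \<psi> n x)) \<le> H1_norm D (\<lambda>x. v x - \<phi> n x) + H1_norm D (\<lambda>x. w x - \<psi> n x)"
      unfolding eq using H1_norm_triangle[OF d] by (simp add: fun_diff_def)
    show "\<forall>\<^sub>F n in sequentially. 0 \<le> H1_norm D (\<lambda>x. (v + w) x - (\<phi> n x + \<psi> n x))"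
      unfolding eq using H1_norm_nonneg[OF subspace_add[OF subspace_H1 d]] by simp
  qed
  moreover have "(\<lambda>x. \<phi> n x + \<psi> n x) \<in> test_fun D" for n
    using test_fun_lincomb[OF v(2)[of n] w(2)[of n], of 1 1] by simp
  ultimately show "v + w \<in> H10 D"
    by (intro H10I[where \<phi> = "\<lambda>n x. \<phi> n x + \<psi> n x"] subspace_add[OF subspace_H1 v(1) w(1)])
next
  fix c v assume "v \<in> H10 D"
  then obtain \<phi> where v: "v \<in> H1 D" "\<And>n. \<phi> n \<in> test_fun D" "(\<lambda>n. H1_norm D (\<lambda>x. v x - \<phi> n x)) \<longlonglongrightarrow> 0"
    by (auto simp: H10_def)
  have d: "v - \<phi> n \<in> H1 D" for n
    using v test_fun_H1(1) subspace_diff[OF subspace_H1] by blast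
  have eq: "(\<lambda>x. (c *\<^sub>R v) x - c * \<phi> n x) = c *\<^sub>R (v - \<phi> n)" for n by (auto simp: fun_eq_iff algebra_simps)
  have "(\<lambda>n. \<bar>c\<bar> * H1_norm D (\<lambda>x. v x - \<phi> n x)) \<longlonglongrightarrow> \<bar>c\<bar> * 0"
    by (intro tendsto_intros v)
  then have "(\<lambda>n. H1_norm D (\<lambda>x. (c *\<^sub>R v) x - c * \<phi> n x)) \<longlonglongrightarrow> 0"
    unfolding eq H1_norm_scale[OF d] by (simp add: fun_diff_def)
  moreover have "(\<lambda>x. c * \<phi> n x) \<in> test_fun D" for n
    using test_fun_lincomb[OF v(2)[of n] v(2)[of n], of c 0] by simp
  ultimately show "c *\<^sub>R v \<in> H10 D"
    by (intro H10I[where \<phi> = "\<lambda>n x. c * \<phi> n x"] subspace_scale[OF subspace_H1 v(1)])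
qed

end

section \<open>Mollification and functions with zero boundary values\<close>

text \<open>The derivative falls on the kernel, so the convolution is as smooth as the kernel even if \<open>w\<close> is
  only continuous.\<close>

lemma convolution_has_derivative:
  fixes w :: "point \<Rightarrow> real"
  assumes w: "continuous_on UNIV w" "bounded S" "\<And>x. x \<notin> S \<Longrightarrow> w x = 0" and \<rho>: "\<rho> \<in> test_fun E"
  shows "((\<lambda>x. \<integral>y. w y * \<rho> (y - x) \<partial>lborel) has_derivative
      (\<lambda>h. \<integral>y. w y * (cgrad \<rho> (y - x) \<bullet> (- h)) \<partial>lborel)) (at x)"
proof -
  obtain L where L: "L-lipschitz_on UNIV \<rho>" using test_fun_lipschitz[OF \<rho>] by metis
  have wm: "w \<in> borel_measurable borel" by (rule borel_measurable_continuous_onI[OF w(1)])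
  show ?thesis
  proof (rule has_derivative_integral_param(1)[where M = lborel and f = "\<lambda>x y. w y * \<rho> (y - x)"
        and f' = "\<lambda>y h. w y * (cgrad \<rho> (y - x) \<bullet> (- h))" and K = "\<lambda>y. \<bar>w y\<bar> * L"])
    show "integrable lborel (\<lambda>y. w y * \<rho> (y - x))" for x
    proof (rule integrable_continuous_bounded_support[OF _ w(2)])
      show "continuous_on UNIV (\<lambda>y. w y * \<rho> (y - x))"
        by (intro continuous_intros w continuous_on_compose2[OF test_fun_continuous[OF \<rho>, of UNIV]]) auto
    qed (simp add: w)
    show "AE y in lborel. ((\<lambda>x. w y * \<rho> (y - x)) has_derivative (\<lambda>h. w y * (cgrad \<rho> (y - x) \<bullet> (- h)))) (at x)"
    proof (intro always_eventually allI has_derivative_mult_right)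
      fix y
      have "((\<lambda>x. y - x) has_derivative (\<lambda>h. - h)) (at x)" by (auto intro!: derivative_eq_intros)
      from has_derivative_compose[OF this test_fun_has_derivative[OF \<rho>]]
      show "((\<lambda>x. \<rho> (y - x)) has_derivative (\<lambda>h. cgrad \<rho> (y - x) \<bullet> (- h))) (at x)" .
    qed
    show "(\<lambda>y. w y * (cgrad \<rho> (y - x) \<bullet> (- h))) \<in> borel_measurable lborel" for h
      using wm cgrad_measurable[OF \<rho>] by (auto intro!: borel_measurable_times borel_measurable_inner measurable_compose[OF _ cgrad_measurable[OF \<rho>]])
    show "\<bar>w y * \<rho> (y - z) - w y * \<rho> (y - x)\<bar> \<le> \<bar>w y\<bar> * L * norm (z - x)" for z y
    proof -
      have "\<bar>\<rho> (y - z) - \<rho> (y - x)\<bar> \<le> L * norm (z - x)"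
        using lipschitz_onD[OF L, of "y - z" "y - x"] by (simp add: dist_norm norm_minus_commute)
      then have "\<bar>w y\<bar> * \<bar>\<rho> (y - z) - \<rho> (y - x)\<bar> \<le> \<bar>w y\<bar> * (L * norm (z - x))" by (rule mult_left_mono) simp
      then show ?thesis by (simp add: abs_mult[symmetric] right_diff_distrib mult.assoc)
    qed
    show "integrable lborel (\<lambda>y. \<bar>w y\<bar> * L)"
      by (intro integrable_mult_left integrable_abs integrable_continuous_bounded_support[OF w])
  qed
qed

lemma convolution_smooth:
  fixes w :: "point \<Rightarrow> real"
  assumes w: "continuous_on UNIV w" "bounded S" "\<And>x. x \<notin> S \<Longrightarrow> w x = 0" and \<rho>: "\<rho> \<in> test_fun E"
  shows "smooth (\<lambda>x. \<integral>y. w y * \<rho> (y - x) \<partial>lborel)"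
proof (rule smoothI_closed)
  let ?S = "{\<lambda>x. \<integral>y. w y * \<rho> (y - x) \<partial>lborel | \<rho>. \<rho> \<in> test_fun E}"
  show "(\<lambda>x. \<integral>y. w y * \<rho> (y - x) \<partial>lborel) \<in> ?S" using \<rho> by blast
  show "g differentiable (at x)" if "g \<in> ?S" for g x
    using that convolution_has_derivative[OF w] unfolding differentiable_def by blast
  show "partial i g \<in> ?S" if gS: "g \<in> ?S" for i g
  proof -
    obtain \<rho> where g: "g = (\<lambda>x. \<integral>y. w y * \<rho> (y - x) \<partial>lborel)" and \<rho>: "\<rho> \<in> test_fun E" using gS by blast
    have "partial i g x = (\<integral>y. w y * (- partial i \<rho> (y - x)) \<partial>lborel)" for x
    proof -
      have "partial i g x = (\<integral>y. w y * (cgrad \<rho> (y - x) \<bullet> (- axis i 1)) \<partial>lborel)"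
        unfolding g by (rule partial_eqI[OF convolution_has_derivative[OF w \<rho>]])
      also have "(\<lambda>y. w y * (cgrad \<rho> (y - x) \<bullet> (- axis i 1))) = (\<lambda>y. w y * (- partial i \<rho> (y - x)))"
        by (rule ext) (simp add: inner_axis cgrad_def)
      finally show ?thesis .
    qed
    then have "partial i g = (\<lambda>x. \<integral>y. w y * (- partial i \<rho> (y - x)) \<partial>lborel)" by (rule ext)
    moreover have "(\<lambda>x. - partial i \<rho> x) \<in> test_fun E"
      using test_fun_lincomb[OF test_fun_partial[OF \<rho>] test_fun_partial[OF \<rho>], of "-1" i 0 i] by simp
    ultimately show ?thesis
      unfolding mem_Collect_eq by (intro exI[of _ "\<lambda>x. - partial i \<rho> x"] conjI)
  qed
qed

lemma gradient_norm_le_lipschitz: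
  assumes "(f has_derivative (\<lambda>h. g \<bullet> h)) (at (x::point))" "L-lipschitz_on UNIV f"
  shows "norm g \<le> L"
proof -
  have "\<bar>g \<bullet> g\<bar> \<le> L * norm g"
    by (rule has_derivative_le_lipschitz[OF assms(1)]) (use lipschitz_onD[OF assms(2)] in \<open>auto simp: dist_norm\<close>)
  then have "norm g * norm g \<le> L * norm g" by (simp add: dot_square_norm power2_eq_square)
  then show ?thesis using lipschitz_on_nonneg[OF assms(2)] mult_right_le_imp_le[of "norm g" "norm g" L]
    by (cases "g = 0") auto
qed

lemma box_bump_integrable: "integrable lborel (box_bump n a b)"
  by (rule integrable_continuous_bounded_support[OF smooth_continuous_on[OF smooth_box_bump] bounded_box])
     (rule box_bump_zero)

lemma box_bump_integral_pos:
  assumes "z \<in> box a b" shows "0 < (\<integral>x. box_bump n a b x \<partial>lborel)"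
proof -
  have "(\<integral>x. box_bump n a b x \<partial>lborel) \<noteq> 0"
  proof
    assume "(\<integral>x. box_bump n a b x \<partial>lborel) = 0"
    then have "AE x in lborel. box_bump n a b x = 0"
      by (subst (asm) integral_nonneg_eq_0_iff_AE[OF box_bump_integrable]) (simp_all add: box_bump_bounds)
    then have "AE x in lborel. x \<notin> box a b"
      by eventually_elim (use box_bump_pos less_irrefl in metis)
    then have "AE x in lebesgue. x \<notin> box a b" by (rule AE_completion)
    then have "negligible (box a b)" by (simp add: AE_iff_null negligible_iff_null_sets)
    then show False using assms open_not_negligible[OF open_box, of a b] by blast
  qed
  moreover have "0 \<le> (\<integral>x. box_bump n a b x \<partial>lborel)" by (simp add: box_bump_bounds)
  ultimately show ?thesis by simp
qed

lemma mollifier_exists: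
  assumes "\<epsilon> > 0"
  obtains \<rho> where "\<rho> \<in> test_fun (UNIV :: point set)" "\<And>x. 0 \<le> \<rho> x" "\<And>x. norm x > \<epsilon> \<Longrightarrow> \<rho> x = 0"
    "integrable lborel \<rho>" "(\<integral>x. \<rho> x \<partial>lborel) = 1"
proof -
  define b :: point where "b = (\<chi> i. \<epsilon> / 2)"
  let ?\<rho> = "box_bump 0 (- b) b"
  have t: "?\<rho> \<in> test_fun UNIV" by (rule box_bump_test_fun) simp
  have sup: "?\<rho> x = 0" if "norm x > \<epsilon>" for x
  proof (rule box_bump_zero)
    show "x \<notin> box (- b) b"
    proof
      assume "x \<in> box (- b) b"
      then have "\<bar>x $ 1\<bar> \<le> \<epsilon> / 2" "\<bar>x $ 2\<bar> \<le> \<epsilon> / 2" by (auto simp: mem_box_2 b_def abs_le_iff)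
      then show False using norm_le_l1_cart[of x] that by (simp add: sum_2)
    qed
  qed
  have int: "integrable lborel ?\<rho>" by (rule box_bump_integrable)
  have "(0 :: point) \<in> box (- b) b" using assms by (simp add: mem_box_2 b_def)
  then have I: "(\<integral>x. ?\<rho> x \<partial>lborel) > 0" by (rule box_bump_integral_pos)
  show ?thesis
  proof (rule that[of "\<lambda>x. (1 / (\<integral>x. ?\<rho> x \<partial>lborel)) * ?\<rho> x"])
    show "(\<lambda>x. (1 / (\<integral>x. ?\<rho> x \<partial>lborel)) * ?\<rho> x) \<in> test_fun UNIV"
      using test_fun_lincomb[OF t t, of "1 / (\<integral>x. ?\<rho> x \<partial>lborel)" 0] by simp
  qed (use I int sup box_bump_bounds in auto)
qed

context planar_domain
begin

text \<open>The test functions are mollifications \<open>\<phi> n\<close> of the truncations \<open>w n = max 0 (v - \<delta> n)\<close>: truncation moves the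
  support into the interior of \<open>D\<close>, and the mollification radius \<open>\<epsilon> n\<close> is small compared with \<open>\<delta> n / L\<close>, so
  that the support stays there. Near a point where \<open>v\<close> is affine, mollification with
  small radius reproduces the gradient exactly; this gives pointwise convergence of gradients almost
  everywhere, and the common Lipschitz constant dominates them.\<close>

lemma H10_of_locally_affine:
  assumes lip: "L-lipschitz_on UNIV v" and nonneg: "\<And>x. 0 \<le> v x" and zero: "\<And>x. x \<notin> D \<Longrightarrow> v x = 0"
    and g: "g \<in> borel_measurable borel"
    and loc: "AE x in lborel. x \<in> D \<longrightarrow> (\<exists>r>0. \<forall>y\<in>ball x r. v y = v x + g x \<bullet> (y - x))"
  shows "v \<in> H10 D" "AE x in lebesgue_on D. grad D v x = g x"
proof -
  have vc: "continuous_on UNIV v" using lip by (rule lipschitz_on_continuous_on)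
  have L: "L \<ge> 0" using lip by (rule lipschitz_on_nonneg)
  have der: "AE x in lborel. x \<in> D \<longrightarrow> (v has_derivative (\<lambda>h. g x \<bullet> h)) (at x)"
    using loc
  proof eventually_elim
    case (elim x)
    show ?case
    proof
      assume "x \<in> D"
      then obtain r where r: "r > 0" "\<forall>y\<in>ball x r. v y = v x + g x \<bullet> (y - x)" using elim by blast
      have "((\<lambda>y. v x + g x \<bullet> (y - x)) has_derivative (\<lambda>h. g x \<bullet> h)) (at x)"
        by (auto intro!: derivative_eq_intros)
      then show "(v has_derivative (\<lambda>h. g x \<bullet> h)) (at x)"
        by (rule has_derivative_transform_within_open[OF _ open_ball[of x r]])
           (use r(1) in simp, rule r(2)[rule_format, symmetric])
    qed
  qed
  have gL: "AE x in lborel. x \<in> D \<longrightarrow> norm (g x) \<le> L"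
    using der by eventually_elim (auto intro: gradient_norm_le_lipschitz lip)
  have gL2: "g \<in> L2 D"
    by (rule bounded_in_L2[where C = L]) (use gL g in \<open>auto intro: borel_imp_lebesgue_on_measurable AE_D_I\<close>)
  have vH1: "v \<in> H1 D" and gv: "AE x in lebesgue_on D. grad D v x = g x"
    using grad_lipschitz[OF lip der g gL2] by auto
  show "AE x in lebesgue_on D. grad D v x = g x" by (rule gv)
  define \<delta> where "\<delta> n = inverse (real (Suc n))" for n
  define \<epsilon> where "\<epsilon> n = \<delta> n / (4 * (L + 1))" for n
  have "\<delta> \<longlonglongrightarrow> 0" unfolding \<delta>_def[abs_def] by (rule LIMSEQ_inverse_real_of_nat)
  then have \<delta>: "\<delta> n > 0" "\<delta> \<longlonglongrightarrow> 0" for n by (auto simp: \<delta>_def)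
  have \<epsilon>: "\<epsilon> n > 0" for n using \<delta>(1)[of n] L by (simp add: \<epsilon>_def)
  have \<epsilon>0: "\<epsilon> \<longlonglongrightarrow> 0" unfolding \<epsilon>_def using tendsto_divide[OF \<delta>(2) tendsto_const, of "4 * (L + 1)"] L by simp
  have L\<epsilon>: "L * \<epsilon> n \<le> \<delta> n / 4" for n
  proof -
    have "L * \<delta> n \<le> (L + 1) * \<delta> n" using \<delta>(1)[of n] by simp
    then show ?thesis using L by (simp add: \<epsilon>_def field_simps)
  qed
  have "\<forall>n. \<exists>\<rho>. \<rho> \<in> test_fun (UNIV :: point set) \<and> (\<forall>x. 0 \<le> \<rho> x) \<and> (\<forall>x. norm x > \<epsilon> n \<longrightarrow> \<rho> x = 0) \<and>
    integrable lborel \<rho> \<and> (\<integral>x. \<rho> x \<partial>lborel) = 1"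
    using mollifier_exists[OF \<epsilon>] by metis
  then obtain \<rho> where \<rho>: "\<And>n. \<rho> n \<in> test_fun (UNIV :: point set)" "\<And>n x. 0 \<le> \<rho> n x"
    "\<And>n x. norm x > \<epsilon> n \<Longrightarrow> \<rho> n x = 0" "\<And>n. integrable lborel (\<rho> n)" "\<And>n. (\<integral>x. \<rho> n x \<partial>lborel) = 1"
    by metis
  (* Truncation at height delta n keeps the support away from the complement of D. *)
  define w where "w n x = max 0 (v x - \<delta> n)" for n x
  define \<phi> where "\<phi> n x = (\<integral>y. w n y * \<rho> n (y - x) \<partial>lborel)" for n x
  have wlip: "\<bar>w n x - w n y\<bar> \<le> L * norm (x - y)" for n x y
  proof -
    have "\<bar>w n x - w n y\<bar> \<le> \<bar>v x - v y\<bar>" unfolding w_def by linarith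
    then show ?thesis using lipschitz_onD[OF lip, of x y] by (simp add: dist_norm)
  qed
  have wc: "continuous_on S (w n)" for n S unfolding w_def
    by (intro continuous_intros continuous_on_subset[OF vc]) auto
  have wD: "w n x = 0" if "x \<notin> D" for n x using zero[OF that] \<delta>(1)[of n] by (simp add: w_def)
  have \<phi>_shift: "\<phi> n x = (\<integral>z. w n (z + x) * \<rho> n z \<partial>lborel)" for n x
  proof -
    have "(\<lambda>y. w n y * \<rho> n (y - x)) \<in> borel_measurable borel"
      by (intro borel_measurable_continuous_onI continuous_intros wc continuous_on_compose2[OF test_fun_continuous[OF \<rho>(1), of UNIV]]) auto
    from lborel_integral_translation[OF this, of x] show ?thesis by (simp add: \<phi>_def)
  qed
  have wint: "integrable lborel (\<lambda>z. w n (z + x) * \<rho> n z)" for n x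
  proof (rule integrable_continuous_bounded_support[where S = "cball 0 (\<epsilon> n)"])
    show "continuous_on UNIV (\<lambda>z. w n (z + x) * \<rho> n z)"
      by (intro continuous_intros test_fun_continuous[OF \<rho>(1)] continuous_on_compose2[OF wc[of UNIV n]]) auto
  qed (use \<rho>(3) in auto)
  have \<phi>smooth: "smooth (\<phi> n)" for n
    unfolding \<phi>_def[abs_def] by (rule convolution_smooth[OF wc bounded_D wD \<rho>(1)])
  have \<phi>lip: "L-lipschitz_on UNIV (\<phi> n)" for n
  proof (rule lipschitz_onI[OF _ L])
    fix x y
    have "\<phi> n x - \<phi> n y = (\<integral>z. w n (z + x) * \<rho> n z - w n (z + y) * \<rho> n z \<partial>lborel)"
      using wint by (simp add: \<phi>_shift)
    also have "\<bar>\<dots>\<bar> \<le> (\<integral>z. L * norm (x - y) * \<rho> n z \<partial>lborel)"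
    proof (rule integral_abs_bound[THEN order_trans], rule integral_mono)
      fix z
      have "\<bar>w n (z + x) - w n (z + y)\<bar> * \<rho> n z \<le> L * norm (x - y) * \<rho> n z"
        using wlip[of n "z + x" "z + y"] \<rho>(2)[of n z] by (intro mult_right_mono) auto
      then show "\<bar>w n (z + x) * \<rho> n z - w n (z + y) * \<rho> n z\<bar> \<le> L * norm (x - y) * \<rho> n z"
        using \<rho>(2)[of n z] by (simp add: left_diff_distrib[symmetric] abs_mult)
    qed (use wint \<rho>(4) in auto)
    also have "\<dots> = L * norm (x - y)" using \<rho>(5) by simp
    finally show "dist (\<phi> n x) (\<phi> n y) \<le> L * dist x y" by (simp add: dist_norm)
  qed
  have \<phi>close: "\<bar>\<phi> n x - v x\<bar> \<le> 2 * \<delta> n" for n x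
  proof -
    have "\<phi> n x - w n x = (\<integral>z. w n (z + x) * \<rho> n z - w n x * \<rho> n z \<partial>lborel)"
      using wint \<rho>(4,5) by (simp add: \<phi>_shift)
    also have "\<bar>\<dots>\<bar> \<le> (\<integral>z. L * \<epsilon> n * \<rho> n z \<partial>lborel)"
    proof (rule integral_abs_bound[THEN order_trans], rule integral_mono)
      fix z
      show "\<bar>w n (z + x) * \<rho> n z - w n x * \<rho> n z\<bar> \<le> L * \<epsilon> n * \<rho> n z"
      proof (cases "norm z > \<epsilon> n")
        case False
        then have "\<bar>w n (z + x) - w n x\<bar> \<le> L * \<epsilon> n"
          using wlip[of n "z + x" x] mult_left_mono[OF _ L, of "norm z" "\<epsilon> n"] by simp
        then have "\<bar>w n (z + x) - w n x\<bar> * \<rho> n z \<le> L * \<epsilon> n * \<rho> n z"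
          using \<rho>(2)[of n z] by (intro mult_right_mono) auto
        then show ?thesis using \<rho>(2)[of n z] by (simp add: left_diff_distrib[symmetric] abs_mult)
      qed (simp add: \<rho>(3))
    qed (use wint \<rho>(4) in auto)
    also have "\<dots> = L * \<epsilon> n" using \<rho>(5) by simp
    finally have "\<bar>\<phi> n x - w n x\<bar> \<le> L * \<epsilon> n" .
    moreover have "\<bar>w n x - v x\<bar> \<le> \<delta> n" using nonneg[of x] \<delta>(1)[of n] unfolding w_def by linarith
    ultimately show ?thesis using L\<epsilon>[of n] \<delta>(1)[of n] by linarith
  qed
  have \<phi>test: "\<phi> n \<in> test_fun D" for n
  proof (rule test_funI[OF \<phi>smooth, of "{x. \<delta> n / 2 \<le> v x}"])
    have "{x. \<delta> n / 2 \<le> v x} \<subseteq> D" using zero \<delta>(1)[of n] by force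
    moreover have "closed {x. \<delta> n / 2 \<le> v x}" using vc by (intro closed_Collect_le continuous_on_const)
    ultimately show "{x. \<delta> n / 2 \<le> v x} \<subseteq> D" "compact {x. \<delta> n / 2 \<le> v x}"
      using bounded_D bounded_subset compact_eq_bounded_closed by blast+
    fix x assume "x \<notin> {x. \<delta> n / 2 \<le> v x}"
    then have vx: "v x < \<delta> n / 2" by simp
    have "w n (z + x) * \<rho> n z = 0" for z
    proof (cases "norm z > \<epsilon> n")
      case False
      have "v (z + x) \<le> v x + L * norm z" using lipschitz_onD[OF lip, of "z + x" x] by (simp add: dist_norm)
      also have "\<dots> \<le> v x + \<delta> n / 4" using False mult_left_mono[OF _ L, of "norm z" "\<epsilon> n"] L\<epsilon>[of n] by linarith
      finally have "v (z + x) \<le> \<delta> n" using vx \<delta>(1)[of n] by linarith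
      then show ?thesis by (simp add: w_def)
    qed (simp add: \<rho>(3))
    then have "(\<lambda>z. w n (z + x) * \<rho> n z) = (\<lambda>z. 0)" by (rule ext)
    then show "\<phi> n x = 0" unfolding \<phi>_shift by (simp only: Bochner_Integration.integral_zero)
  qed
  (* Eventually truncation acts near x by subtracting a constant, or w n vanishes there. *)
  have exact: "\<forall>\<^sub>F n in sequentially. cgrad (\<phi> n) x = g x"
    if r: "r > 0" "\<forall>y\<in>ball x r. v y = v x + g x \<bullet> (y - x)" for x r
  proof -
    obtain r' \<alpha> where r': "r' > 0" and w': "\<forall>\<^sub>F n in sequentially. \<forall>y\<in>ball x r'. w n y = \<alpha> n + g x \<bullet> (y - x)"
    proof (cases "v x = 0")
      case True
      have "g x = 0"
      proof (rule ccontr)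
        assume g0: "g x \<noteq> 0"
        define y where "y = x - (r / (2 * norm (g x))) *\<^sub>R g x"
        have "dist x y = r / 2" using r g0 by (simp add: y_def dist_norm)
        then have "v y = v x + g x \<bullet> (y - x)" using r(1) by (intro r(2)[rule_format]) simp
        also have "\<dots> = - (r / (2 * norm (g x))) * (g x \<bullet> g x)" using True by (simp add: y_def)
        also have "\<dots> < 0" using r g0 by (simp add: divide_neg_pos mult_neg_pos)
        finally show False using nonneg[of y] by simp
      qed
      then have "w n y = 0 + g x \<bullet> (y - x)" if "y \<in> ball x r" for n y
        using r(2)[rule_format, OF that] True \<delta>(1)[of n] by (simp add: w_def)
      then show ?thesis using that[of r "\<lambda>_. 0"] r(1) by auto
    next
      case False
      then have vx: "v x > 0" using nonneg[of x] by simp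
      define r' where "r' = min r (v x / (2 * (norm (g x) + 1)))"
      have r': "r' > 0" using r(1) vx by (simp add: r'_def add_nonneg_pos)
      have ev: "\<forall>\<^sub>F n in sequentially. \<delta> n < v x / 2" using order_tendstoD(2)[OF \<delta>(2), of "v x / 2"] vx by simp
      have "\<forall>\<^sub>F n in sequentially. \<forall>y\<in>ball x r'. w n y = (v x - \<delta> n) + g x \<bullet> (y - x)"
        using ev
      proof eventually_elim
        case (elim n)
        show ?case
        proof
          fix y assume y: "y \<in> ball x r'"
          have "\<bar>g x \<bullet> (y - x)\<bar> \<le> norm (g x) * norm (y - x)" by (rule Cauchy_Schwarz_ineq2)
          also have "\<dots> \<le> (norm (g x) + 1) * (v x / (2 * (norm (g x) + 1)))"
            using y vx by (intro mult_mono) (auto simp: r'_def dist_norm norm_minus_commute)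
          also have "\<dots> = v x / 2" using norm_ge_zero[of "g x"] by (simp add: field_simps add_nonneg_eq_0_iff)
          finally have "v x + g x \<bullet> (y - x) - \<delta> n \<ge> 0" using elim by linarith
          moreover have "v y = v x + g x \<bullet> (y - x)" using y by (intro r(2)[rule_format]) (simp add: r'_def)
          ultimately show "w n y = (v x - \<delta> n) + g x \<bullet> (y - x)" by (simp add: w_def)
        qed
      qed
      then show ?thesis using that[of r' "\<lambda>n. v x - \<delta> n"] r' by blast
    qed
    have "\<forall>\<^sub>F n in sequentially. \<epsilon> n < r' / 2" using order_tendstoD(2)[OF \<epsilon>0, of "r' / 2"] r' by simp
    with w' show ?thesis
    proof eventually_elim
      case (elim n)
      define c where "c = (\<integral>z. (\<alpha> n + g x \<bullet> z) * \<rho> n z \<partial>lborel)"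
      have gint: "integrable lborel (\<lambda>z. (\<alpha> n + g x \<bullet> z) * \<rho> n z)"
        by (rule integrable_continuous_bounded_support[where S = "cball 0 (\<epsilon> n)"])
           (use \<rho>(3) in \<open>auto intro!: continuous_intros test_fun_continuous[OF \<rho>(1)]\<close>)
      have eq: "\<phi> n y = c + g x \<bullet> (y - x)" if y: "y \<in> ball x (r' / 2)" for y
      proof -
        have "w n (z + y) * \<rho> n z = (\<alpha> n + g x \<bullet> z) * \<rho> n z + (g x \<bullet> (y - x)) * \<rho> n z" for z
        proof (cases "norm z > \<epsilon> n")
          case False
          have "dist x (z + y) \<le> dist x y + norm z" using dist_triangle[of x "z + y" y] by (simp add: dist_norm)
          also have "\<dots> < r'" using False elim(2) y by auto
          finally have "w n (z + y) = \<alpha> n + g x \<bullet> (z + y - x)" using elim(1) by auto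
          then have "w n (z + y) = \<alpha> n + g x \<bullet> z + g x \<bullet> (y - x)"
            by (simp add: inner_diff_right inner_add_right)
          then show ?thesis by (simp only: distrib_right)
        qed (simp add: \<rho>(3))
        then have "\<phi> n y = (\<integral>z. (\<alpha> n + g x \<bullet> z) * \<rho> n z + (g x \<bullet> (y - x)) * \<rho> n z \<partial>lborel)"
          by (simp add: \<phi>_shift)
        also have "\<dots> = c + (g x \<bullet> (y - x))" using gint \<rho>(4,5) by (simp add: c_def)
        finally show ?thesis .
      qed
      have "((\<lambda>y. c + g x \<bullet> (y - x)) has_derivative (\<lambda>h. g x \<bullet> h)) (at x)"
        by (auto intro!: derivative_eq_intros)
      then have "(\<phi> n has_derivative (\<lambda>h. g x \<bullet> h)) (at x)"
        by (rule has_derivative_transform_within_open[of _ _ _ _ "ball x (r' / 2)"]) (use r' eq in auto)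
      then show ?case by (simp add: cgrad_def vec_eq_iff partial_eqI inner_axis)
    qed
  qed
  define e where "e n = v - \<phi> n" for n
  have eH1: "e n \<in> H1 D" for n
    unfolding e_def by (rule subspace_diff[OF subspace_H1 vH1 test_fun_H1(1)[OF \<phi>test]])
  have eg: "AE x in lebesgue_on D. grad D (e n) x = g x - cgrad (\<phi> n) x" for n
    using H1_lincomb(2)[OF vH1 test_fun_H1(1)[OF \<phi>test[of n]], of 1 "-1"] gv test_fun_H1(2)[OF \<phi>test[of n]]
    by eventually_elim (simp add: e_def fun_diff_def)
  have lim1: "(\<lambda>n. \<integral>x. e n x * e n x \<partial>lebesgue_on D) \<longlonglongrightarrow> (\<integral>x. 0 \<partial>lebesgue_on D)"
  proof (rule integral_dominated_convergence[where w = "\<lambda>_. 4"])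
    have small: "\<bar>e n x\<bar> \<le> 2 * \<delta> n" for n x using \<phi>close[of n x] by (simp add: e_def abs_minus_commute)
    have e0: "(\<lambda>n. e n x) \<longlonglongrightarrow> 0" for x
      by (rule tendsto_rabs_zero_cancel, rule tendsto_sandwich[OF _ _ tendsto_const, of _ _ _ "\<lambda>n. 2 * \<delta> n"])
         (use small tendsto_mult[OF tendsto_const \<delta>(2), of 2] in auto)
    show "AE x in lebesgue_on D. (\<lambda>n. e n x * e n x) \<longlonglongrightarrow> 0"
      using tendsto_mult[OF e0 e0] by simp
    have "\<delta> n \<le> 1" for n by (simp add: \<delta>_def field_simps)
    then have "\<bar>e n x\<bar> \<le> 2" for n x using order_trans[OF small[of n x], of 2] by simp
    then have "\<bar>e n x * e n x\<bar> \<le> 2 * 2" for n x unfolding abs_mult by (intro mult_mono) auto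
    then show "AE x in lebesgue_on D. norm (e n x * e n x) \<le> 4" for n by simp
    show "(\<lambda>x. e n x * e n x) \<in> borel_measurable (lebesgue_on D)" for n
      using L2_times_integrable[OF H1_L2[OF eH1] H1_L2[OF eH1], of n n] by (rule borel_measurable_integrable)
  qed auto
  have lim2: "(\<lambda>n. \<integral>x. grad D (e n) x \<bullet> grad D (e n) x \<partial>lebesgue_on D) \<longlonglongrightarrow> (\<integral>x. 0 \<partial>lebesgue_on D)"
  proof (rule integral_dominated_convergence[where w = "\<lambda>_. (2 * L)\<^sup>2"])
    have "AE x in lebesgue_on D. \<forall>n. grad D (e n) x = g x - cgrad (\<phi> n) x"
      using eg by (simp add: AE_all_countable)
    moreover have "AE x in lebesgue_on D. \<exists>r>0. \<forall>y\<in>ball x r. v y = v x + g x \<bullet> (y - x)"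
      using loc by (rule AE_D_I)
    ultimately show "AE x in lebesgue_on D. (\<lambda>n. grad D (e n) x \<bullet> grad D (e n) x) \<longlonglongrightarrow> 0"
    proof eventually_elim
      case (elim x)
      then obtain r where "r > 0" "\<forall>y\<in>ball x r. v y = v x + g x \<bullet> (y - x)" by blast
      from exact[OF this] have "\<forall>\<^sub>F n in sequentially. grad D (e n) x \<bullet> grad D (e n) x = 0"
        by eventually_elim (simp add: elim)
      then show ?case by (rule tendsto_eventually)
    qed
    show "AE x in lebesgue_on D. norm (grad D (e n) x \<bullet> grad D (e n) x) \<le> (2 * L)\<^sup>2" for n
      using eg[of n] AE_D_I[OF gL]
    proof eventually_elim
      case (elim x)
      have "norm (cgrad (\<phi> n) x) \<le> L"
        by (rule gradient_norm_le_lipschitz[OF test_fun_has_derivative[OF \<phi>test] \<phi>lip])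
      then have "norm (grad D (e n) x) \<le> 2 * L"
        using elim norm_triangle_ineq4[of "g x" "cgrad (\<phi> n) x"] by simp
      then have "(norm (grad D (e n) x))\<^sup>2 \<le> (2 * L)\<^sup>2" by (rule power_mono) simp
      then show ?case by (simp add: dot_square_norm)
    qed
    show "(\<lambda>x. grad D (e n) x \<bullet> grad D (e n) x) \<in> borel_measurable (lebesgue_on D)" for n
      by (intro borel_measurable_inner grad_measurable eH1)
  qed auto
  have "(\<lambda>n. sqrt (h1_form (e n) (e n))) \<longlonglongrightarrow> sqrt 0"
    unfolding h1_form_def using tendsto_add[OF lim1 lim2] by (intro tendsto_real_sqrt) simp
  then have "(\<lambda>n. H1_norm D (\<lambda>x. v x - \<phi> n x)) \<longlonglongrightarrow> 0"
    by (simp add: H1_norm_eq e_def fun_diff_def)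
  then show "v \<in> H10 D" by (rule H10I[OF vH1 \<phi>test])
qed

section \<open>Boundary values\<close>

lemma L2_semi_inner:
  "semi_inner (L2 D :: (point \<Rightarrow> 'b::euclidean_space) set) (\<lambda>v w. \<integral>x. v x \<bullet> w x \<partial>lebesgue_on D)"
proof
  show "subspace (L2 D :: (point \<Rightarrow> 'b) set)" by (rule subspace_L2)
  show "(\<integral>x. v x \<bullet> w x \<partial>lebesgue_on D) = (\<integral>x. w x \<bullet> v x \<partial>lebesgue_on D)" for v w :: "point \<Rightarrow> 'b"
    by (simp add: inner_commute)
  show "(\<integral>x. (u + v) x \<bullet> w x \<partial>lebesgue_on D) = (\<integral>x. u x \<bullet> w x \<partial>lebesgue_on D) + (\<integral>x. v x \<bullet> w x \<partial>lebesgue_on D)"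
    if "u \<in> L2 D" "v \<in> L2 D" "w \<in> L2 D" for u v w :: "point \<Rightarrow> 'b"
    using L2_product_integrable[OF that(1,3)] L2_product_integrable[OF that(2,3)] by (simp add: inner_add_left)
qed (auto intro!: integral_nonneg_AE)

text \<open>For functions with zero boundary values the test function need not have support in \<open>D\<close>: both sides are
  continuous in the \<open>H1\<close> norm, and the identity holds for test functions in \<open>D\<close> by exchanging the
  roles of the two factors.\<close>

lemma H10_integration_by_parts:
  assumes v: "v \<in> H10 D" and \<psi>: "\<psi> \<in> test_fun E"
  shows "(\<integral>x. v x * partial i \<psi> x \<partial>lebesgue_on D) = - (\<integral>x. grad D v x $ i * \<psi> x \<partial>lebesgue_on D)"
proof -
  interpret S1: semi_inner "L2 D :: (point \<Rightarrow> real) set" "\<lambda>v w. \<integral>x. v x \<bullet> w x \<partial>lebesgue_on D" by (rule L2_semi_inner)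
  interpret S2: semi_inner "L2 D :: (point \<Rightarrow> point) set" "\<lambda>v w. \<integral>x. v x \<bullet> w x \<partial>lebesgue_on D" by (rule L2_semi_inner)
  obtain \<phi> where \<phi>: "\<And>n. \<phi> n \<in> test_fun D" "(\<lambda>n. H1_norm D (\<lambda>x. v x - \<phi> n x)) \<longlonglongrightarrow> 0"
    using v by (auto simp: H10_def)
  note vH = H10_H1[OF v]
  obtain L where L: "L-lipschitz_on UNIV \<psi>" using test_fun_lipschitz[OF \<psi>] by metis
  have p: "partial i \<psi> \<in> L2 D" by (rule test_fun_L2[OF test_fun_partial[OF \<psi>]])
  have \<psi>2: "\<psi> \<in> L2 D" by (rule test_fun_L2[OF \<psi>])
  define \<Psi> where "\<Psi> x = \<psi> x *\<^sub>R axis i (1::real)" for x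
  have \<Psi>: "\<Psi> \<in> L2 D"
  proof -
    obtain C where "\<And>x. \<bar>\<psi> x\<bar> \<le> C" using test_fun_bounded[OF \<psi>] by metis
    then show ?thesis unfolding \<Psi>_def
      by (intro bounded_in_L2[where C = C] borel_imp_lebesgue_on_measurable borel_measurable_scaleR test_fun_measurable[OF \<psi>]) auto
  qed
  define err where "err u = (\<integral>x. u x * partial i \<psi> x \<partial>lebesgue_on D) + (\<integral>x. grad D u x \<bullet> \<Psi> x \<partial>lebesgue_on D)" for u
  have err0: "err (\<phi> n) = 0" for n
  proof -
    have "(\<integral>x. \<psi> x * partial i (\<phi> n) x \<partial>lebesgue_on D) = - (\<integral>x. cgrad \<psi> x $ i * \<phi> n x \<partial>lebesgue_on D)"
      by (rule weak_gradient_lipschitz_on[OF L open_D _ _ cgrad_measurable[OF \<psi>] \<phi>(1)])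
         (use test_fun_has_derivative[OF \<psi>] in auto)
    moreover have "(\<integral>x. grad D (\<phi> n) x \<bullet> \<Psi> x \<partial>lebesgue_on D) = (\<integral>x. \<psi> x * partial i (\<phi> n) x \<partial>lebesgue_on D)"
    proof (rule integral_cong_AE)
      show "AE x in lebesgue_on D. grad D (\<phi> n) x \<bullet> \<Psi> x = \<psi> x * partial i (\<phi> n) x"
        using test_fun_H1(2)[OF \<phi>(1)[of n]] by eventually_elim (simp add: \<Psi>_def inner_axis partial_eq_cgrad)
    qed (use H1_grad[OF test_fun_H1(1)[OF \<phi>(1)[of n]]] \<Psi> test_fun_L2[OF test_fun_partial[OF \<phi>(1)[of n]]] \<psi>2 in
        \<open>auto simp: L2_def intro!: borel_measurable_inner borel_measurable_times\<close>)
    ultimately show ?thesis by (simp add: err_def partial_eq_cgrad mult.commute)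
  qed
  have errd: "err v = err (\<lambda>x. v x - \<phi> n x)" for n
  proof -
    note \<phi>H = test_fun_H1(1)[OF \<phi>(1)[of n]]
    have "(\<integral>x. (v x - \<phi> n x) * partial i \<psi> x \<partial>lebesgue_on D) = (\<integral>x. v x * partial i \<psi> x \<partial>lebesgue_on D) - (\<integral>x. \<phi> n x * partial i \<psi> x \<partial>lebesgue_on D)"
      using L2_times_integrable[OF H1_L2[OF vH] p] L2_times_integrable[OF H1_L2[OF \<phi>H] p] by (simp add: left_diff_distrib)
    moreover have "(\<integral>x. grad D (\<lambda>x. v x - \<phi> n x) x \<bullet> \<Psi> x \<partial>lebesgue_on D) = (\<integral>x. grad D v x \<bullet> \<Psi> x - grad D (\<phi> n) x \<bullet> \<Psi> x \<partial>lebesgue_on D)"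
    proof (rule integral_cong_AE)
      show "AE x in lebesgue_on D. grad D (\<lambda>x. v x - \<phi> n x) x \<bullet> \<Psi> x = grad D v x \<bullet> \<Psi> x - grad D (\<phi> n) x \<bullet> \<Psi> x"
        using H1_lincomb(2)[OF vH \<phi>H, of 1 "-1"] by eventually_elim (simp add: inner_diff_left)
      have "(\<lambda>x. v x - \<phi> n x) \<in> H1 D" using H1_lincomb(1)[OF vH \<phi>H, of 1 "-1"] by simp
      then show "(\<lambda>x. grad D (\<lambda>x. v x - \<phi> n x) x \<bullet> \<Psi> x) \<in> borel_measurable (lebesgue_on D)"
        using \<Psi> by (intro borel_measurable_inner grad_measurable) (auto simp: L2_def)
      show "(\<lambda>x. grad D v x \<bullet> \<Psi> x - grad D (\<phi> n) x \<bullet> \<Psi> x) \<in> borel_measurable (lebesgue_on D)"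
        using \<Psi> vH \<phi>H by (intro borel_measurable_diff borel_measurable_inner grad_measurable) (auto simp: L2_def)
    qed
    ultimately show ?thesis
      using err0[of n] L2_product_integrable[OF conjunct1[OF H1_grad[OF vH]] \<Psi>] L2_product_integrable[OF conjunct1[OF H1_grad[OF \<phi>H]] \<Psi>]
      by (simp add: err_def)
  qed
  define C where "C = sqrt (\<integral>x. partial i \<psi> x * partial i \<psi> x \<partial>lebesgue_on D) + sqrt (\<integral>x. \<Psi> x \<bullet> \<Psi> x \<partial>lebesgue_on D)"
  have bnd: "\<bar>err v\<bar> \<le> H1_norm D (\<lambda>x. v x - \<phi> n x) * C" for n
  proof -
    define u where "u = (\<lambda>x. v x - \<phi> n x)"
    have u: "u \<in> H1 D" using H1_lincomb(1)[OF vH test_fun_H1(1)[OF \<phi>(1)[of n]], of 1 "-1"] by (simp add: u_def)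
    have "\<bar>err u\<bar> \<le> sqrt (\<integral>x. u x * u x \<partial>lebesgue_on D) * sqrt (\<integral>x. partial i \<psi> x * partial i \<psi> x \<partial>lebesgue_on D)
        + sqrt (\<integral>x. grad D u x \<bullet> grad D u x \<partial>lebesgue_on D) * sqrt (\<integral>x. \<Psi> x \<bullet> \<Psi> x \<partial>lebesgue_on D)"
      unfolding err_def using S1.Cauchy_Schwarz[OF H1_L2[OF u] p] S2.Cauchy_Schwarz[OF conjunct1[OF H1_grad[OF u]] \<Psi>] by simp
    also have "\<dots> \<le> H1_norm D u * sqrt (\<integral>x. partial i \<psi> x * partial i \<psi> x \<partial>lebesgue_on D) + H1_norm D u * sqrt (\<integral>x. \<Psi> x \<bullet> \<Psi> x \<partial>lebesgue_on D)"
      unfolding H1_norm_eq h1_form_def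
      by (intro add_mono mult_right_mono) (auto intro!: integral_nonneg_AE)
    finally show ?thesis unfolding errd[of n] u_def C_def by (simp add: algebra_simps)
  qed
  have "(\<lambda>n. H1_norm D (\<lambda>x. v x - \<phi> n x) * C) \<longlonglongrightarrow> 0 * C" by (intro tendsto_intros \<phi>)
  then have "\<bar>err v\<bar> \<le> 0" using LIMSEQ_le_const[of _ 0 "\<bar>err v\<bar>"] bnd by auto
  then show ?thesis by (simp add: err_def \<Psi>_def inner_axis mult.commute)
qed

lemma box_bump_shift: "box_bump n a b (x - c) = box_bump n (a + c) (b + c) x"
  by (simp add: box_bump_def algebra_simps)

text \<open>Averages of \<open>v\<close> over a bump are followed while the bump travels from a ball outside \<open>D\<close> to a ball inside. The average \<open>G\<close>
  starts at zero, ends above \<open>c\<close> times the mass of the bump, and by integration by parts its rate of change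
  is at most \<open>C * norm h\<close> times the mass. No trace theorem is needed.\<close>

lemma H10_not_bounded_below_at_boundary:
  assumes v: "v \<in> H10 D" and C: "AE x in lebesgue_on D. norm (grad D v x) \<le> C"
    and outside: "ball z \<rho> \<inter> D = {}" and int: "ball (z + h) \<rho> \<subseteq> D" and \<rho>: "\<rho> > 0"
    and low: "\<And>x. x \<in> ball (z + h) \<rho> \<Longrightarrow> c \<le> v x"
  shows "c \<le> C * norm h"
proof -
  note vH = H10_H1[OF v]
  obtain a b where ab: "z \<in> box a b" "cbox a b \<subseteq> ball z \<rho>"
    using open_contains_cbox[of "ball z \<rho>"] \<rho> by (metis centre_in_ball open_ball)
  define \<psi> where "\<psi> = box_bump 0 a b"
  have \<psi>0: "\<psi> x = 0" if "x \<notin> ball z \<rho>" for x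
    unfolding \<psi>_def by (rule box_bump_zero) (use ab box_subset_cbox[of a b] that in blast)
  have \<psi>s: "(\<lambda>x. \<psi> (x - s *\<^sub>R h)) \<in> test_fun UNIV" for s
    unfolding \<psi>_def box_bump_shift using box_bump_test_fun[of _ _ UNIV] by simp
  have \<psi>t: "\<psi> \<in> test_fun UNIV" using \<psi>s[of 0] by simp
  have \<psi>nn: "0 \<le> \<psi> x" for x by (simp add: \<psi>_def box_bump_bounds)
  obtain L where L: "L-lipschitz_on UNIV \<psi>" using test_fun_lipschitz[OF \<psi>t] by metis
  have \<psi>int: "integrable lborel (\<lambda>x. \<psi> (x - s *\<^sub>R h))" for s
    unfolding \<psi>_def box_bump_shift
    by (rule integrable_continuous_bounded_support[OF smooth_continuous_on[OF smooth_box_bump] bounded_box]) (rule box_bump_zero)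
  define I where "I = (\<integral>x. \<psi> x \<partial>lborel)"
  have Ipos: "I > 0" unfolding I_def \<psi>_def by (rule box_bump_integral_pos[OF ab(1)])
  have Is: "(\<integral>x. \<psi> (x - s *\<^sub>R h) \<partial>lborel) = I" for s
    using lborel_integral_translation[OF test_fun_measurable[OF \<psi>t], of "- (s *\<^sub>R h)"] by (simp add: I_def)
  have C0: "0 \<le> C"
  proof (rule ccontr)
    assume neg: "\<not> 0 \<le> C"
    have "AE x in lebesgue_on D. False"
      using C
    proof eventually_elim
      case (elim x)
      then show False using neg norm_ge_zero[of "grad D v x"] by linarith
    qed
    then have "AE x in lebesgue. x \<notin> D" by (simp add: AE_D)
    then have "negligible D" by (simp add: AE_iff_null negligible_iff_null_sets)
    then show False using open_D nonempty_D open_not_negligible by blast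
  qed
  define G where "G s = (\<integral>x. v x * \<psi> (x - s *\<^sub>R h) \<partial>lebesgue_on D)" for s
  define G' where "G' s = (\<integral>x. (grad D v x \<bullet> h) * \<psi> (x - s *\<^sub>R h) \<partial>lebesgue_on D)" for s
  have ld: "((\<lambda>t. \<psi> (x - t *\<^sub>R h)) has_derivative (\<lambda>k. cgrad \<psi> (x - s *\<^sub>R h) \<bullet> (- (k *\<^sub>R h)))) (at s)" for x s
  proof -
    have "((\<lambda>t. x - t *\<^sub>R h) has_derivative (\<lambda>k. - (k *\<^sub>R h))) (at s)" by (auto intro!: derivative_eq_intros)
    from has_derivative_compose[OF this test_fun_has_derivative[OF \<psi>t]] show ?thesis .
  qed
  have cg: "cgrad (\<lambda>x. \<psi> (x - s *\<^sub>R h)) x = cgrad \<psi> (x - s *\<^sub>R h)" for s x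
  proof -
    have "((\<lambda>x. x - s *\<^sub>R h) has_derivative (\<lambda>k. k)) (at x)" by (auto intro!: derivative_eq_intros)
    from has_derivative_compose[OF this test_fun_has_derivative[OF \<psi>t]]
    show ?thesis by (simp add: cgrad_def vec_eq_iff partial_eqI inner_axis)
  qed
  have der: "(G has_real_derivative G' s) (at s)" for s
  proof -
    have "(G has_derivative (\<lambda>k. \<integral>x. v x * (cgrad \<psi> (x - s *\<^sub>R h) \<bullet> (- (k *\<^sub>R h))) \<partial>lebesgue_on D)) (at s)"
      unfolding G_def[abs_def]
    proof (rule has_derivative_integral_param(1)[where M = "lebesgue_on D" and f = "\<lambda>s x. v x * \<psi> (x - s *\<^sub>R h)"
          and f' = "\<lambda>x k. v x * (cgrad \<psi> (x - s *\<^sub>R h) \<bullet> (- (k *\<^sub>R h)))" and K = "\<lambda>x. \<bar>v x\<bar> * (L * norm h)"])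
      show "integrable (lebesgue_on D) (\<lambda>x. v x * \<psi> (x - s *\<^sub>R h))" for s
        by (rule L2_times_integrable[OF H1_L2[OF vH] test_fun_L2[OF \<psi>s]])
      show "AE x in lebesgue_on D. ((\<lambda>t. v x * \<psi> (x - t *\<^sub>R h)) has_derivative (\<lambda>k. v x * (cgrad \<psi> (x - s *\<^sub>R h) \<bullet> (- (k *\<^sub>R h))))) (at s)"
        by (intro always_eventually allI has_derivative_mult_right ld)
      show "(\<lambda>x. v x * (cgrad \<psi> (x - s *\<^sub>R h) \<bullet> (- (k *\<^sub>R h)))) \<in> borel_measurable (lebesgue_on D)" for k
      proof (rule borel_measurable_times)
        show "v \<in> borel_measurable (lebesgue_on D)" using H1_L2[OF vH] by (simp add: L2_def)
        have "(\<lambda>x. cgrad \<psi> (x - s *\<^sub>R h)) \<in> borel_measurable borel"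
          using cgrad_measurable[OF \<psi>s[of s]] by (simp only: cg[abs_def])
        then show "(\<lambda>x. cgrad \<psi> (x - s *\<^sub>R h) \<bullet> (- (k *\<^sub>R h))) \<in> borel_measurable (lebesgue_on D)"
          by (intro borel_imp_lebesgue_on_measurable borel_measurable_inner) auto
      qed
      show "\<bar>v x * \<psi> (x - t *\<^sub>R h) - v x * \<psi> (x - s *\<^sub>R h)\<bar> \<le> \<bar>v x\<bar> * (L * norm h) * norm (t - s)" for t x
      proof -
        have "\<bar>\<psi> (x - t *\<^sub>R h) - \<psi> (x - s *\<^sub>R h)\<bar> \<le> L * norm ((s - t) *\<^sub>R h)"
          using lipschitz_onD[OF L, of "x - t *\<^sub>R h" "x - s *\<^sub>R h"] by (simp add: dist_norm scaleR_left_diff_distrib)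
        then have "\<bar>\<psi> (x - t *\<^sub>R h) - \<psi> (x - s *\<^sub>R h)\<bar> \<le> L * norm h * norm (t - s)"
          by (simp add: abs_minus_commute mult_ac)
        then have "\<bar>v x\<bar> * \<bar>\<psi> (x - t *\<^sub>R h) - \<psi> (x - s *\<^sub>R h)\<bar> \<le> \<bar>v x\<bar> * (L * norm h * norm (t - s))"
          by (rule mult_left_mono) simp
        then show ?thesis by (simp add: abs_mult[symmetric] right_diff_distrib mult.assoc)
      qed
      show "integrable (lebesgue_on D) (\<lambda>x. \<bar>v x\<bar> * (L * norm h))"
        by (intro integrable_mult_left integrable_abs L2_integrable H1_L2 vH)
    qed
    moreover have "(\<integral>x. v x * (cgrad \<psi> (x - s *\<^sub>R h) \<bullet> (- (k *\<^sub>R h))) \<partial>lebesgue_on D) = G' s * k" for k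
    proof -
      have i1: "integrable (lebesgue_on D) (\<lambda>x. v x * partial i (\<lambda>x. \<psi> (x - s *\<^sub>R h)) x)" for i
        by (rule L2_times_integrable[OF H1_L2[OF vH] test_fun_L2[OF test_fun_partial[OF \<psi>s]]])
      have i2: "integrable (lebesgue_on D) (\<lambda>x. grad D v x $ i * \<psi> (x - s *\<^sub>R h))" for i
        by (rule L2_times_integrable[OF L2_nth[OF conjunct1[OF H1_grad[OF vH]]] test_fun_L2[OF \<psi>s]])
      have "(\<integral>x. v x * (cgrad \<psi> (x - s *\<^sub>R h) \<bullet> (- (k *\<^sub>R h))) \<partial>lebesgue_on D)
          = (\<integral>x. (\<Sum>i\<in>UNIV. (- k * h $ i) * (v x * partial i (\<lambda>x. \<psi> (x - s *\<^sub>R h)) x)) \<partial>lebesgue_on D)"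
        by (rule Bochner_Integration.integral_cong)
           (auto simp: partial_eq_cgrad cg inner_vec_def sum_distrib_left sum_negf[symmetric] mult_ac intro!: sum.cong)
      also have "\<dots> = (\<Sum>i\<in>UNIV. (- k * h $ i) * (\<integral>x. v x * partial i (\<lambda>x. \<psi> (x - s *\<^sub>R h)) x \<partial>lebesgue_on D))"
        using i1 by (subst Bochner_Integration.integral_sum) auto
      also have "\<dots> = (\<Sum>i\<in>UNIV. (k * h $ i) * (\<integral>x. grad D v x $ i * \<psi> (x - s *\<^sub>R h) \<partial>lebesgue_on D))"
        by (simp add: H10_integration_by_parts[OF v \<psi>s])
      also have "\<dots> = (\<integral>x. (\<Sum>i\<in>UNIV. (k * h $ i) * (grad D v x $ i * \<psi> (x - s *\<^sub>R h))) \<partial>lebesgue_on D)"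
        using i2 by (subst Bochner_Integration.integral_sum) auto
      also have "\<dots> = (\<integral>x. k * ((grad D v x \<bullet> h) * \<psi> (x - s *\<^sub>R h)) \<partial>lebesgue_on D)"
        by (rule Bochner_Integration.integral_cong) (auto simp: inner_vec_def sum_distrib_left sum_distrib_right mult_ac intro!: sum.cong)
      finally show ?thesis by (simp add: G'_def mult.commute)
    qed
    ultimately show ?thesis unfolding has_field_derivative_def
      by (rule has_derivative_eq_rhs[OF _ ext])
  qed
  have bnd: "G' s \<le> C * norm h * I" for s
  proof -
    have i2: "integrable (lebesgue_on D) (\<lambda>x. (grad D v x \<bullet> h) * \<psi> (x - s *\<^sub>R h))"
    proof -
      have "(\<lambda>x. (grad D v x \<bullet> h) * \<psi> (x - s *\<^sub>R h)) = (\<lambda>x. \<Sum>i\<in>UNIV. h $ i * (grad D v x $ i * \<psi> (x - s *\<^sub>R h)))"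
        by (auto simp: fun_eq_iff inner_vec_def sum_distrib_left sum_distrib_right mult_ac intro!: sum.cong)
      then show ?thesis
        using L2_times_integrable[OF L2_nth[OF conjunct1[OF H1_grad[OF vH]]] test_fun_L2[OF \<psi>s]]
        by (simp add: Bochner_Integration.integrable_sum)
    qed
    have "G' s \<le> (\<integral>x. C * norm h * \<psi> (x - s *\<^sub>R h) \<partial>lebesgue_on D)"
      unfolding G'_def
    proof (rule integral_mono_AE[OF i2])
      show "integrable (lebesgue_on D) (\<lambda>x. C * norm h * \<psi> (x - s *\<^sub>R h))"
        by (intro integrable_mult_right L2_integrable test_fun_L2[OF \<psi>s])
      show "AE x in lebesgue_on D. (grad D v x \<bullet> h) * \<psi> (x - s *\<^sub>R h) \<le> C * norm h * \<psi> (x - s *\<^sub>R h)"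
        using C
      proof eventually_elim
        case (elim x)
        have "grad D v x \<bullet> h \<le> norm (grad D v x) * norm h" by (rule norm_cauchy_schwarz)
        also have "\<dots> \<le> C * norm h" using elim by (intro mult_right_mono) auto
        finally show ?case using \<psi>nn by (rule mult_right_mono)
      qed
    qed
    also have "\<dots> = C * norm h * (\<integral>x. \<psi> (x - s *\<^sub>R h) \<partial>lebesgue_on D)" by simp
    also have "(\<integral>x. \<psi> (x - s *\<^sub>R h) \<partial>lebesgue_on D) \<le> (\<integral>x. \<psi> (x - s *\<^sub>R h) \<partial>lborel)"
    proof -
      have "(\<integral>x. \<psi> (x - s *\<^sub>R h) \<partial>lebesgue_on D) = (\<integral>x. indicator D x *\<^sub>R \<psi> (x - s *\<^sub>R h) \<partial>lebesgue)"
        by (simp add: integral_restrict_space)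
      also have "\<dots> = (\<integral>x. indicator D x *\<^sub>R \<psi> (x - s *\<^sub>R h) \<partial>lborel)"
        using test_fun_measurable[OF \<psi>s] open_D by (intro integral_completion) auto
      also have "\<dots> \<le> (\<integral>x. \<psi> (x - s *\<^sub>R h) \<partial>lborel)"
        using \<psi>int open_D \<psi>nn by (intro integral_mono integrable_mult_indicator) (auto simp: indicator_def)
      finally show ?thesis .
    qed
    finally show ?thesis using C0 Is by (simp add: mult_left_mono)
  qed
  (* The mean value theorem in the position of the moving bump. *)
  obtain s where s: "0 < s" "s < 1" "G 1 - G 0 = (1 - 0) * G' s"
    using MVT2[of 0 1 G G'] der by auto
  have G0: "G 0 = 0"
  proof -
    have "G 0 = (\<integral>x. 0 \<partial>lebesgue_on D)" unfolding G_def
    proof (rule Bochner_Integration.integral_cong)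
      show "v x * \<psi> (x - 0 *\<^sub>R h) = 0" if "x \<in> space (lebesgue_on D)" for x
        using that outside \<psi>0[of x] by (cases "x \<in> ball z \<rho>") auto
    qed simp
    then show ?thesis by simp
  qed
  have G1: "c * I \<le> G 1"
  proof -
    have z: "\<psi> (x - 1 *\<^sub>R h) = 0" if "x \<notin> ball (z + h) \<rho>" for x
      by (rule \<psi>0) (use that in \<open>simp add: dist_norm algebra_simps\<close>)
    have "c * I = (\<integral>x. c * \<psi> (x - 1 *\<^sub>R h) \<partial>lborel)" using Is[of 1] by simp
    also have "\<dots> = (\<integral>x. c * \<psi> (x - 1 *\<^sub>R h) \<partial>lebesgue_on D)"
    proof (rule integral_on_D[symmetric])
      fix x assume "x \<notin> D"
      then have "x \<notin> ball (z + h) \<rho>" using int by blast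
      then show "c * \<psi> (x - 1 *\<^sub>R h) = 0" using z by simp
    qed (intro borel_measurable_times borel_measurable_const test_fun_measurable[OF \<psi>s])
    also have "\<dots> \<le> G 1" unfolding G_def
    proof (rule integral_mono)
      show "integrable (lebesgue_on D) (\<lambda>x. c * \<psi> (x - 1 *\<^sub>R h))"
        by (intro integrable_mult_right L2_integrable test_fun_L2[OF \<psi>s])
      show "integrable (lebesgue_on D) (\<lambda>x. v x * \<psi> (x - 1 *\<^sub>R h))"
        by (rule L2_times_integrable[OF H1_L2[OF vH] test_fun_L2[OF \<psi>s]])
      show "c * \<psi> (x - 1 *\<^sub>R h) \<le> v x * \<psi> (x - 1 *\<^sub>R h)" for x
        using z[of x] low[of x] \<psi>nn by (cases "x \<in> ball (z + h) \<rho>") (auto intro: mult_right_mono)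
    qed
    finally show ?thesis .
  qed
  have "c * I \<le> (C * norm h) * I" using G0 G1 s(3) bnd[of s] by simp
  then show ?thesis using Ipos by simp
qed

end

lemma lipschitz_domain_planar: "lipschitz_domain D \<Longrightarrow> planar_domain D"
  by (simp add: lipschitz_domain_def planar_domain_def)

text \<open>The balls are centred on the vertical through the boundary point, one below and one above the graph; the Lipschitz
  constant determines how large they can be.\<close>

lemma lipschitz_domain_two_sided:
  assumes D: "lipschitz_domain D" and x0: "x0 \<in> frontier D" and r: "r > 0"
  obtains z h \<rho> where "\<rho> > 0" "norm h < r" "ball z \<rho> \<subseteq> ball x0 r" "ball z \<rho> \<inter> D = {}"
    "ball (z + h) \<rho> \<subseteq> D \<inter> ball x0 r"
proof -
  obtain r0 e1 e2 \<gamma> L where r0: "r0 > 0" and e: "norm e1 = 1" "norm e2 = 1" "e1 \<bullet> e2 = 0"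
    and \<gamma>: "L-lipschitz_on UNIV (\<gamma> :: real \<Rightarrow> real)"
    and Deq: "D \<inter> ball x0 r0 = {z \<in> ball x0 r0. \<gamma> (z \<bullet> e1) < z \<bullet> e2}"
    using D[unfolded lipschitz_domain_def, THEN conjunct2, THEN conjunct2, THEN conjunct2, THEN conjunct2, rule_format, OF x0]
    by blast
  have L: "L \<ge> 0" using \<gamma> by (rule lipschitz_on_nonneg)
  define F where "F z = z \<bullet> e2 - \<gamma> (z \<bullet> e1)" for z :: point
  have Flip: "\<bar>F z - F w\<bar> \<le> (1 + L) * norm (z - w)" for z w
  proof -
    have 1: "\<bar>(z - w) \<bullet> e2\<bar> \<le> norm (z - w)" using Cauchy_Schwarz_ineq2[of "z - w" e2] e by simp
    have 2: "\<bar>(z - w) \<bullet> e1\<bar> \<le> norm (z - w)" using Cauchy_Schwarz_ineq2[of "z - w" e1] e by simp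
    have "\<bar>\<gamma> (z \<bullet> e1) - \<gamma> (w \<bullet> e1)\<bar> \<le> L * \<bar>(z - w) \<bullet> e1\<bar>"
      using lipschitz_onD[OF \<gamma>, of "z \<bullet> e1" "w \<bullet> e1"] by (simp add: dist_real_def inner_diff_left)
    also have "\<dots> \<le> L * norm (z - w)" using 2 L by (rule mult_left_mono)
    finally have "\<bar>\<gamma> (z \<bullet> e1) - \<gamma> (w \<bullet> e1)\<bar> \<le> L * norm (z - w)" .
    then show ?thesis using 1 unfolding F_def by (simp add: inner_diff_left algebra_simps)
  qed
  have opn: "open D" using D by (simp add: lipschitz_domain_def)
  have "x0 \<notin> D" using x0 opn by (simp add: frontier_def interior_open)
  then have "x0 \<notin> {z \<in> ball x0 r0. \<gamma> (z \<bullet> e1) < z \<bullet> e2}" unfolding Deq[symmetric] by simp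
  then have F1: "F x0 \<le> 0" using r0 unfolding F_def by simp
  have F2: "F x0 \<ge> 0"
  proof (rule ccontr)
    assume neg: "\<not> F x0 \<ge> 0"
    define s where "s = min r0 (- F x0 / (1 + L))"
    have "- F x0 / (1 + L) > 0" using neg L by (intro divide_pos_pos) auto
    then have s: "s > 0" using r0 by (simp add: s_def)
    have "x0 \<in> closure D" using x0 by (simp add: frontier_def)
    then obtain y where y: "y \<in> D" "dist y x0 < s" using s closure_approachable by blast
    then have "y \<in> D \<inter> ball x0 r0" by (auto simp: s_def dist_commute)
    then have "F y > 0" unfolding Deq F_def by simp
    moreover have "(1 + L) * norm (y - x0) < - F x0"
    proof -
      have "norm (y - x0) < - F x0 / (1 + L)" using y(2) by (simp add: s_def dist_norm)
      moreover have "1 + L > 0" using L by simp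
      ultimately have "norm (y - x0) * (1 + L) < - F x0" by (simp only: pos_less_divide_eq)
      then show ?thesis by (simp only: mult.commute)
    qed
    ultimately show False using Flip[of y x0] by linarith
  qed
  have F0: "F x0 = 0" using F1 F2 by simp
  define t where "t = min r r0 / 4"
  have t: "t > 0" "4 * t \<le> r" "4 * t \<le> r0" using r r0 by (auto simp: t_def)
  define \<rho> where "\<rho> = t / (2 * (1 + L))"
  have \<rho>: "\<rho> > 0" using t L by (simp add: \<rho>_def)
  have \<rho>t: "(1 + L) * \<rho> = t / 2" using L by (simp add: \<rho>_def divide_simps)
  have "\<rho> * 1 \<le> \<rho> * (1 + L)" using L \<rho> by (intro mult_left_mono) auto
  then have \<rho>le: "\<rho> \<le> t / 2" using \<rho>t by (simp add: mult.commute)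
  have e22: "e2 \<bullet> e2 = 1" "e2 \<bullet> e1 = 0" using e by (simp_all add: dot_square_norm inner_commute)
  have Fz: "F (x0 + s *\<^sub>R e2) = s" for s
    using F0 unfolding F_def by (simp add: inner_add_left e22)
  have near: "\<bar>F y - s\<bar> < t" "dist x0 y < 2 * t" if "\<bar>s\<bar> = t" "y \<in> ball (x0 + s *\<^sub>R e2) \<rho>" for s y
  proof -
    have d: "norm (y - (x0 + s *\<^sub>R e2)) < \<rho>" using that by (simp add: dist_norm norm_minus_commute)
    have "(1 + L) * norm (y - (x0 + s *\<^sub>R e2)) \<le> (1 + L) * \<rho>" using d L by (intro mult_left_mono) auto
    then show "\<bar>F y - s\<bar> < t" using Flip[of y "x0 + s *\<^sub>R e2"] Fz[of s] \<rho>t t by simp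
    have "dist x0 y \<le> dist x0 (x0 + s *\<^sub>R e2) + dist (x0 + s *\<^sub>R e2) y" by (rule dist_triangle)
    also have "dist x0 (x0 + s *\<^sub>R e2) = t" using that(1) e by (simp add: dist_norm)
    finally show "dist x0 y < 2 * t" using that(2) \<rho>le t by simp
  qed
  show ?thesis
  proof (rule that[of \<rho> "(2 * t) *\<^sub>R e2" "x0 + (- t) *\<^sub>R e2"])
    show "norm ((2 * t) *\<^sub>R e2) < r" using t e by simp
    show "ball (x0 + (- t) *\<^sub>R e2) \<rho> \<subseteq> ball x0 r" using near(2)[of "- t"] t by fastforce
    show "ball (x0 + (- t) *\<^sub>R e2) \<rho> \<inter> D = {}"
    proof (rule ccontr)
      assume "ball (x0 + (- t) *\<^sub>R e2) \<rho> \<inter> D \<noteq> {}"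
      then obtain y where y: "y \<in> ball (x0 + (- t) *\<^sub>R e2) \<rho>" "y \<in> D" by blast
      have "y \<in> D \<inter> ball x0 r0" using near(2)[of "- t" y] y t by simp
      then have "F y > 0" unfolding Deq F_def by simp
      then show False using near(1)[of "- t" y] y t by simp
    qed
    have eq: "x0 + (- t) *\<^sub>R e2 + (2 * t) *\<^sub>R e2 = x0 + t *\<^sub>R e2"
      by (simp add: vec_eq_iff)
    show "ball (x0 + (- t) *\<^sub>R e2 + (2 * t) *\<^sub>R e2) \<rho> \<subseteq> D \<inter> ball x0 r"
      unfolding eq
    proof
      fix y assume y: "y \<in> ball (x0 + t *\<^sub>R e2) \<rho>"
      have "F y > 0" using near(1)[of t y] y t by simp
      then have "y \<in> {z \<in> ball x0 r0. \<gamma> (z \<bullet> e1) < z \<bullet> e2}" using near(2)[of t y] y t by (simp add: F_def)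
      then have "y \<in> D \<inter> ball x0 r0" unfolding Deq .
      moreover have "dist x0 y < r" using near(2)[of t y] y t by simp
      ultimately show "y \<in> D \<inter> ball x0 r" by simp
    qed
  qed (rule \<rho>)
qed

text \<open>Rules out slits: near each boundary point there are balls outside \<open>D\<close>.\<close>

lemma lipschitz_domain_interior_closure:
  assumes D: "lipschitz_domain D"
  shows "interior (closure D) = D"
proof
  have opn: "open D" using D by (simp add: lipschitz_domain_def)
  show "D \<subseteq> interior (closure D)" by (rule interior_maximal[OF closure_subset opn])
  show "interior (closure D) \<subseteq> D"
  proof (rule ccontr)
    assume "\<not> interior (closure D) \<subseteq> D"
    then obtain x where x: "x \<in> interior (closure D)" "x \<notin> D" by blast
    then have fr: "x \<in> frontier D" using opn interior_subset by (auto simp: frontier_def interior_open)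
    obtain r where r: "r > 0" "ball x r \<subseteq> closure D" using x(1) by (auto simp: mem_interior)
    obtain z h \<rho> where z: "\<rho> > 0" "ball z \<rho> \<subseteq> ball x r" "ball z \<rho> \<inter> D = {}"
      using lipschitz_domain_two_sided[OF D fr r(1)] by metis
    have "ball z \<rho> \<inter> closure D = {}" using z(3) open_Int_closure_eq_empty[OF open_ball] by blast
    moreover have zb: "z \<in> ball z \<rho>" using z(1) by simp
    ultimately show False using z(2) r(2) by blast
  qed
qed

text \<open>If \<open>v x0\<close> were positive, \<open>v\<close> would exceed half that value on balls inside \<open>D\<close> arbitrarily close to exterior balls, which
  contradicts the bounded gradient. The negative case follows by symmetry.\<close>

lemma H10_boundary_value:
  assumes D: "lipschitz_domain D" and v: "v \<in> H10 D"
    and C: "AE x in lebesgue_on D. norm (grad D v x) \<le> C"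
    and x0: "x0 \<in> frontier D" and cont: "continuous_on (closure D) v"
  shows "v x0 = 0"
proof -
  interpret planar_domain D by (rule lipschitz_domain_planar[OF D])
  have le: "w x0 \<le> 0" if w: "w \<in> H10 D" "AE x in lebesgue_on D. norm (grad D w x) \<le> C" "continuous_on (closure D) w" for w
  proof (rule ccontr)
    assume "\<not> w x0 \<le> 0"
    then have pos: "w x0 > 0" by simp
    have xc: "x0 \<in> closure D" using x0 by (simp add: frontier_def)
    obtain r where r: "r > 0" "\<And>y. y \<in> closure D \<Longrightarrow> dist y x0 < r \<Longrightarrow> dist (w y) (w x0) < w x0 / 2"
      using w(3)[unfolded continuous_on_iff, rule_format, OF xc half_gt_zero[OF pos]] by blast
    define r' where "r' = min r (w x0 / (2 * (\<bar>C\<bar> + 1)))"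
    have r': "r' > 0" using r pos by (simp add: r'_def add_nonneg_pos)
    obtain z h \<rho> where z: "\<rho> > 0" "norm h < r'" "ball z \<rho> \<inter> D = {}" "ball (z + h) \<rho> \<subseteq> D \<inter> ball x0 r'"
      using lipschitz_domain_two_sided[OF D x0 r'] by metis
    have low: "w x0 / 2 \<le> w x" if "x \<in> ball (z + h) \<rho>" for x
    proof -
      have xx: "x \<in> D" "x \<in> ball x0 r'" using z(4) that by auto
      then have "x \<in> closure D" "dist x x0 < r" using closure_subset by (auto simp: r'_def dist_commute)
      from r(2)[OF this] have "\<bar>w x - w x0\<bar> < w x0 / 2" by (simp add: dist_real_def)
      then show ?thesis by linarith
    qed
    have "w x0 / 2 \<le> C * norm h"
      by (rule H10_not_bounded_below_at_boundary[OF w(1,2) z(3) _ z(1) low]) (use z(4) in auto)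
    also have "\<dots> \<le> (\<bar>C\<bar> + 1) * norm h" by (intro mult_right_mono) auto
    also have "\<dots> < (\<bar>C\<bar> + 1) * (w x0 / (2 * (\<bar>C\<bar> + 1)))"
      using z(2) by (intro mult_strict_left_mono) (auto simp: r'_def add_nonneg_pos)
    also have "\<dots> = w x0 / 2" by (simp add: field_simps add_nonneg_eq_0_iff)
    finally show False by simp
  qed
  have m: "- v \<in> H10 D" using subspace_neg[OF subspace_H10 v] .
  have eqm: "- v = (-1) *\<^sub>R v" by (auto simp: fun_eq_iff)
  have "AE x in lebesgue_on D. norm (grad D (- v) x) \<le> C"
    using grad_scale[OF H10_H1[OF v], of "-1"] C unfolding eqm by eventually_elim simp
  moreover have "continuous_on (closure D) (- v)"
    using continuous_on_minus[OF cont] by (simp add: fun_Compl_def)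
  ultimately have "(- v) x0 \<le> 0" by (intro le m)
  then show ?thesis using le[OF v C cont] by simp
qed

section \<open>Triangles and barycentric coordinates\<close>

definition det2 :: "point \<Rightarrow> point \<Rightarrow> real" where
  "det2 a b = a $ 1 * b $ 2 - a $ 2 * b $ 1"

text \<open>Twice the signed area.\<close>

fun tdet :: "triangle \<Rightarrow> real" where
  "tdet (p, q, r) = det2 (q - p) (r - p)"

lemma inner_2: "a \<bullet> b = a $ 1 * b $ 1 + a $ 2 * b $ 2" for a b :: point
  by (simp add: inner_vec_def sum_2)

lemma norm_sq_2: "(norm a)\<^sup>2 = (a $ 1)\<^sup>2 + (a $ 2)\<^sup>2" for a :: point
  unfolding power2_norm_eq_inner inner_2 by (simp add: power2_eq_square)

lemma midpoint_nth: "midpoint a b $ i = (a $ i + b $ i) / 2" for a b :: point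
  by (simp add: midpoint_def)

lemma noncollinear_tdet:
  assumes "\<not> collinear {p, q, r :: point}" shows "tdet (p, q, r) \<noteq> 0"
proof
  assume 0: "tdet (p, q, r) = 0"
  show False
  proof (cases "q = p")
    case True
    then show False using assms collinear_2[of p r] by (simp add: insert_commute)
  next
    case False
    define a b where "a = q - p" and "b = r - p"
    have d: "a $ 1 * b $ 2 = a $ 2 * b $ 1" using 0 by (simp add: det2_def a_def b_def)
    have a0: "a \<noteq> 0" using False by (simp add: a_def)
    define k where "k = (a \<bullet> b) / (a \<bullet> a)"
    have aa: "a \<bullet> a \<noteq> 0" using a0 by simp
    have "b = k *\<^sub>R a"
    proof -
      have "(a \<bullet> a) * b $ 1 = (a \<bullet> b) * a $ 1" "(a \<bullet> a) * b $ 2 = (a \<bullet> b) * a $ 2"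
        using d by (simp_all add: inner_2) algebra+
      then have "b $ 1 = k * a $ 1" "b $ 2 = k * a $ 2"
        using aa by (simp_all add: k_def field_simps)
      then show ?thesis by (simp add: vec_eq_iff forall_2)
    qed
    then have "collinear {p, q, r}"
      unfolding collinear_def
    proof (intro exI[of _ a] ballI)
      have rq: "r = p + k *\<^sub>R a" "q = p + 1 *\<^sub>R a" "p = p + 0 *\<^sub>R a"
        using \<open>b = k *\<^sub>R a\<close> by (simp_all add: a_def b_def algebra_simps)
      fix x y assume "x \<in> {p, q, r}" "y \<in> {p, q, r}"
      then have "\<exists>s. x = p + s *\<^sub>R a" "\<exists>t. y = p + t *\<^sub>R a" using rq by blast+
      then obtain s t where "x = p + s *\<^sub>R a" "y = p + t *\<^sub>R a" by blast
      then have "x - y = (s - t) *\<^sub>R a" by (simp add: scaleR_left_diff_distrib)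
      then show "\<exists>c. x - y = c *\<^sub>R a" by blast
    qed
    then show False using assms by blast
  qed
qed

text \<open>The affine function that is one at \<open>p\<close> and zero at \<open>q\<close> and \<open>r\<close>, as a quotient of areas.\<close>

definition bcoef :: "point \<Rightarrow> point \<Rightarrow> point \<Rightarrow> point \<Rightarrow> real" where
  "bcoef p q r x = det2 (q - x) (r - x) / det2 (q - p) (r - p)"

definition bgrad :: "point \<Rightarrow> point \<Rightarrow> point \<Rightarrow> point" where
  "bgrad p q r = (1 / det2 (q - p) (r - p)) *\<^sub>R vector [q $ 2 - r $ 2, r $ 1 - q $ 1]"

lemma bcoef_affine:
  assumes "det2 (q - p) (r - p) \<noteq> 0"
  shows "bcoef p q r x = bgrad p q r \<bullet> (x - p) + 1"
  using assms by (simp add: bcoef_def bgrad_def inner_2 divide_simps) (simp add: det2_def algebra_simps)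

lemma bgrad_norm: "(norm (bgrad p q r))\<^sup>2 = (dist q r)\<^sup>2 / (det2 (q - p) (r - p))\<^sup>2"
  by (simp add: bgrad_def dist_norm norm_sq_2 power_mult_distrib power_divide)
     (simp add: field_simps power2_eq_square)

lemma bcoef_vertex:
  assumes "det2 (q - p) (r - p) \<noteq> 0"
  shows "bcoef p q r p = 1" "bcoef p q r q = 0" "bcoef p q r r = 0"
  using assms by (simp_all add: bcoef_def det2_def)

lemma det2_cyclic: "det2 (r - q) (p - q) = det2 (q - p) (r - p)" "det2 (p - r) (q - r) = det2 (q - p) (r - p)"
  by (simp_all add: det2_def algebra_simps)

lemma bcoef_sum:
  assumes "det2 (q - p) (r - p) \<noteq> 0"
  shows "bcoef p q r x + bcoef q r p x + bcoef r p q x = 1"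
proof -
  have "det2 (q - x) (r - x) + det2 (r - x) (p - x) + det2 (p - x) (q - x) = det2 (q - p) (r - p)"
    by (simp add: det2_def algebra_simps)
  then show ?thesis using assms unfolding bcoef_def det2_cyclic
    by (simp add: add_divide_distrib[symmetric])
qed

lemma bcoef_repr:
  assumes "det2 (q - p) (r - p) \<noteq> 0"
  shows "bcoef p q r x *\<^sub>R p + bcoef q r p x *\<^sub>R q + bcoef r p q x *\<^sub>R r = x"
proof -
  have "det2 (q - x) (r - x) * p $ i + det2 (r - x) (p - x) * q $ i + det2 (p - x) (q - x) * r $ i = det2 (q - p) (r - p) * x $ i" for i
    using exhaust_2[of i] by (auto simp: det2_def algebra_simps)
  then show ?thesis using assms unfolding bcoef_def det2_cyclic
    by (simp add: vec_eq_iff divide_simps)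
qed

lemma bcoef_line:
  assumes "det2 (q - p) (r - p) \<noteq> 0"
  shows "bcoef p q r ((1 - s) *\<^sub>R x + s *\<^sub>R y) = (1 - s) * bcoef p q r x + s * bcoef p q r y"
  unfolding bcoef_affine[OF assms] by (simp add: inner_diff_right inner_add_right algebra_simps)

text \<open>Barycentric coordinate of \<open>x\<close> with respect to the vertex \<open>v\<close>; indexing by the vertex itself instead of its
  position in the triple makes statements independent of the reference edge.\<close>

fun bary :: "triangle \<Rightarrow> point \<Rightarrow> point \<Rightarrow> real" where
  "bary (p, q, r) v x = (if v = p then bcoef p q r x else if v = q then bcoef q r p x else bcoef r p q x)"

lemma tdet_distinct: "tdet (p, q, r) \<noteq> 0 \<Longrightarrow> p \<noteq> q \<and> q \<noteq> r \<and> p \<noteq> r"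
  by (auto simp: det2_def)

lemma sum_verts:
  "tdet (p, q, r) \<noteq> 0 \<Longrightarrow> (\<Sum>v\<in>verts (p, q, r). f v) = f p + f q + f r"
  using tdet_distinct[of p q r] by (simp add: add.assoc)

lemma finite_verts [simp]: "finite (verts t)"
  by (cases t) auto

lemma bary_affine:
  assumes "tdet t \<noteq> 0" "v \<in> verts t"
  obtains g where "\<And>x. bary t v x = g \<bullet> (x - v) + 1"
proof -
  obtain p q r where t: "t = (p, q, r)" by (cases t)
  have d: "det2 (q - p) (r - p) \<noteq> 0" "det2 (r - q) (p - q) \<noteq> 0" "det2 (p - r) (q - r) \<noteq> 0"
    using assms(1) by (simp_all add: t det2_cyclic)
  show ?thesis
    using assms(2) tdet_distinct[of p q r] assms(1) bcoef_affine[OF d(1)] bcoef_affine[OF d(2)] bcoef_affine[OF d(3)]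
    by (auto simp: t intro: that)
qed

lemma bary_vertex:
  assumes "tdet t \<noteq> 0" "v \<in> verts t" "w \<in> verts t"
  shows "bary t v w = (if v = w then 1 else 0)"
proof -
  obtain p q r where t: "t = (p, q, r)" by (cases t)
  have d: "det2 (q - p) (r - p) \<noteq> 0" "det2 (r - q) (p - q) \<noteq> 0" "det2 (p - r) (q - r) \<noteq> 0"
    using assms(1) by (simp_all add: t det2_cyclic)
  show ?thesis
    using assms tdet_distinct[of p q r] bcoef_vertex[OF d(1)] bcoef_vertex[OF d(2)] bcoef_vertex[OF d(3)]
    by (auto simp: t)
qed

lemma bary_sum:
  assumes "tdet t \<noteq> 0"
  shows "(\<Sum>v\<in>verts t. bary t v x) = 1" "(\<Sum>v\<in>verts t. bary t v x *\<^sub>R v) = x"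
proof -
  obtain p q r where t: "t = (p, q, r)" by (cases t)
  have d: "det2 (q - p) (r - p) \<noteq> 0" using assms by (simp add: t)
  have dd: "p \<noteq> q" "q \<noteq> r" "p \<noteq> r" using tdet_distinct[of p q r] assms by (simp_all add: t)
  show "(\<Sum>v\<in>verts t. bary t v x) = 1" "(\<Sum>v\<in>verts t. bary t v x *\<^sub>R v) = x"
    using bcoef_sum[OF d, of x] bcoef_repr[OF d, of x] dd assms
    unfolding t by (subst sum_verts; simp)+
qed

lemma bary_convex_comb:
  assumes "tdet t \<noteq> 0" "v \<in> verts t"
  shows "bary t v ((1 - s) *\<^sub>R x + s *\<^sub>R y) = (1 - s) * bary t v x + s * bary t v y"
proof -
  obtain g where "\<And>x. bary t v x = g \<bullet> (x - v) + 1" using bary_affine[OF assms] by metis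
  then have eq: "bary t v = (\<lambda>x. g \<bullet> (x - v) + 1)" by (rule ext)
  show ?thesis unfolding eq by (simp add: inner_diff_right inner_add_right algebra_simps)
qed

lemma bary_continuous: "tdet t \<noteq> 0 \<Longrightarrow> v \<in> verts t \<Longrightarrow> continuous_on S (bary t v)"
  by (erule (1) bary_affine) (auto intro!: continuous_intros cong: continuous_on_cong)

lemma convex_bary_ge: "tdet t \<noteq> 0 \<Longrightarrow> v \<in> verts t \<Longrightarrow> convex {x. 0 \<le> bary t v x}"
proof -
  assume a: "tdet t \<noteq> 0" "v \<in> verts t"
  obtain g where g: "\<And>x. bary t v x = g \<bullet> (x - v) + 1" using bary_affine[OF a] by metis
  have "{x. 0 \<le> bary t v x} = {x. g \<bullet> x \<ge> g \<bullet> v - 1}" by (auto simp: g inner_diff_right)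
  then show ?thesis by (simp add: convex_halfspace_ge)
qed

lemma convex_bary_zero: "tdet t \<noteq> 0 \<Longrightarrow> v \<in> verts t \<Longrightarrow> convex {x. bary t v x = 0}"
proof -
  assume a: "tdet t \<noteq> 0" "v \<in> verts t"
  obtain g where g: "\<And>x. bary t v x = g \<bullet> (x - v) + 1" using bary_affine[OF a] by metis
  have "{x. bary t v x = 0} = {x. g \<bullet> x = g \<bullet> v - 1}" by (auto simp: g inner_diff_right)
  then show ?thesis by (simp add: convex_hyperplane)
qed

lemma tri_iff_bary:
  assumes "tdet t \<noteq> 0"
  shows "x \<in> tri t \<longleftrightarrow> (\<forall>v\<in>verts t. 0 \<le> bary t v x)"
proof
  assume x: "x \<in> tri t"
  show "\<forall>v\<in>verts t. 0 \<le> bary t v x"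
  proof
    fix v assume v: "v \<in> verts t"
    have "tri t \<subseteq> {x. 0 \<le> bary t v x}"
      unfolding tri_def by (rule hull_minimal) (use convex_bary_ge[OF assms v] bary_vertex[OF assms v] in auto)
    then show "0 \<le> bary t v x" using x by auto
  qed
next
  assume "\<forall>v\<in>verts t. 0 \<le> bary t v x"
  then have "(\<Sum>v\<in>verts t. bary t v x *\<^sub>R v) \<in> convex hull (verts t)"
    by (intro convex_sum bary_sum[OF assms]) (auto intro: hull_inc)
  then show "x \<in> tri t" by (simp add: tri_def bary_sum[OF assms])
qed

lemma bary_zero_on_face:
  assumes "tdet t \<noteq> 0" "v \<in> verts t" "V \<subseteq> verts t" "v \<notin> V" "x \<in> convex hull V"
  shows "bary t v x = 0"
proof -
  have "convex hull V \<subseteq> {x. bary t v x = 0}"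
    by (rule hull_minimal) (use convex_bary_zero[OF assms(1,2)] bary_vertex[OF assms(1,2)] assms(3,4) in force)+
  then show ?thesis using assms(5) by auto
qed

text \<open>Affine functions on a triangle are determined by their vertex values.\<close>

lemma affine_fun_on_tri_repr:
  assumes "tdet t \<noteq> 0" "affine_fun_on (tri t) f" "x \<in> tri t"
  shows "f x = (\<Sum>v\<in>verts t. bary t v x * f v)"
proof -
  obtain g c where f: "\<And>x. x \<in> tri t \<Longrightarrow> f x = g \<bullet> x + c" using assms(2) by (auto simp: affine_fun_on_def)
  have v: "v \<in> tri t" if "v \<in> verts t" for v using that by (simp add: tri_def hull_inc)
  have "(\<Sum>v\<in>verts t. bary t v x * f v) = (\<Sum>v\<in>verts t. g \<bullet> (bary t v x *\<^sub>R v) + c * bary t v x)"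
    by (rule sum.cong) (auto simp: f v algebra_simps)
  also have "\<dots> = g \<bullet> (\<Sum>v\<in>verts t. bary t v x *\<^sub>R v) + c * (\<Sum>v\<in>verts t. bary t v x)"
    by (simp add: sum.distrib inner_sum_right sum_distrib_left)
  also have "\<dots> = f x" by (simp add: bary_sum[OF assms(1)] f assms(3))
  finally show ?thesis by simp
qed

lemma affine_fun_on_lincomb:
  assumes "finite I" "\<And>i. i \<in> I \<Longrightarrow> affine_fun_on S (f i)"
  shows "affine_fun_on S (\<lambda>x. \<Sum>i\<in>I. c i * f i x)"
proof -
  have "\<forall>i\<in>I. \<exists>g d. \<forall>x\<in>S. f i x = g \<bullet> x + d" using assms(2) by (auto simp: affine_fun_on_def)
  then obtain g d where gd: "\<And>i x. i \<in> I \<Longrightarrow> x \<in> S \<Longrightarrow> f i x = g i \<bullet> x + d i" by metis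
  show ?thesis unfolding affine_fun_on_def
  proof (intro exI ballI)
    fix x assume "x \<in> S"
    then show "(\<Sum>i\<in>I. c i * f i x) = (\<Sum>i\<in>I. c i *\<^sub>R g i) \<bullet> x + (\<Sum>i\<in>I. c i * d i)"
      by (simp add: gd inner_sum_left sum.distrib distrib_left)
  qed
qed

lemma affine_fun_on_subset: "affine_fun_on S f \<Longrightarrow> U \<subseteq> S \<Longrightarrow> affine_fun_on U f"
  unfolding affine_fun_on_def by blast

lemma affine_fun_on_cong: "affine_fun_on S f \<Longrightarrow> (\<And>x. x \<in> S \<Longrightarrow> h x = f x) \<Longrightarrow> affine_fun_on S h"
  unfolding affine_fun_on_def by simp

lemma compact_tri: "compact (tri t)"
  unfolding tri_def by (intro finite_imp_compact_convex_hull) auto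

lemma closed_tri: "closed (tri t)"
  by (rule compact_imp_closed[OF compact_tri])

lemma convex_tri: "convex (tri t)"
  by (simp add: tri_def)

lemma verts_tri: "v \<in> verts t \<Longrightarrow> v \<in> tri t"
  by (simp add: tri_def hull_inc)

lemma content_tri: "measure lebesgue (tri t) = \<bar>tdet t\<bar> / 2"
proof -
  obtain p q r where t: "t = (p, q, r)" by (cases t)
  have "measure lebesgue (convex hull {p, q, r}) = measure lborel (convex hull {p, q, r})"
    by (rule measure_completion) (use closed_tri[of t] in \<open>simp add: t tri_def borel_closed\<close>)
  also have "\<dots> = \<bar>(r $ 1 - p $ 1) * (q $ 2 - p $ 2) - (q $ 1 - p $ 1) * (r $ 2 - p $ 2)\<bar> / 2"
    using content_triangle[of p q r] by simp
  also have "(r $ 1 - p $ 1) * (q $ 2 - p $ 2) - (q $ 1 - p $ 1) * (r $ 2 - p $ 2) = - tdet t"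
    by (simp add: t det2_def algebra_simps)
  finally show ?thesis by (simp add: t tri_def)
qed

section \<open>Newest vertex bisection\<close>

text \<open>The sum of the squared lengths of the two edges other than the reference edge. This quantity is chosen because
  bisection halves it exactly.\<close>

fun shape :: "triangle \<Rightarrow> real" where
  "shape (p, q, r) = (dist p r)\<^sup>2 + (dist q r)\<^sup>2"

lemma dist_sq_2: "(dist a b)\<^sup>2 = (a $ 1 - b $ 1)\<^sup>2 + (a $ 2 - b $ 2)\<^sup>2" for a b :: point
  by (simp add: dist_norm norm_sq_2)

text \<open>For the shape this is the parallelogram law for the median from \<open>r\<close>. Both quantities are halved, so their quotient is
  invariant: newest vertex bisection cannot degenerate triangles.\<close>

lemma bisect_shape:
  assumes "s \<in> bisect t" shows "shape s = shape t / 2" "\<bar>tdet s\<bar> = \<bar>tdet t\<bar> / 2"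
proof -
  obtain p q r where t: "t = (p, q, r)" by (cases t)
  have s: "s = (r, p, midpoint p q) \<or> s = (q, r, midpoint p q)" using assms by (simp add: t)
  show "shape s = shape t / 2"
    using s by (elim disjE) (simp_all only: t shape.simps dist_sq_2 midpoint_nth, simp_all add: power2_eq_square field_simps)
  have "tdet s = tdet t / 2"
    using s by (auto simp: t det2_def midpoint_nth field_simps)
  then show "\<bar>tdet s\<bar> = \<bar>tdet t\<bar> / 2" by simp
qed

lemma dist_sq_le_shape:
  assumes "v \<in> verts t" "w \<in> verts t"
  shows "(dist v w)\<^sup>2 \<le> 2 * shape t"
proof -
  obtain p q r where t: "t = (p, q, r)" by (cases t)
  have "dist p q \<le> dist p r + dist q r" by (metis dist_commute dist_triangle)
  then have "(dist p q)\<^sup>2 \<le> (dist p r + dist q r)\<^sup>2" by (intro power_mono) auto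
  also have "\<dots> \<le> 2 * shape t" using sum_squares_bound[of "dist p r" "dist q r"] by (simp add: t power2_sum)
  finally have "(dist p q)\<^sup>2 \<le> 2 * shape t" .
  then show ?thesis using assms by (auto simp: t dist_commute)
qed

text \<open>The triangles that arise from \<open>t\<close> by repeated bisection.\<close>

inductive desc :: "triangle \<Rightarrow> triangle \<Rightarrow> bool" where
  desc_refl: "desc t t"
| desc_step: "desc t s \<Longrightarrow> s' \<in> bisect s \<Longrightarrow> desc t s'"

lemma desc_cases_child:
  "desc t s \<Longrightarrow> s = t \<or> (\<exists>t'\<in>bisect t. desc t' s)"
proof (induction rule: desc.induct)
  case (desc_step t s s')
  then show ?case using desc.desc_refl desc.desc_step by blast
qed auto

lemma bisect_verts_tri:
  assumes "s \<in> bisect t" shows "verts s \<subseteq> tri t"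
proof -
  obtain p q r where t: "t = (p, q, r)" by (cases t)
  have v: "p \<in> tri t" "q \<in> tri t" "r \<in> tri t" by (auto simp: t intro: verts_tri)
  have "midpoint p q \<in> tri t"
    using midpoints_in_convex_hull[of p "verts t" q] v by (simp add: tri_def)
  then show ?thesis using assms v by (auto simp: t)
qed

lemma bisect_tri: "s \<in> bisect t \<Longrightarrow> tri s \<subseteq> tri t"
  using bisect_verts_tri[of s t] convex_tri[of t] by (simp add: tri_def[of s] hull_minimal)

lemma desc_tri: "desc t s \<Longrightarrow> tri s \<subseteq> tri t"
  by (induction rule: desc.induct) (use bisect_tri in blast)+

lemma desc_shape:
  "desc t s \<Longrightarrow> shape t \<le> \<kappa> * \<bar>tdet t\<bar> \<Longrightarrow> tdet t \<noteq> 0 \<Longrightarrow> shape s \<le> \<kappa> * \<bar>tdet s\<bar> \<and> tdet s \<noteq> 0"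
proof (induction rule: desc.induct)
  case (desc_step t s s')
  then show ?case unfolding bisect_shape[OF desc_step.hyps(2)]
    using bisect_shape(2)[OF desc_step.hyps(2)] by auto
qed auto

lemma desc_tdet: "desc t s \<Longrightarrow> tdet t \<noteq> 0 \<Longrightarrow> tdet s \<noteq> 0"
proof (induction rule: desc.induct)
  case (desc_step t s s')
  then show ?case using bisect_shape(2)[OF desc_step.hyps(2)] by auto
qed

lemma nvb_refinement_desc:
  "nvb_refinement T S \<Longrightarrow> s \<in> S \<Longrightarrow> \<exists>t\<in>T. desc t s"
proof (induction arbitrary: s rule: nvb_refinement.induct)
  case refl
  then show ?case using desc_refl by blast
next
  case (step S t)
  then show ?case using desc_step by blast
qed

lemma verts_bisect: "verts t \<subseteq> vertices (bisect t)"
  by (cases t) (auto simp: vertices_def)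

lemma nvb_refinement_vertices: "nvb_refinement T S \<Longrightarrow> vertices T \<subseteq> vertices S"
proof (induction rule: nvb_refinement.induct)
  case (step S t)
  have "vertices S \<subseteq> vertices (S - {t} \<union> bisect t)"
  proof
    fix x assume "x \<in> vertices S"
    then obtain s where s: "s \<in> S" "x \<in> verts s" by (auto simp: vertices_def)
    show "x \<in> vertices (S - {t} \<union> bisect t)"
    proof (cases "s = t")
      case True
      then show ?thesis using verts_bisect[of t] s by (auto simp: vertices_def)
    next
      case False
      then show ?thesis using s by (auto simp: vertices_def)
    qed
  qed
  then show ?case using step by blast
qed auto

lemma finite_uniform_refinement: "finite T \<Longrightarrow> finite (uniform_refinement T)"
proof -
  have "finite (bisect t)" for t by (cases t) auto
  then show "finite T \<Longrightarrow> finite (uniform_refinement T)" by (auto simp: uniform_refinement_def)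
qed

lemma bisect_cover: "tdet t \<noteq> 0 \<Longrightarrow> tri t \<subseteq> (\<Union>s\<in>bisect t. tri s)"
proof
  fix x assume d: "tdet t \<noteq> 0" and x: "x \<in> tri t"
  obtain p q r where t: "t = (p, q, r)" by (cases t)
  let ?m = "midpoint p q"
  have dd: "p \<noteq> q" "q \<noteq> r" "p \<noteq> r" using tdet_distinct[of p q r] d by (simp_all add: t)
  obtain a b c where abc: "0 \<le> a" "0 \<le> b" "0 \<le> c" "a + b + c = 1" "x = a *\<^sub>R p + b *\<^sub>R q + c *\<^sub>R r"
    using x by (auto simp: t tri_def convex_hull_3)
  show "x \<in> (\<Union>s\<in>bisect t. tri s)"
  proof (cases "a \<ge> b")
    case True
    have "x = c *\<^sub>R r + (a - b) *\<^sub>R p + (2 * b) *\<^sub>R ?m"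
      unfolding abc(5) by (simp add: vec_eq_iff midpoint_nth algebra_simps)
    then have "x \<in> tri (r, p, ?m)" using abc True unfolding tri_def verts.simps convex_hull_3
      by (intro CollectI exI[of _ c] exI[of _ "a - b"] exI[of _ "2 * b"]) auto
    then show ?thesis by (auto simp: t)
  next
    case False
    have "x = (b - a) *\<^sub>R q + c *\<^sub>R r + (2 * a) *\<^sub>R ?m"
      unfolding abc(5) by (simp add: vec_eq_iff midpoint_nth algebra_simps)
    then have "x \<in> tri (q, r, ?m)" using abc False unfolding tri_def verts.simps convex_hull_3
      by (intro CollectI exI[of _ "b - a"] exI[of _ c] exI[of _ "2 * a"]) auto
    then show ?thesis by (auto simp: t)
  qed
qed

lemma bisect_tdet: "s \<in> bisect t \<Longrightarrow> tdet t \<noteq> 0 \<Longrightarrow> tdet s \<noteq> 0"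
  using bisect_shape(2)[of s t] by auto

lemma bisect2_cover: "tdet t \<noteq> 0 \<Longrightarrow> tri t \<subseteq> (\<Union>s'\<in>bisect t. \<Union>s\<in>bisect s'. tri s)"
proof
  fix x assume t: "tdet t \<noteq> 0" and "x \<in> tri t"
  then obtain s' where s': "s' \<in> bisect t" "x \<in> tri s'" using bisect_cover[OF t] by blast
  then obtain s where "s \<in> bisect s'" "x \<in> tri s" using bisect_cover[OF bisect_tdet[OF s'(1) t]] by blast
  then show "x \<in> (\<Union>s'\<in>bisect t. \<Union>s\<in>bisect s'. tri s)" using s' by blast
qed

section \<open>Hat functions of edge midpoints on one triangle\<close>

text \<open>The restriction to one triangle of the hat function of the refined mesh at an edge midpoint \<open>z\<close>, in closed form: the sons
  are separated by the line where the coordinates of \<open>p\<close> and \<open>q\<close> agree, and the hat function of the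
  midpoint of another edge vanishes beyond that line. It is zero if \<open>z\<close> is no midpoint.\<close>

fun edge_hat :: "triangle \<Rightarrow> point \<Rightarrow> point \<Rightarrow> real" where
  "edge_hat (p, q, r) z x =
     (if z = midpoint p q then 2 * min (bcoef p q r x) (bcoef q r p x)
      else if z = midpoint p r then max 0 (2 * min (bcoef r p q x) (bcoef p q r x - bcoef q r p x))
      else if z = midpoint q r then max 0 (2 * min (bcoef r p q x) (bcoef q r p x - bcoef p q r x))
      else 0)"

definition midpoints :: "triangle \<Rightarrow> point set" where
  "midpoints t = {midpoint v w | v w. v \<in> verts t \<and> w \<in> verts t \<and> v \<noteq> w}"

lemma midpoints_eq: "tdet (p, q, r) \<noteq> 0 \<Longrightarrow> midpoints (p, q, r) = {midpoint p q, midpoint p r, midpoint q r}"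
proof
  assume "tdet (p, q, r) \<noteq> 0"
  then have dd: "p \<noteq> q" "q \<noteq> r" "p \<noteq> r" using tdet_distinct[of p q r] by auto
  show "midpoints (p, q, r) \<subseteq> {midpoint p q, midpoint p r, midpoint q r}"
    by (auto simp: midpoints_def midpoint_sym[of q p] midpoint_sym[of r p] midpoint_sym[of r q])
  show "{midpoint p q, midpoint p r, midpoint q r} \<subseteq> midpoints (p, q, r)"
    using dd by (auto simp: midpoints_def)
qed

lemma midpoints_distinct:
  "tdet (p, q, r) \<noteq> 0 \<Longrightarrow> midpoint p q \<noteq> midpoint p r \<and> midpoint p q \<noteq> midpoint q r \<and> midpoint p r \<noteq> midpoint q r"
  using tdet_distinct[of p q r] by (auto simp: midpoint_eq_iff midpoint_def)

lemma bcoef_midpoint: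
  assumes "det2 (q - p) (r - p) \<noteq> 0"
  shows "bcoef p q r (midpoint v w) = (bcoef p q r v + bcoef p q r w) / 2"
  unfolding bcoef_affine[OF assms] by (simp add: midpoint_def inner_diff_right inner_add_right field_simps)

lemma edge_hat_nonneg:
  assumes "tdet t \<noteq> 0" "x \<in> tri t" shows "0 \<le> edge_hat t z x"
proof -
  obtain p q r where t: "t = (p, q, r)" by (cases t)
  have dd: "p \<noteq> q" "q \<noteq> r" "p \<noteq> r" using tdet_distinct[of p q r] assms by (simp_all add: t)
  have "0 \<le> bcoef p q r x" "0 \<le> bcoef q r p x"
    using tri_iff_bary[OF assms(1), of x] assms(2) dd by (auto simp: t)
  then show ?thesis by (simp add: t)
qed

text \<open>On each edge the function depends on that edge and on \<open>z\<close> only; this makes neighbouring triangles fit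
  together.\<close>

lemma edge_hat_edge:
  assumes t: "tdet t \<noteq> 0" and u: "u \<in> verts t" "w \<in> verts t" "u \<noteq> w" and s: "0 \<le> s" "s \<le> 1"
  shows "edge_hat t z ((1 - s) *\<^sub>R u + s *\<^sub>R w) = (if z = midpoint u w then 2 * min s (1 - s) else 0)"
proof -
  obtain p q r where tt: "t = (p, q, r)" by (cases t)
  have dd: "p \<noteq> q" "q \<noteq> r" "p \<noteq> r" using tdet_distinct[of p q r] t by (simp_all add: tt)
  have d: "det2 (q - p) (r - p) \<noteq> 0" "det2 (r - q) (p - q) \<noteq> 0" "det2 (p - r) (q - r) \<noteq> 0"
    using t by (simp_all add: tt det2_cyclic)
  note b = bcoef_vertex[OF d(1)] bcoef_vertex[OF d(2)] bcoef_vertex[OF d(3)]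
  note l = bcoef_line[OF d(1)] bcoef_line[OF d(2)] bcoef_line[OF d(3)]
  note m = midpoints_distinct[of p q r] midpoint_sym[of q p] midpoint_sym[of r p] midpoint_sym[of r q]
  consider "u = p" "w = q" | "u = q" "w = p" | "u = p" "w = r" | "u = r" "w = p" | "u = q" "w = r" | "u = r" "w = q"
    using u by (auto simp: tt)
  then show ?thesis
    by cases (use s m t in \<open>auto simp: tt l b min_def max_def\<close>)
qed

text \<open>Inequalities between affine functions need to be checked at vertices only; it decides on each grandson which
  argument of the minimum in \<open>edge_hat\<close> is active.\<close>

lemma affine_le_on_tri:
  assumes f: "\<And>x. f x = g \<bullet> x + c" and h: "\<And>x. h x = g' \<bullet> x + (c' :: real)"
    and le: "\<And>v. v \<in> verts s \<Longrightarrow> f v \<le> h v" and x: "x \<in> tri s"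
  shows "f x \<le> h x"
proof -
  have "tri s \<subseteq> {x. (g - g') \<bullet> x \<le> c' - c}"
    unfolding tri_def
  proof (rule hull_minimal)
    show "verts s \<subseteq> {x. (g - g') \<bullet> x \<le> c' - c}"
      using le by (auto simp: f h inner_diff_left algebra_simps)
  qed (rule convex_halfspace_le)
  then have "(g - g') \<bullet> x \<le> c' - c" using x by blast
  then show ?thesis by (simp add: f h inner_diff_left)
qed

lemma bcoef_affine':
  assumes "det2 (q - p) (r - p) \<noteq> 0"
  shows "bcoef p q r x = bgrad p q r \<bullet> x + (1 - bgrad p q r \<bullet> p)"
  using bcoef_affine[OF assms] by (simp add: inner_diff_right)

context
  fixes p q r :: point
  assumes nondeg: "tdet (p, q, r) \<noteq> 0"
begin

private lemma dets: "det2 (q - p) (r - p) \<noteq> 0" "det2 (r - q) (p - q) \<noteq> 0" "det2 (p - r) (q - r) \<noteq> 0"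
  using nondeg by (simp_all add: det2_cyclic)

private lemmas aff = bcoef_affine'[OF dets(1)] bcoef_affine'[OF dets(2)] bcoef_affine'[OF dets(3)]
private lemmas at_vertex = bcoef_vertex[OF dets(1)] bcoef_vertex[OF dets(2)] bcoef_vertex[OF dets(3)]
private lemmas at_mid = bcoef_midpoint[OF dets(1)] bcoef_midpoint[OF dets(2)] bcoef_midpoint[OF dets(3)]

private lemma diff_aff:
  "bcoef p q r x - bcoef q r p x = (bgrad p q r - bgrad q r p) \<bullet> x + ((1 - bgrad p q r \<bullet> p) - (1 - bgrad q r p \<bullet> q))"
  "bcoef q r p x - bcoef p q r x = (bgrad q r p - bgrad p q r) \<bullet> x + ((1 - bgrad q r p \<bullet> q) - (1 - bgrad p q r \<bullet> p))"
  by (simp_all add: aff inner_diff_left)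

private lemma zero_aff: "(0::real) = (0::point) \<bullet> x + 0"
  by simp

lemma child1_le: "x \<in> tri (r, p, midpoint p q) \<Longrightarrow> bcoef q r p x \<le> bcoef p q r x"
  by (rule affine_le_on_tri[OF aff(2) aff(1)]) (auto simp: at_vertex at_mid)

lemma child2_le: "x \<in> tri (q, r, midpoint p q) \<Longrightarrow> bcoef p q r x \<le> bcoef q r p x"
  by (rule affine_le_on_tri[OF aff(1) aff(2)]) (auto simp: at_vertex at_mid)

lemma grandchild1_le:
  "x \<in> tri (midpoint p q, r, midpoint r p) \<Longrightarrow> bcoef p q r x - bcoef q r p x \<le> bcoef r p q x"
  "x \<in> tri (midpoint p q, r, midpoint r p) \<Longrightarrow> 0 \<le> bcoef p q r x - bcoef q r p x"
  by (rule affine_le_on_tri[OF diff_aff(1) aff(3)], (auto simp: at_vertex at_mid)[2])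
     (rule affine_le_on_tri[OF zero_aff diff_aff(1)], auto simp: at_vertex at_mid)

lemma grandchild2_le:
  "x \<in> tri (p, midpoint p q, midpoint r p) \<Longrightarrow> bcoef r p q x \<le> bcoef p q r x - bcoef q r p x"
  "x \<in> tri (p, midpoint p q, midpoint r p) \<Longrightarrow> 0 \<le> bcoef r p q x"
  by (rule affine_le_on_tri[OF aff(3) diff_aff(1)], (auto simp: at_vertex at_mid)[2])
     (rule affine_le_on_tri[OF zero_aff aff(3)], auto simp: at_vertex at_mid)

lemma grandchild3_le:
  "x \<in> tri (midpoint p q, q, midpoint q r) \<Longrightarrow> bcoef r p q x \<le> bcoef q r p x - bcoef p q r x"
  "x \<in> tri (midpoint p q, q, midpoint q r) \<Longrightarrow> 0 \<le> bcoef r p q x"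
  by (rule affine_le_on_tri[OF aff(3) diff_aff(2)], (auto simp: at_vertex at_mid)[2])
     (rule affine_le_on_tri[OF zero_aff aff(3)], auto simp: at_vertex at_mid)

lemma grandchild4_le:
  "x \<in> tri (r, midpoint p q, midpoint q r) \<Longrightarrow> bcoef q r p x - bcoef p q r x \<le> bcoef r p q x"
  "x \<in> tri (r, midpoint p q, midpoint q r) \<Longrightarrow> 0 \<le> bcoef q r p x - bcoef p q r x"
  by (rule affine_le_on_tri[OF diff_aff(2) aff(3)], (auto simp: at_vertex at_mid)[2])
     (rule affine_le_on_tri[OF zero_aff diff_aff(2)], auto simp: at_vertex at_mid)

private lemma affI: "(\<And>x. x \<in> S \<Longrightarrow> f x = c * h x) \<Longrightarrow> (\<And>x. h x = g \<bullet> x + d) \<Longrightarrow> affine_fun_on S f"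
  unfolding affine_fun_on_def by (intro exI[of _ "c *\<^sub>R g"] exI[of _ "c * d"]) (simp add: distrib_left)

private lemma affI0: "(\<And>x. x \<in> S \<Longrightarrow> f x = 0) \<Longrightarrow> affine_fun_on S f"
  unfolding affine_fun_on_def by (intro exI[of _ 0]) simp

lemma edge_hat_affine_ref:
  assumes "c \<in> bisect (p, q, r)"
  shows "affine_fun_on (tri c) (edge_hat (p, q, r) (midpoint p q))"
proof -
  have "c = (r, p, midpoint p q) \<or> c = (q, r, midpoint p q)" using assms by simp
  then show ?thesis
  proof
    assume c: "c = (r, p, midpoint p q)"
    show ?thesis
    proof (rule affI[where c = 2, OF _ aff(2)])
      show "edge_hat (p, q, r) (midpoint p q) x = 2 * bcoef q r p x" if "x \<in> tri c" for x
        using child1_le[of x] that by (simp add: c min.absorb2)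
    qed
  next
    assume c: "c = (q, r, midpoint p q)"
    show ?thesis
    proof (rule affI[where c = 2, OF _ aff(1)])
      show "edge_hat (p, q, r) (midpoint p q) x = 2 * bcoef p q r x" if "x \<in> tri c" for x
        using child2_le[of x] that by (simp add: c min.absorb1)
    qed
  qed
qed

lemma edge_hat_affine_pr:
  "affine_fun_on (tri (q, r, midpoint p q)) (edge_hat (p, q, r) (midpoint p r))"
  "c \<in> bisect (r, p, midpoint p q) \<Longrightarrow> affine_fun_on (tri c) (edge_hat (p, q, r) (midpoint p r))"
proof -
  have m: "midpoint p q \<noteq> midpoint p r" using midpoints_distinct[OF nondeg] by auto
  show "affine_fun_on (tri (q, r, midpoint p q)) (edge_hat (p, q, r) (midpoint p r))"
  proof (rule affI0)
    show "edge_hat (p, q, r) (midpoint p r) x = 0" if "x \<in> tri (q, r, midpoint p q)" for x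
      using child2_le[OF that] m by (auto simp: min_def max_def)
  qed
  assume "c \<in> bisect (r, p, midpoint p q)"
  then have "c = (midpoint p q, r, midpoint r p) \<or> c = (p, midpoint p q, midpoint r p)" by simp
  then show "affine_fun_on (tri c) (edge_hat (p, q, r) (midpoint p r))"
  proof
    assume c: "c = (midpoint p q, r, midpoint r p)"
    show ?thesis
    proof (rule affI[where c = 2, OF _ diff_aff(1)])
      show "edge_hat (p, q, r) (midpoint p r) x = 2 * (bcoef p q r x - bcoef q r p x)" if "x \<in> tri c" for x
        using grandchild1_le[OF that[unfolded c]] m by (auto simp: min_def max_def)
    qed
  next
    assume c: "c = (p, midpoint p q, midpoint r p)"
    show ?thesis
    proof (rule affI[where c = 2, OF _ aff(3)])
      show "edge_hat (p, q, r) (midpoint p r) x = 2 * (bcoef r p q x)" if "x \<in> tri c" for x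
        using grandchild2_le[OF that[unfolded c]] m by (auto simp: min_def max_def)
    qed
  qed
qed

lemma edge_hat_affine_qr:
  "affine_fun_on (tri (r, p, midpoint p q)) (edge_hat (p, q, r) (midpoint q r))"
  "c \<in> bisect (q, r, midpoint p q) \<Longrightarrow> affine_fun_on (tri c) (edge_hat (p, q, r) (midpoint q r))"
proof -
  have m: "midpoint p q \<noteq> midpoint q r" "midpoint p r \<noteq> midpoint q r" using midpoints_distinct[OF nondeg] by auto
  show "affine_fun_on (tri (r, p, midpoint p q)) (edge_hat (p, q, r) (midpoint q r))"
  proof (rule affI0)
    show "edge_hat (p, q, r) (midpoint q r) x = 0" if "x \<in> tri (r, p, midpoint p q)" for x
      using child1_le[OF that] m by (auto simp: min_def max_def)
  qed
  assume "c \<in> bisect (q, r, midpoint p q)"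
  then have "c = (midpoint p q, q, midpoint q r) \<or> c = (r, midpoint p q, midpoint q r)" by simp
  then show "affine_fun_on (tri c) (edge_hat (p, q, r) (midpoint q r))"
  proof
    assume c: "c = (midpoint p q, q, midpoint q r)"
    show ?thesis
    proof (rule affI[where c = 2, OF _ aff(3)])
      show "edge_hat (p, q, r) (midpoint q r) x = 2 * (bcoef r p q x)" if "x \<in> tri c" for x
        using grandchild3_le[OF that[unfolded c]] m by (auto simp: min_def max_def)
    qed
  next
    assume c: "c = (r, midpoint p q, midpoint q r)"
    show ?thesis
    proof (rule affI[where c = 2, OF _ diff_aff(2)])
      show "edge_hat (p, q, r) (midpoint q r) x = 2 * (bcoef q r p x - bcoef p q r x)" if "x \<in> tri c" for x
        using grandchild4_le[OF that[unfolded c]] m by (auto simp: min_def max_def)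
    qed
  qed
qed

lemma edge_hat_affine_other:
  "z \<notin> midpoints (p, q, r) \<Longrightarrow> affine_fun_on S (edge_hat (p, q, r) z)"
  by (rule affI0) (simp add: midpoints_eq[OF nondeg])

end

lemma midpoint_not_vertex:
  assumes t: "tdet t \<noteq> 0" and z: "z \<in> midpoints t" shows "z \<notin> verts t"
proof
  assume v: "z \<in> verts t"
  obtain u w where uw: "z = midpoint u w" "u \<in> verts t" "w \<in> verts t" "u \<noteq> w"
    using z by (auto simp: midpoints_def)
  have "z = (1 - 1 / 2) *\<^sub>R u + (1 / 2) *\<^sub>R w" by (simp add: uw vec_eq_iff midpoint_nth)
  then have "bary t u z = 1 / 2"
    using bary_convex_comb[OF t uw(2), of "1 / 2" u w] bary_vertex[OF t uw(2) uw(2)] bary_vertex[OF t uw(2,3)] uw(4) by simp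
  then show False using bary_vertex[OF t uw(2) v] by (simp split: if_splits)
qed

lemma edge_hat_affine_grandchild:
  assumes t: "tdet t \<noteq> 0" and c: "c \<in> bisect t" and s: "s \<in> bisect c"
  shows "affine_fun_on (tri s) (edge_hat t z)"
proof -
  obtain p q r where tt: "t = (p, q, r)" by (cases t)
  have nd: "tdet (p, q, r) \<noteq> 0" using t by (simp add: tt)
  have sub: "tri s \<subseteq> tri c" by (rule bisect_tri[OF s])
  have cc: "c = (r, p, midpoint p q) \<or> c = (q, r, midpoint p q)" using c by (simp add: tt)
  consider "z = midpoint p q" | "z = midpoint p r" | "z = midpoint q r" | "z \<notin> midpoints t"
    unfolding tt midpoints_eq[OF nd] by blast
  then show ?thesis
  proof cases
    case 1
    show ?thesis unfolding tt 1
      by (rule affine_fun_on_subset[OF edge_hat_affine_ref[OF nd] sub]) (use c tt in simp)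
  next
    case 2
    from cc show ?thesis
    proof
      assume "c = (r, p, midpoint p q)"
      then show ?thesis using edge_hat_affine_pr(2)[OF nd] s unfolding tt 2 by blast
    next
      assume "c = (q, r, midpoint p q)"
      then show ?thesis using affine_fun_on_subset[OF edge_hat_affine_pr(1)[OF nd]] sub unfolding tt 2 by blast
    qed
  next
    case 3
    from cc show ?thesis
    proof
      assume "c = (q, r, midpoint p q)"
      then show ?thesis using edge_hat_affine_qr(2)[OF nd] s unfolding tt 3 by blast
    next
      assume "c = (r, p, midpoint p q)"
      then show ?thesis using affine_fun_on_subset[OF edge_hat_affine_qr(1)[OF nd]] sub unfolding tt 3 by blast
    qed
  next
    case 4
    then show ?thesis using edge_hat_affine_other[OF nd] unfolding tt by blast
  qed
qed

text \<open>If a descendant contains the midpoint \<open>z\<close> at most as a vertex, it lies in a part of \<open>t\<close> on which the hat function is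
  already affine. This puts hat functions at new vertices into the space of every conforming
  refinement that contains these vertices, however local the refinement is.\<close>

lemma edge_hat_affine_desc:
  assumes t: "tdet t \<noteq> 0" and s: "desc t s" and z: "z \<in> tri s \<Longrightarrow> z \<in> verts s"
  shows "affine_fun_on (tri s) (edge_hat t z)"
proof (cases "z \<in> midpoints t")
  case False
  then show ?thesis using edge_hat_affine_other[of _ _ _ z] t by (cases t) blast
next
  case True
  have m_tri: "z' \<in> tri t'" if "z' \<in> midpoints t'" for z' t'
    using that midpoints_in_convex_hull[of _ "verts t'"] by (auto simp: midpoints_def tri_def hull_inc)
  have "s \<noteq> t" using z m_tri[OF True] midpoint_not_vertex[OF t True] by blast
  then obtain c where c: "c \<in> bisect t" "desc c s" using desc_cases_child[OF s] by blast
  have sub: "tri s \<subseteq> tri c" by (rule desc_tri[OF c(2)])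
  obtain p q r where tt: "t = (p, q, r)" by (cases t)
  have nd: "tdet (p, q, r) \<noteq> 0" using t by (simp add: tt)
  have cc: "c = (r, p, midpoint p q) \<or> c = (q, r, midpoint p q)" using c by (simp add: tt)
  have deeper: "\<exists>c'\<in>bisect c. tri s \<subseteq> tri c'" if zc: "z \<in> midpoints c"
  proof -
    have "s \<noteq> c" using z m_tri[OF zc] midpoint_not_vertex[OF bisect_tdet[OF c(1) t] zc] by blast
    then show ?thesis using desc_cases_child[OF c(2)] desc_tri by blast
  qed
  consider "z = midpoint p q" | "z = midpoint p r" | "z = midpoint q r"
    using True unfolding tt midpoints_eq[OF nd] by blast
  then show ?thesis
  proof cases
    case 1
    show ?thesis unfolding tt 1
      by (rule affine_fun_on_subset[OF edge_hat_affine_ref[OF nd] sub]) (use c tt in simp)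
  next
    case 2
    from cc show ?thesis
    proof
      assume c1: "c = (r, p, midpoint p q)"
      have "z \<in> midpoints c" unfolding c1 2
        using midpoints_eq[of r p "midpoint p q"] bisect_tdet[OF c(1) t] c1 by (simp add: midpoint_sym)
      then obtain c' where "c' \<in> bisect c" "tri s \<subseteq> tri c'" using deeper by blast
      then show ?thesis using affine_fun_on_subset[OF edge_hat_affine_pr(2)[OF nd]] unfolding tt 2 c1 by blast
    next
      assume "c = (q, r, midpoint p q)"
      then show ?thesis using affine_fun_on_subset[OF edge_hat_affine_pr(1)[OF nd]] sub unfolding tt 2 by blast
    qed
  next
    case 3
    from cc show ?thesis
    proof
      assume c2: "c = (q, r, midpoint p q)"
      have "z \<in> midpoints c" unfolding c2 3
        using midpoints_eq[of q r "midpoint p q"] bisect_tdet[OF c(1) t] c2 by simp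
      then obtain c' where "c' \<in> bisect c" "tri s \<subseteq> tri c'" using deeper by blast
      then show ?thesis using affine_fun_on_subset[OF edge_hat_affine_qr(2)[OF nd]] unfolding tt 3 c2 by blast
    next
      assume "c = (r, p, midpoint p q)"
      then show ?thesis using affine_fun_on_subset[OF edge_hat_affine_qr(1)[OF nd]] sub unfolding tt 3 by blast
    qed
  qed
qed

text \<open>The four triangles into which the uniform refinement divides \<open>t\<close>.\<close>

definition grandchildren :: "triangle \<Rightarrow> triangle set" where
  "grandchildren t = (\<Union>c\<in>bisect t. bisect c)"

lemma grandchildren_eq:
  "grandchildren (p, q, r) = {(midpoint p q, r, midpoint r p), (p, midpoint p q, midpoint r p),
     (midpoint p q, q, midpoint q r), (r, midpoint p q, midpoint q r)}"
  by (auto simp: grandchildren_def)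

lemma uniform_refinement_grandchildren: "uniform_refinement T = (\<Union>t\<in>T. grandchildren t)"
  by (simp add: uniform_refinement_def grandchildren_def)

lemma grandchild_verts:
  assumes "tdet t \<noteq> 0" "s \<in> grandchildren t" shows "verts s \<subseteq> verts t \<union> midpoints t"
proof -
  obtain p q r where tt: "t = (p, q, r)" by (cases t)
  show ?thesis using assms unfolding tt grandchildren_eq
    by (auto simp: midpoints_eq midpoint_sym)
qed

lemma grandchild_edge:
  assumes "tdet t \<noteq> 0" "u \<in> verts t" "w \<in> verts t" "u \<noteq> w"
  shows "\<exists>s\<in>grandchildren t. u \<in> verts s \<and> midpoint u w \<in> verts s"
proof -
  obtain p q r where tt: "t = (p, q, r)" by (cases t)
  show ?thesis using assms(2-4) unfolding tt grandchildren_eq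
    by (auto simp: midpoint_sym)
qed

lemma grandchild_desc: "s \<in> grandchildren t \<Longrightarrow> desc t s"
  unfolding grandchildren_def using desc_step[OF desc_step[OF desc_refl]] by blast

lemma card_grandchildren: "finite (grandchildren t)" "card (grandchildren t) \<le> 4"
proof -
  obtain p q r where tt: "t = (p, q, r)" by (cases t)
  show "finite (grandchildren t)" "card (grandchildren t) \<le> 4"
    unfolding tt grandchildren_eq by (auto intro!: card_insert_le_m1)
qed

lemma edge_hat_nodes:
  assumes t: "tdet t \<noteq> 0"
  shows "v \<in> verts t \<Longrightarrow> edge_hat t z v = 0"
    and "v \<in> midpoints t \<Longrightarrow> edge_hat t z v = (if z = v then 1 else 0)"
proof -
  assume v: "v \<in> verts t"
  obtain w where w: "w \<in> verts t" "w \<noteq> v"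
  proof -
    obtain p q r where tt: "t = (p, q, r)" by (cases t)
    have "p \<noteq> q \<and> q \<noteq> r \<and> p \<noteq> r" using tdet_distinct[of p q r] t by (simp add: tt)
    then show ?thesis using that v by (cases "v = p") (auto simp: tt)
  qed
  show "edge_hat t z v = 0" using edge_hat_edge[OF t v w(1) w(2)[symmetric], of 0 z] by (simp split: if_splits)
next
  assume "v \<in> midpoints t"
  then obtain u w where uw: "v = midpoint u w" "u \<in> verts t" "w \<in> verts t" "u \<noteq> w" by (auto simp: midpoints_def)
  have "v = (1 - 1 / 2) *\<^sub>R u + (1 / 2) *\<^sub>R w" by (simp add: uw vec_eq_iff midpoint_nth)
  then show "edge_hat t z v = (if z = v then 1 else 0)"
    using edge_hat_edge[OF t uw(2-4), of "1 / 2" z] uw(1) by simp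
qed

text \<open>Along the segment between two points the covering becomes one of an interval, where local Lipschitz constants
  combine without loss.\<close>

lemma lipschitz_on_closed_cover:
  fixes f :: "'a::real_normed_vector \<Rightarrow> real"
  assumes "finite I" "\<And>i. i \<in> I \<Longrightarrow> closed (U i)" "\<And>i. i \<in> I \<Longrightarrow> M-lipschitz_on (U i) f"
    "(\<Union>i\<in>I. U i) = UNIV" "M \<ge> 0"
  shows "M-lipschitz_on UNIV f"
proof (rule lipschitz_onI[OF _ assms(5)])
  fix x y :: 'a
  define \<gamma> where "\<gamma> \<tau> = x + \<tau> *\<^sub>R (y - x)" for \<tau> :: real
  have "(M * norm (y - x))-lipschitz_on {0..1} (f \<circ> \<gamma>)"
  proof (rule lipschitz_on_closed_Union[where I = I and U = "\<lambda>i. \<gamma> -` U i"])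
    fix i assume i: "i \<in> I"
    show "(M * norm (y - x))-lipschitz_on (\<gamma> -` U i) (f \<circ> \<gamma>)"
    proof (rule lipschitz_onI)
      fix a b assume ab: "a \<in> \<gamma> -` U i" "b \<in> \<gamma> -` U i"
      have "dist (f (\<gamma> a)) (f (\<gamma> b)) \<le> M * dist (\<gamma> a) (\<gamma> b)"
        using ab by (intro lipschitz_onD[OF assms(3)[OF i]]) auto
      also have "dist (\<gamma> a) (\<gamma> b) = norm ((a - b) *\<^sub>R (y - x))"
        by (simp add: \<gamma>_def dist_norm scaleR_left_diff_distrib)
      finally show "dist ((f \<circ> \<gamma>) a) ((f \<circ> \<gamma>) b) \<le> M * norm (y - x) * dist a b"
        by (simp add: dist_real_def mult_ac)
    qed (use assms(5) in simp)
    show "closed (\<gamma> -` U i)"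
      by (intro continuous_closed_vimage assms(2)[OF i]) (auto simp: \<gamma>_def[abs_def] intro!: continuous_intros)
  next
    show "{0..1} \<subseteq> (\<Union>i\<in>I. \<gamma> -` U i)"
    proof
      fix \<tau>
      have "\<gamma> \<tau> \<in> (\<Union>i\<in>I. U i)" unfolding assms(4) by simp
      then show "\<tau> \<in> (\<Union>i\<in>I. \<gamma> -` U i)" by blast
    qed
  qed (use assms(1,5) in auto)
  from lipschitz_onD[OF this, of 0 1] show "dist (f x) (f y) \<le> M * dist x y"
    by (simp add: \<gamma>_def dist_norm norm_minus_commute)
qed

lemma affine_fun_on_lipschitz: 
  assumes "affine_fun_on S f" obtains M where "M-lipschitz_on S f"
proof -
  obtain g c where f: "\<forall>x\<in>S. f x = g \<bullet> x + c" using assms by (auto simp: affine_fun_on_def)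
  have "(norm g)-lipschitz_on S f"
  proof (rule lipschitz_onI)
    fix x y assume "x \<in> S" "y \<in> S"
    then have "dist (f x) (f y) = \<bar>g \<bullet> (x - y)\<bar>" using f by (simp add: dist_real_def inner_diff_right)
    also have "\<dots> \<le> norm g * dist x y" unfolding dist_norm by (rule Cauchy_Schwarz_ineq2)
    finally show "dist (f x) (f y) \<le> norm g * dist x y" .
  qed simp
  then show ?thesis by (rule that)
qed

lemma card_verts: assumes "tdet t \<noteq> 0" shows "card (verts t) = 3"
proof -
  obtain p q r where tt: "t = (p, q, r)" by (cases t)
  have "p \<noteq> q" "q \<noteq> r" "p \<noteq> r" using tdet_distinct[of p q r] assms by (auto simp only: tt)
  then show ?thesis by (simp add: tt)
qed

section \<open>Conforming meshes and their uniform refinement\<close>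

text \<open>The constant \<open>\<kappa>\<close> is the quantitative shape regularity that all refinements inherit.\<close>

locale mesh = planar_domain D for D +
  fixes T :: "triangle set" and \<kappa> :: real
  assumes lip_D: "lipschitz_domain D" and conf: "conforming_triangulation D T"
    and shape_T: "\<And>t. t \<in> T \<Longrightarrow> shape t \<le> \<kappa> * \<bar>tdet t\<bar>"
begin

lemma finite_T: "finite T"
  using conf by (simp add: conforming_triangulation_def)

lemma tdet_T: "t \<in> T \<Longrightarrow> tdet t \<noteq> 0"
proof -
  assume t: "t \<in> T"
  obtain p q r where tt: "t = (p, q, r)" by (cases t)
  have "\<forall>t\<in>T. case t of (p, q, r) \<Rightarrow> \<not> collinear {p, q, r}"
    by (rule conf[unfolded conforming_triangulation_def, THEN conjunct2, THEN conjunct2, THEN conjunct1])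
  then have "case t of (p, q, r) \<Rightarrow> \<not> collinear {p, q, r}" using t by (rule bspec)
  then have "\<not> collinear {p, q, r}" unfolding tt by simp
  then show ?thesis unfolding tt by (rule noncollinear_tdet)
qed

lemma cover_T: "(\<Union>t\<in>T. tri t) = closure D"
  using conf by (simp add: conforming_triangulation_def)

lemma tri_closure: "t \<in> T \<Longrightarrow> tri t \<subseteq> closure D"
  using cover_T by blast

lemma inter_T: "t \<in> T \<Longrightarrow> t' \<in> T \<Longrightarrow> tri t \<inter> tri t' = convex hull (verts t \<inter> verts t')"
proof -
  assume t: "t \<in> T" and t': "t' \<in> T"
  show ?thesis
    by (rule bspec[OF bspec[OF conf[unfolded conforming_triangulation_def, THEN conjunct2, THEN conjunct2, THEN conjunct2, THEN conjunct2] t] t'])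
qed

lemma inj_T: "t \<in> T \<Longrightarrow> t' \<in> T \<Longrightarrow> verts t = verts t' \<Longrightarrow> t = t'"
  using conf[unfolded conforming_triangulation_def, THEN conjunct2, THEN conjunct1] by (auto dest: inj_onD)

lemma vertex_in_tri:
  assumes "t \<in> T" "v \<in> vertices T" "v \<in> tri t" shows "v \<in> verts t"
proof (rule ccontr)
  assume nv: "v \<notin> verts t"
  obtain t' where t': "t' \<in> T" "v \<in> verts t'" using assms(2) by (auto simp: vertices_def)
  have "v \<in> tri t' \<inter> tri t" using assms t' verts_tri by blast
  then have "v \<in> convex hull (verts t' \<inter> verts t)" using inter_T[OF t'(1) assms(1)] by simp
  then have "bary t' v v = 0" using nv by (intro bary_zero_on_face[OF tdet_T[OF t'(1)] t'(2)]) auto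
  then show False using bary_vertex[OF tdet_T[OF t'(1)] t'(2) t'(2)] by simp
qed

abbreviation Th where "Th \<equiv> uniform_refinement T"

lemma Th_cases:
  assumes "s \<in> Th" obtains t where "t \<in> T" "s \<in> grandchildren t" "desc t s"
  using assms grandchild_desc unfolding uniform_refinement_grandchildren by blast

lemma Th_I: "t \<in> T \<Longrightarrow> s \<in> grandchildren t \<Longrightarrow> s \<in> Th"
  unfolding uniform_refinement_grandchildren by blast

lemma tdet_Th: "s \<in> Th \<Longrightarrow> tdet s \<noteq> 0"
  by (erule Th_cases) (metis desc_tdet tdet_T)

lemma shape_Th: "s \<in> Th \<Longrightarrow> shape s \<le> \<kappa> * \<bar>tdet s\<bar>"
  by (erule Th_cases) (metis desc_shape shape_T tdet_T)

lemma finite_Th: "finite Th"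
  by (rule finite_uniform_refinement[OF finite_T])

lemma grandchildren_cover: "t \<in> T \<Longrightarrow> tri t \<subseteq> (\<Union>s\<in>grandchildren t. tri s)"
  using bisect2_cover[OF tdet_T] by (fastforce simp: grandchildren_def)

lemma cover_Th: "(\<Union>s\<in>Th. tri s) = closure D"
proof
  show "(\<Union>s\<in>Th. tri s) \<subseteq> closure D"
  proof
    fix x assume "x \<in> (\<Union>s\<in>Th. tri s)"
    then obtain s where s: "s \<in> Th" "x \<in> tri s" by blast
    obtain t where "t \<in> T" "desc t s" using Th_cases[OF s(1)] by metis
    then show "x \<in> closure D" using s desc_tri tri_closure by blast
  qed
  show "closure D \<subseteq> (\<Union>s\<in>Th. tri s)"
  proof
    fix x assume "x \<in> closure D"
    then obtain t where t: "t \<in> T" "x \<in> tri t" using cover_T by blast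
    then obtain s where "s \<in> grandchildren t" "x \<in> tri s" using grandchildren_cover[OF t(1)] by blast
    then show "x \<in> (\<Union>s\<in>Th. tri s)" using Th_I[OF t(1)] by blast
  qed
qed

lemma vertices_Th: "vertices Th = vertices T \<union> (\<Union>t\<in>T. midpoints t)"
proof
  show "vertices Th \<subseteq> vertices T \<union> (\<Union>t\<in>T. midpoints t)"
  proof
    fix v assume "v \<in> vertices Th"
    then obtain s where s: "s \<in> Th" "v \<in> verts s" by (auto simp: vertices_def)
    obtain t where t: "t \<in> T" "s \<in> grandchildren t" using Th_cases[OF s(1)] by metis
    then show "v \<in> vertices T \<union> (\<Union>t\<in>T. midpoints t)"
      using grandchild_verts[OF tdet_T[OF t(1)] t(2)] s(2) by (auto simp: vertices_def)
  qed
  have "v \<in> vertices Th \<and> midpoint v w \<in> vertices Th" if "t \<in> T" "v \<in> verts t" "w \<in> verts t" "v \<noteq> w" for t v w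
    using grandchild_edge[OF tdet_T[OF that(1)] that(2-4)] Th_I[OF that(1)] by (auto simp: vertices_def)
  moreover have "\<exists>w\<in>verts t. v \<noteq> w" if "t \<in> T" "v \<in> verts t" for t v
  proof -
    obtain p q r where tt: "t = (p, q, r)" by (cases t)
    have "p \<noteq> q" "q \<noteq> r" "p \<noteq> r" using tdet_distinct[of p q r] tdet_T[OF that(1)] by (auto simp only: tt)
    then show ?thesis using that(2) by (auto simp: tt)
  qed
  ultimately have "vertices T \<subseteq> vertices Th" "midpoints t \<subseteq> vertices Th" if "t \<in> T" for t
    using that unfolding vertices_def[of T] midpoints_def by blast+
  then show "vertices T \<union> (\<Union>t\<in>T. midpoints t) \<subseteq> vertices Th"
    unfolding vertices_def[of T] by blast
qed

abbreviation Np where "Np \<equiv> new_vertices D T"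

lemma Np_iff: "z \<in> Np \<longleftrightarrow> z \<in> vertices Th \<and> z \<notin> vertices T \<and> z \<notin> frontier D"
  by (auto simp: new_vertices_def)

lemma finite_vertices: "finite S \<Longrightarrow> finite (vertices S)"
  by (simp add: vertices_def)

lemma finite_Np: "finite Np"
  unfolding new_vertices_def using finite_vertices[OF finite_Th] by blast

lemma vertices_Th_closure: "z \<in> vertices Th \<Longrightarrow> z \<in> closure D"
proof -
  assume "z \<in> vertices Th"
  then obtain s where s: "s \<in> Th" "z \<in> verts s" unfolding vertices_def by blast
  then show ?thesis using cover_Th verts_tri[OF s(2)] by blast
qed

lemma Np_in_D: "z \<in> Np \<Longrightarrow> z \<in> D"
  using vertices_Th_closure open_D by (auto simp: Np_iff frontier_def interior_open)

text \<open>The intersection of two triangles is spanned by common vertices, so a triangle that meets the relative interior of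
  an edge contains the whole edge.\<close>

lemma edge_point_in_tri:
  assumes t: "t \<in> T" and uw: "u \<in> verts t" "w \<in> verts t" "u \<noteq> w" and s: "0 < s" "s < 1"
    and t': "t' \<in> T" and x: "(1 - s) *\<^sub>R u + s *\<^sub>R w \<in> tri t'"
  shows "u \<in> verts t'" "w \<in> verts t'"
proof -
  let ?x = "(1 - s) *\<^sub>R u + s *\<^sub>R w"
  note d = tdet_T[OF t]
  have xt: "?x \<in> tri t" by (rule convexD_alt[OF convex_tri verts_tri[OF uw(1)] verts_tri[OF uw(2)]]) (use s in auto)
  have hull: "?x \<in> convex hull (verts t \<inter> verts t')" using inter_T[OF t t'] xt x by blast
  have bu: "bary t u ?x = 1 - s"
    using bary_convex_comb[OF d uw(1), of s u w] bary_vertex[OF d uw(1) uw(1)] bary_vertex[OF d uw(1,2)] uw(3) by simp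
  have bw: "bary t w ?x = s"
    using bary_convex_comb[OF d uw(2), of s u w] bary_vertex[OF d uw(2) uw(2)] bary_vertex[OF d uw(2,1)] uw(3) by simp
  show "u \<in> verts t'"
  proof (rule ccontr)
    assume "u \<notin> verts t'"
    then show False using bary_zero_on_face[OF d uw(1) _ _ hull] bu s by simp
  qed
  show "w \<in> verts t'"
  proof (rule ccontr)
    assume "w \<notin> verts t'"
    then show False using bary_zero_on_face[OF d uw(2) _ _ hull] bw s by simp
  qed
qed

text \<open>Along an open edge the triangles that contain its points are the same. If they cover a neighbourhood of one
  point, translating and scaling shows that they cover a neighbourhood of every other point. Hence an
  edge lies either inside \<open>D\<close> or on its boundary, with the Lipschitz property excluding slits.\<close>

lemma edge_interior_in_D:
  assumes t: "t \<in> T" and uw: "u \<in> verts t" "w \<in> verts t" "u \<noteq> w" and s: "0 < s" "s < 1" and s': "0 < s'" "s' < 1"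
    and z: "(1 - s) *\<^sub>R u + s *\<^sub>R w \<in> D"
  shows "(1 - s') *\<^sub>R u + s' *\<^sub>R w \<in> D"
proof -
  define z x where "z = (1 - s) *\<^sub>R u + s *\<^sub>R w" and "x = (1 - s') *\<^sub>R u + s' *\<^sub>R w"
  have zD: "z \<in> D" unfolding z_def by (rule z)
  define A where "A = {t' \<in> T. z \<notin> tri t'}"
  have cl: "closed (\<Union>t'\<in>A. tri t')"
    by (rule closed_UN) (use finite_T closed_tri in \<open>simp_all add: A_def\<close>)
  have "open (D \<inter> - (\<Union>t'\<in>A. tri t'))" by (rule open_Int[OF open_D open_Compl[OF cl]])
  moreover have "z \<in> D \<inter> - (\<Union>t'\<in>A. tri t')" using zD by (auto simp: A_def)
  ultimately obtain \<epsilon> where \<epsilon>: "\<epsilon> > 0" "ball z \<epsilon> \<subseteq> D \<inter> - (\<Union>t'\<in>A. tri t')" by (rule openE)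
  define W where "W = {t' \<in> T. u \<in> verts t' \<and> w \<in> verts t'}"
  define P where "P = (\<Inter>t'\<in>W. {y. 0 < bary t' u y} \<inter> {y. 0 < bary t' w y})"
  have "open P" unfolding P_def
  proof (intro open_INT ballI open_Int)
    show "finite W" using finite_T by (simp add: W_def)
    fix t' assume "t' \<in> W"
    then have t': "tdet t' \<noteq> 0" "u \<in> verts t'" "w \<in> verts t'" using tdet_T by (auto simp: W_def)
    show "open {y. 0 < bary t' u y}" "open {y. 0 < bary t' w y}"
      by (intro open_Collect_less continuous_on_const bary_continuous t')+
  qed
  moreover have "x \<in> P"
    unfolding P_def
  proof (intro INT_I IntI CollectI)
    fix t' assume "t' \<in> W"
    then have t': "tdet t' \<noteq> 0" "u \<in> verts t'" "w \<in> verts t'" using tdet_T by (auto simp: W_def)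
    show "0 < bary t' u x"
      using bary_convex_comb[OF t'(1,2), of s' u w] bary_vertex[OF t'(1,2,2)] bary_vertex[OF t'] uw(3) s' by (simp add: x_def)
    show "0 < bary t' w x"
      using bary_convex_comb[OF t'(1,3), of s' u w] bary_vertex[OF t'(1,3,3)] bary_vertex[OF t'(1,3,2)] uw(3) s' by (simp add: x_def)
  qed
  ultimately obtain \<delta> where \<delta>: "\<delta> > 0" "ball x \<delta> \<subseteq> P" by (rule openE)
  have "ball x \<delta> \<subseteq> closure D"
  proof
    fix y assume y: "y \<in> ball x \<delta>"
    define \<mu> where "\<mu> = \<epsilon> / (2 * (\<delta> + \<epsilon>))"
    have \<mu>: "\<mu> > 0" using \<epsilon> \<delta> by (simp add: \<mu>_def)
    have "norm (\<mu> *\<^sub>R (y - x)) \<le> \<mu> * \<delta>" using y \<mu> by (simp add: dist_norm norm_minus_commute)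
    also have "\<mu> * \<delta> < \<epsilon>"
    proof -
      have "\<mu> * \<delta> \<le> \<mu> * (\<delta> + \<epsilon>)" using \<mu> \<epsilon> by (intro mult_left_mono) auto
      also have "\<dots> = \<epsilon> / 2" using \<epsilon> \<delta> by (simp add: \<mu>_def divide_simps)
      finally show ?thesis using \<epsilon> by simp
    qed
    finally have "z + \<mu> *\<^sub>R (y - x) \<in> ball z \<epsilon>" by (simp add: dist_norm)
    then have y': "z + \<mu> *\<^sub>R (y - x) \<in> D" "z + \<mu> *\<^sub>R (y - x) \<notin> (\<Union>t'\<in>A. tri t')" using \<epsilon>(2) by auto
    then obtain t' where t': "t' \<in> T" "z + \<mu> *\<^sub>R (y - x) \<in> tri t'"
      using cover_T closure_subset[of D] by blast
    then have zt': "z \<in> tri t'" using y'(2) unfolding A_def by blast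
    have uw': "u \<in> verts t'" "w \<in> verts t'"
      using edge_point_in_tri[OF t uw s t'(1)] zt' by (auto simp: z_def)
    have d': "tdet t' \<noteq> 0" by (rule tdet_T[OF t'(1)])
    have "y \<in> tri t'"
      unfolding tri_iff_bary[OF d']
    proof
      fix v assume v: "v \<in> verts t'"
      show "0 \<le> bary t' v y"
      proof (cases "v = u \<or> v = w")
        case True
        have "y \<in> P" using \<delta>(2) y by auto
        moreover have "t' \<in> W" using t'(1) uw' by (simp add: W_def)
        ultimately have "y \<in> {y. 0 < bary t' u y} \<inter> {y. 0 < bary t' w y}" unfolding P_def by (rule INT_D)
        then show ?thesis using True by auto
      next
        case False
        obtain g where g: "\<And>x. bary t' v x = g \<bullet> (x - v) + 1" using bary_affine[OF d' v] by metis
        have 0: "bary t' v u = 0" "bary t' v w = 0" using bary_vertex[OF d' v] uw' False by auto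
        have "bary t' v z = 0" "bary t' v x = 0"
          using bary_convex_comb[OF d' v, of _ u w] 0 by (simp_all add: z_def x_def)
        moreover have "0 \<le> bary t' v (z + \<mu> *\<^sub>R (y - x))" using t'(2) v unfolding tri_iff_bary[OF d'] by blast
        moreover have "bary t' v (z + \<mu> *\<^sub>R (y - x)) = bary t' v z + \<mu> * (bary t' v y - bary t' v x)"
          by (simp add: g inner_diff_right inner_add_right algebra_simps)
        ultimately show ?thesis using \<mu> by (simp add: zero_le_mult_iff)
      qed
    qed
    then show "y \<in> closure D" using tri_closure[OF t'(1)] by blast
  qed
  then have "x \<in> interior (closure D)" unfolding mem_interior using \<delta>(1) by blast
  then show ?thesis unfolding lipschitz_domain_interior_closure[OF lip_D] by (simp add: x_def)
qed

text \<open>Defines a function piecewise; the choice of the triangle is irrelevant once the pieces agree on common points.\<close>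

definition glue :: "(triangle \<Rightarrow> point \<Rightarrow> real) \<Rightarrow> point \<Rightarrow> real" where
  "glue f x = (if \<exists>t\<in>T. x \<in> tri t then f (SOME t. t \<in> T \<and> x \<in> tri t) x else 0)"

lemma glue_eq:
  assumes cons: "\<And>t t' x. t \<in> T \<Longrightarrow> t' \<in> T \<Longrightarrow> x \<in> tri t \<Longrightarrow> x \<in> tri t' \<Longrightarrow> f t x = f t' x"
    and t: "t \<in> T" "x \<in> tri t"
  shows "glue f x = f t x"
proof -
  define t0 where "t0 = (SOME t. t \<in> T \<and> x \<in> tri t)"
  have "t0 \<in> T \<and> x \<in> tri t0" unfolding t0_def
    by (rule someI[of "\<lambda>t. t \<in> T \<and> x \<in> tri t" t]) (use t in blast)
  then have "f t0 x = f t x" using cons[of t0 t x] t by blast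
  moreover have "glue f x = f t0 x" unfolding glue_def t0_def by (rule if_P) (use t in blast)
  ultimately show ?thesis by simp
qed

lemma glue_outside:
  assumes "x \<notin> closure D" shows "glue f x = 0"
proof -
  have "\<not> (\<exists>t\<in>T. x \<in> tri t)" using assms tri_closure by blast
  then show ?thesis unfolding glue_def by (rule if_not_P)
qed

lemma edge_hat_face:
  assumes t: "tdet t \<noteq> 0" and v: "v \<in> verts t" and x: "x \<in> tri t" "bary t v x = 0" and nz: "edge_hat t z x \<noteq> 0"
  obtains u w s where "u \<in> verts t" "w \<in> verts t" "u \<noteq> w" "0 < s" "s < 1"
    "x = (1 - s) *\<^sub>R u + s *\<^sub>R w" "z = midpoint u w" "u \<noteq> v" "w \<noteq> v"
proof -
  obtain u w where uw: "verts t = {v, u, w}" "u \<noteq> w" "u \<noteq> v" "w \<noteq> v"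
  proof -
    obtain p q r where tt: "t = (p, q, r)" by (cases t)
    have "p \<noteq> q \<and> q \<noteq> r \<and> p \<noteq> r" using tdet_distinct[of p q r] t by (simp add: tt)
    then show ?thesis using v that[of q r] that[of p r] that[of p q] unfolding tt by (simp add: insert_commute) blast
  qed
  have uwv: "u \<in> verts t" "w \<in> verts t" using uw by auto
  have sums: "(\<Sum>v'\<in>{v, u, w}. bary t v' x) = 1" "(\<Sum>v'\<in>{v, u, w}. bary t v' x *\<^sub>R v') = x"
    using bary_sum[OF t, of x] unfolding uw(1) by auto
  define s where "s = bary t w x"
  have 1: "bary t u x = 1 - s" using sums(1) uw x(2) by (simp add: s_def)
  have 2: "x = (1 - s) *\<^sub>R u + s *\<^sub>R w" using sums(2) uw x(2) 1 by (simp add: s_def)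
  have "0 \<le> bary t w x" "0 \<le> bary t u x" using x(1) uwv unfolding tri_iff_bary[OF t] by blast+
  then have s01: "0 \<le> s" "s \<le> 1" using 1 by (simp_all add: s_def)
  have eh: "edge_hat t z x = (if z = midpoint u w then 2 * min s (1 - s) else 0)"
    unfolding 2 by (rule edge_hat_edge[OF t uwv uw(2) s01])
  then have "z = midpoint u w" "min s (1 - s) \<noteq> 0" using nz by (auto split: if_splits)
  then have "z = midpoint u w" "0 < s" "s < 1" using s01 by (auto simp: min_def split: if_splits)
  then show ?thesis using that[of u w s] uw(2-4) uwv 2 by simp
qed

text \<open>Two different triangles meet in an edge, a vertex or not at all, and \<open>edge_hat_edge\<close> determines the values on
  an edge from the edge alone.\<close>

lemma edge_hat_consistent:
  assumes "t \<in> T" "t' \<in> T" "x \<in> tri t" "x \<in> tri t'"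
  shows "edge_hat t z x = edge_hat t' z x"
proof -
  have *: "edge_hat t z x = edge_hat t' z x"
    if t: "t \<in> T" "t' \<in> T" "x \<in> tri t" "x \<in> tri t'" and nz: "edge_hat t z x \<noteq> 0" for t t'
  proof (cases "t = t'")
    case False
    then have "verts t \<noteq> verts t'" using inj_T t by blast
    moreover have "card (verts s) = 3" if "s \<in> T" for s
      by (rule card_verts[OF tdet_T[OF that]])
    ultimately have "\<not> verts t \<subseteq> verts t'" using t(1,2) card_subset_eq[of "verts t'" "verts t"] by auto
    then obtain v where v: "v \<in> verts t" "v \<notin> verts t'" by blast
    have hull: "x \<in> convex hull (verts t \<inter> verts t')" using inter_T t by blast
    have "bary t v x = 0" using v by (intro bary_zero_on_face[OF tdet_T[OF t(1)] v(1) _ _ hull]) auto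
    then obtain u w s where uw: "u \<in> verts t" "w \<in> verts t" "u \<noteq> w" "0 < s" "s < 1"
      "x = (1 - s) *\<^sub>R u + s *\<^sub>R w" "z = midpoint u w"
      using edge_hat_face[OF tdet_T[OF t(1)] v(1) t(3) _ nz] by metis
    have "u \<in> verts t'" "w \<in> verts t'" using edge_point_in_tri[OF t(1) uw(1-5) t(2)] t(4) uw(6) by auto
    then show ?thesis
      using edge_hat_edge[OF tdet_T[OF t(1)] uw(1-3), of s z] edge_hat_edge[OF tdet_T[OF t(2)] _ _ uw(3), of s z] uw by simp
  qed simp
  show ?thesis
  proof (cases "edge_hat t z x = 0")
    case True
    then show ?thesis using *[of t' t] assms by (cases "edge_hat t' z x = 0") auto
  next
    case False
    then show ?thesis using *[of t t'] assms by auto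
  qed
qed

text \<open>The hat function of the refined mesh at a new vertex, assembled from the explicit pieces. It coincides with
  \<open>hat_fun\<close> by \<open>hat_fun_eq_ghat\<close>.\<close>

definition ghat :: "point \<Rightarrow> point \<Rightarrow> real" where
  "ghat z = glue (\<lambda>t. edge_hat t z)"

lemma ghat_eq: "t \<in> T \<Longrightarrow> x \<in> tri t \<Longrightarrow> ghat z x = edge_hat t z x"
  unfolding ghat_def by (rule glue_eq) (auto intro: edge_hat_consistent)

lemma ghat_affine_Th:
  assumes "s \<in> Th" shows "affine_fun_on (tri s) (ghat z)"
proof -
  obtain t where t: "t \<in> T" "s \<in> grandchildren t" "desc t s" using Th_cases[OF assms] by metis
  obtain c where c: "c \<in> bisect t" "s \<in> bisect c" using t(2) by (auto simp: grandchildren_def simp del: bisect.simps)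
  show ?thesis
    by (rule affine_fun_on_cong[OF edge_hat_affine_grandchild[OF tdet_T[OF t(1)] c]])
       (use ghat_eq[OF t(1)] desc_tri[OF t(3)] in blast)
qed

lemma ghat_vertex:
  assumes z: "z \<notin> vertices T" and v: "v \<in> vertices Th"
  shows "ghat z v = (if v = z then 1 else 0)"
proof -
  from v consider t where "t \<in> T" "v \<in> verts t" | t where "t \<in> T" "v \<in> midpoints t"
    unfolding vertices_Th by (auto simp: vertices_def)
  then show ?thesis
  proof cases
    case 1
    then have "v \<noteq> z" using z by (auto simp: vertices_def)
    then show ?thesis using ghat_eq[OF 1(1) verts_tri[OF 1(2)]] edge_hat_nodes(1)[OF tdet_T[OF 1(1)] 1(2)] by simp
  next
    case 2
    have "v \<in> tri t" using 2(2) midpoints_in_convex_hull[of _ "verts t"] by (auto simp: midpoints_def tri_def hull_inc)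
    then show ?thesis using ghat_eq[OF 2(1)] edge_hat_nodes(2)[OF tdet_T[OF 2(1)] 2(2)] by auto
  qed
qed

lemma verts_Th: "s \<in> Th \<Longrightarrow> v \<in> verts s \<Longrightarrow> v \<in> vertices Th"
  unfolding vertices_def by blast

text \<open>Nodal values one and zero determine the affine pieces.\<close>

lemma ghat_bary:
  assumes z: "z \<notin> vertices T" and s: "s \<in> Th" and x: "x \<in> tri s"
  shows "ghat z x = (if z \<in> verts s then bary s z x else 0)"
proof -
  have "ghat z x = (\<Sum>v\<in>verts s. bary s v x * ghat z v)"
    by (rule affine_fun_on_tri_repr[OF tdet_Th[OF s] ghat_affine_Th[OF s] x])
  also have "\<dots> = (\<Sum>v\<in>verts s. if v = z then bary s z x else 0)"
    by (rule sum.cong[OF HOL.refl]) (simp add: ghat_vertex[OF z verts_Th[OF s]])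
  finally show ?thesis by (simp add: sum.delta)
qed

lemma hat_fun_eq_ghat:
  assumes z: "z \<notin> vertices T" shows "hat_fun Th z = ghat z"
  unfolding hat_fun_def
proof (rule the_equality)
  show "(\<forall>t\<in>Th. affine_fun_on (tri t) (ghat z)) \<and> (\<forall>z'\<in>vertices Th. ghat z z' = (if z' = z then 1 else 0)) \<and>
      (\<forall>x. x \<notin> (\<Union>t\<in>Th. tri t) \<longrightarrow> ghat z x = 0)"
    using ghat_affine_Th ghat_vertex[OF z] glue_outside unfolding cover_Th ghat_def by auto
  fix v assume v: "(\<forall>t\<in>Th. affine_fun_on (tri t) v) \<and> (\<forall>z'\<in>vertices Th. v z' = (if z' = z then 1 else 0)) \<and>
      (\<forall>x. x \<notin> (\<Union>t\<in>Th. tri t) \<longrightarrow> v x = 0)"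
  show "v = ghat z"
  proof
    fix x show "v x = ghat z x"
    proof (cases "x \<in> closure D")
      case True
      then obtain s where s: "s \<in> Th" "x \<in> tri s" using cover_Th by blast
      have "v x = (\<Sum>w\<in>verts s. bary s w x * v w)"
        using v s by (intro affine_fun_on_tri_repr tdet_Th) auto
      also have "\<dots> = (\<Sum>w\<in>verts s. bary s w x * ghat z w)"
        by (rule sum.cong[OF HOL.refl]) (use v ghat_vertex[OF z verts_Th[OF s(1)]] verts_Th[OF s(1)] in simp)
      also have "\<dots> = ghat z x"
        by (rule affine_fun_on_tri_repr[OF tdet_Th[OF s(1)] ghat_affine_Th[OF s(1)] s(2), symmetric])
      finally show ?thesis .
    next
      case False
      then show ?thesis using v glue_outside[of x] unfolding cover_Th ghat_def by simp
    qed
  qed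
qed

lemma interior_tri_in_D: "s \<in> Th \<Longrightarrow> interior (tri s) \<subseteq> D"
  using interior_mono[of "tri s" "closure D"] cover_Th lipschitz_domain_interior_closure[OF lip_D] by blast

lemma interior_tri_T_in_D: "t \<in> T \<Longrightarrow> interior (tri t) \<subseteq> D"
  using interior_mono[OF tri_closure] lipschitz_domain_interior_closure[OF lip_D] by blast

lemma bary_pos_interior:
  assumes "tdet t \<noteq> 0" "\<And>v. v \<in> verts t \<Longrightarrow> 0 < bary t v x" shows "x \<in> interior (tri t)"
proof -
  have "open (\<Inter>v\<in>verts t. {x. 0 < bary t v x})"
    by (intro open_INT ballI open_Collect_less continuous_on_const bary_continuous assms) auto
  moreover have "(\<Inter>v\<in>verts t. {x. 0 < bary t v x}) \<subseteq> tri t"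
    using tri_iff_bary[OF assms(1)] by (auto simp: less_imp_le)
  ultimately show ?thesis using assms(2) interior_maximal by blast
qed

text \<open>A nonzero value at a boundary point would have to occur on the edge with midpoint \<open>z\<close>, which lies inside \<open>D\<close>
  because \<open>z\<close> does.\<close>

lemma ghat_zero_outside:
  assumes z: "z \<in> Np" and x: "x \<notin> D" shows "ghat z x = 0"
proof (cases "x \<in> closure D")
  case False
  then show ?thesis by (simp add: ghat_def glue_outside)
next
  case True
  then obtain t where t: "t \<in> T" "x \<in> tri t" using cover_T by blast
  note d = tdet_T[OF t(1)]
  show ?thesis
  proof (rule ccontr)
    assume "ghat z x \<noteq> 0"
    then have nz: "edge_hat t z x \<noteq> 0" using ghat_eq[OF t] by simp
    have "x \<notin> interior (tri t)" using interior_tri_T_in_D[OF t(1)] x by blast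
    then obtain v where v: "v \<in> verts t" "\<not> 0 < bary t v x" using bary_pos_interior[OF d] by blast
    then have "bary t v x = 0" using t(2) unfolding tri_iff_bary[OF d] by force
    then obtain u w s where uw: "u \<in> verts t" "w \<in> verts t" "u \<noteq> w" "0 < s" "s < 1"
      "x = (1 - s) *\<^sub>R u + s *\<^sub>R w" "z = midpoint u w"
      using edge_hat_face[OF d v(1) t(2) _ nz] by metis
    have half: "(1 - 1 / 2) *\<^sub>R u + (1 / 2) *\<^sub>R w \<in> D"
      using Np_in_D[OF z] uw(7) by (simp add: midpoint_def scaleR_add_right)
    have "x \<in> D" unfolding uw(6) by (rule edge_interior_in_D[OF t(1) uw(1-3) _ _ uw(4,5) half]) auto
    then show False using x by blast
  qed
qed

lemma ghat_nonneg: "0 \<le> ghat z x"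
proof (cases "x \<in> closure D")
  case True
  then obtain t where t: "t \<in> T" "x \<in> tri t" using cover_T by blast
  then show ?thesis using ghat_eq[OF t] edge_hat_nonneg[OF tdet_T[OF t(1)] t(2)] by simp
qed (simp add: ghat_def glue_outside)

lemma ghat_lipschitz:
  assumes z: "z \<in> Np" obtains M where "M-lipschitz_on UNIV (ghat z)"
proof -
  have "\<forall>s\<in>Th. \<exists>M. M-lipschitz_on (tri s) (ghat z)"
    using affine_fun_on_lipschitz[OF ghat_affine_Th] by metis
  then obtain M where M: "\<And>s. s \<in> Th \<Longrightarrow> (M s)-lipschitz_on (tri s) (ghat z)" by metis
  have M0: "0 \<le> M s" if "s \<in> Th" for s using M[OF that] by (rule lipschitz_on_nonneg)
  define U where "U i = (case i of Some s \<Rightarrow> tri s | None \<Rightarrow> - D)" for i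
  have "(\<Sum>s\<in>Th. M s)-lipschitz_on UNIV (ghat z)"
  proof (rule lipschitz_on_closed_cover[where I = "insert None (Some ` Th)" and U = U])
    show "finite (insert None (Some ` Th))" using finite_Th by simp
    show "closed (U i)" if "i \<in> insert None (Some ` Th)" for i
      using that closed_tri open_D by (auto simp: U_def)
    show nn: "0 \<le> (\<Sum>s\<in>Th. M s)" using M0 by (rule sum_nonneg)
    show "(\<Sum>s\<in>Th. M s)-lipschitz_on (U i) (ghat z)" if "i \<in> insert None (Some ` Th)" for i
    proof (cases i)
      case None
      then show ?thesis using ghat_zero_outside[OF z] nn by (auto simp: U_def lipschitz_on_def)
    next
      case (Some s)
      then have s: "s \<in> Th" using that by auto
      have "M s \<le> (\<Sum>s\<in>Th. M s)" using M0 finite_Th s by (intro member_le_sum) auto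
      then show ?thesis using lipschitz_on_le[OF M[OF s]] Some by (simp add: U_def)
    qed
    show "(\<Union>i\<in>insert None (Some ` Th). U i) = UNIV"
      using cover_Th closure_subset[of D] by (auto simp: U_def)
  qed
  then show ?thesis by (rule that)
qed

lemma AE_interior_Th: "AE x in lborel. x \<in> D \<longrightarrow> (\<exists>s\<in>Th. x \<in> interior (tri s))"
proof -
  have "AE x in lborel. x \<notin> frontier (tri s)" for s
  proof -
    have "frontier (tri s) \<in> null_sets lebesgue"
      using negligible_convex_frontier[OF convex_tri] by (simp add: negligible_iff_null_sets)
    then have "AE x in lebesgue. x \<notin> frontier (tri s)" by (rule AE_not_in)
    then show ?thesis by (simp add: AE_completion_iff)
  qed
  then have "AE x in lborel. \<forall>s\<in>Th. x \<notin> frontier (tri s)" using finite_Th by (simp add: AE_finite_all)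
  then show ?thesis
  proof eventually_elim
    case (elim x)
    show ?case
    proof
      assume "x \<in> D"
      then obtain s where s: "s \<in> Th" "x \<in> tri s" using cover_Th closure_subset[of D] by blast
      then have "x \<in> interior (tri s)" using elim closed_tri by (auto simp: frontier_def)
      then show "\<exists>s\<in>Th. x \<in> interior (tri s)" using s by blast
    qed
  qed
qed

text \<open>The hat function is Lipschitz, nonnegative, zero off \<open>D\<close> and affine near every point off the edges, which is a null
  set; so truncation and mollification apply.\<close>

lemma ghat_H10:
  assumes z: "z \<in> Np" shows "ghat z \<in> H10 D"
proof -
  obtain M where M: "M-lipschitz_on UNIV (ghat z)" using ghat_lipschitz[OF z] by metis
  define O' where "O' = (\<Union>s\<in>Th. interior (tri s))"
  define g where "g x = (if x \<in> O' then cgrad (ghat z) x else 0)" for x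
  have loc: "\<exists>G. \<forall>x\<in>interior (tri s). g x = G \<and> (\<exists>r>0. \<forall>y\<in>ball x r. ghat z y = ghat z x + G \<bullet> (y - x))" if s: "s \<in> Th" for s
  proof -
    have "\<exists>g c. \<forall>x\<in>tri s. ghat z x = g \<bullet> x + c"
      using ghat_affine_Th[OF s, of z] by (simp only: affine_fun_on_def)
    then obtain G c where G: "\<And>x. x \<in> tri s \<Longrightarrow> ghat z x = G \<bullet> x + c" by blast
    have "g x = G \<and> (\<exists>r>0. \<forall>y\<in>ball x r. ghat z y = ghat z x + G \<bullet> (y - x))" if x: "x \<in> interior (tri s)" for x
    proof
      have "((\<lambda>x. G \<bullet> x + c) has_derivative (\<lambda>h. G \<bullet> h)) (at x)" by (auto intro!: derivative_eq_intros)
      then have "(ghat z has_derivative (\<lambda>h. G \<bullet> h)) (at x)"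
        by (rule has_derivative_transform_within_open[OF _ open_interior x]) (use G interior_subset in force)
      then have "cgrad (ghat z) x = G" by (simp add: cgrad_def vec_eq_iff partial_eqI inner_axis)
      then show "g x = G" using x s by (auto simp: g_def O'_def)
      obtain r where r: "r > 0" "ball x r \<subseteq> tri s" using x by (auto simp: mem_interior)
      have "ghat z y = ghat z x + G \<bullet> (y - x)" if "y \<in> ball x r" for y
      proof -
        have "y \<in> tri s" "x \<in> tri s" using r that by auto
        then show ?thesis using G[of y] G[of x] by (simp add: inner_diff_right)
      qed
      then show "\<exists>r>0. \<forall>y\<in>ball x r. ghat z y = ghat z x + G \<bullet> (y - x)" using r by blast
    qed
    then show ?thesis by blast
  qed
  show ?thesis
  proof (rule H10_of_locally_affine(1)[OF M ghat_nonneg ghat_zero_outside[OF z]])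
    show "g \<in> borel_measurable borel"
    proof (rule measurable_piecewise_restrict[where C = "insert (- O') ((\<lambda>s. interior (tri s)) ` Th)"])
      show "countable (insert (- O') ((\<lambda>s. interior (tri s)) ` Th))" using finite_Th by (simp add: countable_finite)
      fix \<Omega> assume \<Omega>: "\<Omega> \<in> insert (- O') ((\<lambda>s. interior (tri s)) ` Th)"
      have "open O'" by (auto simp: O'_def)
      then show "\<Omega> \<inter> space borel \<in> sets borel" using \<Omega> by auto
      have "\<exists>G. \<forall>x\<in>\<Omega>. g x = G" using \<Omega>
      proof
        assume "\<Omega> = - O'" then show ?thesis by (auto simp: g_def)
      next
        assume "\<Omega> \<in> (\<lambda>s. interior (tri s)) ` Th" then show ?thesis using loc by blast
      qed
      then obtain G where G: "\<And>x. x \<in> \<Omega> \<Longrightarrow> g x = G" by blast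
      have "(\<lambda>_. G) \<in> borel_measurable (restrict_space borel \<Omega>)" by simp
      then show "g \<in> borel_measurable (restrict_space borel \<Omega>)"
        by (rule measurable_cong[THEN iffD1, rotated]) (auto simp: G space_restrict_space)
    qed (auto simp: O'_def)
    show "AE x in lborel. x \<in> D \<longrightarrow> (\<exists>r>0. \<forall>y\<in>ball x r. ghat z y = ghat z x + g x \<bullet> (y - x))"
      using AE_interior_Th
    proof eventually_elim
      case (elim x)
      show ?case
      proof
        assume "x \<in> D"
        then obtain s where s: "s \<in> Th" "x \<in> interior (tri s)" using elim by blast
        obtain G where G: "\<forall>x\<in>interior (tri s). g x = G \<and> (\<exists>r>0. \<forall>y\<in>ball x r. ghat z y = ghat z x + G \<bullet> (y - x))"
          using loc[OF s(1)] by (rule exE)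
        note bspec[OF G s(2)]
        then have "g x = G" "\<exists>r>0. \<forall>y\<in>ball x r. ghat z y = ghat z x + G \<bullet> (y - x)" by (rule conjunct1, rule conjunct2)
        then show "\<exists>r>0. \<forall>y\<in>ball x r. ghat z y = ghat z x + g x \<bullet> (y - x)" by (simp only:)
      qed
    qed
  qed
qed

lemma ghat_S10_Th: "z \<in> Np \<Longrightarrow> ghat z \<in> S10 D Th"
  by (simp add: S10_def ghat_H10 ghat_affine_Th)

end

section \<open>Splitting of refined finite element functions\<close>

lemma affine_gradient_unique:
  assumes s: "tdet s \<noteq> 0" and eq: "\<And>x. x \<in> tri s \<Longrightarrow> G \<bullet> x + c = G' \<bullet> x + c'"
  shows "G = G'"
proof -
  obtain p q r where t: "s = (p, q, r)" by (cases s)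
  have v: "p \<in> tri s" "q \<in> tri s" "r \<in> tri s" by (auto simp: t intro: verts_tri)
  define a u w where "a = G - G'" and "u = q - p" and "w = r - p"
  have "a \<bullet> u = 0" "a \<bullet> w = 0"
    using eq[OF v(1)] eq[OF v(2)] eq[OF v(3)]
    by (simp_all add: a_def u_def w_def inner_diff_left inner_diff_right)
  then have e: "a $ 1 * u $ 1 + a $ 2 * u $ 2 = 0" "a $ 1 * w $ 1 + a $ 2 * w $ 2 = 0"
    by (simp_all add: inner_2)
  have d: "u $ 1 * w $ 2 - u $ 2 * w $ 1 \<noteq> 0" using s by (simp add: t det2_def u_def w_def)
  have "a $ 1 * (u $ 1 * w $ 2 - u $ 2 * w $ 1) = (a $ 1 * u $ 1 + a $ 2 * u $ 2) * w $ 2 - (a $ 1 * w $ 1 + a $ 2 * w $ 2) * u $ 2"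
    by (simp add: algebra_simps)
  then have "a $ 1 = 0" using e d by simp
  moreover have "a $ 2 * (u $ 1 * w $ 2 - u $ 2 * w $ 1) = (a $ 1 * w $ 1 + a $ 2 * w $ 2) * u $ 1 - (a $ 1 * u $ 1 + a $ 2 * u $ 2) * w $ 1"
    by (simp add: algebra_simps)
  then have "a $ 2 = 0" using e d by simp
  ultimately have "a = 0" by (simp add: vec_eq_iff forall_2)
  then show ?thesis by (simp add: a_def)
qed

text \<open>The gradient of a barycentric coordinate has the length of the reciprocal height.\<close>

lemma bary_gradient_bound:
  assumes s: "tdet s \<noteq> 0" and v: "v \<in> verts s"
  shows "\<exists>g. (\<forall>x. bary s v x = g \<bullet> (x - v) + 1) \<and> (norm g)\<^sup>2 \<le> 2 * shape s / (tdet s)\<^sup>2"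
proof -
  obtain p q r where t: "s = (p, q, r)" by (cases s)
  have d: "det2 (q - p) (r - p) \<noteq> 0" "det2 (r - q) (p - q) \<noteq> 0" "det2 (p - r) (q - r) \<noteq> 0"
    using s by (simp_all add: t det2_cyclic)
  have dd: "p \<noteq> q" "q \<noteq> r" "p \<noteq> r" using tdet_distinct[of p q r] s by (auto simp only: t)
  have b: "(norm (bgrad p q r))\<^sup>2 \<le> 2 * shape s / (tdet s)\<^sup>2" "(norm (bgrad q r p))\<^sup>2 \<le> 2 * shape s / (tdet s)\<^sup>2"
    "(norm (bgrad r p q))\<^sup>2 \<le> 2 * shape s / (tdet s)\<^sup>2"
  proof -
    have e: "(dist q r)\<^sup>2 \<le> 2 * shape s" "(dist r p)\<^sup>2 \<le> 2 * shape s" "(dist p q)\<^sup>2 \<le> 2 * shape s"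
      by (rule dist_sq_le_shape; simp add: t)+
    have dc: "det2 (q - p) (r - p) = tdet s" "det2 (r - q) (p - q) = tdet s" "det2 (p - r) (q - r) = tdet s"
      unfolding t tdet.simps by (rule HOL.refl det2_cyclic)+
    show "(norm (bgrad p q r))\<^sup>2 \<le> 2 * shape s / (tdet s)\<^sup>2" "(norm (bgrad q r p))\<^sup>2 \<le> 2 * shape s / (tdet s)\<^sup>2"
      "(norm (bgrad r p q))\<^sup>2 \<le> 2 * shape s / (tdet s)\<^sup>2"
      unfolding bgrad_norm dc using e by (auto intro!: divide_right_mono simp del: shape.simps)
  qed
  have "v = p \<or> v = q \<or> v = r" using v by (simp add: t)
  then show ?thesis
  proof (elim disjE)
    assume "v = p"
    then show ?thesis using b(1) bcoef_affine[OF d(1)] by (intro exI[of _ "bgrad p q r"]) (simp add: t)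
  next
    assume "v = q"
    then show ?thesis using b(2) bcoef_affine[OF d(2)] dd by (intro exI[of _ "bgrad q r p"]) (simp add: t)
  next
    assume "v = r"
    then show ?thesis using b(3) bcoef_affine[OF d(3)] dd by (intro exI[of _ "bgrad r p q"]) (simp add: t)
  qed
qed

lemma bary_affine_UNIV: "tdet t \<noteq> 0 \<Longrightarrow> v \<in> verts t \<Longrightarrow> affine_fun_on UNIV (bary t v)"
proof -
  assume a: "tdet t \<noteq> 0" "v \<in> verts t"
  obtain g where g: "\<And>x. bary t v x = g \<bullet> (x - v) + 1" using bary_affine[OF a] by metis
  have "bary t v x = g \<bullet> x + (1 - g \<bullet> v)" for x using g[of x] by (simp add: inner_diff_right)
  then show ?thesis unfolding affine_fun_on_def by blast
qed

lemma affine_fun_on_agree_hull: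
  assumes "affine_fun_on UNIV f" "affine_fun_on UNIV h" "\<And>v. v \<in> V \<Longrightarrow> f v = h v" "x \<in> convex hull V"
  shows "f x = h x"
proof -
  obtain g c where f: "\<And>x. f x = g \<bullet> x + c" using assms(1) by (auto simp: affine_fun_on_def)
  obtain g' c' where h: "\<And>x. h x = g' \<bullet> x + c'" using assms(2) by (auto simp: affine_fun_on_def)
  have "convex hull V \<subseteq> {x. (g - g') \<bullet> x = c' - c}"
  proof (rule hull_minimal)
    show "V \<subseteq> {x. (g - g') \<bullet> x = c' - c}"
      using assms(3) by (auto simp: f h inner_diff_left algebra_simps)
  qed (rule convex_hyperplane)
  then have "(g - g') \<bullet> x = c' - c" using assms(4) by blast
  then show ?thesis by (simp add: f h inner_diff_left)
qed

lemma affine_fun_on_agree_tri: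
  assumes s: "tdet s \<noteq> 0" and "affine_fun_on (tri s) f" "affine_fun_on (tri s) h"
    and eq: "\<And>v. v \<in> verts s \<Longrightarrow> f v = h v" and x: "x \<in> tri s"
  shows "f x = h x"
proof -
  have "f x = (\<Sum>v\<in>verts s. bary s v x * f v)" by (rule affine_fun_on_tri_repr[OF s assms(2) x])
  also have "\<dots> = (\<Sum>v\<in>verts s. bary s v x * h v)" by (rule sum.cong[OF HOL.refl]) (simp add: eq)
  also have "\<dots> = h x" by (rule affine_fun_on_tri_repr[OF s assms(3) x, symmetric])
  finally show ?thesis .
qed

lemma affine_fun_on_midpoint:
  assumes "affine_fun_on S f" "u \<in> S" "w \<in> S" "midpoint u w \<in> S"
  shows "f (midpoint u w) = (f u + f w) / 2"
proof -
  obtain g c where f: "\<forall>x\<in>S. f x = g \<bullet> x + c" using assms(1) by (auto simp: affine_fun_on_def)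
  have "f (midpoint u w) = g \<bullet> midpoint u w + c" "f u = g \<bullet> u + c" "f w = g \<bullet> w + c" using f assms by blast+
  then show ?thesis by (simp add: midpoint_def inner_add_right)
qed

lemma midpoints_in_tri: "z \<in> midpoints t \<Longrightarrow> z \<in> tri t"
  using midpoints_in_convex_hull[of _ "verts t"] by (auto simp: midpoints_def tri_def hull_inc)

lemma subspace_S10:
  assumes "planar_domain D" shows "subspace (S10 D T)"
proof -
  interpret planar_domain D by (rule assms)
  show ?thesis
    unfolding subspace_def
  proof (intro conjI ballI allI)
    show "0 \<in> S10 D T" using subspace_0[OF subspace_H10]
      by (auto simp: S10_def affine_fun_on_def intro!: exI[of _ 0])
    show "v + w \<in> S10 D T" if "v \<in> S10 D T" "w \<in> S10 D T" for v w
    proof -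
      have "affine_fun_on (tri t) (v + w)" if t: "t \<in> T" for t
      proof -
        obtain g c g' c' where "\<forall>x\<in>tri t. v x = g \<bullet> x + c" "\<forall>x\<in>tri t. w x = g' \<bullet> x + c'"
          using \<open>v \<in> S10 D T\<close> \<open>w \<in> S10 D T\<close> t unfolding S10_def affine_fun_on_def by blast
        then have "\<forall>x\<in>tri t. (v + w) x = (g + g') \<bullet> x + (c + c')" by (simp add: inner_add_left)
        then show ?thesis unfolding affine_fun_on_def by blast
      qed
      then show ?thesis using that subspace_add[OF subspace_H10] by (simp add: S10_def)
    qed
    show "k *\<^sub>R v \<in> S10 D T" if "v \<in> S10 D T" for k v
    proof -
      have "affine_fun_on (tri t) (k *\<^sub>R v)" if t: "t \<in> T" for t
      proof -
        obtain g c where "\<forall>x\<in>tri t. v x = g \<bullet> x + c"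
          using \<open>v \<in> S10 D T\<close> t unfolding S10_def affine_fun_on_def by blast
        then have "\<forall>x\<in>tri t. (k *\<^sub>R v) x = (k *\<^sub>R g) \<bullet> x + (k * c)" by (simp add: distrib_left)
        then show ?thesis unfolding affine_fun_on_def by blast
      qed
      then show ?thesis using that subspace_scale[OF subspace_H10] by (simp add: S10_def)
    qed
  qed
qed

lemma (in planar_domain) grad_sum:
  assumes "finite I" "\<And>i. i \<in> I \<Longrightarrow> f i \<in> H1 D"
  shows "AE x in lebesgue_on D. grad D (\<Sum>i\<in>I. c i *\<^sub>R f i) x = (\<Sum>i\<in>I. c i *\<^sub>R grad D (f i) x)"
  using assms
proof (induction I)
  case empty
  have "AE x in lebesgue_on D. grad D (0 *\<^sub>R 0) x = 0 *\<^sub>R grad D 0 x"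
    by (rule grad_scale[OF subspace_0[OF subspace_H1]])
  then have "AE x in lebesgue_on D. grad D 0 x = 0" by simp
  then show ?case unfolding sum.empty .
next
  case (insert i I)
  have f: "f i \<in> H1 D" and s: "(\<Sum>i\<in>I. c i *\<^sub>R f i) \<in> H1 D"
    using insert.prems by (auto intro!: subspace_sum[OF subspace_H1] subspace_scale[OF subspace_H1])
  have "AE x in lebesgue_on D. grad D (\<Sum>i\<in>I. c i *\<^sub>R f i) x = (\<Sum>i\<in>I. c i *\<^sub>R grad D (f i) x)"
    by (rule insert.IH) (use insert.prems in auto)
  moreover have "AE x in lebesgue_on D. grad D (c i *\<^sub>R f i + (\<Sum>i\<in>I. c i *\<^sub>R f i)) x = grad D (c i *\<^sub>R f i) x + grad D (\<Sum>i\<in>I. c i *\<^sub>R f i) x"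
    by (rule grad_add[OF subspace_scale[OF subspace_H1 f] s])
  moreover have "AE x in lebesgue_on D. grad D (c i *\<^sub>R f i) x = c i *\<^sub>R grad D (f i) x" by (rule grad_scale[OF f])
  ultimately show ?case
    unfolding sum.insert[OF insert.hyps] by eventually_elim (simp only:)
qed

context mesh
begin

lemma S10_Th_H1: "v \<in> S10 D Th \<Longrightarrow> v \<in> H1 D"
  by (simp add: S10_def H10_H1)

lemma S10_Th_affine: "v \<in> S10 D Th \<Longrightarrow> s \<in> Th \<Longrightarrow> affine_fun_on (tri s) v"
  by (simp add: S10_def)

text \<open>The constant gradient of \<open>v\<close> on the triangle \<open>s\<close>.\<close>

definition gcoef :: "(point \<Rightarrow> real) \<Rightarrow> triangle \<Rightarrow> point" where
  "gcoef v s = (SOME G. \<exists>c. \<forall>x\<in>tri s. v x = G \<bullet> x + c)"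

lemma gcoef:
  assumes "affine_fun_on (tri s) v" obtains c where "\<And>x. x \<in> tri s \<Longrightarrow> v x = gcoef v s \<bullet> x + c"
proof -
  have "\<exists>c. \<forall>x\<in>tri s. v x = gcoef v s \<bullet> x + c"
    unfolding gcoef_def by (rule someI_ex) (use assms in \<open>simp only: affine_fun_on_def\<close>)
  then show ?thesis using that by blast
qed

lemma gcoef_eq:
  assumes "tdet s \<noteq> 0" "\<And>x. x \<in> tri s \<Longrightarrow> v x = G \<bullet> x + c" shows "gcoef v s = G"
proof -
  have "affine_fun_on (tri s) v" using assms(2) unfolding affine_fun_on_def by blast
  then obtain c' where "\<And>x. x \<in> tri s \<Longrightarrow> v x = gcoef v s \<bullet> x + c'" using gcoef by blast
  then have "\<And>x. x \<in> tri s \<Longrightarrow> gcoef v s \<bullet> x + c' = G \<bullet> x + c" using assms(2) by simp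
  then show ?thesis by (rule affine_gradient_unique[OF assms(1)])
qed

lemma grad_S10:
  assumes v: "v \<in> S10 D Th"
  shows "AE x in lebesgue_on D. \<forall>s\<in>Th. x \<in> interior (tri s) \<longrightarrow> grad D v x = gcoef v s"
proof -
  have "AE x in lebesgue_on D. x \<in> interior (tri s) \<longrightarrow> grad D v x = gcoef v s" if s: "s \<in> Th" for s
  proof -
    obtain c where c: "\<And>x. x \<in> tri s \<Longrightarrow> v x = gcoef v s \<bullet> x + c" using gcoef[OF S10_Th_affine[OF v s]] by blast
    show ?thesis
      by (rule grad_affine_on[OF S10_Th_H1[OF v] open_interior interior_tri_in_D[OF s], where c = c])
         (use c interior_subset in blast)
  qed
  then show ?thesis using finite_Th by (simp add: AE_finite_all)
qed

lemma AE_D_interior: "AE x in lebesgue_on D. \<exists>s\<in>Th. x \<in> interior (tri s)"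
  by (rule AE_D_I[OF AE_interior_Th])

text \<open>The gradient takes finitely many values, hence is bounded, and the function is continuous on the closure of \<open>D\<close>.\<close>

lemma S10_boundary:
  assumes v: "v \<in> S10 D Th" and x: "x \<in> frontier D" shows "v x = 0"
proof (rule H10_boundary_value[OF lip_D _ _ x])
  show "v \<in> H10 D" using v by (simp add: S10_def)
  show "AE x in lebesgue_on D. norm (grad D v x) \<le> (\<Sum>s\<in>Th. norm (gcoef v s))"
    using grad_S10[OF v] AE_D_interior
  proof eventually_elim
    case (elim x)
    then obtain s where s: "s \<in> Th" "x \<in> interior (tri s)" by blast
    then have "grad D v x = gcoef v s" using elim(1) by blast
    then show ?case using finite_Th s(1) by (auto intro!: member_le_sum)
  qed
  have "continuous_on (tri s) v" if "s \<in> Th" for s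
    using affine_fun_on_lipschitz[OF S10_Th_affine[OF v that]] lipschitz_on_continuous_on by metis
  then have "continuous_on (\<Union>s\<in>Th. tri s) v"
    by (intro continuous_on_closed_Union finite_Th closed_tri) auto
  then show "continuous_on (closure D) v" by (simp only: cover_Th)
qed

text \<open>The Dirichlet energy of \<open>v\<close> on \<open>s\<close>: the squared gradient times the area.\<close>

definition en :: "(point \<Rightarrow> real) \<Rightarrow> triangle \<Rightarrow> real" where
  "en v s = (norm (gcoef v s))\<^sup>2 * (\<bar>tdet s\<bar> / 2)"

lemma kappa_nonneg: "s \<in> Th \<Longrightarrow> 0 \<le> \<kappa>"
proof -
  assume s: "s \<in> Th"
  have "0 \<le> shape s" by (cases s) simp
  then have "0 \<le> \<kappa> * \<bar>tdet s\<bar>" using shape_Th[OF s] by linarith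
  then show ?thesis using tdet_Th[OF s] by (simp add: zero_le_mult_iff)
qed

lemma ghat_gcoef_zero:
  assumes "z \<notin> vertices T" "s \<in> Th" "z \<notin> verts s" shows "gcoef (ghat z) s = 0"
  by (rule gcoef_eq[OF tdet_Th[OF assms(2)], where c = 0]) (simp add: ghat_bary[OF assms(1,2)] assms(3))

text \<open>In two dimensions the energy of a hat function is invariant under scaling, so it depends on the shape only.\<close>

lemma ghat_en:
  assumes z: "z \<notin> vertices T" and s: "s \<in> Th" shows "en (ghat z) s \<le> \<kappa>"
proof (cases "z \<in> verts s")
  case True
  note d = tdet_Th[OF s]
  obtain g where g: "\<And>x. bary s z x = g \<bullet> (x - z) + 1" "(norm g)\<^sup>2 \<le> 2 * shape s / (tdet s)\<^sup>2"
    using bary_gradient_bound[OF d True] by blast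
  have G: "gcoef (ghat z) s = g"
    by (rule gcoef_eq[OF d, where c = "1 - g \<bullet> z"]) (simp add: ghat_bary[OF z s] True g(1) inner_diff_right)
  have "en (ghat z) s \<le> (2 * shape s / (tdet s)\<^sup>2) * (\<bar>tdet s\<bar> / 2)"
    unfolding en_def G by (rule mult_right_mono[OF g(2)]) simp
  also have "\<dots> = shape s / \<bar>tdet s\<bar>" using d by (simp add: power2_eq_square abs_if divide_simps)
  also have "\<dots> \<le> \<kappa>" using shape_Th[OF s] d by (simp add: pos_divide_le_eq)
  finally show ?thesis .
next
  case False
  then show ?thesis using ghat_gcoef_zero[OF z s] kappa_nonneg[OF s] by (simp add: en_def)
qed

text \<open>Differences of nodal values are controlled by the energy, again without a power of the mesh size.\<close>

lemma difference_le_en: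
  assumes v: "affine_fun_on (tri s) v" and s: "s \<in> Th" and uw: "u \<in> verts s" "w \<in> verts s"
  shows "(v u - v w)\<^sup>2 \<le> 4 * \<kappa> * en v s"
proof -
  obtain c where c: "\<And>x. x \<in> tri s \<Longrightarrow> v x = gcoef v s \<bullet> x + c" using gcoef[OF v] by blast
  let ?G = "gcoef v s"
  have "v u - v w = ?G \<bullet> (u - w)" using c verts_tri uw by (simp add: inner_diff_right)
  then have "\<bar>v u - v w\<bar> \<le> norm ?G * dist u w" using Cauchy_Schwarz_ineq2[of ?G "u - w"] by (simp add: dist_norm)
  then have "\<bar>v u - v w\<bar>\<^sup>2 \<le> (norm ?G * dist u w)\<^sup>2" by (rule power_mono) simp
  then have "(v u - v w)\<^sup>2 \<le> (norm ?G)\<^sup>2 * (dist u w)\<^sup>2" by (simp add: power_mult_distrib)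
  also have "\<dots> \<le> (norm ?G)\<^sup>2 * (2 * (\<kappa> * \<bar>tdet s\<bar>))"
    using dist_sq_le_shape[OF uw] shape_Th[OF s] by (intro mult_left_mono) auto
  also have "\<dots> = 4 * \<kappa> * en v s" by (simp add: en_def)
  finally show ?thesis .
qed

definition energy_on :: "point set \<Rightarrow> (point \<Rightarrow> real) \<Rightarrow> real" where
  "energy_on A v = (\<integral>x. indicator A x * (grad D v x \<bullet> grad D v x) \<partial>lebesgue_on D)"

lemma energy_integrable:
  assumes "v \<in> H1 D" "A \<in> sets lebesgue"
  shows "integrable (lebesgue_on D) (\<lambda>x. indicator A x * (grad D v x \<bullet> grad D v x))"
proof -
  have "integrable (lebesgue_on D) (\<lambda>x. grad D v x \<bullet> grad D v x)"
    using dform_integrable[OF const_Linf[of 1] assms(1) assms(1)] by simp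
  moreover have "A \<inter> D \<in> sets (lebesgue_on D)" using assms(2) by (auto simp: sets_restrict_space)
  ultimately have "integrable (lebesgue_on D) (\<lambda>x. (grad D v x \<bullet> grad D v x) * indicator (A \<inter> D) x)"
    by (rule integrable_real_mult_indicator[rotated])
  then show ?thesis
    by (rule Bochner_Integration.integrable_cong[THEN iffD1, rotated 2]) (auto simp: indicator_def)
qed

lemma tri_lebesgue: "tri s \<in> sets lebesgue"
  using borel_closed[OF closed_tri] by auto

lemma energy_on_mono:
  assumes "v \<in> H1 D" "A \<in> sets lebesgue" "A' \<in> sets lebesgue" "A \<subseteq> A'"
  shows "energy_on A v \<le> energy_on A' v"
  unfolding energy_on_def
  by (rule integral_mono[OF energy_integrable[OF assms(1,2)] energy_integrable[OF assms(1,3)]])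
     (use assms(4) in \<open>auto simp: indicator_def\<close>)

lemma energy_on_tri:
  assumes v: "v \<in> S10 D Th" and s: "s \<in> Th"
  shows "energy_on (tri s) v = en v s"
proof -
  let ?c = "(norm (gcoef v s))\<^sup>2"
  have fr: "AE x in lebesgue_on D. x \<notin> frontier (tri s)"
    unfolding AE_D using AE_not_in[of "frontier (tri s)" lebesgue] negligible_convex_frontier[OF convex_tri]
    by (auto simp: negligible_iff_null_sets elim: eventually_mono)
  have "energy_on (tri s) v = (\<integral>x. ?c * indicator (interior (tri s)) x \<partial>lebesgue_on D)"
    unfolding energy_on_def
  proof (rule integral_cong_AE)
    show "AE x in lebesgue_on D. indicator (tri s) x * (grad D v x \<bullet> grad D v x) = ?c * indicator (interior (tri s)) x"
      using grad_S10[OF v] fr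
    proof eventually_elim
      case (elim x)
      show ?case
      proof (cases "x \<in> interior (tri s)")
        case True
        then have "grad D v x = gcoef v s" using elim(1) s by blast
        moreover have "x \<in> tri s" using True interior_subset by blast
        ultimately show ?thesis using True by (simp add: dot_square_norm)
      next
        case False
        then have "x \<notin> tri s" using elim(2) closed_tri by (auto simp: frontier_def)
        then show ?thesis using False by simp
      qed
    qed
    show "(\<lambda>x. indicator (tri s) x * (grad D v x \<bullet> grad D v x)) \<in> borel_measurable (lebesgue_on D)"
      by (rule borel_measurable_integrable[OF energy_integrable[OF S10_Th_H1[OF v] tri_lebesgue]])
    show "(\<lambda>x. ?c * indicator (interior (tri s)) x) \<in> borel_measurable (lebesgue_on D)"
      by (intro borel_imp_lebesgue_on_measurable) auto
  qed
  also have "\<dots> = ?c * measure (lebesgue_on D) (interior (tri s) \<inter> D)"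
    by (simp add: space_restrict_space)
  also have "interior (tri s) \<inter> D = interior (tri s)" using interior_tri_in_D[OF s] by blast
  also have "measure (lebesgue_on D) (interior (tri s)) = measure lebesgue (interior (tri s))"
    by (rule measure_restrict_space) (use interior_tri_in_D[OF s] in auto)
  also have "\<dots> = measure lebesgue (tri s)"
    by (rule measure_interior[OF compact_imp_bounded[OF compact_tri] negligible_convex_frontier[OF convex_tri]])
  finally show ?thesis by (simp add: content_tri en_def)
qed

text \<open>The energy of a hat function is bounded by \<open>\<kappa>\<close> times the number of refined triangles at its vertex, counted through their
  parents.\<close>

lemma ghat_energy:
  assumes z: "z \<in> Np"
  shows "dform (\<lambda>_. 1) (ghat z) (ghat z) \<le> (\<Sum>t\<in>T. \<Sum>s\<in>grandchildren t. if z \<in> verts s then \<kappa> else 0)"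
proof -
  have zT: "z \<notin> vertices T" using z by (simp add: Np_iff)
  note S = ghat_S10_Th[OF z]
  let ?f = "\<lambda>x. grad D (ghat z) x \<bullet> grad D (ghat z) x"
  let ?h = "\<lambda>s x. (if z \<in> verts s then 1 else 0) * (indicator (tri s) x * ?f x)"
  have int: "integrable (lebesgue_on D) (?h s)" for s
    by (intro integrable_mult_right energy_integrable[OF S10_Th_H1[OF S] tri_lebesgue])
  have "dform (\<lambda>_. 1) (ghat z) (ghat z) \<le> (\<integral>x. (\<Sum>t\<in>T. \<Sum>s\<in>grandchildren t. ?h s x) \<partial>lebesgue_on D)"
    unfolding dform_def
  proof (rule integral_mono_AE)
    show "integrable (lebesgue_on D) (\<lambda>x. 1 * ?f x)"
      by (rule dform_integrable[OF const_Linf S10_Th_H1[OF S] S10_Th_H1[OF S]])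
    show "integrable (lebesgue_on D) (\<lambda>x. \<Sum>t\<in>T. \<Sum>s\<in>grandchildren t. ?h s x)"
      by (intro Bochner_Integration.integrable_sum int)
    show "AE x in lebesgue_on D. 1 * ?f x \<le> (\<Sum>t\<in>T. \<Sum>s\<in>grandchildren t. ?h s x)"
      using grad_S10[OF S] AE_D_interior
    proof eventually_elim
      case (elim x)
      obtain s where s: "s \<in> Th" "x \<in> interior (tri s)" using elim(2) by blast
      have nn: "0 \<le> ?h s x" for s by simp
      show ?case
      proof (cases "z \<in> verts s")
        case False
        then have "grad D (ghat z) x = 0" using elim(1) s ghat_gcoef_zero[OF zT s(1)] by auto
        then show ?thesis by simp
      next
        case True
        obtain t where t: "t \<in> T" "s \<in> grandchildren t" using Th_cases[OF s(1)] by blast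
        have "x \<in> tri s" using s(2) interior_subset by blast
        then have "1 * ?f x = ?h s x" using True by simp
        also have "\<dots> \<le> (\<Sum>s\<in>grandchildren t. ?h s x)"
          by (rule member_le_sum[OF t(2) nn card_grandchildren(1)])
        also have "\<dots> \<le> (\<Sum>t\<in>T. \<Sum>s\<in>grandchildren t. ?h s x)"
          by (rule member_le_sum[OF t(1) _ finite_T]) (intro sum_nonneg nn)
        finally show ?thesis .
      qed
    qed
  qed
  also have "\<dots> = (\<Sum>t\<in>T. \<Sum>s\<in>grandchildren t. \<integral>x. ?h s x \<partial>lebesgue_on D)"
    using int by (simp add: Bochner_Integration.integral_sum)
  also have "\<dots> \<le> (\<Sum>t\<in>T. \<Sum>s\<in>grandchildren t. if z \<in> verts s then \<kappa> else 0)"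
  proof (intro sum_mono)
    fix t s assume "t \<in> T" "s \<in> grandchildren t"
    then have s: "s \<in> Th" by (rule Th_I)
    show "(\<integral>x. ?h s x \<partial>lebesgue_on D) \<le> (if z \<in> verts s then \<kappa> else 0)"
      using energy_on_tri[OF S s] ghat_en[OF zT s] by (simp add: energy_on_def)
  qed
  finally show ?thesis .
qed

lemma AE_off_edges: "AE x in lebesgue_on D. \<forall>t\<in>T. \<forall>v\<in>verts t. bary t v x \<noteq> 0"
proof -
  have "AE x in lebesgue_on D. bary t v x \<noteq> 0" if t: "t \<in> T" and v: "v \<in> verts t" for t v
  proof -
    obtain g where g: "\<And>x. bary t v x = g \<bullet> (x - v) + 1" using bary_affine[OF tdet_T[OF t] v] by blast
    have g0: "g \<noteq> 0"
    proof
      assume "g = 0"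
      obtain w where w: "w \<in> verts t" "w \<noteq> v"
        using card_verts[OF tdet_T[OF t]] by (metis card_1_singletonE card_le_Suc0_iff_eq finite_verts le_SucI numeral_3_eq_3 Suc_n_not_le_n order_refl v le_add2 add_2_eq_Suc' not_less_eq_eq)
      show False using bary_vertex[OF tdet_T[OF t] v w(1)] w(2) g \<open>g = 0\<close> by simp
    qed
    have "{x. bary t v x = 0} = {x. g \<bullet> x = g \<bullet> v - 1}" by (auto simp: g inner_diff_right)
    then have "negligible {x. bary t v x = 0}" using negligible_hyperplane[of g "g \<bullet> v - 1"] g0 by simp
    then have "{x. bary t v x = 0} \<in> null_sets lebesgue" by (simp add: negligible_iff_null_sets)
    then have "AE x in lebesgue. x \<notin> {x. bary t v x = 0}" by (rule AE_not_in)
    then show ?thesis unfolding AE_D by eventually_elim simp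
  qed
  then have "AE x in lebesgue_on D. \<forall>v\<in>verts t. bary t v x \<noteq> 0" if "t \<in> T" for t
    using that by (simp add: AE_finite_all)
  then show ?thesis using finite_T by (simp add: AE_finite_all)
qed

text \<open>Triangles overlap in null sets only.\<close>

lemma energy_sum_T:
  assumes v: "v \<in> H1 D" shows "(\<Sum>t\<in>T. energy_on (tri t) v) \<le> dform (\<lambda>_. 1) v v"
proof -
  let ?f = "\<lambda>x. grad D v x \<bullet> grad D v x"
  have "(\<Sum>t\<in>T. energy_on (tri t) v) = (\<integral>x. (\<Sum>t\<in>T. indicator (tri t) x * ?f x) \<partial>lebesgue_on D)"
    unfolding energy_on_def using energy_integrable[OF v tri_lebesgue] by (simp add: Bochner_Integration.integral_sum)
  also have "\<dots> \<le> dform (\<lambda>_. 1) v v"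
    unfolding dform_def
  proof (rule integral_mono_AE)
    show "integrable (lebesgue_on D) (\<lambda>x. \<Sum>t\<in>T. indicator (tri t) x * ?f x)"
      by (intro Bochner_Integration.integrable_sum energy_integrable[OF v tri_lebesgue])
    show "integrable (lebesgue_on D) (\<lambda>x. 1 * ?f x)"
      by (rule dform_integrable[OF const_Linf v v])
    show "AE x in lebesgue_on D. (\<Sum>t\<in>T. indicator (tri t) x * ?f x) \<le> 1 * ?f x"
      using AE_off_edges
    proof eventually_elim
      case (elim x)
      show ?case
      proof (cases "\<exists>t\<in>T. x \<in> tri t")
        case False
        then have "(\<Sum>t\<in>T. indicator (tri t) x * ?f x) = 0" by (intro sum.neutral) auto
        then show ?thesis by simp
      next
        case True
        then obtain t where t: "t \<in> T" "x \<in> tri t" by blast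
        have "indicator (tri t') x * ?f x = 0" if t': "t' \<in> T - {t}" for t'
        proof -
          have "x \<notin> tri t'"
          proof
            assume x: "x \<in> tri t'"
            have ne: "verts t \<noteq> verts t'" using inj_T[OF t(1), of t'] t' by blast
            have "\<not> verts t \<subseteq> verts t'"
            proof
              assume "verts t \<subseteq> verts t'"
              then have "verts t = verts t'"
                using card_verts[OF tdet_T[OF t(1)]] card_verts[OF tdet_T, of t'] t' by (intro card_subset_eq) auto
              then show False using ne by blast
            qed
            then obtain w where w: "w \<in> verts t" "w \<notin> verts t'" by blast
            have "x \<in> convex hull (verts t \<inter> verts t')" using inter_T[OF t(1), of t'] t' t(2) x by blast
            then have "bary t w x = 0" using w by (intro bary_zero_on_face[OF tdet_T[OF t(1)] w(1)]) auto
            then show False using elim t(1) w(1) by blast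
          qed
          then show ?thesis by simp
        qed
        then have "(\<Sum>t'\<in>T - {t}. indicator (tri t') x * ?f x) = 0" by (rule sum.neutral[OF ballI])
        then have "(\<Sum>t'\<in>T. indicator (tri t') x * ?f x) = indicator (tri t) x * ?f x"
          using sum.remove[OF finite_T t(1), of "\<lambda>t'. indicator (tri t') x * ?f x"] by simp
        then show ?thesis using t(2) by simp
      qed
    qed
  qed
  finally show ?thesis .
qed

text \<open>The function \<open>w\<close> is the nodal interpolant of \<open>v\<close> on the coarse mesh and \<open>c z\<close> is the interpolation error at the
  midpoint \<open>z\<close>, that is the mean of two differences of nodal values of \<open>v\<close> along half edges. Each of them is bounded by the local
  energy, with constant \<open>4 \<kappa>\<close>; each hat function contributes \<open>\<kappa>\<close> per triangle, and there are four
  grandsons with three vertices each, which gives \<open>48 = 4 * 4 * 3\<close>. New vertices on the boundary are not in the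
  sum: there \<open>v\<close> and its interpolant vanish.\<close>

lemma interpolation_split:
  assumes v: "v \<in> S10 D Th"
  obtains c w where "w \<in> S10 D T" "v = w + (\<Sum>z\<in>Np. c z *\<^sub>R ghat z)"
    "(\<Sum>z\<in>Np. (c z)\<^sup>2 * dform (\<lambda>_. 1) (ghat z) (ghat z)) \<le> 48 * \<kappa>\<^sup>2 * dform (\<lambda>_. 1) v v"
proof -
  define f where "f t x = (\<Sum>u\<in>verts t. bary t u x * v u)" for t x
  have f_aff: "affine_fun_on UNIV (f t)" if t: "t \<in> T" for t
  proof -
    have "affine_fun_on UNIV (\<lambda>x. \<Sum>u\<in>verts t. v u * bary t u x)"
      by (rule affine_fun_on_lincomb) (use bary_affine_UNIV[OF tdet_T[OF t]] in auto)
    then show ?thesis by (rule affine_fun_on_cong) (simp add: f_def mult.commute)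
  qed
  have f_vert: "f t u = v u" if t: "t \<in> T" and u: "u \<in> verts t" for t u
  proof -
    have "f t u = (\<Sum>u'\<in>verts t. if u' = u then v u else 0)"
      unfolding f_def by (rule sum.cong[OF HOL.refl]) (use bary_vertex[OF tdet_T[OF t] _ u] in auto)
    then show ?thesis using u by (simp add: sum.delta)
  qed
  have f_cons: "f t x = f t' x" if "t \<in> T" "t' \<in> T" "x \<in> tri t" "x \<in> tri t'" for t t' x
  proof (rule affine_fun_on_agree_hull[OF f_aff[OF that(1)] f_aff[OF that(2)]])
    show "x \<in> convex hull (verts t \<inter> verts t')" using inter_T that by blast
    show "f t u = f t' u" if "u \<in> verts t \<inter> verts t'" for u
      using that f_vert \<open>t \<in> T\<close> \<open>t' \<in> T\<close> by simp
  qed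
  (* I is the interpolant on the coarse mesh, defined on the closure of D only. *)
  define I where "I = glue f"
  have I: "I x = f t x" if "t \<in> T" "x \<in> tri t" for t x
    unfolding I_def by (rule glue_eq[OF f_cons that])
  define c where "c z = v z - I z" for z
  define w where "w = v - (\<Sum>z\<in>Np. c z *\<^sub>R ghat z)"
  have w_apply: "w x = v x - (\<Sum>z\<in>Np. c z * ghat z x)" for x by (simp add: w_def sum_fun_apply)
  have I_mid: "I (midpoint u u') = (v u + v u') / 2" if t: "t \<in> T" and u: "u \<in> verts t" "u' \<in> verts t" "u \<noteq> u'" for t u u'
  proof -
    have "midpoint u u' \<in> midpoints t" using u unfolding midpoints_def by blast
    then have "I (midpoint u u') = f t (midpoint u u')" by (intro I[OF t] midpoints_in_tri)
    also have "\<dots> = (f t u + f t u') / 2" by (rule affine_fun_on_midpoint[OF f_aff[OF t]]) auto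
    finally show ?thesis using f_vert[OF t] u by simp
  qed
  have w_sum0: "(\<Sum>z\<in>Np. c z * ghat z y) = (if y \<in> Np then c y else 0)" if y: "y \<in> vertices Th" for y
  proof -
    have "(\<Sum>z\<in>Np. c z * ghat z y) = (\<Sum>z\<in>Np. if z = y then c y else 0)"
    proof (rule sum.cong[OF HOL.refl])
      fix z assume "z \<in> Np"
      then have "z \<notin> vertices T" by (simp add: Np_iff)
      from ghat_vertex[OF this y] show "c z * ghat z y = (if z = y then c y else 0)" by auto
    qed
    then show ?thesis using finite_Np by (simp add: sum.delta)
  qed
  (* Agreement at the nodes of the refined mesh; the case of a boundary midpoint needs zero boundary values. *)
  have w_nodes: "w y = f t y" if t: "t \<in> T" and s: "s \<in> grandchildren t" and y: "y \<in> verts s" for t s y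
  proof -
    have yTh: "y \<in> vertices Th" by (rule verts_Th[OF Th_I[OF t s] y])
    from grandchild_verts[OF tdet_T[OF t] s] y consider "y \<in> verts t" | "y \<in> midpoints t" by blast
    then show ?thesis
    proof cases
      case 1
      then have "y \<in> vertices T" using t unfolding vertices_def by blast
      then have "y \<notin> Np" by (simp add: Np_iff)
      then show ?thesis using w_sum0[OF yTh] f_vert[OF t 1] by (simp add: w_apply)
    next
      case 2
      have yt: "y \<in> tri t" by (rule midpoints_in_tri[OF 2])
      show ?thesis
      proof (cases "y \<in> Np")
        case True
        then show ?thesis using w_sum0[OF yTh] I[OF t yt] by (simp add: w_apply c_def)
      next
        case False
        have "y \<notin> vertices T" using vertex_in_tri[OF t _ yt] midpoint_not_vertex[OF tdet_T[OF t] 2] by blast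
        then have fr: "y \<in> frontier D" using False yTh by (simp add: Np_iff)
        obtain u u' where u: "y = midpoint u u'" "u \<in> verts t" "u' \<in> verts t" "u \<noteq> u'"
          using 2 unfolding midpoints_def by blast
        have zero: "v a = 0" if a: "a \<in> verts t" "b \<in> verts t" "a \<noteq> b" "y = midpoint a b" for a b
        proof -
          obtain s' where s': "s' \<in> grandchildren t" "a \<in> verts s'" "y \<in> verts s'"
            using grandchild_edge[OF tdet_T[OF t] a(1-3)] a(4) by blast
          let ?x = "midpoint a y"
          have x_eq: "?x = (1 - 1/4) *\<^sub>R a + (1/4) *\<^sub>R b" unfolding a(4) by (simp add: vec_eq_iff midpoint_nth field_simps)
          have y_eq: "y = (1 - 1/2) *\<^sub>R a + (1/2) *\<^sub>R b" unfolding a(4) by (simp add: vec_eq_iff midpoint_nth)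
          have "?x \<notin> D"
          proof
            assume "?x \<in> D"
            then have "(1 - 1/2) *\<^sub>R a + (1/2) *\<^sub>R b \<in> D"
              unfolding x_eq by (intro edge_interior_in_D[OF t a(1-3), of "1/4" "1/2"]) auto
            then have "y \<in> D" unfolding y_eq .
            then show False using fr open_D by (simp add: frontier_def interior_open)
          qed
          moreover have xs: "?x \<in> tri s'"
            using midpoints_in_convex_hull[of a "verts s'" y] s' by (simp add: tri_def hull_inc)
          then have "?x \<in> closure D" using cover_Th Th_I[OF t s'(1)] by blast
          ultimately have "?x \<in> frontier D" using open_D by (simp add: frontier_def interior_open)
          then have "v ?x = 0" by (rule S10_boundary[OF v])
          moreover have "v ?x = (v a + v y) / 2"
            by (rule affine_fun_on_midpoint[OF S10_Th_affine[OF v Th_I[OF t s'(1)]] verts_tri[OF s'(2)] verts_tri[OF s'(3)] xs])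
          moreover have "v y = 0" by (rule S10_boundary[OF v fr])
          ultimately show ?thesis by simp
        qed
        have "v u = 0" by (rule zero[OF u(2,3,4,1)])
        moreover have "v u' = 0" by (rule zero[OF u(3,2) u(4)[symmetric]]) (simp add: u(1) midpoint_sym)
        ultimately have "f t y = 0" using I_mid[OF t u(2-4)] I[OF t yt] u(1) by simp
        moreover have "w y = 0" using w_sum0[OF yTh] False S10_boundary[OF v fr] by (simp add: w_apply)
        ultimately show ?thesis by simp
      qed
    qed
  qed
  have sumS: "(\<Sum>z\<in>Np. c z *\<^sub>R ghat z) \<in> S10 D Th"
    by (intro subspace_sum[OF subspace_S10] subspace_scale[OF subspace_S10] ghat_S10_Th planar_domain_axioms)
  have wTh: "w \<in> S10 D Th" unfolding w_def by (rule subspace_diff[OF subspace_S10[OF planar_domain_axioms] v sumS])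
  have wS: "w \<in> S10 D T"
  proof -
    have "affine_fun_on (tri t) w" if t: "t \<in> T" for t
    proof (rule affine_fun_on_cong[OF affine_fun_on_subset[OF f_aff[OF t]]])
      fix x assume "x \<in> tri t"
      then obtain s where s: "s \<in> grandchildren t" "x \<in> tri s" using grandchildren_cover[OF t] by blast
      show "w x = f t x"
        by (rule affine_fun_on_agree_tri[OF tdet_Th[OF Th_I[OF t s(1)]] S10_Th_affine[OF wTh Th_I[OF t s(1)]]
              affine_fun_on_subset[OF f_aff[OF t]] w_nodes[OF t s(1)] s(2)]) auto
    qed auto
    then show ?thesis using wTh by (simp add: S10_def)
  qed
  have cb: "(c z)\<^sup>2 \<le> 4 * \<kappa> * energy_on (tri t) v"
    if t: "t \<in> T" and s: "s \<in> grandchildren t" and z: "z \<in> Np" "z \<in> verts s" for t s z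
  proof -
    have "z \<in> midpoints t"
      using grandchild_verts[OF tdet_T[OF t] s] z t unfolding Np_iff vertices_def by blast
    then obtain u u' where u: "z = midpoint u u'" "u \<in> verts t" "u' \<in> verts t" "u \<noteq> u'"
      unfolding midpoints_def by blast
    have half: "(v z - v a)\<^sup>2 \<le> 4 * \<kappa> * energy_on (tri t) v"
      if a: "a \<in> verts t" "b \<in> verts t" "a \<noteq> b" "z = midpoint a b" for a b
    proof -
      obtain s' where s': "s' \<in> grandchildren t" "a \<in> verts s'" "z \<in> verts s'"
        using grandchild_edge[OF tdet_T[OF t] a(1-3)] a(4) by blast
      note sTh = Th_I[OF t s'(1)]
      have "(v z - v a)\<^sup>2 \<le> 4 * \<kappa> * en v s'"
        by (rule difference_le_en[OF S10_Th_affine[OF v sTh] sTh s'(3,2)])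
      also have "en v s' = energy_on (tri s') v" by (rule energy_on_tri[OF v sTh, symmetric])
      also have "4 * \<kappa> * energy_on (tri s') v \<le> 4 * \<kappa> * energy_on (tri t) v"
        using kappa_nonneg[OF sTh] desc_tri[OF grandchild_desc[OF s'(1)]]
        by (intro mult_left_mono energy_on_mono S10_Th_H1[OF v] tri_lebesgue) auto
      finally show ?thesis .
    qed
    have c_eq: "c z = ((v z - v u) + (v z - v u')) / 2"
      unfolding c_def using I_mid[OF t u(2-4)] u(1) by (simp add: field_simps)
    have "(c z)\<^sup>2 \<le> ((v z - v u)\<^sup>2 + (v z - v u')\<^sup>2) / 2"
    proof -
      have "0 \<le> ((v z - v u) - (v z - v u'))\<^sup>2" by simp
      then show ?thesis unfolding c_eq by (simp add: power2_eq_square field_simps)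
    qed
    also have "\<dots> \<le> 4 * \<kappa> * energy_on (tri t) v"
      using half[OF u(2-4,1)] half[OF u(3,2) u(4)[symmetric]] u(1) by (simp add: midpoint_sym)
    finally show ?thesis .
  qed
  have "(\<Sum>z\<in>Np. (c z)\<^sup>2 * dform (\<lambda>_. 1) (ghat z) (ghat z))
      \<le> (\<Sum>z\<in>Np. (c z)\<^sup>2 * (\<Sum>t\<in>T. \<Sum>s\<in>grandchildren t. if z \<in> verts s then \<kappa> else 0))"
    by (intro sum_mono mult_left_mono ghat_energy) auto
  also have "\<dots> = (\<Sum>z\<in>Np. \<Sum>t\<in>T. \<Sum>s\<in>grandchildren t. (c z)\<^sup>2 * (if z \<in> verts s then \<kappa> else 0))"
    by (simp add: sum_distrib_left)
  also have "\<dots> = (\<Sum>t\<in>T. \<Sum>z\<in>Np. \<Sum>s\<in>grandchildren t. (c z)\<^sup>2 * (if z \<in> verts s then \<kappa> else 0))"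
    by (rule sum.swap)
  also have "\<dots> = (\<Sum>t\<in>T. \<Sum>s\<in>grandchildren t. \<Sum>z\<in>Np. (c z)\<^sup>2 * (if z \<in> verts s then \<kappa> else 0))"
    by (rule sum.cong[OF HOL.refl], rule sum.swap)
  also have "\<dots> \<le> (\<Sum>t\<in>T. \<Sum>s\<in>grandchildren t. 12 * \<kappa>\<^sup>2 * energy_on (tri t) v)"
  proof (intro sum_mono)
    fix t s assume ts: "t \<in> T" "s \<in> grandchildren t"
    have k0: "0 \<le> \<kappa>" by (rule kappa_nonneg[OF Th_I[OF ts]])
    have e0: "0 \<le> energy_on (tri t) v" unfolding energy_on_def by (rule integral_nonneg_AE) simp
    have "(\<Sum>z\<in>Np. (c z)\<^sup>2 * (if z \<in> verts s then \<kappa> else 0)) = (\<Sum>z\<in>Np \<inter> verts s. (c z)\<^sup>2 * \<kappa>)"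
      using finite_Np by (simp add: sum.inter_restrict if_distrib[of "\<lambda>x. _ * x"] cong: if_cong)
    also have "\<dots> \<le> of_nat (card (Np \<inter> verts s)) * (4 * \<kappa> * energy_on (tri t) v * \<kappa>)"
      by (rule sum_bounded_above) (use cb[OF ts] k0 in \<open>auto intro: mult_right_mono\<close>)
    also have "\<dots> \<le> 3 * (4 * \<kappa> * energy_on (tri t) v * \<kappa>)"
    proof (rule mult_right_mono)
      have "card (Np \<inter> verts s) \<le> card (verts s)" by (rule card_mono) auto
      then show "real (card (Np \<inter> verts s)) \<le> 3" using card_verts[OF tdet_Th[OF Th_I[OF ts]]] by simp
    qed (use k0 e0 in auto)
    finally show "(\<Sum>z\<in>Np. (c z)\<^sup>2 * (if z \<in> verts s then \<kappa> else 0)) \<le> 12 * \<kappa>\<^sup>2 * energy_on (tri t) v"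
      by (simp add: power2_eq_square mult_ac)
  qed
  also have "\<dots> \<le> (\<Sum>t\<in>T. 48 * \<kappa>\<^sup>2 * energy_on (tri t) v)"
  proof (rule sum_mono)
    fix t assume "t \<in> T"
    have e0: "0 \<le> energy_on (tri t) v" unfolding energy_on_def by (rule integral_nonneg_AE) simp
    have "real (card (grandchildren t)) * (12 * \<kappa>\<^sup>2 * energy_on (tri t) v) \<le> 4 * (12 * \<kappa>\<^sup>2 * energy_on (tri t) v)"
      using card_grandchildren(2)[of t] e0 by (intro mult_right_mono) auto
    then show "(\<Sum>s\<in>grandchildren t. 12 * \<kappa>\<^sup>2 * energy_on (tri t) v) \<le> 48 * \<kappa>\<^sup>2 * energy_on (tri t) v" by simp
  qed
  also have "\<dots> = 48 * \<kappa>\<^sup>2 * (\<Sum>t\<in>T. energy_on (tri t) v)" by (simp add: sum_distrib_left)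
  also have "\<dots> \<le> 48 * \<kappa>\<^sup>2 * dform (\<lambda>_. 1) v v"
    by (rule mult_left_mono[OF energy_sum_T[OF S10_Th_H1[OF v]]]) simp
  finally have "(\<Sum>z\<in>Np. (c z)\<^sup>2 * dform (\<lambda>_. 1) (ghat z) (ghat z)) \<le> 48 * \<kappa>\<^sup>2 * dform (\<lambda>_. 1) v v" .
  moreover have "v = w + (\<Sum>z\<in>Np. c z *\<^sub>R ghat z)" by (simp add: w_def)
  ultimately show ?thesis using that wS by blast
qed

text \<open>The Cauchy--Schwarz inequality for at most three nonzero summands.\<close>

lemma norm_sum_support_3:
  fixes g :: "point \<Rightarrow> point"
  assumes "finite R" "\<And>z. z \<in> R \<Longrightarrow> z \<notin> V \<Longrightarrow> g z = 0" "finite V" "card V \<le> 3"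
  shows "(norm (\<Sum>z\<in>R. g z))\<^sup>2 \<le> 3 * (\<Sum>z\<in>R. (norm (g z))\<^sup>2)"
proof -
  have "(\<Sum>z\<in>R. g z) = (\<Sum>z\<in>R \<inter> V. g z)"
    by (rule sum.mono_neutral_right) (use assms in auto)
  then have "norm (\<Sum>z\<in>R. g z) \<le> (\<Sum>z\<in>R \<inter> V. norm (g z))" using norm_sum by metis
  then have "(norm (\<Sum>z\<in>R. g z))\<^sup>2 \<le> (\<Sum>z\<in>R \<inter> V. norm (g z))\<^sup>2" by (rule power_mono) simp
  also have "\<dots> \<le> (\<Sum>z\<in>R \<inter> V. (norm (g z))\<^sup>2) * real (card (R \<inter> V))"
    using sum_squared_le_sum_of_squares[of "\<lambda>z. norm (g z)" "R \<inter> V"] assms by (simp add: mult.commute)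
  also have "\<dots> \<le> (\<Sum>z\<in>R \<inter> V. (norm (g z))\<^sup>2) * 3"
  proof (rule mult_left_mono)
    have "card (R \<inter> V) \<le> card V" by (rule card_mono) (use assms in auto)
    then show "real (card (R \<inter> V)) \<le> 3" using assms(4) by simp
  qed (simp add: sum_nonneg)
  also have "(\<Sum>z\<in>R \<inter> V. (norm (g z))\<^sup>2) \<le> (\<Sum>z\<in>R. (norm (g z))\<^sup>2)"
    by (rule sum_mono2) (use assms in auto)
  finally show ?thesis by simp
qed

text \<open>At almost every point only the hat functions of the three vertices of one refined triangle have nonzero gradient.\<close>

lemma hat_overlap:
  assumes a: "a \<in> Linf D" "AE x in lebesgue_on D. 0 \<le> a x" and R: "R \<subseteq> Np"
  shows "dform a (\<Sum>z\<in>R. c z *\<^sub>R ghat z) (\<Sum>z\<in>R. c z *\<^sub>R ghat z) \<le> 3 * (\<Sum>z\<in>R. (c z)\<^sup>2 * dform a (ghat z) (ghat z))"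
proof -
  have fR: "finite R" using R finite_Np by (rule finite_subset)
  have H: "ghat z \<in> H1 D" if "z \<in> R" for z using that R S10_Th_H1[OF ghat_S10_Th] by blast
  let ?w = "\<Sum>z\<in>R. c z *\<^sub>R ghat z"
  have wH: "?w \<in> H1 D" by (intro subspace_sum[OF subspace_H1] subspace_scale[OF subspace_H1] H)
  have gs: "AE x in lebesgue_on D. grad D ?w x = (\<Sum>z\<in>R. c z *\<^sub>R grad D (ghat z) x)"
    by (rule grad_sum[OF fR H])
  let ?r = "\<lambda>x. \<Sum>z\<in>R. 3 * (c z)\<^sup>2 * (a x * (grad D (ghat z) x \<bullet> grad D (ghat z) x))"
  have "AE x in lebesgue_on D. \<forall>z\<in>R. \<forall>s\<in>Th. x \<in> interior (tri s) \<longrightarrow> grad D (ghat z) x = gcoef (ghat z) s"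
    using fR R grad_S10[OF ghat_S10_Th] by (subst AE_finite_all) auto
  then have le: "AE x in lebesgue_on D. a x * (grad D ?w x \<bullet> grad D ?w x) \<le> ?r x"
    using gs a(2) AE_D_interior
  proof eventually_elim
    case (elim x)
    obtain s where s: "s \<in> Th" "x \<in> interior (tri s)" using elim(4) by blast
    have "(norm (\<Sum>z\<in>R. c z *\<^sub>R grad D (ghat z) x))\<^sup>2 \<le> 3 * (\<Sum>z\<in>R. (norm (c z *\<^sub>R grad D (ghat z) x))\<^sup>2)"
    proof (rule norm_sum_support_3[OF fR, where V = "verts s"])
      fix z assume z: "z \<in> R" "z \<notin> verts s"
      have "z \<notin> vertices T" using z R by (auto simp: Np_iff)
      from ghat_gcoef_zero[OF this s(1) z(2)] show "c z *\<^sub>R grad D (ghat z) x = 0" using elim(1) z(1) s by simp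
    qed (use card_verts[OF tdet_Th[OF s(1)]] in auto)
    then have "grad D ?w x \<bullet> grad D ?w x \<le> 3 * (\<Sum>z\<in>R. (c z)\<^sup>2 * (grad D (ghat z) x \<bullet> grad D (ghat z) x))"
      unfolding elim(2) by (simp add: dot_square_norm power_mult_distrib)
    from mult_left_mono[OF this elim(3)] show ?case by (simp add: sum_distrib_left mult_ac)
  qed
  have int: "integrable (lebesgue_on D) (\<lambda>x. a x * (grad D (ghat z) x \<bullet> grad D (ghat z) x))" if "z \<in> R" for z
    by (rule dform_integrable[OF a(1) H[OF that] H[OF that]])
  have "dform a ?w ?w \<le> (\<integral>x. ?r x \<partial>lebesgue_on D)"
    unfolding dform_def
    by (rule integral_mono_AE[OF dform_integrable[OF a(1) wH wH] _ le])
       (intro Bochner_Integration.integrable_sum integrable_mult_right int)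
  also have "\<dots> = (\<Sum>z\<in>R. 3 * (c z)\<^sup>2 * dform a (ghat z) (ghat z))"
    unfolding dform_def using int by (subst Bochner_Integration.integral_sum) auto
  finally show ?thesis by (simp add: sum_distrib_left mult.assoc)
qed

lemma refinement_mesh:
  assumes "nvb_refinement T T'" "conforming_triangulation D T'" shows "mesh D T' \<kappa>"
proof unfold_locales
  fix s assume "s \<in> T'"
  then obtain t where t: "t \<in> T" "desc t s" using nvb_refinement_desc[OF assms(1)] by blast
  show "shape s \<le> \<kappa> * \<bar>tdet s\<bar>" using desc_shape[OF t(2) shape_T[OF t(1)] tdet_T[OF t(1)]] by blast
qed (use lip_D assms in auto)

lemma S10_nested:
  assumes "nvb_refinement T T'" shows "S10 D T \<subseteq> S10 D T'"
proof
  fix v assume v: "v \<in> S10 D T"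
  have "affine_fun_on (tri s) v" if s: "s \<in> T'" for s
  proof -
    obtain t where t: "t \<in> T" "desc t s" using nvb_refinement_desc[OF assms s] by blast
    show ?thesis using affine_fun_on_subset[OF _ desc_tri[OF t(2)]] v t(1) by (simp add: S10_def)
  qed
  then show "v \<in> S10 D T'" using v by (simp add: S10_def)
qed

lemma S10_subset_Th: "S10 D T \<subseteq> S10 D Th"
proof
  fix v assume v: "v \<in> S10 D T"
  have "affine_fun_on (tri s) v" if s: "s \<in> Th" for s
  proof -
    obtain t where t: "t \<in> T" "desc t s" using Th_cases[OF s] by blast
    show ?thesis using affine_fun_on_subset[OF _ desc_tri[OF t(2)]] v t(1) by (simp add: S10_def)
  qed
  then show "v \<in> S10 D Th" using v by (simp add: S10_def)
qed

text \<open>In a conforming refinement a triangle contains the mesh vertex \<open>z\<close> only as one of its own vertices, so \<open>edge_hat_affine_desc\<close> applies.\<close>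

lemma ghat_S10_refinement:
  assumes "nvb_refinement T T'" "conforming_triangulation D T'" "z \<in> Np" "z \<in> vertices T'"
  shows "ghat z \<in> S10 D T'"
proof -
  interpret M': mesh D T' \<kappa> by (rule refinement_mesh[OF assms(1,2)])
  have "affine_fun_on (tri s) (ghat z)" if s: "s \<in> T'" for s
  proof -
    obtain t where t: "t \<in> T" "desc t s" using nvb_refinement_desc[OF assms(1) s] by blast
    have "affine_fun_on (tri s) (edge_hat t z)"
      by (rule edge_hat_affine_desc[OF tdet_T[OF t(1)] t(2)]) (rule M'.vertex_in_tri[OF s assms(4)])
    then show ?thesis
      by (rule affine_fun_on_cong) (use ghat_eq[OF t(1)] desc_tri[OF t(2)] in blast)
  qed
  then show ?thesis using ghat_H10[OF assms(3)] by (simp add: S10_def)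
qed

text \<open>Functions in the space are unconstrained outside the closure of \<open>D\<close>, so the space itself has infinite
  dimension; restricted to the closure it is determined by the vertex values.\<close>

lemma S10_finite_dim:
  obtains Z where "finite Z" "Z \<subseteq> S10 D T" "\<And>v. v \<in> S10 D T \<Longrightarrow> \<exists>w\<in>span Z. \<forall>x\<in>closure D. v x = w x"
proof -
  define ev :: "(point \<Rightarrow> real) \<Rightarrow> point \<Rightarrow> real" where "ev v = (\<lambda>z. if z \<in> vertices T then v z else 0)" for v
  define \<delta> :: "point \<Rightarrow> point \<Rightarrow> real" where "\<delta> z = (\<lambda>y. if y = z then 1 else 0)" for z
  have lin: "linear ev" by (rule linearI) (auto simp: ev_def fun_eq_iff)
  note sub = subspace_S10[OF planar_domain_axioms, of T]
  have fv: "finite (vertices T)" by (rule finite_vertices[OF finite_T])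
  have ev_span: "ev v \<in> span (\<delta> ` vertices T)" for v
  proof -
    have "ev v = (\<Sum>z\<in>vertices T. v z *\<^sub>R \<delta> z)"
    proof
      fix y
      have "(\<Sum>z\<in>vertices T. v z *\<^sub>R \<delta> z) y = (\<Sum>z\<in>vertices T. if z = y then v y else 0)"
        unfolding sum_fun_apply by (rule sum.cong[OF HOL.refl]) (auto simp: \<delta>_def)
      then show "ev v y = (\<Sum>z\<in>vertices T. v z *\<^sub>R \<delta> z) y" using fv by (simp add: ev_def sum.delta)
    qed
    then show ?thesis by (simp add: span_sum span_scale span_base)
  qed
  obtain B where B: "B \<subseteq> ev ` S10 D T" "independent B" "ev ` S10 D T \<subseteq> span B"
    using maximal_independent_subset[of "ev ` S10 D T"] by blast
  have "B \<subseteq> span (\<delta> ` vertices T)" using B(1) ev_span by blast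
  then have "finite B" using independent_span_bound[OF finite_imageI[OF fv] B(2)] by blast
  then obtain Z where Z: "finite Z" "Z \<subseteq> S10 D T" "B = ev ` Z" using finite_subset_image[OF _ B(1)] by blast
  show ?thesis
  proof (rule that[OF Z(1,2)])
    fix v assume v: "v \<in> S10 D T"
    have "ev v \<in> ev ` span Z" using B(3) v unfolding Z(3) linear_span_image[OF lin] by blast
    then obtain w where w: "w \<in> span Z" "ev v = ev w" by blast
    have wS: "w \<in> S10 D T" using w(1) span_minimal[OF Z(2) sub] by blast
    have "v x = w x" if x: "x \<in> closure D" for x
    proof -
      obtain t where t: "t \<in> T" "x \<in> tri t" using x cover_T by blast
      show ?thesis
      proof (rule affine_fun_on_agree_tri[OF tdet_T[OF t(1)] _ _ _ t(2)])
        show "affine_fun_on (tri t) v" "affine_fun_on (tri t) w" using v wS t(1) by (simp_all add: S10_def)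
        fix y assume "y \<in> verts t"
        then have "y \<in> vertices T" using t(1) unfolding vertices_def by blast
        then show "v y = w y" using fun_cong[OF w(2), of y] by (simp add: ev_def)
      qed
    qed
    then show "\<exists>w\<in>span Z. \<forall>x\<in>closure D. v x = w x" using w(1) by blast
  qed
qed

lemma dform_eq_zero_on:
  assumes "v \<in> H1 D" "\<And>x. x \<in> D \<Longrightarrow> v x = 0" "w \<in> H1 D" "a \<in> Linf D"
  shows "dform a v w = 0"
proof -
  have "AE x in lebesgue_on D. x \<in> D \<longrightarrow> grad D v x = 0"
    by (rule grad_affine_on[OF assms(1) open_D subset_refl, where c = 0]) (simp add: assms(2))
  then have "AE x in lebesgue_on D. grad D v x = 0" unfolding AE_D by eventually_elim simp
  then have "dform a v w = (\<integral>x. 0 \<partial>lebesgue_on D)"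
    unfolding dform_def by (intro integral_cong_AE borel_measurable_integrable[OF dform_integrable] assms) (auto elim: eventually_mono)
  then show ?thesis by simp
qed

end

section \<open>Random fields and their bilinear forms\<close>

context planar_domain
begin

lemma norm_grad_L2: "v \<in> H1 D \<Longrightarrow> (\<lambda>x. norm (grad D v x)) \<in> L2 D"
  using H1_grad[of v] by (simp add: L2_def)

lemma dform_bound:
  assumes \<alpha>: "\<alpha> \<in> Linf D" and v: "v \<in> H1 D" and w: "w \<in> H1 D"
  shows "\<bar>dform \<alpha> v w\<bar> \<le> Linf_norm D \<alpha> * (H1_norm D v * H1_norm D w)"
proof -
  interpret S: semi_inner "L2 D :: (point \<Rightarrow> real) set" "\<lambda>v w. \<integral>x. v x \<bullet> w x \<partial>lebesgue_on D" by (rule L2_semi_inner)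
  let ?p = "\<lambda>x. norm (grad D v x) * norm (grad D w x)"
  have int: "integrable (lebesgue_on D) ?p" by (rule L2_times_integrable[OF norm_grad_L2[OF v] norm_grad_L2[OF w]])
  have "\<bar>dform \<alpha> v w\<bar> \<le> (\<integral>x. \<bar>\<alpha> x * (grad D v x \<bullet> grad D w x)\<bar> \<partial>lebesgue_on D)"
    unfolding dform_def by (rule integral_abs_bound)
  also have "\<dots> \<le> (\<integral>x. Linf_norm D \<alpha> * ?p x \<partial>lebesgue_on D)"
  proof (rule integral_mono_AE)
    show "integrable (lebesgue_on D) (\<lambda>x. \<bar>\<alpha> x * (grad D v x \<bullet> grad D w x)\<bar>)"
      by (rule integrable_abs[OF dform_integrable[OF \<alpha> v w]])
    show "integrable (lebesgue_on D) (\<lambda>x. Linf_norm D \<alpha> * ?p x)" by (rule integrable_mult_right[OF int])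
    show "AE x in lebesgue_on D. \<bar>\<alpha> x * (grad D v x \<bullet> grad D w x)\<bar> \<le> Linf_norm D \<alpha> * ?p x"
      using Linf_bound(2)[OF \<alpha>]
    proof eventually_elim
      case (elim x)
      show ?case unfolding abs_mult
        by (rule mult_mono) (use elim Cauchy_Schwarz_ineq2 Linf_bound(1)[OF \<alpha>] in auto)
    qed
  qed
  also have "\<dots> = Linf_norm D \<alpha> * (\<integral>x. ?p x \<partial>lebesgue_on D)" by simp
  also have "\<dots> \<le> Linf_norm D \<alpha> * (H1_norm D v * H1_norm D w)"
  proof (rule mult_left_mono[OF _ Linf_bound(1)[OF \<alpha>]])
    have "(\<integral>x. ?p x \<partial>lebesgue_on D) \<le> sqrt (dform (\<lambda>_. 1) v v) * sqrt (dform (\<lambda>_. 1) w w)"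
      using S.Cauchy_Schwarz[OF norm_grad_L2[OF v] norm_grad_L2[OF w]]
      by (simp add: dform_def dot_square_norm power2_eq_square)
    also have "\<dots> \<le> H1_norm D v * H1_norm D w"
      by (rule mult_mono[OF D1_le_H1_norm[OF v] D1_le_H1_norm[OF w] H1_norm_nonneg[OF v]]) (simp add: D1.nonneg[OF w])
    finally show "(\<integral>x. ?p x \<partial>lebesgue_on D) \<le> H1_norm D v * H1_norm D w" .
  qed
  finally show ?thesis .
qed

lemma dform_add_right:
  "\<alpha> \<in> Linf D \<Longrightarrow> u \<in> H1 D \<Longrightarrow> v \<in> H1 D \<Longrightarrow> w \<in> H1 D \<Longrightarrow> dform \<alpha> w (u + v) = dform \<alpha> w u + dform \<alpha> w v"
  using dform_add[of \<alpha> u v w] by (simp only: dform_sym[of \<alpha> w])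

lemma dform_scale_right:
  "\<alpha> \<in> Linf D \<Longrightarrow> v \<in> H1 D \<Longrightarrow> w \<in> H1 D \<Longrightarrow> dform \<alpha> w (c *\<^sub>R v) = c * dform \<alpha> w v"
  using dform_scale[of \<alpha> v w c] by (simp only: dform_sym[of \<alpha> w])

lemma dform_diff_bound:
  assumes \<alpha>: "\<alpha> \<in> Linf D" and H: "s \<in> H1 D" "t \<in> H1 D" "u \<in> H1 D" "v \<in> H1 D"
  shows "\<bar>dform \<alpha> s t - dform \<alpha> u v\<bar> \<le>
    Linf_norm D \<alpha> * (H1_norm D (s - u) * (H1_norm D v + H1_norm D (t - v)) + H1_norm D u * H1_norm D (t - v))"
proof -
  have su: "s - u \<in> H1 D" and tv: "t - v \<in> H1 D" using H subspace_diff[OF subspace_H1] by blast+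
  have t_eq: "v + (t - v) = t" and s_eq: "u + (s - u) = s" by (simp only: add.commute[of v] diff_add_cancel, simp only: add.commute[of u] diff_add_cancel)
  have "dform \<alpha> s t = dform \<alpha> u t + dform \<alpha> (s - u) t"
    using dform_add[OF \<alpha> H(3) su H(2)] unfolding s_eq .
  also have "dform \<alpha> u t = dform \<alpha> u v + dform \<alpha> u (t - v)"
    using dform_add_right[OF \<alpha> H(4) tv H(3)] unfolding t_eq .
  finally have "\<bar>dform \<alpha> s t - dform \<alpha> u v\<bar> \<le> \<bar>dform \<alpha> (s - u) t\<bar> + \<bar>dform \<alpha> u (t - v)\<bar>" by linarith
  also have "\<dots> \<le> Linf_norm D \<alpha> * (H1_norm D (s - u) * H1_norm D t) + Linf_norm D \<alpha> * (H1_norm D u * H1_norm D (t - v))"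
    by (intro add_mono dform_bound \<alpha> H su tv)
  also have "\<dots> \<le> Linf_norm D \<alpha> * (H1_norm D (s - u) * (H1_norm D v + H1_norm D (t - v))) + Linf_norm D \<alpha> * (H1_norm D u * H1_norm D (t - v))"
  proof -
    have "H1_norm D t \<le> H1_norm D v + H1_norm D (t - v)" using H1_norm_triangle[OF H(4) tv] unfolding t_eq .
    then show ?thesis using H1_norm_nonneg[OF su] Linf_bound(1)[OF \<alpha>] by (intro add_right_mono mult_left_mono) auto
  qed
  finally show ?thesis unfolding distrib_left by linarith
qed

end

text \<open>The random coefficient acts by multiplication and its gradient never occurs, so essentially bounded functions are the
  natural class here.\<close>

locale random_field = planar_domain D for D +
  fixes a0 :: "point \<Rightarrow> real" and \<pi> :: "nat \<Rightarrow> real measure" and a :: "nat \<Rightarrow> point \<Rightarrow> real" and a0_min \<tau> :: real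
  assumes a0_Linf: "a0 \<in> Linf D" and a0_min_pos: "0 < a0_min" and a0_lower: "AE x in lebesgue_on D. a0_min \<le> a0 x"
    and a_Linf: "\<And>m. a m \<in> Linf D" and a_summable: "summable (\<lambda>m. Linf_norm D (a m))"
    and tau_eq: "\<tau> = (1 / a0_min) * (\<Sum>m. Linf_norm D (a m))" and tau_less: "\<tau> < 1"
    and param: "\<And>m. parameter_measure (\<pi> m)"
begin

abbreviation N where "N \<equiv> prod_measure \<pi>"

lemma prob_pi: "prob_space (\<pi> m)"
  using param by (simp add: parameter_measure_def)

lemma prob_N: "prob_space N"
  by (rule prob_space_PiM) (rule prob_pi)

lemma space_pi: "space (\<pi> m) = {-1..1}"
  using sets_eq_imp_space_eq[of "\<pi> m" "restrict_space borel {-1..1}"] param[of m]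
  by (simp add: parameter_measure_def space_restrict_space)

lemma param_bounded: "y \<in> space N \<Longrightarrow> \<bar>y m\<bar> \<le> 1"
  using space_pi[of m] by (auto simp: space_PiM PiE_iff abs_le_iff)

lemma borel_measurable_pi: "f \<in> borel_measurable borel \<Longrightarrow> f \<in> borel_measurable (\<pi> m)"
proof -
  assume "f \<in> borel_measurable borel"
  then have "f \<in> borel_measurable (restrict_space borel {-1..1})" by (rule measurable_restrict_space1)
  then show ?thesis using param[of m] by (simp add: parameter_measure_def cong: measurable_cong_sets)
qed

lemma component_measurable: "(\<lambda>y. y m) \<in> borel_measurable N"
  using measurable_compose[OF measurable_component_singleton[OF UNIV_I, of m \<pi>] borel_measurable_pi[of "\<lambda>x. x" m]] by simp

abbreviation V where "V \<equiv> V_space D \<pi>"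

lemma V_H10: "u \<in> V \<Longrightarrow> y \<in> space N \<Longrightarrow> u y \<in> H10 D"
  by (simp add: V_space_def bochner_L2_def)

lemma V_H1: "u \<in> V \<Longrightarrow> y \<in> space N \<Longrightarrow> u y \<in> H1 D"
  using V_H10 H10_H1 by blast

lemma V_approx:
  assumes "u \<in> V"
  obtains s where "\<And>n. simple_function N (s n)" "\<And>n y. y \<in> space N \<Longrightarrow> s n y \<in> H10 D"
    "\<And>y. y \<in> space N \<Longrightarrow> (\<lambda>n. H1_norm D (s n y - u y)) \<longlonglongrightarrow> 0"
proof -
  obtain s where s: "\<forall>n. simple_function N (s n) \<and> (\<forall>y\<in>space N. s n y \<in> H10 D)"
    "\<forall>y\<in>space N. (\<lambda>n::nat. H1_norm D (\<lambda>x. s n y x - u y x)) \<longlonglongrightarrow> 0"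
    using assms unfolding V_space_def bochner_L2_def by blast
  have "(\<lambda>n. H1_norm D (s n y - u y)) \<longlonglongrightarrow> 0" if "y \<in> space N" for y
    using bspec[OF s(2) that] by (simp only: fun_diff_def)
  then show ?thesis using that s(1) by blast
qed

lemma V_I:
  assumes "\<And>y. y \<in> space N \<Longrightarrow> u y \<in> H10 D"
    "\<And>n. simple_function N (s n)" "\<And>n y. y \<in> space N \<Longrightarrow> s n y \<in> H10 D"
    "\<And>y. y \<in> space N \<Longrightarrow> (\<lambda>n. H1_norm D (s n y - u y)) \<longlonglongrightarrow> 0"
    "(\<integral>\<^sup>+y. ennreal ((H1_norm D (u y))\<^sup>2) \<partial>N) < \<infinity>"
  shows "u \<in> V"
proof -
  have "(\<lambda>n. H1_norm D (\<lambda>x. s n y x - u y x)) \<longlonglongrightarrow> 0" if "y \<in> space N" for y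
    using assms(4)[OF that] by (simp only: fun_diff_def)
  then show ?thesis unfolding V_space_def bochner_L2_def using assms(1,2,3,5) by blast
qed

text \<open>Strong measurability: the norm of a pointwise limit of simple functions is the limit of their norms.\<close>

lemma H1_norm_lim_measurable:
  assumes s: "\<And>n. simple_function N (s n)" "\<And>n y. y \<in> space N \<Longrightarrow> s n y \<in> H10 D"
    and u: "\<And>y. y \<in> space N \<Longrightarrow> u y \<in> H10 D"
    and lim: "\<And>y. y \<in> space N \<Longrightarrow> (\<lambda>n. H1_norm D (s n y - u y)) \<longlonglongrightarrow> 0"
  shows "(\<lambda>y. H1_norm D (u y)) \<in> borel_measurable N"
proof (rule borel_measurable_LIMSEQ_real)
  show "(\<lambda>y. H1_norm D (s n y)) \<in> borel_measurable N" for n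
    using simple_function_compose[OF s(1)[of n], of "H1_norm D"]
    by (intro borel_measurable_simple_function) (simp add: comp_def)
  fix y assume y: "y \<in> space N"
  have H: "s n y \<in> H1 D" "u y \<in> H1 D" for n using s(2)[OF y] u[OF y] H10_H1 by blast+
  have le: "\<bar>H1_norm D (s n y) - H1_norm D (u y)\<bar> \<le> H1_norm D (s n y - u y)" for n
  proof -
    have d: "s n y - u y \<in> H1 D" by (rule subspace_diff[OF subspace_H1 H])
    have "H1_norm D (s n y) \<le> H1_norm D (u y) + H1_norm D (s n y - u y)"
      using H1_norm_triangle[OF H(2) d] by simp
    moreover have "H1_norm D (u y) \<le> H1_norm D (s n y) + H1_norm D (s n y - u y)"
    proof -
      have "u y = s n y + (-1) *\<^sub>R (s n y - u y)" by (simp add: fun_eq_iff)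
      then have "H1_norm D (u y) \<le> H1_norm D (s n y) + H1_norm D ((-1) *\<^sub>R (s n y - u y))"
        using H1_norm_triangle[OF H(1) subspace_scale[OF subspace_H1 d, of "-1"]] by metis
      then show ?thesis using H1_norm_scale[OF d, of "-1"] by simp
    qed
    ultimately show ?thesis by linarith
  qed
  have "(\<lambda>n. H1_norm D (s n y) - H1_norm D (u y)) \<longlonglongrightarrow> 0"
    by (rule Lim_null_comparison[OF _ lim[OF y]]) (simp add: le)
  then show "(\<lambda>n. H1_norm D (s n y)) \<longlonglongrightarrow> H1_norm D (u y)" by (rule LIM_zero_cancel)
qed

lemma H1_norm_measurable: assumes u: "u \<in> V" shows "(\<lambda>y. H1_norm D (u y)) \<in> borel_measurable N"
proof -
  obtain s where s: "\<And>n. simple_function N (s n)" "\<And>n y. y \<in> space N \<Longrightarrow> s n y \<in> H10 D"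
    "\<And>y. y \<in> space N \<Longrightarrow> (\<lambda>n. H1_norm D (s n y - u y)) \<longlonglongrightarrow> 0" using V_approx[OF u] by blast
  show ?thesis by (rule H1_norm_lim_measurable[of s u, OF s(1,2) V_H10[OF u] s(3)])
qed

lemma H1_normsq_integrable: 
  assumes u: "u \<in> V" shows "integrable N (\<lambda>y. (H1_norm D (u y))\<^sup>2)"
proof (rule integrableI_bounded)
  show "(\<lambda>y. (H1_norm D (u y))\<^sup>2) \<in> borel_measurable N"
    using H1_norm_measurable[OF u] by measurable
  show "(\<integral>\<^sup>+y. ennreal (norm ((H1_norm D (u y))\<^sup>2)) \<partial>N) < \<infinity>"
    using u by (simp add: V_space_def bochner_L2_def)
qed

lemma subspace_V: "subspace V"
  unfolding subspace_def
proof (intro conjI ballI allI)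
  have z: "H1_norm D 0 = 0" using H1_norm_scale[of 0 0] subspace_0[OF subspace_H1] by simp
  show "0 \<in> V"
  proof (rule V_I[where s = "\<lambda>_ _. 0"])
    show "(\<lambda>n. H1_norm D (0 - (0 :: rfield) y)) \<longlonglongrightarrow> 0" for y
      unfolding zero_fun_apply diff_self z by (rule tendsto_const)
    show "(\<integral>\<^sup>+y. ennreal ((H1_norm D ((0 :: rfield) y))\<^sup>2) \<partial>N) < \<infinity>" unfolding zero_fun_apply z by simp
    show "(0 :: rfield) y \<in> H10 D" for y using subspace_0[OF subspace_H10] by (simp add: zero_fun_def)
    show "(0 :: point \<Rightarrow> real) \<in> H10 D" by (rule subspace_0[OF subspace_H10])
    show "simple_function N (\<lambda>_. 0 :: point \<Rightarrow> real)" by (rule simple_function_const)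
  qed
next
  fix u v assume u: "u \<in> V" and v: "v \<in> V"
  obtain s where s: "\<And>n. simple_function N (s n)" "\<And>n y. y \<in> space N \<Longrightarrow> s n y \<in> H10 D"
    "\<And>y. y \<in> space N \<Longrightarrow> (\<lambda>n. H1_norm D (s n y - u y)) \<longlonglongrightarrow> 0" using V_approx[OF u] by blast
  obtain t where t: "\<And>n. simple_function N (t n)" "\<And>n y. y \<in> space N \<Longrightarrow> t n y \<in> H10 D"
    "\<And>y. y \<in> space N \<Longrightarrow> (\<lambda>n. H1_norm D (t n y - v y)) \<longlonglongrightarrow> 0" using V_approx[OF v] by blast
  show "u + v \<in> V"
  proof (rule V_I[where s = "\<lambda>n y. s n y + t n y"])
    show "(u + v) y \<in> H10 D" if "y \<in> space N" for y
      unfolding plus_fun_apply[of u v y] by (intro subspace_add[OF subspace_H10] V_H10[OF u that] V_H10[OF v that])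
    show "simple_function N (\<lambda>y. s n y + t n y)" for n
      by (rule simple_function_compose2[OF s(1) t(1)])
    show "s n y + t n y \<in> H10 D" if "y \<in> space N" for n y
      by (intro subspace_add[OF subspace_H10] s(2) t(2) that)
    show "(\<lambda>n. H1_norm D (s n y + t n y - (u + v) y)) \<longlonglongrightarrow> 0" if y: "y \<in> space N" for y
    proof (rule tendsto_sandwich[OF _ _ tendsto_const])
      have d: "s n y - u y \<in> H1 D" "t n y - v y \<in> H1 D" for n
        using subspace_diff[OF subspace_H10] s(2)[OF y] t(2)[OF y] V_H10[OF u y] V_H10[OF v y] H10_H1 by blast+
      have eq: "s n y + t n y - (u + v) y = (s n y - u y) + (t n y - v y)" for n
        unfolding plus_fun_apply[of u v y] by (simp only: add_diff_add)
      show "\<forall>\<^sub>F n in sequentially. 0 \<le> H1_norm D (s n y + t n y - (u + v) y)"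
        unfolding eq using H1_norm_nonneg[OF subspace_add[OF subspace_H1 d]] by simp
      show "\<forall>\<^sub>F n in sequentially. H1_norm D (s n y + t n y - (u + v) y) \<le> H1_norm D (s n y - u y) + H1_norm D (t n y - v y)"
        unfolding eq using H1_norm_triangle[OF d] by simp
      show "(\<lambda>n. H1_norm D (s n y - u y) + H1_norm D (t n y - v y)) \<longlonglongrightarrow> 0"
        using tendsto_add[OF s(3)[OF y] t(3)[OF y]] by simp
    qed
    have int: "integrable N (\<lambda>y. 2 * (H1_norm D (u y))\<^sup>2 + 2 * (H1_norm D (v y))\<^sup>2)"
      using H1_normsq_integrable[OF u] H1_normsq_integrable[OF v] by simp
    have "(\<integral>\<^sup>+y. ennreal ((H1_norm D ((u + v) y))\<^sup>2) \<partial>N) \<le> (\<integral>\<^sup>+y. ennreal (norm (2 * (H1_norm D (u y))\<^sup>2 + 2 * (H1_norm D (v y))\<^sup>2)) \<partial>N)"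
    proof (rule nn_integral_mono, rule ennreal_leI)
      fix y assume y: "y \<in> space N"
      have H: "u y \<in> H1 D" "v y \<in> H1 D" using V_H1 u v y by blast+
      have "H1_norm D ((u + v) y) \<le> H1_norm D (u y) + H1_norm D (v y)"
        unfolding plus_fun_apply[of u v y] by (rule H1_norm_triangle[OF H])
      then have "(H1_norm D ((u + v) y))\<^sup>2 \<le> (H1_norm D (u y) + H1_norm D (v y))\<^sup>2"
        by (rule power_mono) (unfold plus_fun_apply[of u v y], rule H1_norm_nonneg[OF subspace_add[OF subspace_H1 H]])
      also have "\<dots> \<le> 2 * (H1_norm D (u y))\<^sup>2 + 2 * (H1_norm D (v y))\<^sup>2"
        using sum_squares_bound[of "H1_norm D (u y)" "H1_norm D (v y)"] by (simp add: power2_sum)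
      finally show "(H1_norm D ((u + v) y))\<^sup>2 \<le> norm (2 * (H1_norm D (u y))\<^sup>2 + 2 * (H1_norm D (v y))\<^sup>2)" by simp
    qed
    also have "\<dots> < \<infinity>" using int by (simp add: integrable_iff_bounded)
    finally show "(\<integral>\<^sup>+y. ennreal ((H1_norm D ((u + v) y))\<^sup>2) \<partial>N) < \<infinity>" .
  qed
next
  fix c u assume u: "u \<in> V"
  obtain s where s: "\<And>n. simple_function N (s n)" "\<And>n y. y \<in> space N \<Longrightarrow> s n y \<in> H10 D"
    "\<And>y. y \<in> space N \<Longrightarrow> (\<lambda>n. H1_norm D (s n y - u y)) \<longlonglongrightarrow> 0" using V_approx[OF u] by blast
  show "c *\<^sub>R u \<in> V"
  proof (rule V_I[where s = "\<lambda>n y. c *\<^sub>R s n y"])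
    show "(c *\<^sub>R u) y \<in> H10 D" if "y \<in> space N" for y
      unfolding scaleR_fun_apply[of c u y] by (intro subspace_scale[OF subspace_H10] V_H10[OF u that])
    show "simple_function N (\<lambda>y. c *\<^sub>R s n y)" for n
      using simple_function_compose[OF s(1)[of n], of "\<lambda>v. c *\<^sub>R v"] by (simp only: comp_def)
    show "c *\<^sub>R s n y \<in> H10 D" if "y \<in> space N" for n y
      by (intro subspace_scale[OF subspace_H10] s(2) that)
    show "(\<lambda>n. H1_norm D (c *\<^sub>R s n y - (c *\<^sub>R u) y)) \<longlonglongrightarrow> 0" if y: "y \<in> space N" for y
    proof -
      have d: "s n y - u y \<in> H1 D" for n
        using subspace_diff[OF subspace_H10] s(2)[OF y] V_H10[OF u y] H10_H1 by blast
      have "H1_norm D (c *\<^sub>R s n y - (c *\<^sub>R u) y) = \<bar>c\<bar> * H1_norm D (s n y - u y)" for n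
        unfolding scaleR_fun_apply[of c u y] scaleR_right_diff_distrib[symmetric] by (rule H1_norm_scale[OF d])
      then show ?thesis using tendsto_mult[OF tendsto_const s(3)[OF y], of "\<bar>c\<bar>"] by simp
    qed
    have eq: "(H1_norm D ((c *\<^sub>R u) y))\<^sup>2 = c\<^sup>2 * (H1_norm D (u y))\<^sup>2" if "y \<in> space N" for y
      unfolding scaleR_fun_apply[of c u y] by (simp add: H1_norm_scale[OF V_H1[OF u that]] power_mult_distrib)
    have "integrable N (\<lambda>y. c\<^sup>2 * (H1_norm D (u y))\<^sup>2)" using H1_normsq_integrable[OF u] by simp
    then have "(\<integral>\<^sup>+y. ennreal (norm (c\<^sup>2 * (H1_norm D (u y))\<^sup>2)) \<partial>N) < \<infinity>" by (simp only: integrable_iff_bounded)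
    moreover have "(\<integral>\<^sup>+y. ennreal ((H1_norm D ((c *\<^sub>R u) y))\<^sup>2) \<partial>N) = (\<integral>\<^sup>+y. ennreal (norm (c\<^sup>2 * (H1_norm D (u y))\<^sup>2)) \<partial>N)"
      by (rule nn_integral_cong) (simp only: eq, simp)
    ultimately show "(\<integral>\<^sup>+y. ennreal ((H1_norm D ((c *\<^sub>R u) y))\<^sup>2) \<partial>N) < \<infinity>" by simp
  qed
qed

lemma dform_measurable:
  assumes \<alpha>: "\<alpha> \<in> Linf D" and u: "u \<in> V" and v: "v \<in> V"
  shows "(\<lambda>y. dform \<alpha> (u y) (v y)) \<in> borel_measurable N"
proof -
  obtain s where s: "\<And>n. simple_function N (s n)" "\<And>n y. y \<in> space N \<Longrightarrow> s n y \<in> H10 D"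
    "\<And>y. y \<in> space N \<Longrightarrow> (\<lambda>n. H1_norm D (s n y - u y)) \<longlonglongrightarrow> 0" using V_approx[OF u] by blast
  obtain t where t: "\<And>n. simple_function N (t n)" "\<And>n y. y \<in> space N \<Longrightarrow> t n y \<in> H10 D"
    "\<And>y. y \<in> space N \<Longrightarrow> (\<lambda>n. H1_norm D (t n y - v y)) \<longlonglongrightarrow> 0" using V_approx[OF v] by blast
  show ?thesis
  proof (rule borel_measurable_LIMSEQ_real)
    show "(\<lambda>y. dform \<alpha> (s n y) (t n y)) \<in> borel_measurable N" for n
      by (intro borel_measurable_simple_function simple_function_compose2[OF s(1) t(1)])
    fix y assume y: "y \<in> space N"
    have H: "s n y \<in> H1 D" "t n y \<in> H1 D" "u y \<in> H1 D" "v y \<in> H1 D" for n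
      using s(2)[OF y] t(2)[OF y] V_H10[OF u y] V_H10[OF v y] H10_H1 by blast+
    have "(\<lambda>n. dform \<alpha> (s n y) (t n y) - dform \<alpha> (u y) (v y)) \<longlonglongrightarrow> 0"
    proof (rule Lim_null_comparison)
      show "\<forall>\<^sub>F n in sequentially. norm (dform \<alpha> (s n y) (t n y) - dform \<alpha> (u y) (v y)) \<le>
        Linf_norm D \<alpha> * (H1_norm D (s n y - u y) * (H1_norm D (v y) + H1_norm D (t n y - v y)) + H1_norm D (u y) * H1_norm D (t n y - v y))"
        using dform_diff_bound[OF \<alpha> H] by simp
      have "(\<lambda>n. Linf_norm D \<alpha> * (H1_norm D (s n y - u y) * (H1_norm D (v y) + H1_norm D (t n y - v y)) + H1_norm D (u y) * H1_norm D (t n y - v y)))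
        \<longlonglongrightarrow> Linf_norm D \<alpha> * (0 * (H1_norm D (v y) + 0) + H1_norm D (u y) * 0)"
        by (intro tendsto_intros s(3)[OF y] t(3)[OF y])
      then show "(\<lambda>n. Linf_norm D \<alpha> * (H1_norm D (s n y - u y) * (H1_norm D (v y) + H1_norm D (t n y - v y)) + H1_norm D (u y) * H1_norm D (t n y - v y))) \<longlonglongrightarrow> 0"
        by simp
    qed
    then show "(\<lambda>n. dform \<alpha> (s n y) (t n y)) \<longlonglongrightarrow> dform \<alpha> (u y) (v y)" by (rule LIM_zero_cancel)
  qed
qed

lemma dform_V_bound:
  assumes \<alpha>: "\<alpha> \<in> Linf D" and u: "u \<in> V" and v: "v \<in> V" and y: "y \<in> space N"
  shows "\<bar>dform \<alpha> (u y) (v y)\<bar> \<le> Linf_norm D \<alpha> * ((H1_norm D (u y))\<^sup>2 + (H1_norm D (v y))\<^sup>2)"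
proof -
  have H: "u y \<in> H1 D" "v y \<in> H1 D" using V_H1 u v y by blast+
  have "H1_norm D (u y) * H1_norm D (v y) \<le> (H1_norm D (u y))\<^sup>2 + (H1_norm D (v y))\<^sup>2"
    using sum_squares_bound[of "H1_norm D (u y)" "H1_norm D (v y)"] mult_nonneg_nonneg[OF H1_norm_nonneg[OF H(1)] H1_norm_nonneg[OF H(2)]]
    unfolding mult.assoc by linarith
  from mult_left_mono[OF this Linf_bound(1)[OF \<alpha>]] show ?thesis using dform_bound[OF \<alpha> H] by linarith
qed

lemma form_integrable:
  assumes \<alpha>: "\<alpha> \<in> Linf D" and u: "u \<in> V" and v: "v \<in> V"
    and \<psi>: "\<psi> \<in> borel_measurable N" "\<And>y. y \<in> space N \<Longrightarrow> \<bar>\<psi> y\<bar> \<le> 1"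
  shows "integrable N (\<lambda>y. \<psi> y * dform \<alpha> (u y) (v y))"
    "\<bar>\<integral>y. \<psi> y * dform \<alpha> (u y) (v y) \<partial>N\<bar> \<le> Linf_norm D \<alpha> * (\<integral>y. (H1_norm D (u y))\<^sup>2 + (H1_norm D (v y))\<^sup>2 \<partial>N)"
proof -
  let ?b = "\<lambda>y. Linf_norm D \<alpha> * ((H1_norm D (u y))\<^sup>2 + (H1_norm D (v y))\<^sup>2)"
  have ib: "integrable N ?b" using H1_normsq_integrable[OF u] H1_normsq_integrable[OF v] by simp
  have le: "\<bar>\<psi> y * dform \<alpha> (u y) (v y)\<bar> \<le> ?b y" if "y \<in> space N" for y
  proof -
    have "\<bar>\<psi> y * dform \<alpha> (u y) (v y)\<bar> \<le> 1 * \<bar>dform \<alpha> (u y) (v y)\<bar>"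
      unfolding abs_mult using \<psi>(2)[OF that] by (intro mult_right_mono) auto
    then show ?thesis using dform_V_bound[OF \<alpha> u v that] by linarith
  qed
  show int: "integrable N (\<lambda>y. \<psi> y * dform \<alpha> (u y) (v y))"
  proof (rule Bochner_Integration.integrable_bound[OF ib])
    show "(\<lambda>y. \<psi> y * dform \<alpha> (u y) (v y)) \<in> borel_measurable N"
      by (intro borel_measurable_times \<psi>(1) dform_measurable[OF \<alpha> u v])
    show "AE y in N. norm (\<psi> y * dform \<alpha> (u y) (v y)) \<le> norm (?b y)"
      by (rule AE_I2) (use le in \<open>fastforce intro: order_trans[OF _ abs_ge_self]\<close>)
  qed
  have "\<bar>\<integral>y. \<psi> y * dform \<alpha> (u y) (v y) \<partial>N\<bar> \<le> (\<integral>y. \<bar>\<psi> y * dform \<alpha> (u y) (v y)\<bar> \<partial>N)"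
    by (rule integral_abs_bound)
  also have "\<dots> \<le> (\<integral>y. ?b y \<partial>N)"
    by (rule integral_mono[OF integrable_abs[OF int] ib]) (rule le)
  finally show "\<bar>\<integral>y. \<psi> y * dform \<alpha> (u y) (v y) \<partial>N\<bar> \<le> Linf_norm D \<alpha> * (\<integral>y. (H1_norm D (u y))\<^sup>2 + (H1_norm D (v y))\<^sup>2 \<partial>N)"
    by simp
qed

lemma component_bounded: "y \<in> space N \<Longrightarrow> \<bar>(\<lambda>y. y m) y\<bar> \<le> 1"
  by (simp add: param_bounded)

text \<open>The contribution of the \<open>m\<close>-th parameter to the bilinear form.\<close>

definition bm :: "nat \<Rightarrow> rfield \<Rightarrow> rfield \<Rightarrow> real" where
  "bm m u v = (\<integral>y. y m * dform (a m) (u y) (v y) \<partial>N)"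

lemma B0_eq: "B0 D a0 \<pi> u v = (\<integral>y. 1 * dform a0 (u y) (v y) \<partial>N)"
  by (simp add: B0_def dform_def)

lemma B_eq: "B D a0 \<pi> a u v = B0 D a0 \<pi> u v + (\<Sum>m. bm m u v)"
  by (simp add: B_def bm_def dform_def mult.assoc)

lemma form_linear:
  assumes \<alpha>: "\<alpha> \<in> Linf D" and V: "u \<in> V" "v \<in> V" "w \<in> V"
    and \<psi>: "\<psi> \<in> borel_measurable N" "\<And>y. y \<in> space N \<Longrightarrow> \<bar>\<psi> y\<bar> \<le> 1"
  shows "(\<integral>y. \<psi> y * dform \<alpha> ((u + v) y) (w y) \<partial>N) = (\<integral>y. \<psi> y * dform \<alpha> (u y) (w y) \<partial>N) + (\<integral>y. \<psi> y * dform \<alpha> (v y) (w y) \<partial>N)"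
    "(\<integral>y. \<psi> y * dform \<alpha> ((c *\<^sub>R u) y) (w y) \<partial>N) = c * (\<integral>y. \<psi> y * dform \<alpha> (u y) (w y) \<partial>N)"
proof -
  have "(\<integral>y. \<psi> y * dform \<alpha> ((u + v) y) (w y) \<partial>N) = (\<integral>y. \<psi> y * dform \<alpha> (u y) (w y) + \<psi> y * dform \<alpha> (v y) (w y) \<partial>N)"
  proof (rule Bochner_Integration.integral_cong[OF HOL.refl])
    fix y assume y: "y \<in> space N"
    show "\<psi> y * dform \<alpha> ((u + v) y) (w y) = \<psi> y * dform \<alpha> (u y) (w y) + \<psi> y * dform \<alpha> (v y) (w y)"
      unfolding plus_fun_apply[of u v y] dform_add[OF \<alpha> V_H1[OF V(1) y] V_H1[OF V(2) y] V_H1[OF V(3) y]]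
      by (rule distrib_left)
  qed
  then show "(\<integral>y. \<psi> y * dform \<alpha> ((u + v) y) (w y) \<partial>N) = (\<integral>y. \<psi> y * dform \<alpha> (u y) (w y) \<partial>N) + (\<integral>y. \<psi> y * dform \<alpha> (v y) (w y) \<partial>N)"
    using form_integrable(1)[OF \<alpha> V(1,3) \<psi>] form_integrable(1)[OF \<alpha> V(2,3) \<psi>] by simp
  have "(\<integral>y. \<psi> y * dform \<alpha> ((c *\<^sub>R u) y) (w y) \<partial>N) = (\<integral>y. c * (\<psi> y * dform \<alpha> (u y) (w y)) \<partial>N)"
  proof (rule Bochner_Integration.integral_cong[OF HOL.refl])
    fix y assume y: "y \<in> space N"
    show "\<psi> y * dform \<alpha> ((c *\<^sub>R u) y) (w y) = c * (\<psi> y * dform \<alpha> (u y) (w y))"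
      unfolding scaleR_fun_apply[of c u y] dform_scale[OF \<alpha> V_H1[OF V(1) y] V_H1[OF V(3) y]]
      by (rule mult.left_commute)
  qed
  then show "(\<integral>y. \<psi> y * dform \<alpha> ((c *\<^sub>R u) y) (w y) \<partial>N) = c * (\<integral>y. \<psi> y * dform \<alpha> (u y) (w y) \<partial>N)" by simp
qed

lemma one_meas: "(\<lambda>_. 1 :: real) \<in> borel_measurable N" "y \<in> space N \<Longrightarrow> \<bar>(\<lambda>_. 1 :: real) y\<bar> \<le> 1"
  by simp_all

lemma a0_nonneg: "AE x in lebesgue_on D. 0 \<le> a0 x"
  using a0_lower by eventually_elim (use a0_min_pos in linarith)

sublocale A0: semi_inner "H1 D" "dform a0"
  by (rule dform_semi_inner[OF a0_Linf a0_nonneg])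

sublocale B0: semi_inner V "B0 D a0 \<pi>"
proof
  show "subspace V" by (rule subspace_V)
  show "B0 D a0 \<pi> v w = B0 D a0 \<pi> w v" for v w
    unfolding B0_eq by (subst dform_sym) (rule HOL.refl)
  show "B0 D a0 \<pi> (u + v) w = B0 D a0 \<pi> u w + B0 D a0 \<pi> v w" if "u \<in> V" "v \<in> V" "w \<in> V" for u v w
    unfolding B0_eq by (rule form_linear(1)[OF a0_Linf that one_meas])
  show "B0 D a0 \<pi> (c *\<^sub>R v) w = c * B0 D a0 \<pi> v w" if "v \<in> V" "w \<in> V" for c v w
    unfolding B0_eq by (rule form_linear(2)[OF a0_Linf that(1) that(1) that(2) one_meas])
  show "0 \<le> B0 D a0 \<pi> v v" if "v \<in> V" for v
    unfolding B0_eq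
  proof (rule integral_nonneg_AE, rule AE_I2)
    fix y assume "y \<in> space N"
    then show "0 \<le> 1 * dform a0 (v y) (v y)" using A0.nonneg[OF V_H1[OF that]] by simp
  qed
qed

lemma bm_summable: "u \<in> V \<Longrightarrow> v \<in> V \<Longrightarrow> summable (\<lambda>m. bm m u v)"
proof (rule summable_comparison_test')
  assume uv: "u \<in> V" "v \<in> V"
  let ?C = "\<integral>y. (H1_norm D (u y))\<^sup>2 + (H1_norm D (v y))\<^sup>2 \<partial>N"
  show "summable (\<lambda>m. Linf_norm D (a m) * ?C)" by (rule summable_mult2[OF a_summable])
  show "norm (bm m u v) \<le> Linf_norm D (a m) * ?C" for m
    unfolding bm_def real_norm_def
    by (rule form_integrable(2)[OF a_Linf uv component_measurable component_bounded])
qed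

lemma dform_one_le_a0: "v \<in> H1 D \<Longrightarrow> a0_min * dform (\<lambda>_. 1) v v \<le> dform a0 v v"
  using dform_mono[OF const_Linf[of a0_min] a0_Linf _ a0_lower, of v] unfolding dform_const[of a0_min v v] .

lemma dform_le_Linf:
  assumes \<alpha>: "\<alpha> \<in> Linf D" and v: "v \<in> H1 D"
  shows "\<bar>dform \<alpha> v v\<bar> \<le> Linf_norm D \<alpha> * dform (\<lambda>_. 1) v v"
proof -
  have "AE x in lebesgue_on D. \<alpha> x \<le> Linf_norm D \<alpha>"
    using Linf_bound(2)[OF \<alpha>] by eventually_elim simp
  then have 1: "dform \<alpha> v v \<le> Linf_norm D \<alpha> * dform (\<lambda>_. 1) v v"
    using dform_mono[OF \<alpha> const_Linf[of "Linf_norm D \<alpha>"] v] unfolding dform_const[of "Linf_norm D \<alpha>" v v] by blast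
  have "AE x in lebesgue_on D. - Linf_norm D \<alpha> \<le> \<alpha> x"
    using Linf_bound(2)[OF \<alpha>] by eventually_elim (simp add: abs_le_iff)
  then have "- Linf_norm D \<alpha> * dform (\<lambda>_. 1) v v \<le> dform \<alpha> v v"
    using dform_mono[OF const_Linf[of "- Linf_norm D \<alpha>"] \<alpha> v] unfolding dform_const[of "- Linf_norm D \<alpha>" v v] by blast
  with 1 show ?thesis by (simp add: abs_le_iff)
qed

lemma bm_le:
  assumes v: "v \<in> V" shows "\<bar>bm m v v\<bar> \<le> Linf_norm D (a m) * (1 / a0_min * B0 D a0 \<pi> v v)"
proof -
  have i0: "integrable N (\<lambda>y. 1 * dform a0 (v y) (v y))" by (rule form_integrable(1)[OF a0_Linf v v one_meas])
  have i1: "integrable N (\<lambda>y. y m * dform (a m) (v y) (v y))"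
    by (rule form_integrable(1)[OF a_Linf v v component_measurable component_bounded])
  have "\<bar>bm m v v\<bar> \<le> (\<integral>y. \<bar>y m * dform (a m) (v y) (v y)\<bar> \<partial>N)"
    unfolding bm_def by (rule integral_abs_bound)
  also have "\<dots> \<le> (\<integral>y. (Linf_norm D (a m) * (1 / a0_min)) * (1 * dform a0 (v y) (v y)) \<partial>N)"
  proof (rule integral_mono[OF integrable_abs[OF i1] integrable_mult_right[OF i0]])
    fix y assume y: "y \<in> space N"
    note H = V_H1[OF v y]
    have "\<bar>y m * dform (a m) (v y) (v y)\<bar> \<le> 1 * \<bar>dform (a m) (v y) (v y)\<bar>"
      unfolding abs_mult using param_bounded[OF y] by (intro mult_right_mono) auto
    also have "\<dots> \<le> Linf_norm D (a m) * dform (\<lambda>_. 1) (v y) (v y)" using dform_le_Linf[OF a_Linf H] by simp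
    also have "\<dots> \<le> Linf_norm D (a m) * (1 / a0_min * dform a0 (v y) (v y))"
    proof (rule mult_left_mono[OF _ Linf_bound(1)[OF a_Linf]])
      show "dform (\<lambda>_. 1) (v y) (v y) \<le> 1 / a0_min * dform a0 (v y) (v y)"
        using dform_one_le_a0[OF H] a0_min_pos by (simp add: pos_le_divide_eq mult.commute)
    qed
    finally show "\<bar>y m * dform (a m) (v y) (v y)\<bar> \<le> (Linf_norm D (a m) * (1 / a0_min)) * (1 * dform a0 (v y) (v y))"
      by (simp only: mult.assoc mult_1)
  qed
  also have "\<dots> = Linf_norm D (a m) * (1 / a0_min * B0 D a0 \<pi> v v)"
    unfolding B0_eq Bochner_Integration.integral_mult_right_zero by (rule mult.assoc)
  finally show ?thesis .
qed

text \<open>Parameters are bounded by one, so \<open>a_m\<close> contributes at most its supremum divided by \<open>a0_min\<close>, relative to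
  \<open>B0\<close>; the sum of these bounds is \<open>\<tau>\<close>.\<close>

lemma B_close_B0:
  assumes v: "v \<in> V" shows "\<bar>B D a0 \<pi> a v v - B0 D a0 \<pi> v v\<bar> \<le> \<tau> * B0 D a0 \<pi> v v"
proof -
  let ?c = "1 / a0_min * B0 D a0 \<pi> v v"
  have s: "summable (\<lambda>m. Linf_norm D (a m) * ?c)" by (rule summable_mult2[OF a_summable])
  have sn: "summable (\<lambda>m. \<bar>bm m v v\<bar>)"
    by (rule summable_comparison_test'[OF s, of 0]) (simp only: real_norm_def abs_idempotent, rule bm_le[OF v])
  have "\<bar>\<Sum>m. bm m v v\<bar> \<le> (\<Sum>m. \<bar>bm m v v\<bar>)" by (rule summable_rabs[OF sn])
  also have "\<dots> \<le> (\<Sum>m. Linf_norm D (a m) * ?c)" by (rule suminf_le[OF bm_le[OF v] sn s])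
  also have "\<dots> = (\<Sum>m. Linf_norm D (a m)) * ?c" by (rule suminf_mult2[OF a_summable, symmetric])
  also have "\<dots> = \<tau> * B0 D a0 \<pi> v v" by (simp add: tau_eq)
  finally show ?thesis by (simp add: B_eq)
qed

lemma tau_nonneg: "0 \<le> \<tau>"
  unfolding tau_eq using a0_min_pos suminf_nonneg[OF a_summable] Linf_bound(1)[OF a_Linf] by simp

lemma B_lower: "v \<in> V \<Longrightarrow> (1 - \<tau>) * B0 D a0 \<pi> v v \<le> B D a0 \<pi> a v v"
  using B_close_B0[of v] by (simp add: left_diff_distrib abs_le_iff)

lemma B_upper: "v \<in> V \<Longrightarrow> B D a0 \<pi> a v v \<le> (1 + \<tau>) * B0 D a0 \<pi> v v"
  using B_close_B0[of v] by (simp add: distrib_right abs_le_iff)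

sublocale BB: semi_inner V "B D a0 \<pi> a"
proof
  show "subspace V" by (rule subspace_V)
  show "B D a0 \<pi> a v w = B D a0 \<pi> a w v" if "v \<in> V" "w \<in> V" for v w
  proof -
    have "bm m v w = bm m w v" for m unfolding bm_def by (subst dform_sym) (rule HOL.refl)
    then show ?thesis using B0.sym[OF that] by (simp add: B_eq)
  qed
  show "B D a0 \<pi> a (u + v) w = B D a0 \<pi> a u w + B D a0 \<pi> a v w" if "u \<in> V" "v \<in> V" "w \<in> V" for u v w
  proof -
    have "bm m (u + v) w = bm m u w + bm m v w" for m
      unfolding bm_def by (rule form_linear(1)[OF a_Linf that component_measurable component_bounded])
    then have "(\<Sum>m. bm m (u + v) w) = (\<Sum>m. bm m u w) + (\<Sum>m. bm m v w)"
      using suminf_add[OF bm_summable[OF that(1,3)] bm_summable[OF that(2,3)]] by simp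
    then show ?thesis unfolding B_eq B0.add[OF that] by simp
  qed
  show "B D a0 \<pi> a (c *\<^sub>R v) w = c * B D a0 \<pi> a v w" if "v \<in> V" "w \<in> V" for c v w
  proof -
    have "bm m (c *\<^sub>R v) w = c * bm m v w" for m
      unfolding bm_def by (rule form_linear(2)[OF a_Linf that(1) that(1) that(2) component_measurable component_bounded])
    then have "(\<Sum>m. bm m (c *\<^sub>R v) w) = c * (\<Sum>m. bm m v w)"
      using suminf_mult[OF bm_summable[OF that]] by simp
    then show ?thesis unfolding B_eq B0.scale[OF that] by (simp add: distrib_left)
  qed
  show "0 \<le> B D a0 \<pi> a v v" if "v \<in> V" for v
  proof -
    have "0 \<le> (1 - \<tau>) * B0 D a0 \<pi> v v" using tau_less B0.nonneg[OF that] by simp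
    then show ?thesis using B_lower[OF that] by linarith
  qed
qed

text \<open>The elementary tensor of a spatial function and a function of the parameters.\<close>

definition tens :: "(point \<Rightarrow> real) \<Rightarrow> ((nat \<Rightarrow> real) \<Rightarrow> real) \<Rightarrow> rfield" where
  "tens \<phi> p = (\<lambda>y x. \<phi> x * p y)"

lemma tens_apply: "tens \<phi> p y = p y *\<^sub>R \<phi>"
  by (simp add: tens_def fun_eq_iff mult.commute)

lemma tens_V:
  assumes \<phi>: "\<phi> \<in> H10 D" and p: "p \<in> borel_measurable N" "\<And>y. y \<in> space N \<Longrightarrow> \<bar>p y\<bar> \<le> C"
  shows "tens \<phi> p \<in> V"
proof -
  obtain F where F: "\<And>i. simple_function N (F i)" "\<And>y. y \<in> space N \<Longrightarrow> (\<lambda>i. F i y) \<longlonglongrightarrow> p y"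
    using borel_measurable_implies_sequence_metric[OF p(1), of 0] by blast
  note H = H10_H1[OF \<phi>]
  show ?thesis
  proof (rule V_I[where s = "\<lambda>n y. F n y *\<^sub>R \<phi>"])
    show "tens \<phi> p y \<in> H10 D" for y unfolding tens_apply by (rule subspace_scale[OF subspace_H10 \<phi>])
    show "simple_function N (\<lambda>y. F n y *\<^sub>R \<phi>)" for n
      using simple_function_compose[OF F(1)[of n], of "\<lambda>c. c *\<^sub>R \<phi>"] by (simp only: comp_def)
    show "F n y *\<^sub>R \<phi> \<in> H10 D" for n y by (rule subspace_scale[OF subspace_H10 \<phi>])
    show "(\<lambda>n. H1_norm D (F n y *\<^sub>R \<phi> - tens \<phi> p y)) \<longlonglongrightarrow> 0" if y: "y \<in> space N" for y
    proof -
      have eq: "H1_norm D (F n y *\<^sub>R \<phi> - tens \<phi> p y) = \<bar>F n y - p y\<bar> * H1_norm D \<phi>" for n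
        unfolding tens_apply scaleR_left_diff_distrib[symmetric] by (rule H1_norm_scale[OF H])
      have "(\<lambda>n. \<bar>F n y - p y\<bar> * H1_norm D \<phi>) \<longlonglongrightarrow> 0 * H1_norm D \<phi>"
        by (intro tendsto_intros tendsto_rabs_zero LIM_zero F(2)[OF y])
      then show ?thesis unfolding eq by simp
    qed
    have "(\<integral>\<^sup>+y. ennreal ((H1_norm D (tens \<phi> p y))\<^sup>2) \<partial>N) \<le> (\<integral>\<^sup>+y. ennreal ((C * H1_norm D \<phi>)\<^sup>2) \<partial>N)"
    proof (rule nn_integral_mono, rule ennreal_leI, rule power_mono)
      fix y assume y: "y \<in> space N"
      show "H1_norm D (tens \<phi> p y) \<le> C * H1_norm D \<phi>"
        unfolding tens_apply H1_norm_scale[OF H] by (rule mult_right_mono[OF p(2)[OF y] H1_norm_nonneg[OF H]])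
      show "0 \<le> H1_norm D (tens \<phi> p y)"
        unfolding tens_apply H1_norm_scale[OF H] using H1_norm_nonneg[OF H] by simp
    qed
    also have "\<dots> < \<infinity>" by (simp add: prob_space.emeasure_space_1[OF prob_N] ennreal_mult_less_top)
    finally show "(\<integral>\<^sup>+y. ennreal ((H1_norm D (tens \<phi> p y))\<^sup>2) \<partial>N) < \<infinity>" .
  qed
qed

lemma B0_tens:
  assumes "\<phi> \<in> H1 D" "\<psi> \<in> H1 D"
  shows "B0 D a0 \<pi> (tens \<phi> p) (tens \<psi> q) = dform a0 \<phi> \<psi> * (\<integral>y. p y * q y \<partial>N)"
proof -
  have "1 * dform a0 (tens \<phi> p y) (tens \<psi> q y) = dform a0 \<phi> \<psi> * (p y * q y)" for y
    unfolding tens_apply dform_scale[OF a0_Linf assms(1) subspace_scale[OF subspace_H1 assms(2)]]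
      dform_scale_right[OF a0_Linf assms(2,1)] by (simp only: mult_1 mult_ac)
  then show ?thesis unfolding B0_eq by simp
qed

end

section \<open>Tensor product polynomials\<close>

text \<open>A detail index differs by one from a member of \<open>\<PP>\<close> in one of finitely many positions.\<close>

lemma finite_detail_indices:
  assumes "finite \<PP>" shows "finite (detail_indices \<PP>)"
proof (rule finite_subset)
  let ?U = "\<Union>\<nu>\<in>\<PP>. \<Union>m\<in>{..active_dim \<PP>}. {\<nu>(m := \<nu> m + 1), \<nu>(m := \<nu> m - 1)}"
  show "detail_indices \<PP> \<subseteq> ?U"
  proof
    fix \<mu> assume "\<mu> \<in> detail_indices \<PP>"
    then obtain \<nu> m where \<nu>: "\<nu> \<in> \<PP>" "m \<in> {..active_dim \<PP>}" and e: "\<mu> = \<nu>(m := \<nu> m + 1) \<or> \<nu> = \<mu>(m := \<mu> m + 1)"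
      unfolding detail_indices_def by blast
    have "\<mu> = \<nu>(m := \<nu> m - 1)" if "\<nu> = \<mu>(m := \<mu> m + 1)" unfolding that by simp
    then show "\<mu> \<in> ?U" using \<nu> e by blast
  qed
  show "finite ?U" using assms by simp
qed

lemma detail_indices_multi: "detail_indices \<PP> \<subseteq> multi_indices" "\<PP> \<inter> detail_indices \<PP> = {}"
  by (auto simp: detail_indices_def)

locale parametric_basis = random_field D a0 \<pi> a a0_min \<tau> for D a0 \<pi> a a0_min \<tau> +
  fixes P :: "nat \<Rightarrow> nat \<Rightarrow> real poly"
  assumes orth: "orthonormal_polys \<pi> P"
begin

abbreviation tp where "tp \<equiv> tensor_poly P"

lemma poly_measurable: "(\<lambda>t. poly p (t :: real)) \<in> borel_measurable borel"
  by (intro borel_measurable_continuous_onI continuous_intros)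

lemma poly_bounded: "\<exists>c. \<forall>t::real. \<bar>t\<bar> \<le> 1 \<longrightarrow> \<bar>poly p t\<bar> \<le> c"
proof -
  have "\<exists>x\<in>{-1..1::real}. \<forall>t\<in>{-1..1}. \<bar>poly p t\<bar> \<le> \<bar>poly p x\<bar>"
    by (rule continuous_attains_sup) (auto intro!: continuous_intros)
  then obtain x where "\<forall>t\<in>{-1..1::real}. \<bar>poly p t\<bar> \<le> \<bar>poly p x\<bar>" by blast
  then show ?thesis by (intro exI[of _ "\<bar>poly p x\<bar>"]) (auto simp: abs_le_iff)
qed

lemma tensor_poly_measurable: "tp \<nu> \<in> borel_measurable N"
proof -
  have "(\<lambda>y. \<Prod>m\<in>supp \<nu>. poly (P m (\<nu> m)) (y m)) \<in> borel_measurable N"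
    by (intro borel_measurable_prod measurable_compose[OF component_measurable poly_measurable])
  then show ?thesis by (simp add: tensor_poly_def[abs_def])
qed

lemma tensor_poly_bounded: obtains C where "\<And>y. y \<in> space N \<Longrightarrow> \<bar>tp \<nu> y\<bar> \<le> C"
proof -
  define c where "c m = (SOME c. \<forall>t::real. \<bar>t\<bar> \<le> 1 \<longrightarrow> \<bar>poly (P m (\<nu> m)) t\<bar> \<le> c)" for m
  have c: "\<forall>t::real. \<bar>t\<bar> \<le> 1 \<longrightarrow> \<bar>poly (P m (\<nu> m)) t\<bar> \<le> c m" for m
    unfolding c_def by (rule someI_ex[OF poly_bounded])
  have "\<bar>tp \<nu> y\<bar> \<le> (\<Prod>m\<in>supp \<nu>. c m)" if "y \<in> space N" for y
    unfolding tensor_poly_def abs_prod by (rule prod_mono) (use c param_bounded[OF that] in auto)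
  then show ?thesis by (rule that)
qed

lemma tensor_poly_extend:
  assumes "finite J" "supp \<nu> \<subseteq> J" shows "tp \<nu> y = (\<Prod>m\<in>J. poly (P m (\<nu> m)) (y m))"
  unfolding tensor_poly_def
proof (rule prod.mono_neutral_left[OF assms], rule ballI)
  fix m assume "m \<in> J - supp \<nu>"
  then have "\<nu> m = 0" by (simp add: supp_def)
  then show "poly (P m (\<nu> m)) (y m) = 1" using orth by (simp add: orthonormal_polys_def)
qed

text \<open>Both polynomials depend on finitely many parameters; projecting the infinite product measure to these leaves a
  finite product of integrals.\<close>

lemma tensor_poly_orthonormal:
  assumes "\<nu> \<in> multi_indices" "\<mu> \<in> multi_indices"
  shows "(\<integral>y. tp \<nu> y * tp \<mu> y \<partial>N) = (if \<nu> = \<mu> then 1 else 0)"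
proof -
  interpret PS: product_prob_space \<pi> UNIV by (rule product_prob_spaceI[OF prob_pi])
  define J where "J = supp \<nu> \<union> supp \<mu>"
  have J: "finite J" "supp \<nu> \<subseteq> J" "supp \<mu> \<subseteq> J" using assms by (auto simp: J_def multi_indices_def)
  define g where "g m t = poly (P m (\<nu> m)) t * poly (P m (\<mu> m)) t" for m and t :: real
  have gm: "g m \<in> borel_measurable (\<pi> m)" for m
    unfolding g_def by (intro borel_measurable_times borel_measurable_pi poly_measurable)
  have gi: "integrable (\<pi> m) (g m)" for m
  proof -
    obtain c where c: "\<And>t::real. \<bar>t\<bar> \<le> 1 \<Longrightarrow> \<bar>poly (P m (\<nu> m) * P m (\<mu> m)) t\<bar> \<le> c" using poly_bounded by blast
    have fm: "finite_measure (\<pi> m)" by (rule prob_space.finite_measure[OF prob_pi])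
    have b: "norm (g m t) \<le> c" if "t \<in> space (\<pi> m)" for t
      using c[of t] that unfolding space_pi g_def poly_mult by (auto simp: abs_le_iff)
    show ?thesis by (rule finite_measure.integrable_const_bound[OF fm _ gm, where B = c]) (rule AE_I2, rule b)
  qed
  have pm: "(\<lambda>x. \<Prod>m\<in>J. g m (x m)) \<in> borel_measurable (PiM J \<pi>)"
  proof (rule borel_measurable_prod)
    fix m assume m: "m \<in> J"
    show "(\<lambda>x. g m (x m)) \<in> borel_measurable (PiM J \<pi>)"
      by (rule measurable_compose[where g = "g m", OF measurable_component_singleton[OF m, of \<pi>] gm[of m]])
  qed
  have "(\<integral>y. tp \<nu> y * tp \<mu> y \<partial>N) = (\<integral>y. (\<Prod>m\<in>J. g m (restrict y J m)) \<partial>N)"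
    by (simp add: tensor_poly_extend[OF J(1,2)] tensor_poly_extend[OF J(1,3)] g_def prod.distrib)
  also have "\<dots> = (\<integral>x. (\<Prod>m\<in>J. g m (x m)) \<partial>distr N (PiM J \<pi>) (\<lambda>x. restrict x J))"
    by (rule integral_distr[OF measurable_restrict_subset[OF subset_UNIV] pm, symmetric])
  also have "\<dots> = (\<integral>x. (\<Prod>m\<in>J. g m (x m)) \<partial>PiM J \<pi>)"
    by (simp only: PS.distr_PiM_restrict_finite[OF J(1) subset_UNIV])
  also have "\<dots> = (\<Prod>m\<in>J. \<integral>t. g m t \<partial>\<pi> m)" by (rule PS.product_integral_prod[OF J(1) gi])
  also have "\<dots> = (\<Prod>m\<in>J. if \<nu> m = \<mu> m then 1 else 0)"
    using orth by (simp add: g_def orthonormal_polys_def)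
  also have "\<dots> = (if \<nu> = \<mu> then 1 else 0)"
  proof (cases "\<nu> = \<mu>")
    case False
    then obtain m where m: "\<nu> m \<noteq> \<mu> m" by (auto simp: fun_eq_iff)
    then have "m \<in> J" by (auto simp: J_def supp_def)
    then have "(\<Prod>m\<in>J. if \<nu> m = \<mu> m then 1 else 0 :: real) = 0" using J(1) m by (intro prod_zero) auto
    then show ?thesis using False by simp
  qed simp
  finally show ?thesis .
qed

text \<open>Elements of a tensor product space are handled through their coefficient functions with respect to the polynomial
  basis.\<close>

definition expand :: "multi_index set \<Rightarrow> (multi_index \<Rightarrow> point \<Rightarrow> real) \<Rightarrow> rfield" where
  "expand \<PP> v = (\<lambda>y x. \<Sum>\<nu>\<in>\<PP>. v \<nu> x * tp \<nu> y)"

lemma expand_sum: "expand \<PP> v = (\<Sum>\<nu>\<in>\<PP>. tens (v \<nu>) (tp \<nu>))"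
  by (simp add: fun_eq_iff expand_def sum_fun_apply tens_def)

lemma tens_poly_V: "\<phi> \<in> H10 D \<Longrightarrow> tens \<phi> (tp \<nu>) \<in> V"
  using tensor_poly_bounded[of \<nu>] tens_V[OF _ tensor_poly_measurable] by metis

lemma expand_V: "(\<And>\<nu>. \<nu> \<in> \<PP> \<Longrightarrow> v \<nu> \<in> H10 D) \<Longrightarrow> expand \<PP> v \<in> V"
  unfolding expand_sum by (intro subspace_sum[OF subspace_V] tens_poly_V)

lemma expand_extend:
  assumes "finite \<PP>'" "\<PP> \<subseteq> \<PP>'" shows "expand \<PP> v = expand \<PP>' (\<lambda>\<nu>. if \<nu> \<in> \<PP> then v \<nu> else 0)"
  unfolding expand_def by (intro ext sum.mono_neutral_cong_left[OF assms]) auto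

lemma tensor_space_iff:
  assumes fin: "finite \<PP>" and X: "subspace X"
  shows "w \<in> tensor_space X (poly_space P \<PP>) \<longleftrightarrow> (\<exists>v. (\<forall>\<nu>. v \<nu> \<in> X) \<and> w = expand \<PP> v)"
proof
  assume "w \<in> tensor_space X (poly_space P \<PP>)"
  then obtain n v p where vp: "\<forall>i<n. v i \<in> X \<and> p i \<in> poly_space P \<PP>" and w: "w = (\<lambda>y x. \<Sum>i<(n::nat). v i x * p i y)"
    unfolding tensor_space_def by blast
  have "\<forall>i. \<exists>c. i < n \<longrightarrow> p i = (\<lambda>y. \<Sum>\<nu>\<in>\<PP>. c \<nu> * tp \<nu> y)" using vp unfolding poly_space_def by blast
  from choice[OF this] obtain c where c: "\<And>i. i < n \<Longrightarrow> p i = (\<lambda>y. \<Sum>\<nu>\<in>\<PP>. c i \<nu> * tp \<nu> y)" by blast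
  define v' where "v' \<nu> = (\<Sum>i<n. c i \<nu> *\<^sub>R v i)" for \<nu>
  have "v' \<nu> \<in> X" for \<nu> unfolding v'_def using vp by (intro subspace_sum[OF X] subspace_scale[OF X]) blast
  moreover have "w = expand \<PP> v'"
  proof (intro ext)
    fix y x
    have "w y x = (\<Sum>i<n. \<Sum>\<nu>\<in>\<PP>. v i x * (c i \<nu> * tp \<nu> y))"
      unfolding w by (simp add: c sum_distrib_left)
    also have "\<dots> = (\<Sum>\<nu>\<in>\<PP>. \<Sum>i<n. v i x * (c i \<nu> * tp \<nu> y))" by (rule sum.swap)
    also have "\<dots> = expand \<PP> v' y x"
      by (simp add: expand_def v'_def sum_fun_apply sum_distrib_left sum_distrib_right mult_ac)
    finally show "w y x = expand \<PP> v' y x" .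
  qed
  ultimately show "\<exists>v. (\<forall>\<nu>. v \<nu> \<in> X) \<and> w = expand \<PP> v" by blast
next
  assume "\<exists>v. (\<forall>\<nu>. v \<nu> \<in> X) \<and> w = expand \<PP> v"
  then obtain v where v: "\<And>\<nu>. v \<nu> \<in> X" "w = expand \<PP> v" by blast
  obtain h where h: "bij_betw h {0..<card \<PP>} \<PP>" using ex_bij_betw_nat_finite[OF fin] by blast
  have "tp \<nu> \<in> poly_space P \<PP>" if "\<nu> \<in> \<PP>" for \<nu>
  proof -
    have "(\<Sum>\<mu>\<in>\<PP>. (if \<mu> = \<nu> then 1 else 0) * tp \<mu> y) = (\<Sum>\<mu>\<in>\<PP>. if \<mu> = \<nu> then tp \<mu> y else 0)" for y
      by (rule sum.cong) auto
    then have "tp \<nu> = (\<lambda>y. \<Sum>\<mu>\<in>\<PP>. (if \<mu> = \<nu> then 1 else 0) * tp \<mu> y)"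
      using fin that by (intro ext) simp
    then show ?thesis unfolding poly_space_def by (intro CollectI exI)
  qed
  then have "\<forall>i<card \<PP>. v (h i) \<in> X \<and> tp (h i) \<in> poly_space P \<PP>"
    using v(1) bij_betwE[OF h] by simp
  moreover have "w = (\<lambda>y x. \<Sum>i<card \<PP>. v (h i) x * tp (h i) y)"
    unfolding v(2) expand_def by (intro ext, subst sum.reindex_bij_betw[OF h, symmetric]) (simp add: atLeast0LessThan)
  ultimately show "w \<in> tensor_space X (poly_space P \<PP>)" unfolding tensor_space_def
    by (intro CollectI exI[of _ "card \<PP>"] exI[of _ "\<lambda>i. v (h i)"] exI[of _ "\<lambda>i. tp (h i)"] conjI)
qed

lemma S10_sub: "subspace (S10 D T)"
  by (rule subspace_S10) unfold_locales

lemma S10_H10: "v \<in> S10 D T \<Longrightarrow> v \<in> H10 D"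
  by (simp add: S10_def)

lemma V_disc_iff: "finite \<PP> \<Longrightarrow> w \<in> V_disc D P T \<PP> \<longleftrightarrow> (\<exists>v. (\<forall>\<nu>. v \<nu> \<in> S10 D T) \<and> w = expand \<PP> v)"
  unfolding V_disc_def by (rule tensor_space_iff[OF _ S10_sub])

lemma expand_V_disc:
  assumes "finite \<PP>" "\<PP>' \<subseteq> \<PP>" "\<And>\<nu>. \<nu> \<in> \<PP>' \<Longrightarrow> v \<nu> \<in> S10 D T" shows "expand \<PP>' v \<in> V_disc D P T \<PP>"
  unfolding V_disc_iff[OF assms(1)] expand_extend[OF assms(1,2)]
  by (rule exI[of _ "\<lambda>\<nu>. if \<nu> \<in> \<PP>' then v \<nu> else 0"]) (use assms(3) subspace_0[OF S10_sub] in simp)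

lemma V_disc_V: "finite \<PP> \<Longrightarrow> V_disc D P T \<PP> \<subseteq> V"
proof
  fix w assume "finite \<PP>" "w \<in> V_disc D P T \<PP>"
  then obtain v where v: "\<And>\<nu>. v \<nu> \<in> S10 D T" and w: "w = expand \<PP> v" using V_disc_iff by blast
  show "w \<in> V" unfolding w by (rule expand_V[OF S10_H10[OF v]])
qed

lemma V_disc_mono:
  assumes "finite \<PP>'" "\<PP> \<subseteq> \<PP>'" "S10 D T \<subseteq> S10 D T'" shows "V_disc D P T \<PP> \<subseteq> V_disc D P T' \<PP>'"
proof
  fix w assume "w \<in> V_disc D P T \<PP>"
  then obtain v where "\<And>\<nu>. v \<nu> \<in> S10 D T" "w = expand \<PP> v" using V_disc_iff[OF finite_subset[OF assms(2,1)]] by blast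
  then show "w \<in> V_disc D P T' \<PP>'" using expand_V_disc[OF assms(1,2)] assms(3) by blast
qed

text \<open>Orthonormality decouples the polynomial modes.\<close>

lemma B0_expand:
  assumes "finite \<PP>" "\<PP> \<subseteq> multi_indices" "\<And>\<nu>. \<nu> \<in> \<PP> \<Longrightarrow> v \<nu> \<in> H10 D"
  shows "B0 D a0 \<pi> (expand \<PP> v) (expand \<PP> v) = (\<Sum>\<nu>\<in>\<PP>. dform a0 (v \<nu>) (v \<nu>))"
proof -
  have "B0 D a0 \<pi> (expand \<PP> v) (expand \<PP> v) = (\<Sum>\<nu>\<in>\<PP>. B0 D a0 \<pi> (tens (v \<nu>) (tp \<nu>)) (expand \<PP> v))"
    unfolding expand_sum[of \<PP> v] by (rule B0.sum_left) (intro tens_poly_V subspace_sum[OF subspace_V] assms(3); assumption)+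
  also have "\<dots> = (\<Sum>\<nu>\<in>\<PP>. dform a0 (v \<nu>) (v \<nu>))"
  proof (rule sum.cong[OF HOL.refl])
    fix \<nu> assume \<nu>: "\<nu> \<in> \<PP>"
    have "B0 D a0 \<pi> (tens (v \<nu>) (tp \<nu>)) (expand \<PP> v) = (\<Sum>\<mu>\<in>\<PP>. B0 D a0 \<pi> (tens (v \<nu>) (tp \<nu>)) (tens (v \<mu>) (tp \<mu>)))"
      unfolding expand_sum by (rule B0.sum_right) (intro tens_poly_V assms(3) \<nu>; assumption)+
    also have "\<dots> = (\<Sum>\<mu>\<in>\<PP>. if \<mu> = \<nu> then dform a0 (v \<nu>) (v \<nu>) else 0)"
    proof (rule sum.cong[OF HOL.refl])
      fix \<mu> assume \<mu>: "\<mu> \<in> \<PP>"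
      have "(\<integral>y. tp \<nu> y * tp \<mu> y \<partial>N) = (if \<nu> = \<mu> then 1 else 0)"
        by (rule tensor_poly_orthonormal) (use \<nu> \<mu> assms(2) in blast)+
      then show "B0 D a0 \<pi> (tens (v \<nu>) (tp \<nu>)) (tens (v \<mu>) (tp \<mu>)) = (if \<mu> = \<nu> then dform a0 (v \<nu>) (v \<nu>) else 0)"
        unfolding B0_tens[OF H10_H1[OF assms(3)[OF \<nu>]] H10_H1[OF assms(3)[OF \<mu>]]] by simp
    qed
    also have "\<dots> = dform a0 (v \<nu>) (v \<nu>)" using \<nu> assms(1) by simp
    finally show "B0 D a0 \<pi> (tens (v \<nu>) (tp \<nu>)) (expand \<PP> v) = dform a0 (v \<nu>) (v \<nu>)" .
  qed
  finally show ?thesis .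
qed

lemma energy_seminorm0_square:
  assumes "\<phi> \<in> H1 D" shows "(energy_seminorm0 D a0 \<phi>)\<^sup>2 = dform a0 \<phi> \<phi>"
proof -
  have g: "grad D \<phi> \<in> borel_measurable (lebesgue_on D)" using H1_grad[OF assms] by (simp add: L2_def)
  have am: "a0 \<in> borel_measurable (lebesgue_on D)" using a0_Linf by (simp add: Linf_def)
  have "(\<integral>x. (norm (sqrt (a0 x) *\<^sub>R grad D \<phi> x))\<^sup>2 \<partial>lebesgue_on D) = dform a0 \<phi> \<phi>"
    unfolding dform_def
  proof (rule integral_cong_AE)
    show "(\<lambda>x. (norm (sqrt (a0 x) *\<^sub>R grad D \<phi> x))\<^sup>2) \<in> borel_measurable (lebesgue_on D)"
      using g am by measurable
    show "(\<lambda>x. a0 x * (grad D \<phi> x \<bullet> grad D \<phi> x)) \<in> borel_measurable (lebesgue_on D)"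
      by (intro borel_measurable_times borel_measurable_inner g am)
    show "AE x in lebesgue_on D. (norm (sqrt (a0 x) *\<^sub>R grad D \<phi> x))\<^sup>2 = a0 x * (grad D \<phi> x \<bullet> grad D \<phi> x)"
      using a0_nonneg by eventually_elim (simp add: power_mult_distrib dot_square_norm)
  qed
  then show ?thesis unfolding energy_seminorm0_def L2_norm_on_def by (simp add: A0.nonneg[OF assms])
qed

end

section \<open>Marking\<close>

lemma young_product:
  fixes x y s :: real assumes "0 < s" shows "x * y \<le> x\<^sup>2 / (2 * s) + s / 2 * y\<^sup>2"
proof -
  have "0 \<le> (x - s * y)\<^sup>2 / (2 * s)" using assms by simp
  also have "\<dots> = x\<^sup>2 / (2 * s) + s / 2 * y\<^sup>2 - x * y"
    using assms by (simp add: power2_eq_square field_simps)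
  finally show ?thesis by simp
qed

text \<open>The weights are chosen such that, after summation, the first term is the estimate and the second is absorbed by the
  energy.\<close>

lemma young_weighted:
  fixes c x s K h :: real assumes "0 < s" "0 < K" "0 < h" 
  shows "c * x \<le> K / (2 * s) * (x\<^sup>2 / h) + s / (2 * K) * (c\<^sup>2 * h)"
proof -
  have "x * c \<le> x\<^sup>2 / (2 * (s * h / K)) + (s * h / K) / 2 * c\<^sup>2"
    by (rule young_product) (use assms in simp)
  also have "x\<^sup>2 / (2 * (s * h / K)) = K / (2 * s) * (x\<^sup>2 / h)" using assms by (simp add: mult_ac)
  also have "(s * h / K) / 2 * c\<^sup>2 = s / (2 * K) * (c\<^sup>2 * h)" by (simp add: mult_ac)
  finally show ?thesis by (simp only: mult.commute[of c])
qed

lemma eta_set_nonneg: "0 \<le> eta_set \<eta> M"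
  by (simp add: eta_set_def sum_nonneg)

lemma eta_set_square: "(eta_set \<eta> M)\<^sup>2 = (\<Sum>z\<in>M. (\<eta> z)\<^sup>2)"
  by (simp add: eta_set_def sum_nonneg)

lemma eta_set_mono: "finite M \<Longrightarrow> L \<subseteq> M \<Longrightarrow> eta_set \<eta> L \<le> eta_set \<eta> M"
  unfolding eta_set_def by (intro real_sqrt_le_mono sum_mono2) auto

lemma square_le_of_scaled_le:
  fixes x y \<theta> :: real assumes "0 < \<theta>" "0 \<le> x" "\<theta> * x \<le> y" shows "x\<^sup>2 \<le> 1 / \<theta>\<^sup>2 * y\<^sup>2"
proof -
  have "(\<theta> * x)\<^sup>2 \<le> y\<^sup>2" by (rule power_mono) (use assms in simp_all)
  then show ?thesis using assms(1) by (simp add: power_mult_distrib pos_le_divide_eq mult.commute)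
qed

text \<open>The hypotheses bound only the parts of the estimates that the step resolves: the new vertices of the refined mesh
  and the marked indices. In each case of each criterion, Doerfler marking extends the bound of one part to
  its full estimate, and the comparison by \<open>\<Theta>\<close> extends it to the other estimate. For the second criterion the
  comparison involves the auxiliary refinement, which in the first case is coarser than the actual one because
  both are generated by the same marked vertices.\<close>

lemma marking_bound:
  assumes mark: "marking_A D \<theta>X \<theta>P \<Theta> \<eta>X \<eta>P T \<PP> M \<MM> \<or> marking_B D \<theta>X \<theta>P \<Theta> \<eta>X \<eta>P T \<PP> M \<MM>"
    and T1: "is_refine D T M T1" and fin: "finite (new_vertices D T)"
    and pos: "0 < \<theta>X" "0 < \<theta>P" "0 < \<Theta>"
    and X: "(eta_set \<eta>X (new_vertices D T \<inter> vertices T1))\<^sup>2 \<le> \<delta>" and P: "(eta_set \<eta>P \<MM>)\<^sup>2 \<le> \<delta>"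
  defines "C \<equiv> (1 / \<theta>X\<^sup>2 + 1 / \<theta>P\<^sup>2) * (1 + \<Theta>\<^sup>2 + 1 / \<Theta>\<^sup>2)"
  shows "(eta_set \<eta>X (new_vertices D T))\<^sup>2 \<le> C * \<delta> \<and> (eta_set \<eta>P (detail_indices \<PP>))\<^sup>2 \<le> C * \<delta>"
proof -
  let ?N = "new_vertices D T" and ?Q = "detail_indices \<PP>"
  define p q t r where "p = 1 / \<theta>X\<^sup>2" and "q = 1 / \<theta>P\<^sup>2" and "t = \<Theta>\<^sup>2" and "r = 1 / \<Theta>\<^sup>2"
  have nn: "0 \<le> p" "0 \<le> q" "0 \<le> t" "0 \<le> r" by (simp_all add: p_def q_def t_def r_def)
  have nn2: "0 \<le> p * t" "0 \<le> p * r" "0 \<le> q * t" "0 \<le> q * r" using nn by simp_all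
  have C: "C = p + p * t + p * r + q + q * t + q * r"
    by (simp add: C_def p_def q_def t_def r_def distrib_left distrib_right add_divide_distrib)
  have d: "0 \<le> \<delta>" using X zero_le_power2 order_trans by blast
  have le: "x \<le> C * \<delta>" if "x \<le> c * y" "y \<le> \<delta>" "0 \<le> c" "c \<le> C" for x c y
  proof -
    have "c * y \<le> c * \<delta>" by (rule mult_left_mono[OF that(2,3)])
    also have "\<dots> \<le> C * \<delta>" by (rule mult_right_mono[OF that(4) d])
    finally show ?thesis using that(1) by linarith
  qed
  have Cle: "p \<le> C" "q \<le> C" "p * t \<le> C" "p * r \<le> C" "q * t \<le> C" "q * r \<le> C"
    unfolding C using nn nn2 by linarith+
  have mX: "(eta_set \<eta>X ?N)\<^sup>2 \<le> p * (eta_set \<eta>X M')\<^sup>2"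
    if "minimal_marking \<eta>X \<theta>X ?N M'" for M'
    unfolding p_def using that by (intro square_le_of_scaled_le[OF pos(1) eta_set_nonneg]) (simp add: minimal_marking_def)
  have mP: "(eta_set \<eta>P ?Q)\<^sup>2 \<le> q * (eta_set \<eta>P M')\<^sup>2" if "minimal_marking \<eta>P \<theta>P ?Q M'" for M'
    unfolding q_def using that by (intro square_le_of_scaled_le[OF pos(2) eta_set_nonneg]) (simp add: minimal_marking_def)
  have t_le: "x\<^sup>2 \<le> t * y\<^sup>2" if "x \<le> \<Theta> * y" "0 \<le> x" for x y :: real
    using power_mono[OF that, of 2] by (simp add: t_def power_mult_distrib)
  have MT: "M \<subseteq> vertices T1" "nvb_refinement T T1" "conforming_triangulation D T1" using T1 by (auto simp: is_refine_def)
  from mark show ?thesis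
  proof
    assume A: "marking_A D \<theta>X \<theta>P \<Theta> \<eta>X \<eta>P T \<PP> M \<MM>"
    show ?thesis
    proof (cases "\<Theta> * eta_set \<eta>P ?Q \<le> eta_set \<eta>X ?N")
      case True
      then have m: "minimal_marking \<eta>X \<theta>X ?N M" using A by (simp add: marking_A_def)
      then have "M \<subseteq> ?N \<inter> vertices T1" using MT(1) by (auto simp: minimal_marking_def)
      then have "eta_set \<eta>X M \<le> eta_set \<eta>X (?N \<inter> vertices T1)" using fin by (intro eta_set_mono) auto
      from power_mono[OF this eta_set_nonneg, of 2] have M: "(eta_set \<eta>X M)\<^sup>2 \<le> \<delta>" using X by linarith
      have x: "(eta_set \<eta>X ?N)\<^sup>2 \<le> p * (eta_set \<eta>X M)\<^sup>2" by (rule mX[OF m])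
      have "(eta_set \<eta>P ?Q)\<^sup>2 \<le> r * (eta_set \<eta>X ?N)\<^sup>2"
        unfolding r_def by (rule square_le_of_scaled_le[OF pos(3) eta_set_nonneg True])
      also have "\<dots> \<le> r * (p * (eta_set \<eta>X M)\<^sup>2)" by (rule mult_left_mono[OF x nn(4)])
      finally have y: "(eta_set \<eta>P ?Q)\<^sup>2 \<le> (p * r) * (eta_set \<eta>X M)\<^sup>2" by (simp add: mult_ac)
      show ?thesis using le[OF x M nn(1) Cle(1)] le[OF y M nn2(2) Cle(4)] by blast
    next
      case False
      then have m: "minimal_marking \<eta>P \<theta>P ?Q \<MM>" using A by (simp add: marking_A_def)
      note y = mP[OF m]
      have "(eta_set \<eta>X ?N)\<^sup>2 \<le> t * (eta_set \<eta>P ?Q)\<^sup>2" by (rule t_le) (use False eta_set_nonneg in auto)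
      also have "\<dots> \<le> t * (q * (eta_set \<eta>P \<MM>)\<^sup>2)" by (rule mult_left_mono[OF y nn(3)])
      finally have x: "(eta_set \<eta>X ?N)\<^sup>2 \<le> (q * t) * (eta_set \<eta>P \<MM>)\<^sup>2" by (simp add: mult_ac)
      show ?thesis using le[OF x P nn2(3) Cle(5)] le[OF y P nn(2) Cle(2)] by blast
    qed
  next
    assume "marking_B D \<theta>X \<theta>P \<Theta> \<eta>X \<eta>P T \<PP> M \<MM>"
    then obtain \<MM>' M' T' where mp: "minimal_marking \<eta>P \<theta>P ?Q \<MM>'" and mx: "minimal_marking \<eta>X \<theta>X ?N M'"
      and T': "is_refine D T M' T'"
      and alt: "if \<Theta> * eta_set \<eta>P \<MM>' \<le> eta_set \<eta>X (?N \<inter> vertices T') then \<MM> = {} \<and> M = M' else \<MM> = \<MM>' \<and> M = {}"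
      unfolding marking_B_def by blast
    have "M' \<subseteq> ?N \<inter> vertices T'" using mx T' by (auto simp: minimal_marking_def is_refine_def)
    then have "eta_set \<eta>X M' \<le> eta_set \<eta>X (?N \<inter> vertices T')" using fin by (intro eta_set_mono) auto
    from power_mono[OF this eta_set_nonneg, of 2]
    have MR: "(eta_set \<eta>X M')\<^sup>2 \<le> (eta_set \<eta>X (?N \<inter> vertices T'))\<^sup>2" .
    show ?thesis
    proof (cases "\<Theta> * eta_set \<eta>P \<MM>' \<le> eta_set \<eta>X (?N \<inter> vertices T')")
      case True
      then have "M = M'" using alt by simp
      then have "nvb_refinement T' T1" using T' MT by (simp add: is_refine_def)
      then have "vertices T' \<subseteq> vertices T1" by (rule nvb_refinement_vertices)
      then have "eta_set \<eta>X (?N \<inter> vertices T') \<le> eta_set \<eta>X (?N \<inter> vertices T1)" using fin by (intro eta_set_mono) auto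
      from power_mono[OF this eta_set_nonneg, of 2]
      have R: "(eta_set \<eta>X (?N \<inter> vertices T'))\<^sup>2 \<le> \<delta>" using X by linarith
      then have M: "(eta_set \<eta>X M')\<^sup>2 \<le> \<delta>" using MR by linarith
      have "(eta_set \<eta>P \<MM>')\<^sup>2 \<le> r * (eta_set \<eta>X (?N \<inter> vertices T'))\<^sup>2"
        unfolding r_def by (rule square_le_of_scaled_le[OF pos(3) eta_set_nonneg True])
      from order_trans[OF mP[OF mp] mult_left_mono[OF this nn(2)]]
      have y: "(eta_set \<eta>P ?Q)\<^sup>2 \<le> (q * r) * (eta_set \<eta>X (?N \<inter> vertices T'))\<^sup>2" by (simp only: mult.assoc)
      show ?thesis using le[OF mX[OF mx] M nn(1) Cle(1)] le[OF y R nn2(4) Cle(6)] by blast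
    next
      case False
      then have "\<MM> = \<MM>'" using alt by simp
      then have MP: "(eta_set \<eta>P \<MM>')\<^sup>2 \<le> \<delta>" using P by simp
      have "(eta_set \<eta>X (?N \<inter> vertices T'))\<^sup>2 \<le> t * (eta_set \<eta>P \<MM>')\<^sup>2" by (rule t_le) (use False eta_set_nonneg in auto)
      with MR have M: "(eta_set \<eta>X M')\<^sup>2 \<le> t * (eta_set \<eta>P \<MM>')\<^sup>2" by linarith
      from order_trans[OF mX[OF mx] mult_left_mono[OF M nn(1)]]
      have x: "(eta_set \<eta>X ?N)\<^sup>2 \<le> (p * t) * (eta_set \<eta>P \<MM>')\<^sup>2" by (simp only: mult.assoc)
      show ?thesis using le[OF x MP nn2(1) Cle(3)] le[OF mP[OF mp] MP nn(2) Cle(2)] by blast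
    qed
  qed
qed

section \<open>Residuals on one level\<close>

text \<open>One level of the algorithm, seen only through the error \<open>r\<close> of its Galerkin solution.\<close>

locale galerkin_level = parametric_basis D a0 \<pi> a a0_min \<tau> P + mesh D T \<kappa> for D a0 \<pi> a a0_min \<tau> P T \<kappa> +
  fixes \<PP> :: "multi_index set" and r :: rfield
  assumes finite_PP: "finite \<PP>" and PP_multi: "\<PP> \<subseteq> multi_indices" and r_V: "r \<in> V"
    and orthog: "\<And>v. v \<in> V_disc D P T \<PP> \<Longrightarrow> B D a0 \<pi> a r v = 0"
begin

text \<open>The residual of the Galerkin solution, tested with an elementary tensor.\<close>

definition rho :: "(point \<Rightarrow> real) \<Rightarrow> multi_index \<Rightarrow> real" where
  "rho \<phi> \<nu> = B D a0 \<pi> a r (tens \<phi> (tp \<nu>))"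

lemma tens_add: "tens (\<phi> + \<psi>) p = tens \<phi> p + tens \<psi> p"
  by (simp add: fun_eq_iff tens_def distrib_right)

lemma tens_scale: "tens (c *\<^sub>R \<phi>) p = c *\<^sub>R tens \<phi> p"
  by (simp add: fun_eq_iff tens_def)

lemma rho_add: "\<phi> \<in> H10 D \<Longrightarrow> \<psi> \<in> H10 D \<Longrightarrow> rho (\<phi> + \<psi>) \<nu> = rho \<phi> \<nu> + rho \<psi> \<nu>"
  unfolding rho_def tens_add by (intro BB.add_right tens_poly_V r_V)

lemma rho_scale: "\<phi> \<in> H10 D \<Longrightarrow> rho (c *\<^sub>R \<phi>) \<nu> = c * rho \<phi> \<nu>"
  unfolding rho_def tens_scale by (intro BB.scale_right tens_poly_V r_V)

lemma rho_sum:
  assumes "finite I" "\<And>i. i \<in> I \<Longrightarrow> \<phi> i \<in> H10 D" shows "rho (\<Sum>i\<in>I. c i *\<^sub>R \<phi> i) \<nu> = (\<Sum>i\<in>I. c i * rho (\<phi> i) \<nu>)"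
  using assms
proof (induction I)
  case empty
  have "rho ((0 :: real) *\<^sub>R 0) \<nu> = 0" using rho_scale[OF subspace_0[OF subspace_H10], of 0] by simp
  then show ?case by (simp only: sum.empty scaleR_zero_left)
next
  case (insert i I)
  have "rho (\<Sum>i\<in>insert i I. c i *\<^sub>R \<phi> i) \<nu> = rho (c i *\<^sub>R \<phi> i + (\<Sum>i\<in>I. c i *\<^sub>R \<phi> i)) \<nu>"
    by (simp only: sum.insert[OF insert.hyps])
  also have "\<dots> = rho (c i *\<^sub>R \<phi> i) \<nu> + rho (\<Sum>i\<in>I. c i *\<^sub>R \<phi> i) \<nu>"
    by (intro rho_add subspace_sum[OF subspace_H10] subspace_scale[OF subspace_H10] insert.prems) simp_all
  also have "\<dots> = c i * rho (\<phi> i) \<nu> + (\<Sum>i\<in>I. c i * rho (\<phi> i) \<nu>)"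
    by (simp only: insert.IH[OF insert.prems[OF insertI2]] rho_scale[OF insert.prems[OF insertI1]])
  finally show ?case by (simp only: sum.insert[OF insert.hyps])
qed

text \<open>Needed since the Dirichlet form is degenerate on representatives: a hat function of energy zero would make the
  error estimate a quotient by zero.\<close>

lemma rho_null:
  assumes "\<phi> \<in> H10 D" "dform a0 \<phi> \<phi> = 0" shows "rho \<phi> \<nu> = 0"
proof -
  let ?t = "tens \<phi> (tp \<nu>)"
  have t: "?t \<in> V" by (rule tens_poly_V[OF assms(1)])
  have "B0 D a0 \<pi> ?t ?t = 0" using B0_tens[OF H10_H1[OF assms(1)] H10_H1[OF assms(1)]] assms(2) by simp
  then have "B D a0 \<pi> a ?t ?t = 0" using B_upper[OF t] BB.nonneg[OF t] by simp
  then have "(rho \<phi> \<nu>)\<^sup>2 \<le> 0" using BB.Cauchy_Schwarz_square[OF r_V t] by (simp add: rho_def)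
  then show ?thesis by simp
qed

lemma rho_S10: "\<phi> \<in> S10 D T \<Longrightarrow> \<nu> \<in> \<PP> \<Longrightarrow> rho \<phi> \<nu> = 0"
  using orthog[OF expand_V_disc[OF finite_PP, of "{\<nu>}" "\<lambda>_. \<phi>"]] by (simp add: expand_sum rho_def)

lemma B_expand: "(\<And>\<nu>. \<nu> \<in> \<QQ> \<Longrightarrow> v \<nu> \<in> H10 D) \<Longrightarrow> B D a0 \<pi> a r (expand \<QQ> v) = (\<Sum>\<nu>\<in>\<QQ>. rho (v \<nu>) \<nu>)"
  unfolding expand_sum rho_def by (intro BB.sum_right tens_poly_V r_V)

text \<open>The defining property of \<open>e_index\<close>, reduced to the Dirichlet form with weight \<open>a0\<close>.\<close>

definition representer :: "multi_index \<Rightarrow> (point \<Rightarrow> real) \<Rightarrow> bool" where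
  "representer \<nu> e \<longleftrightarrow> e \<in> S10 D T \<and> (\<forall>v\<in>S10 D T. dform a0 e v = rho v \<nu>)"

lemma S10_H1: "v \<in> S10 D S \<Longrightarrow> v \<in> H1 D"
  using S10_H10 H10_H1 by blast

text \<open>The Riesz representation is applied on a finite spanning set; the remaining functions differ from its span only
  outside \<open>D\<close>, where neither side can see them.\<close>

lemma representer_exists: "\<exists>e. representer \<nu> e"
proof -
  interpret S: semi_inner "S10 D T" "dform a0"
  proof (rule semi_inner.intro)
    show "dform a0 v w = dform a0 w v" for v w by (rule dform_sym)
    show "dform a0 (u + v) w = dform a0 u w + dform a0 v w" if "u \<in> S10 D T" "v \<in> S10 D T" "w \<in> S10 D T" for u v w
      by (rule A0.add[OF that[THEN S10_H1]])
    show "dform a0 (c *\<^sub>R v) w = c * dform a0 v w" if "v \<in> S10 D T" "w \<in> S10 D T" for c v w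
      by (rule A0.scale[OF that[THEN S10_H1]])
    show "0 \<le> dform a0 v v" if "v \<in> S10 D T" for v by (rule A0.nonneg[OF that[THEN S10_H1]])
  qed (rule S10_sub)
  obtain Z where Z: "finite Z" "Z \<subseteq> S10 D T" "\<And>v. v \<in> S10 D T \<Longrightarrow> \<exists>w\<in>span Z. \<forall>x\<in>closure D. v x = w x"
    using S10_finite_dim by blast
  have sp: "span Z \<subseteq> S10 D T" by (rule span_minimal[OF Z(2) S10_sub])
  have "\<exists>e\<in>span Z. \<forall>v\<in>span Z. dform a0 e v = rho v \<nu>"
    by (rule S.finite_dim_riesz[OF Z(1,2)]) (intro rho_add rho_scale rho_null S10_H10; assumption)+
  then obtain e where e: "e \<in> span Z" "\<And>v. v \<in> span Z \<Longrightarrow> dform a0 e v = rho v \<nu>" by blast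
  have "dform a0 e v = rho v \<nu>" if v: "v \<in> S10 D T" for v
  proof -
    obtain w where w: "w \<in> span Z" "\<forall>x\<in>closure D. v x = w x" using Z(3)[OF v] by blast
    have wS: "w \<in> S10 D T" and eS: "e \<in> S10 D T" using sp w(1) e(1) by blast+
    have dS: "v - w \<in> S10 D T" by (rule subspace_diff[OF S10_sub v wS])
    have z: "dform a0 (v - w) u = 0" if "u \<in> H1 D" for u
      by (rule dform_eq_zero_on[OF S10_H1[OF dS] _ that a0_Linf]) (use w(2) closure_subset in auto)
    have vw: "w + (v - w) = v" by (simp only: add.commute[of w] diff_add_cancel)
    have "dform a0 e v = dform a0 e w + dform a0 (v - w) e"
      using S.add_right[OF wS dS eS] S.sym[OF dS eS] unfolding vw by simp
    also have "\<dots> = rho w \<nu> + rho (v - w) \<nu>"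
      using z[OF S10_H1[OF eS]] e(2)[OF w(1)] rho_null[OF S10_H10[OF dS] z[OF S10_H1[OF dS]]] by simp
    also have "\<dots> = rho v \<nu>" using rho_add[OF S10_H10[OF wS] S10_H10[OF dS]] unfolding vw by simp
    finally show ?thesis .
  qed
  then show ?thesis using e(1) sp unfolding representer_def by blast
qed

abbreviation hat_sq where "hat_sq z \<equiv> dform a0 (ghat z) (ghat z)"

lemma hat_sq_nonneg: "z \<in> Np \<Longrightarrow> 0 \<le> hat_sq z"
  by (rule A0.nonneg[OF H10_H1[OF ghat_H10]])

text \<open>The coarse part of \<open>v\<close> is annihilated by Galerkin orthogonality. The hat functions are treated by Young's inequality, and the
  stability of the splitting returns their energies to \<open>v\<close>. The ratio \<open>M / m\<close> passes between the weight
  \<open>a0\<close> and the weight one.\<close>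

lemma rho_refined_bound:
  assumes v: "v \<in> S10 D Th" and \<nu>: "\<nu> \<in> \<PP>" and m: "0 < m" "AE x in lebesgue_on D. m \<le> a0 x" "AE x in lebesgue_on D. a0 x \<le> M"
    and M0: "0 \<le> M"
    and s: "0 < s" and K: "K = 48 * \<kappa>\<^sup>2 * M / m + 1"
  shows "rho v \<nu> \<le> K / (2 * s) * (\<Sum>z\<in>Np. (rho (ghat z) \<nu>)\<^sup>2 / hat_sq z) + s / 2 * dform a0 v v"
proof -
  have K1: "1 \<le> K" using M0 m(1) by (simp add: K)
  obtain c w where w: "w \<in> S10 D T" and vw: "v = w + (\<Sum>z\<in>Np. c z *\<^sub>R ghat z)"
    and le: "(\<Sum>z\<in>Np. (c z)\<^sup>2 * dform (\<lambda>_. 1) (ghat z) (ghat z)) \<le> 48 * \<kappa>\<^sup>2 * dform (\<lambda>_. 1) v v"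
    by (rule interpolation_split[OF v])
  have vH: "v \<in> H1 D" by (rule S10_H1[OF v])
  have one: "m * dform (\<lambda>_. 1) v v \<le> dform a0 v v"
    using dform_mono[OF const_Linf[of m] a0_Linf vH m(2)] unfolding dform_const[of m v v] .
  have hat: "hat_sq z \<le> M * dform (\<lambda>_. 1) (ghat z) (ghat z)" if "z \<in> Np" for z
    using dform_mono[OF a0_Linf const_Linf[of M] H10_H1[OF ghat_H10[OF that]] m(3)] unfolding dform_const[of M "ghat z" "ghat z"] .
  have "(\<Sum>z\<in>Np. (c z)\<^sup>2 * hat_sq z) \<le> (\<Sum>z\<in>Np. M * ((c z)\<^sup>2 * dform (\<lambda>_. 1) (ghat z) (ghat z)))"
    by (rule sum_mono) (use hat in \<open>simp add: mult.left_commute[of M] mult_left_mono\<close>)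
  also have "\<dots> \<le> M * (48 * \<kappa>\<^sup>2 * dform (\<lambda>_. 1) v v)"
    unfolding sum_distrib_left[symmetric] by (rule mult_left_mono[OF le M0])
  also have "\<dots> = (48 * \<kappa>\<^sup>2 * M / m) * (m * dform (\<lambda>_. 1) v v)" using m(1) by simp
  also have "\<dots> \<le> (48 * \<kappa>\<^sup>2 * M / m) * dform a0 v v" by (rule mult_left_mono[OF one]) (use M0 m(1) in simp)
  also have "\<dots> \<le> K * dform a0 v v" by (rule mult_right_mono[OF _ A0.nonneg[OF vH]]) (simp add: K)
  finally have stab: "(\<Sum>z\<in>Np. (c z)\<^sup>2 * hat_sq z) \<le> K * dform a0 v v" .
  have sH: "(\<Sum>z\<in>Np. c z *\<^sub>R ghat z) \<in> H10 D"
    by (intro subspace_sum[OF subspace_H10] subspace_scale[OF subspace_H10] ghat_H10)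
  have "rho v \<nu> = rho w \<nu> + rho (\<Sum>z\<in>Np. c z *\<^sub>R ghat z) \<nu>"
    unfolding vw by (rule rho_add[OF S10_H10[OF w] sH])
  also have "\<dots> = (\<Sum>z\<in>Np. c z * rho (ghat z) \<nu>)"
    using rho_S10[OF w \<nu>] rho_sum[OF finite_Np ghat_H10] by simp
  also have "\<dots> \<le> (\<Sum>z\<in>Np. K / (2 * s) * ((rho (ghat z) \<nu>)\<^sup>2 / hat_sq z) + s / (2 * K) * ((c z)\<^sup>2 * hat_sq z))"
  proof (rule sum_mono)
    fix z assume z: "z \<in> Np"
    show "c z * rho (ghat z) \<nu> \<le> K / (2 * s) * ((rho (ghat z) \<nu>)\<^sup>2 / hat_sq z) + s / (2 * K) * ((c z)\<^sup>2 * hat_sq z)"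
    proof (cases "hat_sq z = 0")
      case True
      then show ?thesis using rho_null[OF ghat_H10[OF z]] by simp
    next
      case False
      then have A: "0 < hat_sq z" using hat_sq_nonneg[OF z] by simp
      show ?thesis by (rule young_weighted[OF s _ A]) (use K1 in linarith)
    qed
  qed
  also have "\<dots> = K / (2 * s) * (\<Sum>z\<in>Np. (rho (ghat z) \<nu>)\<^sup>2 / hat_sq z) + s / (2 * K) * (\<Sum>z\<in>Np. (c z)\<^sup>2 * hat_sq z)"
    by (simp only: sum.distrib sum_distrib_left)
  also have "\<dots> \<le> K / (2 * s) * (\<Sum>z\<in>Np. (rho (ghat z) \<nu>)\<^sup>2 / hat_sq z) + s / (2 * K) * (K * dform a0 v v)"
    by (intro add_left_mono mult_left_mono[OF stab]) (use s K1 in simp)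
  also have "\<dots> = K / (2 * s) * (\<Sum>z\<in>Np. (rho (ghat z) \<nu>)\<^sup>2 / hat_sq z) + s / 2 * dform a0 v v" using K1 by simp
  finally show ?thesis .
qed

end

section \<open>Reliability and efficiency\<close>

lemma fun_diff2: "(\<lambda>y x. u y x - w y x) = (u - w :: rfield)"
  by (simp add: fun_eq_iff)

context random_field
begin

text \<open>With \<open>v\<close> the Riesz-type test function of the estimate \<open>H\<close>, both \<open>B d v\<close> and the energy of \<open>v\<close> are of size \<open>H\<close>; the
  Cauchy--Schwarz inequality then leaves \<open>H\<close> bounded by the energy of \<open>d\<close>.\<close>

lemma efficiency_duality:
  assumes d: "d \<in> V" and v: "v \<in> V" and H: "0 \<le> H" "B D a0 \<pi> a d v = H" and c: "B0 D a0 \<pi> v v \<le> c * H" and c0: "0 \<le> c"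
  shows "H \<le> c * (1 + \<tau>) * B D a0 \<pi> a d d"
proof (cases "H = 0")
  case True
  then show ?thesis using tau_nonneg BB.nonneg[OF d] c0 by simp
next
  case False
  then have pos: "0 < H" using H by simp
  have "H\<^sup>2 \<le> B D a0 \<pi> a d d * B D a0 \<pi> a v v" using BB.Cauchy_Schwarz_square[OF d v] by (simp only: H)
  also have "\<dots> \<le> B D a0 \<pi> a d d * ((1 + \<tau>) * (c * H))"
    by (intro mult_left_mono[OF _ BB.nonneg[OF d]] order_trans[OF B_upper[OF v]] mult_left_mono[OF c]) (use tau_nonneg in simp)
  finally have "H * H \<le> (c * (1 + \<tau>) * B D a0 \<pi> a d d) * H" by (simp add: power2_eq_square mult_ac)
  then show ?thesis using pos by simp
qed

end

context galerkin_level
begin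

abbreviation QQ where "QQ \<equiv> detail_indices \<PP>"

lemma finite_QQ: "finite QQ"
  by (rule finite_detail_indices[OF finite_PP])

text \<open>The enriched space has refined coefficient functions on old modes and coarse ones on new modes, so the polynomial
  modes can be estimated separately.\<close>

lemma V_enriched_iff:
  "w \<in> V_enriched D P T \<PP> \<longleftrightarrow>
    (\<exists>g. (\<forall>\<nu>\<in>\<PP>. g \<nu> \<in> S10 D Th) \<and> (\<forall>\<nu>\<in>QQ. g \<nu> \<in> S10 D T) \<and> w = expand (\<PP> \<union> QQ) g)"
proof
  have fin: "finite (\<PP> \<union> QQ)" using finite_PP finite_QQ by simp
  {
    assume "w \<in> V_enriched D P T \<PP>"
    then obtain v1 v2 where v1: "v1 \<in> V_disc D P Th \<PP>" and v2: "v2 \<in> V_disc D P T (\<PP> \<union> QQ)"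
      and w: "w = (\<lambda>y x. v1 y x + v2 y x)"
      unfolding V_enriched_def V_disc_def by blast
    obtain g1 where g1: "\<And>\<nu>. g1 \<nu> \<in> S10 D Th" "v1 = expand \<PP> g1" using v1 V_disc_iff[OF finite_PP] by blast
    obtain g2 where g2: "\<And>\<nu>. g2 \<nu> \<in> S10 D T" "v2 = expand (\<PP> \<union> QQ) g2" using v2 V_disc_iff[OF fin] by blast
    define g where "g \<nu> = (if \<nu> \<in> \<PP> then g1 \<nu> else 0) + g2 \<nu>" for \<nu>
    have "w = expand (\<PP> \<union> QQ) g"
      unfolding w g1(2) g2(2) expand_extend[OF fin Un_upper1, of g1]
      by (intro ext) (simp add: expand_def g_def distrib_right sum.distrib)
    moreover have "g \<nu> \<in> S10 D Th" if "\<nu> \<in> \<PP>" for \<nu>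
    proof -
      have "g \<nu> = g1 \<nu> + g2 \<nu>" using that by (simp only: g_def if_True)
      then show ?thesis using subspace_add[OF S10_sub g1(1) subsetD[OF S10_subset_Th g2(1)]] by (simp only:)
    qed
    moreover have "g \<nu> \<in> S10 D T" if "\<nu> \<in> QQ" for \<nu>
    proof -
      have "\<nu> \<notin> \<PP>" using that detail_indices_multi(2)[of \<PP>] by blast
      then have "g \<nu> = g2 \<nu>" by (simp only: g_def if_False add_0)
      then show ?thesis using g2(1) by (simp only:)
    qed
    ultimately show "\<exists>g. (\<forall>\<nu>\<in>\<PP>. g \<nu> \<in> S10 D Th) \<and> (\<forall>\<nu>\<in>QQ. g \<nu> \<in> S10 D T) \<and> w = expand (\<PP> \<union> QQ) g" by blast
  next
    assume "\<exists>g. (\<forall>\<nu>\<in>\<PP>. g \<nu> \<in> S10 D Th) \<and> (\<forall>\<nu>\<in>QQ. g \<nu> \<in> S10 D T) \<and> w = expand (\<PP> \<union> QQ) g"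
    then obtain g where g: "\<And>\<nu>. \<nu> \<in> \<PP> \<Longrightarrow> g \<nu> \<in> S10 D Th" "\<And>\<nu>. \<nu> \<in> QQ \<Longrightarrow> g \<nu> \<in> S10 D T" "w = expand (\<PP> \<union> QQ) g" by blast
    have "w = (\<lambda>y x. expand \<PP> g y x + expand QQ g y x)"
      unfolding g(3) expand_def using detail_indices_multi(2)[of \<PP>] by (simp add: sum.union_disjoint[OF finite_PP finite_QQ])
    moreover have "expand \<PP> g \<in> V_disc D P Th \<PP>" by (rule expand_V_disc[OF finite_PP subset_refl g(1)])
    moreover have "expand QQ g \<in> V_disc D P T (\<PP> \<union> QQ)" by (rule expand_V_disc[OF fin Un_upper2 g(2)])
    ultimately show "w \<in> V_enriched D P T \<PP>" unfolding V_enriched_def V_disc_def by blast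
  }
qed

lemma V_enriched_V: "V_enriched D P T \<PP> \<subseteq> V"
proof
  fix w assume "w \<in> V_enriched D P T \<PP>"
  then obtain g where g: "\<forall>\<nu>\<in>\<PP>. g \<nu> \<in> S10 D Th" "\<forall>\<nu>\<in>QQ. g \<nu> \<in> S10 D T" and w: "w = expand (\<PP> \<union> QQ) g"
    unfolding V_enriched_iff by blast
  show "w \<in> V" unfolding w by (rule expand_V) (use g S10_H10 in blast)
qed

lemma V_enriched_diff:
  assumes "v \<in> V_enriched D P T \<PP>" "w \<in> V_enriched D P T \<PP>" shows "v - w \<in> V_enriched D P T \<PP>"
proof -
  obtain g where g: "\<forall>\<nu>\<in>\<PP>. g \<nu> \<in> S10 D Th" "\<forall>\<nu>\<in>QQ. g \<nu> \<in> S10 D T" and v: "v = expand (\<PP> \<union> QQ) g"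
    using assms(1) unfolding V_enriched_iff by blast
  obtain h where h: "\<forall>\<nu>\<in>\<PP>. h \<nu> \<in> S10 D Th" "\<forall>\<nu>\<in>QQ. h \<nu> \<in> S10 D T" and w: "w = expand (\<PP> \<union> QQ) h"
    using assms(2) unfolding V_enriched_iff by blast
  have "v - w = expand (\<PP> \<union> QQ) (\<lambda>\<nu>. g \<nu> - h \<nu>)"
    unfolding v w expand_def by (intro ext) (simp add: left_diff_distrib sum_subtractf)
  moreover have "\<forall>\<nu>\<in>\<PP>. g \<nu> - h \<nu> \<in> S10 D Th" "\<forall>\<nu>\<in>QQ. g \<nu> - h \<nu> \<in> S10 D T"
    using g h subspace_diff[OF S10_sub] by blast+
  ultimately show ?thesis unfolding V_enriched_iff by (intro exI[of _ "\<lambda>\<nu>. g \<nu> - h \<nu>"] conjI)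
qed

lemma V_disc_enriched: "V_disc D P T \<PP> \<subseteq> V_enriched D P T \<PP>"
proof
  fix w assume "w \<in> V_disc D P T \<PP>"
  then obtain v where v: "\<And>\<nu>. v \<nu> \<in> S10 D T" and w: "w = expand \<PP> v" using V_disc_iff[OF finite_PP] by blast
  have fin: "finite (\<PP> \<union> QQ)" using finite_PP finite_QQ by simp
  let ?g = "\<lambda>\<nu>. if \<nu> \<in> \<PP> then v \<nu> else 0"
  have "?g \<nu> \<in> S10 D T" for \<nu> using v subspace_0[OF S10_sub, of T] by (cases "\<nu> \<in> \<PP>") (simp_all only: if_True if_False)
  then show "w \<in> V_enriched D P T \<PP>"
    unfolding V_enriched_iff w expand_extend[OF fin Un_upper1] using S10_subset_Th by (intro exI[of _ ?g] conjI ballI) (blast, blast, rule HOL.refl)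
qed

text \<open>The energy of the enriched increment is the residual tested with the increment itself. Old modes are bounded by the vertex
  estimates, new modes by their Riesz representers. The factor \<open>s = 1 - \<tau>\<close> in Young's inequality lets the
  ellipticity of \<open>B\<close> absorb half of the left-hand side.\<close>

lemma reliability:
  assumes e: "e \<in> V_enriched D P T \<PP>" and ee: "B D a0 \<pi> a e e = B D a0 \<pi> a r e"
    and E: "\<And>\<nu>. \<nu> \<in> QQ \<Longrightarrow> representer \<nu> (E \<nu>)"
    and m: "0 < m" "AE x in lebesgue_on D. m \<le> a0 x" "AE x in lebesgue_on D. a0 x \<le> M" "0 \<le> M"
    and K: "K = 48 * \<kappa>\<^sup>2 * M / m + 1"
  shows "(1 - \<tau>) * B D a0 \<pi> a e e \<le>
    K * (\<Sum>z\<in>Np. \<Sum>\<nu>\<in>\<PP>. (rho (ghat z) \<nu>)\<^sup>2 / hat_sq z) + (\<Sum>\<nu>\<in>QQ. dform a0 (E \<nu>) (E \<nu>))"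
proof -
  define s where "s = 1 - \<tau>"
  have s: "0 < s" using tau_less by (simp add: s_def)
  obtain g where g: "\<And>\<nu>. \<nu> \<in> \<PP> \<Longrightarrow> g \<nu> \<in> S10 D Th" "\<And>\<nu>. \<nu> \<in> QQ \<Longrightarrow> g \<nu> \<in> S10 D T" and eg: "e = expand (\<PP> \<union> QQ) g"
    using e unfolding V_enriched_iff by blast
  have gH: "g \<nu> \<in> H10 D" if "\<nu> \<in> \<PP> \<union> QQ" for \<nu> using that g S10_H10 by blast
  have disj: "\<PP> \<inter> QQ = {}" by (rule detail_indices_multi(2))
  let ?SX = "\<Sum>z\<in>Np. \<Sum>\<nu>\<in>\<PP>. (rho (ghat z) \<nu>)\<^sup>2 / hat_sq z" and ?SP = "\<Sum>\<nu>\<in>QQ. dform a0 (E \<nu>) (E \<nu>)"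
  let ?A = "\<Sum>\<nu>\<in>\<PP>. dform a0 (g \<nu>) (g \<nu>)" and ?B = "\<Sum>\<nu>\<in>QQ. dform a0 (g \<nu>) (g \<nu>)"
  have "B D a0 \<pi> a e e = (\<Sum>\<nu>\<in>\<PP>. rho (g \<nu>) \<nu>) + (\<Sum>\<nu>\<in>QQ. rho (g \<nu>) \<nu>)"
    unfolding ee unfolding eg by (simp only: B_expand[of "\<PP> \<union> QQ" g, OF gH] sum.union_disjoint[OF finite_PP finite_QQ disj])
  moreover have "(\<Sum>\<nu>\<in>\<PP>. rho (g \<nu>) \<nu>) \<le> (\<Sum>\<nu>\<in>\<PP>. K / (2 * s) * (\<Sum>z\<in>Np. (rho (ghat z) \<nu>)\<^sup>2 / hat_sq z) + s / 2 * dform a0 (g \<nu>) (g \<nu>))"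
    by (rule sum_mono) (rule rho_refined_bound[OF g(1) _ m s K])
  moreover have "\<dots> = K / (2 * s) * ?SX + s / 2 * ?A"
    by (simp only: sum.distrib sum_distrib_left[symmetric] sum.swap[of _ Np \<PP>])
  moreover have "(\<Sum>\<nu>\<in>QQ. rho (g \<nu>) \<nu>) \<le> (\<Sum>\<nu>\<in>QQ. 1 / (2 * s) * dform a0 (E \<nu>) (E \<nu>) + s / 2 * dform a0 (g \<nu>) (g \<nu>))"
  proof (rule sum_mono)
    fix \<nu> assume \<nu>: "\<nu> \<in> QQ"
    have EH: "E \<nu> \<in> H1 D" and rep: "rho (g \<nu>) \<nu> = dform a0 (E \<nu>) (g \<nu>)"
      using E[OF \<nu>] g(2)[OF \<nu>] S10_H1 unfolding representer_def by (blast, metis)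
    have gH1: "g \<nu> \<in> H1 D" by (rule S10_H1[OF g(2)[OF \<nu>]])
    have "dform a0 (E \<nu>) (g \<nu>) \<le> sqrt (dform a0 (E \<nu>) (E \<nu>)) * sqrt (dform a0 (g \<nu>) (g \<nu>))"
      using A0.Cauchy_Schwarz[OF EH gH1] by linarith
    also have "\<dots> \<le> (sqrt (dform a0 (E \<nu>) (E \<nu>)))\<^sup>2 / (2 * s) + s / 2 * (sqrt (dform a0 (g \<nu>) (g \<nu>)))\<^sup>2"
      by (rule young_product[OF s])
    finally show "rho (g \<nu>) \<nu> \<le> 1 / (2 * s) * dform a0 (E \<nu>) (E \<nu>) + s / 2 * dform a0 (g \<nu>) (g \<nu>)"
      unfolding rep real_sqrt_pow2[OF A0.nonneg[OF EH]] real_sqrt_pow2[OF A0.nonneg[OF gH1]] by simp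
  qed
  moreover have "\<dots> = 1 / (2 * s) * ?SP + s / 2 * ?B" by (simp only: sum.distrib sum_distrib_left[symmetric])
  ultimately have 1: "B D a0 \<pi> a e e \<le> (K / (2 * s) * ?SX + s / 2 * ?A) + (1 / (2 * s) * ?SP + s / 2 * ?B)" by linarith
  have "B0 D a0 \<pi> e e = (\<Sum>\<nu>\<in>\<PP> \<union> QQ. dform a0 (g \<nu>) (g \<nu>))"
    unfolding eg by (rule B0_expand) (use finite_PP finite_QQ PP_multi detail_indices_multi(1)[of \<PP>] gH in auto)
  then have "B0 D a0 \<pi> e e = ?A + ?B" by (simp only: sum.union_disjoint[OF finite_PP finite_QQ disj])
  then have "s * (?A + ?B) \<le> B D a0 \<pi> a e e" using B_lower[of e] e V_enriched_V unfolding s_def by (metis subsetD)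
  then have "s / 2 * ?A + s / 2 * ?B \<le> B D a0 \<pi> a e e / 2" by (simp add: distrib_left)
  with 1 have "B D a0 \<pi> a e e / 2 \<le> K / (2 * s) * ?SX + 1 / (2 * s) * ?SP" by linarith
  from mult_left_mono[OF this, of "2 * s"] show ?thesis using s unfolding s_def[symmetric] by (simp add: distrib_left)
qed

text \<open>The test function combines the hat functions with the normalised residuals as coefficients. It belongs to the next discrete
  space, and the threefold overlap bounds its energy.\<close>

lemma vertex_efficiency:
  assumes d: "d \<in> V" and P': "finite \<PP>'" "\<PP> \<subseteq> \<PP>'" and R: "R \<subseteq> Np" "\<And>z. z \<in> R \<Longrightarrow> ghat z \<in> S10 D T'"
    and gal: "\<And>v. v \<in> V_disc D P T' \<PP>' \<Longrightarrow> B D a0 \<pi> a d v = B D a0 \<pi> a r v"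
  shows "(\<Sum>z\<in>R. \<Sum>\<nu>\<in>\<PP>. (rho (ghat z) \<nu>)\<^sup>2 / hat_sq z) \<le> 3 * (1 + \<tau>) * B D a0 \<pi> a d d"
proof -
  have fR: "finite R" by (rule finite_subset[OF R(1) finite_Np])
  have hR: "ghat z \<in> H10 D" if "z \<in> R" for z using ghat_H10 R(1) that by blast
  define c where "c \<nu> z = rho (ghat z) \<nu> / hat_sq z" for \<nu> z
  define v where "v \<nu> = (\<Sum>z\<in>R. c \<nu> z *\<^sub>R ghat z)" for \<nu>
  let ?H = "\<Sum>z\<in>R. \<Sum>\<nu>\<in>\<PP>. (rho (ghat z) \<nu>)\<^sup>2 / hat_sq z"
  have vS: "v \<nu> \<in> S10 D T'" for \<nu>
    unfolding v_def by (intro subspace_sum[OF S10_sub] subspace_scale[OF S10_sub] R(2))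
  have swap: "?H = (\<Sum>\<nu>\<in>\<PP>. \<Sum>z\<in>R. (rho (ghat z) \<nu>)\<^sup>2 / hat_sq z)" by (rule sum.swap)
  have H0: "0 \<le> ?H" by (intro sum_nonneg divide_nonneg_nonneg zero_le_power2 hat_sq_nonneg) (use R(1) in blast)
  have "B D a0 \<pi> a d (expand \<PP> v) = B D a0 \<pi> a r (expand \<PP> v)" by (rule gal[OF expand_V_disc[OF P' vS]])
  also have "\<dots> = (\<Sum>\<nu>\<in>\<PP>. rho (v \<nu>) \<nu>)" by (rule B_expand[OF S10_H10[OF vS]])
  also have "\<dots> = ?H" unfolding swap
  proof (rule sum.cong[OF HOL.refl])
    fix \<nu> 
    have "rho (v \<nu>) \<nu> = (\<Sum>z\<in>R. c \<nu> z * rho (ghat z) \<nu>)" unfolding v_def by (rule rho_sum[OF fR hR])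
    then show "rho (v \<nu>) \<nu> = (\<Sum>z\<in>R. (rho (ghat z) \<nu>)\<^sup>2 / hat_sq z)" by (simp add: c_def power2_eq_square)
  qed
  finally have BH: "B D a0 \<pi> a d (expand \<PP> v) = ?H" .
  have "B0 D a0 \<pi> (expand \<PP> v) (expand \<PP> v) = (\<Sum>\<nu>\<in>\<PP>. dform a0 (v \<nu>) (v \<nu>))"
    by (rule B0_expand[OF finite_PP PP_multi S10_H10[OF vS]])
  also have "\<dots> \<le> (\<Sum>\<nu>\<in>\<PP>. 3 * (\<Sum>z\<in>R. (rho (ghat z) \<nu>)\<^sup>2 / hat_sq z))"
  proof (rule sum_mono)
    fix \<nu>
    have "(c \<nu> z)\<^sup>2 * hat_sq z = (rho (ghat z) \<nu>)\<^sup>2 / hat_sq z" for z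
      by (cases "hat_sq z = 0") (simp_all add: c_def power2_eq_square)
    then show "dform a0 (v \<nu>) (v \<nu>) \<le> 3 * (\<Sum>z\<in>R. (rho (ghat z) \<nu>)\<^sup>2 / hat_sq z)"
      using hat_overlap[OF a0_Linf a0_nonneg R(1), of "c \<nu>"] unfolding v_def by (simp only:)
  qed
  also have "\<dots> = 3 * ?H" unfolding swap by (rule sum_distrib_left[symmetric])
  finally show ?thesis by (rule efficiency_duality[OF d expand_V[OF S10_H10[OF vS]] H0 BH]) simp
qed

text \<open>The representers themselves serve as test functions on the new modes.\<close>

lemma index_efficiency:
  assumes d: "d \<in> V" and P': "finite \<PP>'" "\<QQ> \<subseteq> \<PP>'" "\<QQ> \<subseteq> multi_indices" and T': "S10 D T \<subseteq> S10 D T'"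
    and E: "\<And>\<nu>. \<nu> \<in> \<QQ> \<Longrightarrow> representer \<nu> (E \<nu>)"
    and gal: "\<And>v. v \<in> V_disc D P T' \<PP>' \<Longrightarrow> B D a0 \<pi> a d v = B D a0 \<pi> a r v"
  shows "(\<Sum>\<nu>\<in>\<QQ>. dform a0 (E \<nu>) (E \<nu>)) \<le> 1 * (1 + \<tau>) * B D a0 \<pi> a d d"
proof -
  have ES: "E \<nu> \<in> S10 D T" and Erep: "rho (E \<nu>) \<nu> = dform a0 (E \<nu>) (E \<nu>)" if "\<nu> \<in> \<QQ>" for \<nu>
    using E[OF that] unfolding representer_def by (blast, metis)
  let ?H = "\<Sum>\<nu>\<in>\<QQ>. dform a0 (E \<nu>) (E \<nu>)"
  have fin: "finite \<QQ>" by (rule finite_subset[OF P'(2,1)])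
  have H0: "0 \<le> ?H" by (intro sum_nonneg A0.nonneg S10_H1[OF ES])
  have "B D a0 \<pi> a d (expand \<QQ> E) = B D a0 \<pi> a r (expand \<QQ> E)"
    by (rule gal[OF expand_V_disc[OF P'(1,2)]]) (use ES T' in blast)
  also have "\<dots> = (\<Sum>\<nu>\<in>\<QQ>. rho (E \<nu>) \<nu>)" by (rule B_expand[OF S10_H10[OF ES]])
  also have "\<dots> = ?H" by (rule sum.cong[OF HOL.refl Erep])
  finally have BH: "B D a0 \<pi> a d (expand \<QQ> E) = ?H" .
  have EV: "expand \<QQ> E \<in> V" by (rule expand_V) (rule S10_H10[OF ES])
  have "B0 D a0 \<pi> (expand \<QQ> E) (expand \<QQ> E) \<le> 1 * ?H"
    using B0_expand[OF fin P'(3) S10_H10[OF ES]] by simp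
  then show ?thesis by (rule efficiency_duality[OF d EV H0 BH]) simp
qed

context
  fixes f :: "(nat \<Rightarrow> real) \<Rightarrow> (point \<Rightarrow> real) \<Rightarrow> real" and w :: rfield
  assumes res: "\<And>v. v \<in> V \<Longrightarrow> residual D a0 \<pi> a f w v = B D a0 \<pi> a r v"
begin

lemma residual_tens: "\<phi> \<in> H10 D \<Longrightarrow> residual D a0 \<pi> a f w (\<lambda>y x. \<phi> x * tp \<nu> y) = rho \<phi> \<nu>"
  using res[OF tens_poly_V, of \<phi> \<nu>] by (simp add: rho_def tens_def)

lemma eta_vertex_square:
  assumes z: "z \<in> Np"
  shows "(eta_vertex D a0 \<pi> a P f T \<PP> w z)\<^sup>2 = (\<Sum>\<nu>\<in>\<PP>. (rho (ghat z) \<nu>)\<^sup>2 / hat_sq z)"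
proof -
  have "hat_fun Th z = ghat z" using z by (intro hat_fun_eq_ghat) (simp add: Np_iff)
  then have "eta_vertex D a0 \<pi> a P f T \<PP> w z = sqrt (\<Sum>\<nu>\<in>\<PP>. (rho (ghat z) \<nu>)\<^sup>2 / hat_sq z)"
    by (simp only: eta_vertex_def Let_def residual_tens[OF ghat_H10[OF z]] power2_abs energy_seminorm0_square[OF H10_H1[OF ghat_H10[OF z]]])
  moreover have "0 \<le> (\<Sum>\<nu>\<in>\<PP>. (rho (ghat z) \<nu>)\<^sup>2 / hat_sq z)"
    by (intro sum_nonneg divide_nonneg_nonneg zero_le_power2 hat_sq_nonneg z)
  ultimately show ?thesis by (simp only: real_sqrt_pow2)
qed

text \<open>The choice in \<open>e_index\<close> is made from a nonempty set; any element has the property used above.\<close>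

lemma representer_e_index:
  assumes \<nu>: "\<nu> \<in> multi_indices" shows "representer \<nu> (e_index D a0 \<pi> a P f T w \<nu>)"
proof -
  have eq: "B0 D a0 \<pi> (\<lambda>y x. e x * tp \<nu> y) (\<lambda>y x. v x * tp \<nu> y) = dform a0 e v"
    if "e \<in> S10 D T" "v \<in> S10 D T" for e v
    using B0_tens[OF S10_H1[OF that(1)] S10_H1[OF that(2)], of "tp \<nu>" "tp \<nu>"] tensor_poly_orthonormal[OF \<nu> \<nu>]
    by (simp add: tens_def)
  have "representer \<nu> e \<longleftrightarrow> e \<in> S10 D T \<and> (\<forall>v\<in>S10 D T. B0 D a0 \<pi> (\<lambda>y x. e x * tp \<nu> y) (\<lambda>y x. v x * tp \<nu> y)
      = residual D a0 \<pi> a f w (\<lambda>y x. v x * tp \<nu> y))" for e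
    unfolding representer_def using eq residual_tens[OF S10_H10] by (metis (no_types, lifting))
  then have "e_index D a0 \<pi> a P f T w \<nu> = (SOME e. representer \<nu> e)" unfolding e_index_def by presburger
  then show ?thesis using someI_ex[OF representer_exists] by simp
qed

lemma eta_index_square:
  assumes \<nu>: "\<nu> \<in> multi_indices"
  shows "(eta_index D a0 \<pi> a P f T w \<nu>)\<^sup>2 = dform a0 (e_index D a0 \<pi> a P f T w \<nu>) (e_index D a0 \<pi> a P f T w \<nu>)"
  unfolding eta_index_def
  by (rule energy_seminorm0_square[OF S10_H1]) (use representer_e_index[OF \<nu>] in \<open>unfold representer_def, blast\<close>)

end

end

section \<open>Contraction of the error\<close>

lemma marking_subset:
  assumes "marking_A D \<theta>X \<theta>P \<Theta> \<eta>X \<eta>P T \<PP> M \<MM> \<or> marking_B D \<theta>X \<theta>P \<Theta> \<eta>X \<eta>P T \<PP> M \<MM>"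
  shows "\<MM> \<subseteq> detail_indices \<PP>"
  using assms by (auto simp: marking_A_def marking_B_def minimal_marking_def split: if_splits)

lemma (in random_field) galerkin_orthogonal:
  assumes u: "galerkin D a0 \<pi> a f V u" and w: "galerkin D a0 \<pi> a f W w" and W: "W \<subseteq> V" and v: "v \<in> W"
  shows "B D a0 \<pi> a (u - w) v = 0"
proof -
  have V: "u \<in> V" "w \<in> V" "v \<in> V" using u w W v unfolding galerkin_def by blast+
  have "B D a0 \<pi> a u v = B D a0 \<pi> a w v" using u w V(3) v unfolding galerkin_def by simp
  then show ?thesis using BB.diff_left[OF V] by simp
qed

lemma (in random_field) galerkin_pythagoras:
  assumes u: "galerkin D a0 \<pi> a f V u" and w: "galerkin D a0 \<pi> a f W w" and W: "W \<subseteq> V" and v: "v \<in> V" "w - v \<in> W"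
  shows "B D a0 \<pi> a (u - v) (u - v) = B D a0 \<pi> a (u - w) (u - w) + B D a0 \<pi> a (w - v) (w - v)"
    "B D a0 \<pi> a (u - v) (w - v) = B D a0 \<pi> a (w - v) (w - v)"
proof -
  have V: "u \<in> V" "w \<in> V" using u w W unfolding galerkin_def by blast+
  have d: "u - w \<in> V" "w - v \<in> V" using V v subspace_diff[OF subspace_V] by blast+
  have z: "B D a0 \<pi> a (u - w) (w - v) = 0" by (rule galerkin_orthogonal[OF u w W v(2)])
  have eq: "(u - w) + (w - v) = u - v" by (simp only: add_diff_eq diff_add_cancel)
  show "B D a0 \<pi> a (u - v) (u - v) = B D a0 \<pi> a (u - w) (u - w) + B D a0 \<pi> a (w - v) (w - v)"
    using BB.quadratic[OF d, of 1] z unfolding scaleR_one eq by simp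
  show "B D a0 \<pi> a (u - v) (w - v) = B D a0 \<pi> a (w - v) (w - v)"
    using BB.add[OF d d(2)] z unfolding eq by simp
qed

text \<open>The enriched increment bounds the error by saturation; the estimates and the marking bound it by the actual increment, which
  is the decrease of the squared error.\<close>

lemma (in galerkin_level) error_decrease:
  assumes r: "r = u - w"
    and u: "galerkin D a0 \<pi> a f V u"
    and w: "galerkin D a0 \<pi> a f (V_disc D P T \<PP>) w"
    and wh: "galerkin D a0 \<pi> a f (V_enriched D P T \<PP>) wh"
    and w1: "galerkin D a0 \<pi> a f (V_disc D P T1 (\<PP> \<union> \<MM>)) w1"
    and T1: "is_refine D T M T1"
    and mark: "marking_A D \<theta>X \<theta>P \<Theta> (eta_vertex D a0 \<pi> a P f T \<PP> w) (eta_index D a0 \<pi> a P f T w) T \<PP> M \<MM> \<or>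
      marking_B D \<theta>X \<theta>P \<Theta> (eta_vertex D a0 \<pi> a P f T \<PP> w) (eta_index D a0 \<pi> a P f T w) T \<PP> M \<MM>"
    and pos: "0 < \<theta>X" "0 < \<theta>P" "0 < \<Theta>"
    and m: "0 < m" "AE x in lebesgue_on D. m \<le> a0 x" "AE x in lebesgue_on D. a0 x \<le> M'" "0 \<le> M'"
    and sat: "B D a0 \<pi> a (u - wh) (u - wh) \<le> q\<^sup>2 * B D a0 \<pi> a r r"
    and K: "K = 48 * \<kappa>\<^sup>2 * M' / m + 1"
    and C: "C = (1 / \<theta>X\<^sup>2 + 1 / \<theta>P\<^sup>2) * (1 + \<Theta>\<^sup>2 + 1 / \<Theta>\<^sup>2)"
  shows "(1 - \<tau>) * (1 - q\<^sup>2) * B D a0 \<pi> a r r \<le> (K + 1) * C * 6 * (B D a0 \<pi> a r r - B D a0 \<pi> a (u - w1) (u - w1))"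
proof -
  let ?\<eta>X = "eta_vertex D a0 \<pi> a P f T \<PP> w" and ?\<eta>P = "eta_index D a0 \<pi> a P f T w"
  let ?E = "e_index D a0 \<pi> a P f T w"
  let ?W1 = "V_disc D P T1 (\<PP> \<union> \<MM>)"
  have MQ: "\<MM> \<subseteq> QQ" by (rule marking_subset[OF mark])
  have fP1: "finite (\<PP> \<union> \<MM>)" using finite_PP finite_subset[OF MQ finite_QQ] by simp
  have ref: "nvb_refinement T T1" "conforming_triangulation D T1" using T1 by (auto simp: is_refine_def)
  note nested = S10_nested[OF ref(1)]
  have W1V: "?W1 \<subseteq> V" by (rule V_disc_V[OF fP1])
  have uV: "u \<in> V" using u by (simp add: galerkin_def)
  have wW: "w \<in> V_disc D P T \<PP>" using w by (simp add: galerkin_def)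
  have wV: "w \<in> V" using wW V_disc_V[OF finite_PP] by blast
  have wW1: "w \<in> ?W1" using wW V_disc_mono[OF fP1 Un_upper1 nested] by blast
  have w1W1: "w1 \<in> ?W1" using w1 by (simp add: galerkin_def)
  have w1V: "w1 \<in> V" using w1W1 W1V by blast
  have dW1: "w1 - w \<in> ?W1"
  proof -
    obtain g where g: "\<And>\<nu>. g \<nu> \<in> S10 D T1" "w1 = expand (\<PP> \<union> \<MM>) g" using w1W1 V_disc_iff[OF fP1] by blast
    obtain h where h: "\<And>\<nu>. h \<nu> \<in> S10 D T1" "w = expand (\<PP> \<union> \<MM>) h" using wW1 V_disc_iff[OF fP1] by blast
    have "w1 - w = expand (\<PP> \<union> \<MM>) (\<lambda>\<nu>. g \<nu> - h \<nu>)"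
      unfolding g(2) h(2) expand_def by (intro ext) (simp add: left_diff_distrib sum_subtractf)
    moreover have "g \<nu> - h \<nu> \<in> S10 D T1" for \<nu> by (rule subspace_diff[OF S10_sub g(1) h(1)])
    ultimately show ?thesis unfolding V_disc_iff[OF fP1] by (intro exI[of _ "\<lambda>\<nu>. g \<nu> - h \<nu>"] conjI allI)
  qed
  have dV: "w1 - w \<in> V" using dW1 W1V by blast
  have whE: "wh \<in> V_enriched D P T \<PP>" using wh by (simp add: galerkin_def)
  have eE: "wh - w \<in> V_enriched D P T \<PP>" by (rule V_enriched_diff[OF whE subsetD[OF V_disc_enriched wW]])
  note py1 = galerkin_pythagoras[OF u w1 W1V wV dW1]
  note py2 = galerkin_pythagoras[OF u wh V_enriched_V wV eE]
  let ?d = "B D a0 \<pi> a (w1 - w) (w1 - w)" and ?e = "B D a0 \<pi> a (wh - w) (wh - w)"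
  have res: "residual D a0 \<pi> a f w v = B D a0 \<pi> a r v" if v: "v \<in> V" for v
  proof -
    have "F \<pi> f v = B D a0 \<pi> a u v" using u v by (simp add: galerkin_def)
    then show ?thesis unfolding residual_def r using BB.diff_left[OF uV wV v] by simp
  qed
  have gal: "B D a0 \<pi> a (w1 - w) v = B D a0 \<pi> a r v" if v: "v \<in> ?W1" for v
  proof -
    have vV: "v \<in> V" using v W1V by blast
    have "B D a0 \<pi> a u v = B D a0 \<pi> a w1 v" using u w1 v vV by (simp add: galerkin_def)
    then show ?thesis unfolding r BB.diff_left[OF uV wV vV] BB.diff_left[OF w1V wV vV] by simp
  qed
  have d0: "0 \<le> ?d" by (rule BB.nonneg[OF dV])
  (* 1 + \<tau> is replaced by its bound 2. *)
  have t6: "3 * (1 + \<tau>) * ?d \<le> 6 * ?d" "1 * (1 + \<tau>) * ?d \<le> 6 * ?d"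
    by (rule mult_right_mono[OF _ d0], use tau_less in simp)+
  let ?R = "Np \<inter> vertices T1"
  have sqX: "(eta_set ?\<eta>X S)\<^sup>2 = (\<Sum>z\<in>S. \<Sum>\<nu>\<in>\<PP>. (rho (ghat z) \<nu>)\<^sup>2 / hat_sq z)" if "S \<subseteq> Np" for S
    unfolding eta_set_square by (rule sum.cong[OF HOL.refl], rule eta_vertex_square[OF res]) (use that in blast)+
  have sqP: "(eta_set ?\<eta>P S)\<^sup>2 = (\<Sum>\<nu>\<in>S. dform a0 (?E \<nu>) (?E \<nu>))" if "S \<subseteq> QQ" for S
    unfolding eta_set_square by (rule sum.cong[OF HOL.refl], rule eta_index_square[OF res]) (use that detail_indices_multi(1) in blast)+
  have rep: "representer \<nu> (?E \<nu>)" if "\<nu> \<in> QQ" for \<nu>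
    by (rule representer_e_index[OF res]) (use that detail_indices_multi(1) in blast)+
  have X: "(eta_set ?\<eta>X ?R)\<^sup>2 \<le> 6 * ?d"
  proof -
    have "(eta_set ?\<eta>X ?R)\<^sup>2 \<le> 3 * (1 + \<tau>) * ?d"
      unfolding sqX[OF Int_lower1]
      by (rule vertex_efficiency[OF dV fP1 Un_upper1 Int_lower1 ghat_S10_refinement[OF ref] gal]) simp_all
    then show ?thesis using t6(1) by linarith
  qed
  have P: "(eta_set ?\<eta>P \<MM>)\<^sup>2 \<le> 6 * ?d"
  proof -
    have "(eta_set ?\<eta>P \<MM>)\<^sup>2 \<le> 1 * (1 + \<tau>) * ?d"
      unfolding sqP[OF MQ]
      by (rule index_efficiency[OF dV fP1 Un_upper2 order_trans[OF MQ detail_indices_multi(1)] nested rep gal]) (use MQ in blast)+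
    then show ?thesis using t6(2) by linarith
  qed
  have mb: "(eta_set ?\<eta>X Np)\<^sup>2 \<le> C * (6 * ?d)" "(eta_set ?\<eta>P QQ)\<^sup>2 \<le> C * (6 * ?d)"
    using marking_bound[OF mark T1 finite_Np pos X P] unfolding C[symmetric] by blast+
  have K0: "0 \<le> K" using m(1,4) by (simp add: K)
  have "(1 - \<tau>) * ?e \<le> K * (eta_set ?\<eta>X Np)\<^sup>2 + (eta_set ?\<eta>P QQ)\<^sup>2"
    unfolding sqX[OF subset_refl] sqP[OF subset_refl]
    by (rule reliability[OF eE _ rep m K]) (simp_all only: r py2(2))
  also have "\<dots> \<le> K * (C * (6 * ?d)) + C * (6 * ?d)" by (intro add_mono mult_left_mono mb K0)
  also have "\<dots> = (K + 1) * C * 6 * ?d" by (simp only: distrib_right mult_1_left mult.assoc)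
  finally have rel: "(1 - \<tau>) * ?e \<le> (K + 1) * C * 6 * ?d" .
  have "(1 - q\<^sup>2) * B D a0 \<pi> a r r \<le> ?e" using sat py2(1) unfolding r left_diff_distrib by linarith
  from mult_left_mono[OF this, of "1 - \<tau>"] have "(1 - \<tau>) * (1 - q\<^sup>2) * B D a0 \<pi> a r r \<le> (1 - \<tau>) * ?e"
    using tau_less by (simp add: mult.assoc)
  also note rel
  also have "?d = B D a0 \<pi> a r r - B D a0 \<pi> a (u - w1) (u - w1)" using py1(1) unfolding r by linarith
  finally show ?thesis .
qed

lemma sqrt_contraction:
  fixes x y \<delta> L c :: real
  assumes c: "c * x \<le> L * (x - y)" and L: "0 < L" and lam: "\<delta> * L \<le> c" and x: "0 \<le> x"
  shows "sqrt y \<le> sqrt (1 - \<delta>) * sqrt x"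
proof -
  have "\<delta> * L * x \<le> L * (x - y)" using mult_right_mono[OF lam x] c by linarith
  then have "L * (\<delta> * x) \<le> L * (x - y)" by (simp only: mult_ac)
  then have "\<delta> * x \<le> x - y" using L by simp
  then have "y \<le> (1 - \<delta>) * x" by (simp add: left_diff_distrib)
  then show ?thesis unfolding real_sqrt_mult[symmetric] by (rule real_sqrt_le_mono)
qed

text \<open>The bounds \<open>m\<close> and \<open>M'\<close> for \<open>a0\<close> are separate from \<open>a0_min\<close> and \<open>a0_max\<close>: they are fixed together with \<open>a0\<close>, so
  that \<open>\<delta>\<close> can be chosen before the other data.\<close>

lemma adaptive_contraction:
  assumes D: "lipschitz_domain D" and T0: "conforming_triangulation D T0" and \<kappa>: "\<And>t. t \<in> T0 \<Longrightarrow> shape t \<le> \<kappa> * \<bar>tdet t\<bar>"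
    and a0: "a0 \<in> W1inf D" and tau: "\<tau> < 1" and q: "0 < q" and pos: "0 < \<theta>X" "0 < \<theta>P" "0 < \<Theta>"
    and m: "0 < m" "AE x in lebesgue_on D. m \<le> a0 x" "AE x in lebesgue_on D. a0 x \<le> M'" "0 \<le> M'"
    and K: "K = 48 * \<kappa>\<^sup>2 * M' / m + 1"
    and C: "C = (1 / \<theta>X\<^sup>2 + 1 / \<theta>P\<^sup>2) * (1 + \<Theta>\<^sup>2 + 1 / \<Theta>\<^sup>2)"
    and lam: "\<delta> * ((K + 1) * C * 6) \<le> (1 - \<tau>) * (1 - q\<^sup>2)"
    and a0_min: "0 < a0_min" "AE x in lebesgue_on D. a0_min \<le> a0 x \<and> a0 x \<le> a0_max"
    and a: "\<forall>m. a m \<in> W1inf D" "summable (\<lambda>m. Linf_norm D (a m))" "\<tau> = (1 / a0_min) * (\<Sum>m. Linf_norm D (a m))"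
    and \<pi>: "\<forall>m. parameter_measure (\<pi> m)" and P: "orthonormal_polys \<pi> P"
    and u: "galerkin D a0 \<pi> a f (V_space D \<pi>) u"
    and run: "adaptive_run D a0 \<pi> a P f (marking_A D \<theta>X \<theta>P \<Theta>) T0 T \<PP> u_gal \<or>
        adaptive_run D a0 \<pi> a P f (marking_B D \<theta>X \<theta>P \<Theta>) T0 T \<PP> u_gal"
    and hat: "\<forall>l. galerkin D a0 \<pi> a f (V_enriched D P (T l) (\<PP> l)) (u_hat l)"
    and sat: "\<forall>l. energy_norm D a0 \<pi> a (\<lambda>y x. u y x - u_hat l y x) \<le> q * energy_norm D a0 \<pi> a (\<lambda>y x. u y x - u_gal l y x)"
  shows "energy_norm D a0 \<pi> a (\<lambda>y x. u y x - u_gal (Suc l) y x)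
    \<le> sqrt (1 - \<delta>) * energy_norm D a0 \<pi> a (\<lambda>y x. u y x - u_gal l y x)"
proof -
  interpret planar_domain D by (rule lipschitz_domain_planar[OF D])
  interpret parametric_basis D a0 \<pi> a a0_min \<tau> P
  proof unfold_locales
    show "a0 \<in> Linf D" "a m \<in> Linf D" for m using a0 a(1) by (simp_all add: W1inf_def)
    show "AE x in lebesgue_on D. a0_min \<le> a0 x" using a0_min(2) by eventually_elim simp
  qed (use a0_min a \<pi> P tau in blast)+
  have T_0: "T 0 = T0" and P_0: "\<PP> 0 = {\<lambda>_. 0}" and gal: "\<And>l. galerkin D a0 \<pi> a f (V_disc D P (T l) (\<PP> l)) (u_gal l)"
    using run unfolding adaptive_run_def by blast+
  define marked where "marked l M \<MM> \<longleftrightarrow>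
      marking_A D \<theta>X \<theta>P \<Theta> (eta_vertex D a0 \<pi> a P f (T l) (\<PP> l) (u_gal l)) (eta_index D a0 \<pi> a P f (T l) (u_gal l)) (T l) (\<PP> l) M \<MM> \<or>
      marking_B D \<theta>X \<theta>P \<Theta> (eta_vertex D a0 \<pi> a P f (T l) (\<PP> l) (u_gal l)) (eta_index D a0 \<pi> a P f (T l) (u_gal l)) (T l) (\<PP> l) M \<MM>" for l M \<MM>
  have step: "\<exists>M \<MM>. marked l M \<MM> \<and>
      \<PP> (Suc l) = \<PP> l \<union> \<MM> \<and> is_refine D (T l) M (T (Suc l))" for l
    using run unfolding adaptive_run_def marked_def by metis
  have level: "mesh D (T l) \<kappa> \<and> finite (\<PP> l) \<and> \<PP> l \<subseteq> multi_indices" for l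
  proof (induction l)
    case 0
    have "mesh D T0 \<kappa>" by unfold_locales (use D T0 \<kappa> in auto)
    then show ?case unfolding T_0 P_0 by (simp add: multi_indices_def supp_def)
  next
    case (Suc l)
    obtain M \<MM> where mark: "marked l M \<MM>"
      and P1: "\<PP> (Suc l) = \<PP> l \<union> \<MM>" and T1: "is_refine D (T l) M (T (Suc l))" using step by blast
    have "mesh D (T (Suc l)) \<kappa>" using mesh.refinement_mesh[of D "T l" \<kappa>] Suc T1 by (simp add: is_refine_def)
    moreover have "\<MM> \<subseteq> detail_indices (\<PP> l)" by (rule marking_subset[OF mark[unfolded marked_def]])
    ultimately show ?case
      unfolding P1 using Suc finite_detail_indices[of "\<PP> l"] detail_indices_multi(1)[of "\<PP> l"] finite_subset by blast
  qed
  obtain M \<MM> where mark: "marked l M \<MM>"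
    and P1: "\<PP> (Suc l) = \<PP> l \<union> \<MM>" and T1: "is_refine D (T l) M (T (Suc l))" using step by blast
  have fin: "finite (\<PP> l)" using level by blast
  have rV: "u - u_gal l \<in> V"
    using u gal[of l] V_disc_V[OF fin, of "T l"] subspace_diff[OF subspace_V] unfolding galerkin_def by blast
  have lev: "galerkin_level D a0 \<pi> a a0_min \<tau> P (T l) \<kappa> (\<PP> l) (u - u_gal l)"
    by (intro galerkin_level.intro galerkin_level_axioms.intro parametric_basis_axioms)
      (use level rV galerkin_orthogonal[OF u gal V_disc_V[OF fin]] in blast)+
  interpret L: galerkin_level D a0 \<pi> a a0_min \<tau> P "T l" \<kappa> "\<PP> l" "u - u_gal l" by (rule lev)
  let ?r = "B D a0 \<pi> a (u - u_gal l) (u - u_gal l)"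
  have r0: "0 \<le> ?r" by (rule BB.nonneg[OF rV])
  have h0: "0 \<le> B D a0 \<pi> a (u - u_hat l) (u - u_hat l)"
  proof (rule BB.nonneg)
    show "u - u_hat l \<in> V"
      using u hat L.V_enriched_V subspace_diff[OF subspace_V] unfolding galerkin_def by blast
  qed
  have "sqrt (B D a0 \<pi> a (u - u_hat l) (u - u_hat l)) \<le> q * sqrt ?r"
    using sat unfolding energy_norm_def fun_diff2 by blast
  from power_mono[OF this, of 2] have sat': "B D a0 \<pi> a (u - u_hat l) (u - u_hat l) \<le> q\<^sup>2 * ?r"
    using r0 h0 by (simp add: power_mult_distrib)
  have dec: "(1 - \<tau>) * (1 - q\<^sup>2) * ?r \<le> (K + 1) * C * 6 * (?r - B D a0 \<pi> a (u - u_gal (Suc l)) (u - u_gal (Suc l)))"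
    by (rule L.error_decrease[OF HOL.refl u gal _ _ T1 mark[unfolded marked_def] pos m sat' K C]) (use hat gal[of "Suc l"] P1 in auto)
  have KC: "0 < (K + 1) * C * 6"
  proof -
    have "0 \<le> 48 * \<kappa>\<^sup>2 * M' / m" using m(1,4) by simp
    then have "0 < K + 1" unfolding K by linarith
    moreover have "0 < C" unfolding C using pos by (intro mult_pos_pos add_pos_pos) simp_all
    ultimately show ?thesis by simp
  qed
  show ?thesis unfolding energy_norm_def fun_diff2 by (rule sqrt_contraction[OF dec KC lam r0])
qed

text \<open>The initial mesh is finite and its triangles are nondegenerate.\<close>

lemma shape_bound_exists:
  assumes "conforming_triangulation D T0"
  obtains \<kappa> where "\<And>t. t \<in> T0 \<Longrightarrow> shape t \<le> \<kappa> * \<bar>tdet t\<bar>"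
proof -
  define \<kappa> where "\<kappa> = Max ((\<lambda>t. shape t / \<bar>tdet t\<bar>) ` T0)"
  have fin: "finite T0" using assms by (simp add: conforming_triangulation_def)
  have "shape t \<le> \<kappa> * \<bar>tdet t\<bar>" if t: "t \<in> T0" for t
  proof -
    obtain p q r where pqr: "t = (p, q, r)" by (cases t)
    have "\<not> collinear {p, q, r}" using assms t unfolding pqr conforming_triangulation_def by auto
    then have "tdet t \<noteq> 0" unfolding pqr by (rule noncollinear_tdet)
    moreover have "shape t / \<bar>tdet t\<bar> \<le> \<kappa>" unfolding \<kappa>_def using fin t by (intro Max_ge) auto
    ultimately show ?thesis by (simp add: pos_divide_le_eq)
  qed
  then show ?thesis by (rule that)
qed

theorem theorem8:
  fixes D :: "point set" and T0 :: "triangle set" and a0 :: "point \<Rightarrow> real"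
    and \<tau> q_sat \<theta>X \<theta>P \<Theta> :: real
  assumes "lipschitz_domain D" and "polygonal_boundary D"
    and "conforming_triangulation D T0"
    and "a0 \<in> W1inf D"
    and "\<tau> < 1"
    and "0 < q_sat" and "q_sat < 1"
    and "0 < \<theta>X" and "\<theta>X \<le> 1" and "0 < \<theta>P" and "\<theta>P \<le> 1" and "0 < \<Theta>"
  shows "\<exists>q_lin. 0 < q_lin \<and> q_lin < 1 \<and>
    (\<forall>(a0_min::real) a0_max (\<pi> :: nat \<Rightarrow> real measure) (a :: nat \<Rightarrow> point \<Rightarrow> real)
       (P :: nat \<Rightarrow> nat \<Rightarrow> real poly) (f :: (nat \<Rightarrow> real) \<Rightarrow> (point \<Rightarrow> real) \<Rightarrow> real)
       (u :: rfield) (T :: nat \<Rightarrow> triangle set) (\<PP> :: nat \<Rightarrow> multi_index set)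
       (u_gal :: nat \<Rightarrow> rfield) (u_hat :: nat \<Rightarrow> rfield).
       0 < a0_min \<and>
       (AE x in lebesgue_on D. a0_min \<le> a0 x \<and> a0 x \<le> a0_max) \<and>
       (\<forall>m. a m \<in> W1inf D) \<and>
       summable (\<lambda>m. Linf_norm D (a m)) \<and>
       \<tau> = (1 / a0_min) * (\<Sum>m. Linf_norm D (a m)) \<and>
       (\<forall>m. parameter_measure (\<pi> m)) \<and>
       orthonormal_polys \<pi> P \<and>
       f \<in> rhs_space D \<pi> \<and>
       galerkin D a0 \<pi> a f (V_space D \<pi>) u \<and>
       (adaptive_run D a0 \<pi> a P f (marking_A D \<theta>X \<theta>P \<Theta>) T0 T \<PP> u_gal \<or>
        adaptive_run D a0 \<pi> a P f (marking_B D \<theta>X \<theta>P \<Theta>) T0 T \<PP> u_gal) \<and>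
       (\<forall>l. galerkin D a0 \<pi> a f (V_enriched D P (T l) (\<PP> l)) (u_hat l)) \<and>
       (\<forall>l. energy_norm D a0 \<pi> a (\<lambda>y x. u y x - u_hat l y x)
            \<le> q_sat * energy_norm D a0 \<pi> a (\<lambda>y x. u y x - u_gal l y x))
       \<longrightarrow>
       (\<forall>l. energy_norm D a0 \<pi> a (\<lambda>y x. u y x - u_gal (Suc l) y x)
            \<le> q_lin * energy_norm D a0 \<pi> a (\<lambda>y x. u y x - u_gal l y x)))"
proof -
  obtain \<kappa> where \<kappa>: "\<And>t. t \<in> T0 \<Longrightarrow> shape t \<le> \<kappa> * \<bar>tdet t\<bar>" using shape_bound_exists[OF assms(3)] by blast
  show ?thesis
  proof (cases "\<exists>m M'. 0 < m \<and> 0 \<le> M' \<and> (AE x in lebesgue_on D. m \<le> a0 x) \<and> (AE x in lebesgue_on D. a0 x \<le> M')")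
    case True
    then obtain m M' where m: "0 < m" "AE x in lebesgue_on D. m \<le> a0 x" "AE x in lebesgue_on D. a0 x \<le> M'" "0 \<le> M'" by blast
    define K where "K = 48 * \<kappa>\<^sup>2 * M' / m + 1"
    define C where "C = (1 / \<theta>X\<^sup>2 + 1 / \<theta>P\<^sup>2) * (1 + \<Theta>\<^sup>2 + 1 / \<Theta>\<^sup>2)"
    define c where "c = (1 - \<tau>) * (1 - q_sat\<^sup>2)"
    (* The minimum keeps the contraction factor positive also for negative \<tau>, which no coefficient attains. *)
    define \<delta> where "\<delta> = min (1 / 2) (c / ((K + 1) * C * 6))"
    have "q_sat\<^sup>2 < 1" using assms(6,7) by (simp add: power_less_one_iff)
    then have c: "0 < c" using assms(5) by (simp add: c_def)
    have "0 \<le> 48 * \<kappa>\<^sup>2 * M' / m" using m(1,4) by simp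
    then have "0 < K + 1" unfolding K_def by linarith
    moreover have "0 < C" unfolding C_def using assms(8,10,12) by (intro mult_pos_pos add_pos_pos) simp_all
    ultimately have KC: "0 < (K + 1) * C * 6" by simp
    have \<delta>: "0 < \<delta>" "\<delta> \<le> 1 / 2" using c KC by (simp_all add: \<delta>_def)
    have "\<delta> \<le> c / ((K + 1) * C * 6)" by (simp add: \<delta>_def)
    then have lam: "\<delta> * ((K + 1) * C * 6) \<le> (1 - \<tau>) * (1 - q_sat\<^sup>2)"
      using KC by (simp only: pos_le_divide_eq c_def)
    show ?thesis
    proof (intro exI[of _ "sqrt (1 - \<delta>)"] conjI allI impI)
      show "0 < sqrt (1 - \<delta>)" "sqrt (1 - \<delta>) < 1" using \<delta> by simp_all
    qed (elim conjE, rule adaptive_contraction[OF assms(1,3) \<kappa> assms(4,5,6,8,10,12) m K_def C_def lam]; assumption)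
  next
    case False
    have "\<not> (0 < a0_min \<and> (AE x in lebesgue_on D. a0_min \<le> a0 x \<and> a0 x \<le> a0_max))" for a0_min a0_max :: real
    proof
      assume A: "0 < a0_min \<and> (AE x in lebesgue_on D. a0_min \<le> a0 x \<and> a0 x \<le> a0_max)"
      then have pos: "0 < a0_min" and ae: "AE x in lebesgue_on D. a0_min \<le> a0 x \<and> a0 x \<le> a0_max" by blast+
      have lower: "AE x in lebesgue_on D. a0_min \<le> a0 x" using ae by eventually_elim (rule conjunct1)
      have upper: "AE x in lebesgue_on D. a0 x \<le> max 0 a0_max"
        using ae by eventually_elim (rule order_trans[OF conjunct2 max.cobounded2])
      have "\<exists>m M'. 0 < m \<and> 0 \<le> M' \<and> (AE x in lebesgue_on D. m \<le> a0 x) \<and> (AE x in lebesgue_on D. a0 x \<le> M')"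
        by (intro exI conjI) (rule pos, rule max.cobounded1, rule lower, rule upper)
      with False show False ..
    qed
    then show ?thesis by (intro exI[of _ "1 / 2"]) auto
  qed
qed

end
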